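(* Let $\boldsymbol u\in K_{\boldsymbol u}$ be the minimiser of $I$, $\boldsymbol T\in K_{\boldsymbol T}$ a maximiser of $D$, and choose the discrete data $\boldsymbol f_h=\Pi_h\boldsymbol f\in(\mathbb P^0(\mathcal T_h))^d$, $\boldsymbol F_h=\Pi_h\boldsymbol F\in(\mathbb P^0(\mathcal T_h))^{d\times d}$, $\widehat{\boldsymbol u}^h_D=\mathcal I^{cr}_h\widehat{\boldsymbol u}_D\in V^h$. Let $\boldsymbol u_h\in K^h_{\boldsymbol u}$ be the minimiser of $I_h$ and $\boldsymbol T_h\in K_{\boldsymbol T}^h$ a maximiser of $D_h$. Then the following statements apply. (i) There holds the a priori error identity $$\tfrac\nu2\|\nabla_h\mathcal I_h^{cr}\boldsymbol u-\nabla_h\boldsymbol u_h\|_\Omega^2+\tfrac1{2\nu}\|\Pi_h\mathrm{dev}(\mathcal I_h^{rt}(\boldsymbol T-\boldsymbol F))-\Pi_h\mathrm{dev}(\boldsymbol T_h-\boldsymbol F_h)\|_\Omega^2=\tfrac1{2\nu}\|\Pi_h\mathrm{dev}(\boldsymbol T-\boldsymbol F)-\Pi_h\mathrm{dev}\,\mathcal I_h^{rt}(\boldsymbol T-\boldsymbol F)\|_\Omega^2 .$$ (ii) There holds the quasi-optimal error estimate $$\nu\|\nabla(\boldsymbol u+\widehat{\boldsymbol u}_D)-\nabla_h(\boldsymbol u_h+\widehat{\boldsymbol u}_D^h)\|_\Omega^2+\tfrac1\nu\|\mathrm{dev}\,\boldsymbol T-\Pi_h\mathrm{dev}\,\boldsymbol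 T_h\|_\Omega^2$$ $$\le 6\inf_{\boldsymbol v_h\in K^h_{\boldsymbol u}}\big\{\nu\|\nabla(\boldsymbol u+\widehat{\boldsymbol u}_D)-\nabla_h(\boldsymbol v_h+\widehat{\boldsymbol u}_D^h)\|_\Omega^2\big\}+6\inf_{\boldsymbol\tau_h\in K^h_{\boldsymbol T}}\big\{\tfrac1\nu\|\mathrm{dev}\,\boldsymbol T-\mathrm{dev}\,\Pi_h\boldsymbol\tau_h\|_\Omega^2\big\}.$$
   Context: Domain. $d\ge 2$; $\Omega\subset\mathbb R^d$ is a bounded polyhedral Lipschitz domain whose boundary is divided into disjoint relatively open parts $\Gamma_D\neq\emptyset$ and $\Gamma_N$ with $\overline\Gamma_D\cup\overline\Gamma_N=\partial\Omega$. $(\cdot,\cdot)_\Omega$, $\|\cdot\|_\Omega$ denote the $L^2(\Omega)$ inner product and norm (scalar, vector or matrix valued). $\mathrm{dev}\,\boldsymbol A=\boldsymbol A-\frac1d\mathrm{tr}(\boldsymbol A)\boldsymbol I$; $(\nabla\boldsymbol v)_{ij}=\partial_j v_i$; the divergence of a matrix field is taken row-wise. $\mathbf H^1_D(\Omega)$: fields in $(H^1(\Omega))^d$ with zero trace on $\Gamma_D$. $\mathbf H_N(\mathrm{div};\Omega)$: matrix fields $\boldsymbol\tau\in(L^2(\Omega))^{d\times d}$ with $\mathrm{div}\,\boldsymbol\tau\in(L^2(\Omega))^d$ and $\boldsymbol\tau\boldsymbol n=\boldsymbol 0$ weakly on $\Gamma_N$ (in the dual of $\mathbf H^{1/2}_{00}(\Gamma_N)$),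 i.e. $(\boldsymbol\tau,\nabla\boldsymbol v)_\Omega+(\mathrm{div}\,\boldsymbol\tau,\boldsymbol v)_\Omega=0$ for all $\boldsymbol v\in\mathbf H^1_D(\Omega)$. Continuous incompressible Stokes problem. $\nu>0$; $\widehat{\boldsymbol u}_D\in(H^1(\Omega))^d$ with $\mathrm{div}\,\widehat{\boldsymbol u}_D=0$ a.e. in $\Omega$ (lift of the Dirichlet datum); the load $\boldsymbol f^*\in(\mathbf H^1_D(\Omega))^*$ is represented by fixed $\boldsymbol f\in(L^2(\Omega))^d$, $\boldsymbol F\in(L^2(\Omega))^{d\times d}$ via $\langle\boldsymbol f^*,\boldsymbol v\rangle_\Omega=(\boldsymbol f,\boldsymbol v)_\Omega+(\boldsymbol F,\nabla\boldsymbol v)_\Omega$. $K_{\boldsymbol u}=\{\boldsymbol v\in\mathbf H^1_D(\Omega):\mathrm{div}\,\boldsymbol v=0\}$, $I(\boldsymbol v)=\frac\nu2\|\nabla(\boldsymbol v+\widehat{\boldsymbol u}_D)\|_\Omega^2-\langle\boldsymbol f^*,\boldsymbol v\rangle_\Omega$ on $K_{\boldsymbol u}$. $K_{\boldsymbol T}=\{\boldsymbol\tau\in\boldsymbol F+\mathbf H_N(\mathrm{div};\Omega):\mathrm{div}(\boldsymbol\tau-\boldsymbol F)=-\boldsymbol f\}$, $D(\boldsymbol\tau)=-\frac1{2\nu}\|\mathrm{dev}\,\boldsymbol\tau\|_\Omega^2+(\mathrm{dev}\,\boldsymbol\tau,\nabla\widehat{\boldsymbol u}_D)_\Omega$ on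 $K_{\boldsymbol T}$. Mesh and spaces. $\mathcal T_h$ is a triangulation of $\Omega$ into closed simplices (from a shape-regular family), with each boundary side lying in $\overline\Gamma_D$ or in $\overline\Gamma_N$. $\mathbb P^k(\mathcal T_h)$: element-wise polynomials of degree at most $k$. $\Pi_h$: element-wise mean (componentwise). $\nabla_h$, $\mathrm{div}_h$: element-wise gradient and divergence. $V^h$ (Crouzeix–Raviart) is the set of $\boldsymbol v_h\in(\mathbb P^1(\mathcal T_h))^d$ whose jump has zero mean over every interior side; $V^h_D$ is the set of $\boldsymbol v_h\in V^h$ having zero mean over every side in $\overline\Gamma_D$. $\Sigma^h$ (Raviart–Thomas) is the set of $\boldsymbol\tau_h\in(\mathbb P^1(\mathcal T_h))^{d\times d}$ such that, for each $T$, $\boldsymbol\tau_h|_T\boldsymbol n_T$ is constant on each side of $T$, and $\boldsymbol\tau_h\boldsymbol n$ is continuous across interior sides; $\Sigma^h_N=\{\boldsymbol\tau_h\in\Sigma^h:\boldsymbol\tau_h\boldsymbol n=\boldsymbol 0\text{ on }\Gamma_N\}$. $\mathcal I_h^{cr}:(H^1(\Omega))^d\to V^h$ is the canonical Crouzeix–Raviart interpolation: $\mathcal I_h^{cr}\boldsymbol v$ is the element of $V^h$ with the same mean as $\boldsymbol v$ on every side (it maps $\mathbf H^1_D(\Omega)$ to $V^h_D$). $\mathcal I_h^{rt}:\mathbf H_N(\mathrm{div};\Omega)\to\Sigma^h_N$ is a (quasi-)interpolation operator with $\mathrm{div}(\mathcal I_h^{rt}\boldsymbol\tau)=\Pi_h(\mathrm{div}\,\boldsymbol\tau)$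 a.e. in $\Omega$ for all $\boldsymbol\tau$ (e.g. the one of Ern–Gudi–Smears–Vohralík, 2022). Discrete problem. $K^h_{\boldsymbol u}=\{\boldsymbol v_h\in V_D^h:\mathrm{div}_h\boldsymbol v_h=0\}$ and on it $I_h(\boldsymbol v_h)=\frac\nu2\|\nabla_h(\boldsymbol v_h+\widehat{\boldsymbol u}_D^h)\|_\Omega^2-(\boldsymbol f_h,\Pi_h\boldsymbol v_h)_\Omega-(\boldsymbol F_h,\nabla_h\boldsymbol v_h)_\Omega$. $K^h_{\boldsymbol T}=\{\boldsymbol\tau_h\in\boldsymbol F_h+\Sigma^h_N:\mathrm{div}(\boldsymbol\tau_h-\boldsymbol F_h)=-\boldsymbol f_h\}$ and on it $D_h(\boldsymbol\tau_h)=-\frac1{2\nu}\|\mathrm{dev}\,\Pi_h\boldsymbol\tau_h\|_\Omega^2+(\mathrm{dev}\,\Pi_h\boldsymbol\tau_h,\nabla_h\widehat{\boldsymbol u}_D^h)_\Omega$. Here $\mathrm{div}(\boldsymbol\tau_h-\boldsymbol F_h)=-\boldsymbol f_h$ etc. are understood a.e. in $\Omega$. *)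

theory Defs
  imports "HOL-Analysis.Analysis"
begin

text \<open>
  The space dimension is \<open>d = CARD('n)\<close>. Fields are functions on the whole of \<open>real^'n\<close>, of which
  only the values almost everywhere in \<open>\<Omega>\<close> matter. The inner product and norm of \<open>real^'n^'n\<close>
  are the Frobenius ones.
\<close>

section \<open>Square-integrable fields\<close>

definition L2_space :: "(real^'n) set \<Rightarrow> (real^'n \<Rightarrow> 'b::euclidean_space) set" where
  "L2_space \<Omega> = {f. f \<in> borel_measurable (lebesgue_on \<Omega>) \<and>
                     integrable (lebesgue_on \<Omega>) (\<lambda>x. (norm (f x))\<^sup>2)}"

definition ip :: "(real^'n) set \<Rightarrow> (real^'n \<Rightarrow> 'b::euclidean_space) \<Rightarrow> (real^'n \<Rightarrow> 'b) \<Rightarrow> real" where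
  "ip \<Omega> f g = (LINT x|lebesgue_on \<Omega>. f x \<bullet> g x)"

definition l2norm :: "(real^'n) set \<Rightarrow> (real^'n \<Rightarrow> 'b::euclidean_space) \<Rightarrow> real" where
  "l2norm \<Omega> f = sqrt (ip \<Omega> f f)"

definition dev :: "real^'n^'n \<Rightarrow> real^'n^'n" where
  "dev A = A - (trace A / real CARD('n)) *\<^sub>R mat 1"

section \<open>Weak derivatives\<close>

text \<open>Weak derivatives are tested with compactly supported \<open>C\<^sup>1\<close> functions \<open>\<phi>\<close> (with gradient \<open>\<gamma>\<close>).
  For square-integrable fields this is equivalent to testing with smooth ones.\<close>

definition test_fun :: "(real^'n) set \<Rightarrow> (real^'n \<Rightarrow> real) \<Rightarrow> (real^'n \<Rightarrow> real^'n) \<Rightarrow> bool" where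
  "test_fun \<Omega> \<phi> \<gamma> \<longleftrightarrow> (\<forall>x. GDERIV \<phi> x :> \<gamma> x) \<and> continuous_on UNIV \<gamma> \<and>
     (\<exists>K. compact K \<and> K \<subseteq> \<Omega> \<and> (\<forall>x. x \<notin> K \<longrightarrow> \<phi> x = 0))"

text \<open>\<open>G x $ i $ j\<close> is the derivative of the \<open>i\<close>-th component in direction \<open>j\<close>.\<close>

definition is_weak_grad :: "(real^'n) set \<Rightarrow> (real^'n \<Rightarrow> real^'n) \<Rightarrow> (real^'n \<Rightarrow> real^'n^'n) \<Rightarrow> bool" where
  "is_weak_grad \<Omega> v G \<longleftrightarrow> G \<in> L2_space \<Omega> \<and>
     (\<forall>\<phi> \<gamma> i. test_fun \<Omega> \<phi> \<gamma> \<longrightarrow>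
        (LINT x|lebesgue_on \<Omega>. (v x $ i) *\<^sub>R \<gamma> x) = - (LINT x|lebesgue_on \<Omega>. \<phi> x *\<^sub>R (G x $ i)))"

definition is_weak_div :: "(real^'n) set \<Rightarrow> (real^'n \<Rightarrow> real^'n^'n) \<Rightarrow> (real^'n \<Rightarrow> real^'n) \<Rightarrow> bool" where
  "is_weak_div \<Omega> \<tau> g \<longleftrightarrow> g \<in> L2_space \<Omega> \<and>
     (\<forall>\<phi> \<gamma> i. test_fun \<Omega> \<phi> \<gamma> \<longrightarrow>
        (LINT x|lebesgue_on \<Omega>. (\<tau> x $ i) \<bullet> \<gamma> x) = - (LINT x|lebesgue_on \<Omega>. \<phi> x * (g x $ i)))"

text \<open>The weak derivatives are unique up to null sets; the operators pick a representative.\<close>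

definition wgrad :: "(real^'n) set \<Rightarrow> (real^'n \<Rightarrow> real^'n) \<Rightarrow> real^'n \<Rightarrow> real^'n^'n" where
  "wgrad \<Omega> v = (SOME G. is_weak_grad \<Omega> v G)"

definition wdiv :: "(real^'n) set \<Rightarrow> (real^'n \<Rightarrow> real^'n^'n) \<Rightarrow> real^'n \<Rightarrow> real^'n" where
  "wdiv \<Omega> \<tau> = (SOME g. is_weak_div \<Omega> \<tau> g)"

definition H1 :: "(real^'n) set \<Rightarrow> (real^'n \<Rightarrow> real^'n) set" where
  "H1 \<Omega> = {v \<in> L2_space \<Omega>. \<exists>G. is_weak_grad \<Omega> v G}"

definition Hdiv :: "(real^'n) set \<Rightarrow> (real^'n \<Rightarrow> real^'n^'n) set" where
  "Hdiv \<Omega> = {\<tau> \<in> L2_space \<Omega>. \<exists>g. is_weak_div \<Omega> \<tau> g}"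

section \<open>Surface measure and traces\<close>

text \<open>The \<open>(d-1)\<close>-dimensional Lebesgue measure on a hyperplane \<open>H\<close>: the surface measure of
  \<open>A \<subseteq> H\<close> is the volume of the right prism with midsection \<open>A\<close> and height 1.\<close>

definition surface_measure :: "(real^'n) set \<Rightarrow> (real^'n) measure" where
  "surface_measure H =
     distr (restrict_space lborel {x. infdist x H \<le> 1/2}) borel (closest_point H)"

definition C1_field :: "(real^'n \<Rightarrow> real^'n) \<Rightarrow> bool" where
  "C1_field \<phi> \<longleftrightarrow> (\<forall>x. \<phi> differentiable (at x)) \<and> continuous_on UNIV (\<lambda>x. jacobian \<phi> (at x))"

text \<open>\<open>w\<close> is the trace of \<open>v \<in> H1 \<Omega>\<close> on a subset \<open>A\<close> of the hyperplane \<open>H\<close>. The trace operator is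
  the continuous extension of the restriction of \<open>C\<^sup>1\<close> fields, so traces are limits in \<open>L\<^sup>2(A)\<close> of
  restrictions of \<open>C\<^sup>1\<close> fields that converge to \<open>v\<close> in \<open>H1 \<Omega>\<close>.\<close>

definition has_trace ::
  "(real^'n) set \<Rightarrow> (real^'n) set \<Rightarrow> (real^'n) set \<Rightarrow> (real^'n \<Rightarrow> real^'n) \<Rightarrow> (real^'n \<Rightarrow> real^'n) \<Rightarrow> bool" where
  "has_trace \<Omega> H A v w \<longleftrightarrow> w \<in> borel_measurable borel \<and>
     (\<exists>\<phi>. (\<forall>k::nat. C1_field (\<phi> k)) \<and>
        (\<lambda>k. l2norm \<Omega> (\<lambda>x. \<phi> k x - v x)) \<longlonglongrightarrow> 0 \<and>
        (\<lambda>k. l2norm \<Omega> (\<lambda>x. jacobian (\<phi> k) (at x) - wgrad \<Omega> v x)) \<longlonglongrightarrow> 0 \<and>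
        (\<lambda>k. set_nn_integral (surface_measure H) A (\<lambda>x. ennreal ((norm (\<phi> k x - w x))\<^sup>2))) \<longlonglongrightarrow> 0)"

text \<open>For subsets \<open>\<Gamma>\<close> of the boundary of a polyhedral domain: that boundary lies in finitely many
  hyperplanes, and on every other hyperplane \<open>\<Gamma>\<close> has surface measure zero.\<close>

definition zero_trace_on :: "(real^'n) set \<Rightarrow> (real^'n) set \<Rightarrow> (real^'n \<Rightarrow> real^'n) \<Rightarrow> bool" where
  "zero_trace_on \<Omega> \<Gamma> v \<longleftrightarrow>
     (\<forall>a b. a \<noteq> 0 \<longrightarrow> has_trace \<Omega> {x. a \<bullet> x = b} (\<Gamma> \<inter> {x. a \<bullet> x = b}) v (\<lambda>_. 0))"

text \<open>The closure of \<open>\<Gamma>\<^sub>D\<close> only makes a difference for degenerate partitions of the boundary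
  whose interface has positive surface measure. There it is what matches the discrete condition,
  which is imposed on the sides contained in the closure of \<open>\<Gamma>\<^sub>D\<close>.\<close>

definition H1_D :: "(real^'n) set \<Rightarrow> (real^'n) set \<Rightarrow> (real^'n \<Rightarrow> real^'n) set" where
  "H1_D \<Omega> \<Gamma>\<^sub>D = {v \<in> H1 \<Omega>. zero_trace_on \<Omega> (closure \<Gamma>\<^sub>D) v}"

text \<open>The condition \<open>\<tau> n = 0\<close> on \<open>\<Gamma>\<^sub>N\<close> is meant weakly, whence the parameter \<open>\<Gamma>\<^sub>D\<close>.\<close>

definition Hdiv_N :: "(real^'n) set \<Rightarrow> (real^'n) set \<Rightarrow> (real^'n \<Rightarrow> real^'n^'n) set" where
  "Hdiv_N \<Omega> \<Gamma>\<^sub>D = {\<tau> \<in> Hdiv \<Omega>. \<forall>v \<in> H1_D \<Omega> \<Gamma>\<^sub>D. ip \<Omega> \<tau> (wgrad \<Omega> v) + ip \<Omega> (wdiv \<Omega> \<tau>) v = 0}"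

section \<open>The domain\<close>

text \<open>Near each boundary point, \<open>\<Omega>\<close> is the part above the graph of a Lipschitz function \<open>g\<close> over
  the hyperplane orthogonal to a unit vector \<open>e\<close>.\<close>

definition lipschitz_boundary :: "(real^'n) set \<Rightarrow> bool" where
  "lipschitz_boundary \<Omega> \<longleftrightarrow> (\<forall>z \<in> frontier \<Omega>. \<exists>U e L g. open U \<and> z \<in> U \<and> norm e = 1 \<and>
     L-lipschitz_on UNIV g \<and> \<Omega> \<inter> U = {y \<in> U. (g (y - (y \<bullet> e) *\<^sub>R e) :: real) < y \<bullet> e})"

definition polyhedral_lipschitz_domain :: "(real^'n) set \<Rightarrow> bool" where
  "polyhedral_lipschitz_domain \<Omega> \<longleftrightarrow> open \<Omega> \<and> connected \<Omega> \<and> bounded \<Omega> \<and> \<Omega> \<noteq> {} \<and>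
     (\<exists>P. finite P \<and> (\<forall>p \<in> P. polytope p) \<and> closure \<Omega> = \<Union>P) \<and> lipschitz_boundary \<Omega>"

definition boundary_parts :: "(real^'n) set \<Rightarrow> (real^'n) set \<Rightarrow> (real^'n) set \<Rightarrow> bool" where
  "boundary_parts \<Omega> \<Gamma>\<^sub>D \<Gamma>\<^sub>N \<longleftrightarrow>
     openin (top_of_set (frontier \<Omega>)) \<Gamma>\<^sub>D \<and> openin (top_of_set (frontier \<Omega>)) \<Gamma>\<^sub>N \<and>
     \<Gamma>\<^sub>D \<inter> \<Gamma>\<^sub>N = {} \<and> \<Gamma>\<^sub>D \<noteq> {} \<and> closure \<Gamma>\<^sub>D \<union> closure \<Gamma>\<^sub>N = frontier \<Omega>"

section \<open>The continuous problem\<close>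

definition Ku :: "(real^'n) set \<Rightarrow> (real^'n) set \<Rightarrow> (real^'n \<Rightarrow> real^'n) set" where
  "Ku \<Omega> \<Gamma>\<^sub>D = {v \<in> H1_D \<Omega> \<Gamma>\<^sub>D. AE x in lebesgue_on \<Omega>. trace (wgrad \<Omega> v x) = 0}"

definition primal ::
  "(real^'n) set \<Rightarrow> real \<Rightarrow> (real^'n \<Rightarrow> real^'n) \<Rightarrow> (real^'n \<Rightarrow> real^'n^'n) \<Rightarrow> (real^'n \<Rightarrow> real^'n) \<Rightarrow>
   (real^'n \<Rightarrow> real^'n) \<Rightarrow> real" where
  "primal \<Omega> \<nu> f F uD v =
     \<nu> / 2 * (l2norm \<Omega> (wgrad \<Omega> (\<lambda>x. v x + uD x)))\<^sup>2 - (ip \<Omega> f v + ip \<Omega> F (wgrad \<Omega> v))"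

definition KT ::
  "(real^'n) set \<Rightarrow> (real^'n) set \<Rightarrow> (real^'n \<Rightarrow> real^'n) \<Rightarrow> (real^'n \<Rightarrow> real^'n^'n) \<Rightarrow>
   (real^'n \<Rightarrow> real^'n^'n) set" where
  "KT \<Omega> \<Gamma>\<^sub>D f F = {\<tau>. (\<lambda>x. \<tau> x - F x) \<in> Hdiv_N \<Omega> \<Gamma>\<^sub>D \<and>
     (AE x in lebesgue_on \<Omega>. wdiv \<Omega> (\<lambda>x. \<tau> x - F x) x = - f x)}"

definition dual ::
  "(real^'n) set \<Rightarrow> real \<Rightarrow> (real^'n \<Rightarrow> real^'n) \<Rightarrow> (real^'n \<Rightarrow> real^'n^'n) \<Rightarrow> real" where
  "dual \<Omega> \<nu> uD \<tau> =
     - (1 / (2 * \<nu>)) * (l2norm \<Omega> (\<lambda>x. dev (\<tau> x)))\<^sup>2 + ip \<Omega> (\<lambda>x. dev (\<tau> x)) (wgrad \<Omega> uD)"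

section \<open>Mesh and discrete spaces\<close>

definition simplicial_mesh :: "(real^'n) set \<Rightarrow> (real^'n) set set \<Rightarrow> bool" where
  "simplicial_mesh \<Omega> M \<longleftrightarrow>
     triangulation M \<and> (\<forall>T \<in> M. int CARD('n) simplex T) \<and> \<Union>M = closure \<Omega>"

definition mesh_resolves_boundary ::
  "(real^'n) set \<Rightarrow> (real^'n) set \<Rightarrow> (real^'n) set \<Rightarrow> (real^'n) set set \<Rightarrow> bool" where
  "mesh_resolves_boundary \<Omega> \<Gamma>\<^sub>D \<Gamma>\<^sub>N M \<longleftrightarrow>
     (\<forall>T \<in> M. \<forall>S. S facet_of T \<and> S \<subseteq> frontier \<Omega> \<longrightarrow> S \<subseteq> closure \<Gamma>\<^sub>D \<or> S \<subseteq> closure \<Gamma>\<^sub>N)"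

text \<open>Element-wise polynomials of degree at most 1. Values on the skeleton, a null set, are arbitrary.\<close>

definition P1 :: "(real^'n) set set \<Rightarrow> (real^'n \<Rightarrow> 'b::euclidean_space) set" where
  "P1 M = {v. \<forall>T \<in> M. \<exists>A b. linear A \<and> (\<forall>x \<in> interior T. v x = A x + b)}"

text \<open>The continuous extension to \<open>T\<close> of the restriction of \<open>v\<close> to the interior of \<open>T\<close>.\<close>

definition elem_val :: "(real^'n) set \<Rightarrow> (real^'n \<Rightarrow> 'b::euclidean_space) \<Rightarrow> real^'n \<Rightarrow> 'b" where
  "elem_val T v x = Lim (at x within interior T) v"

text \<open>The element-wise mean.\<close>

definition Pi_h :: "(real^'n) set set \<Rightarrow> (real^'n \<Rightarrow> 'b::euclidean_space) \<Rightarrow> real^'n \<Rightarrow> 'b" where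
  "Pi_h M f x = (\<Sum>T\<in>M. indicator (interior T) x *\<^sub>R
     ((LINT y|lebesgue_on (interior T). f y) /\<^sub>R measure lebesgue (interior T)))"

text \<open>Almost every point lies in the interior of an element, where the classical derivative of an
  element-wise polynomial is its element-wise derivative.\<close>

definition grad_h :: "(real^'n \<Rightarrow> real^'n) \<Rightarrow> real^'n \<Rightarrow> real^'n^'n" where
  "grad_h v x = jacobian v (at x)"

definition div_h :: "(real^'n \<Rightarrow> real^'n) \<Rightarrow> real^'n \<Rightarrow> real" where
  "div_h v x = trace (grad_h v x)"

text \<open>The mean over a \<open>(d-1)\<close>-dimensional polytope \<open>S\<close>.\<close>

definition side_mean :: "(real^'n) set \<Rightarrow> (real^'n \<Rightarrow> real^'n) \<Rightarrow> real^'n" where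
  "side_mean S g =
     (LINT x:S|surface_measure (affine hull S). g x) /\<^sub>R measure (surface_measure (affine hull S)) S"

definition side_normal :: "(real^'n) set \<Rightarrow> real^'n \<Rightarrow> bool" where
  "side_normal S n \<longleftrightarrow> norm n = 1 \<and> (\<exists>c. S \<subseteq> {x. n \<bullet> x = c})"

text \<open>Crouzeix--Raviart space. The interior sides are the common facets of two distinct elements.\<close>

definition CR :: "(real^'n) set set \<Rightarrow> (real^'n \<Rightarrow> real^'n) set" where
  "CR M = {v \<in> P1 M. \<forall>T \<in> M. \<forall>T' \<in> M. \<forall>S. T \<noteq> T' \<and> S facet_of T \<and> S facet_of T' \<longrightarrow>
     side_mean S (\<lambda>x. elem_val T v x - elem_val T' v x) = 0}"

definition CR_D :: "(real^'n) set \<Rightarrow> (real^'n) set set \<Rightarrow> (real^'n \<Rightarrow> real^'n) set" where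
  "CR_D \<Gamma>\<^sub>D M = {v \<in> CR M. \<forall>T \<in> M. \<forall>S. S facet_of T \<and> S \<subseteq> closure \<Gamma>\<^sub>D \<longrightarrow>
     side_mean S (elem_val T v) = 0}"

text \<open>Raviart--Thomas space. The conditions do not depend on the orientation of the normals.\<close>

definition RT :: "(real^'n) set set \<Rightarrow> (real^'n \<Rightarrow> real^'n^'n) set" where
  "RT M = {\<tau> \<in> P1 M.
     (\<forall>T \<in> M. \<forall>S n. S facet_of T \<and> side_normal S n \<longrightarrow>
        (\<exists>c. \<forall>x \<in> S. elem_val T \<tau> x *v n = c)) \<and>
     (\<forall>T \<in> M. \<forall>T' \<in> M. \<forall>S n. T \<noteq> T' \<and> S facet_of T \<and> S facet_of T' \<and> side_normal S n \<longrightarrow>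
        (\<forall>x \<in> S. elem_val T \<tau> x *v n = elem_val T' \<tau> x *v n))}"

definition RT_N :: "(real^'n) set \<Rightarrow> (real^'n) set set \<Rightarrow> (real^'n \<Rightarrow> real^'n^'n) set" where
  "RT_N \<Gamma>\<^sub>N M = {\<tau> \<in> RT M. \<forall>T \<in> M. \<forall>S n. S facet_of T \<and> S \<subseteq> closure \<Gamma>\<^sub>N \<and> side_normal S n \<longrightarrow>
     (\<forall>x \<in> S. elem_val T \<tau> x *v n = 0)}"

text \<open>The operator is determined by this up to values on the skeleton.\<close>

definition is_cr_interpolation ::
  "(real^'n) set \<Rightarrow> (real^'n) set set \<Rightarrow> ((real^'n \<Rightarrow> real^'n) \<Rightarrow> (real^'n \<Rightarrow> real^'n)) \<Rightarrow> bool" where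
  "is_cr_interpolation \<Omega> M Icr \<longleftrightarrow> (\<forall>v \<in> H1 \<Omega>. Icr v \<in> CR M \<and>
     (\<forall>T \<in> M. \<forall>S. S facet_of T \<longrightarrow>
        (\<exists>w. has_trace \<Omega> (affine hull S) S v w \<and> side_mean S (elem_val T (Icr v)) = side_mean S w)))"

definition is_rt_interpolation ::
  "(real^'n) set \<Rightarrow> (real^'n) set \<Rightarrow> (real^'n) set \<Rightarrow> (real^'n) set set \<Rightarrow>
   ((real^'n \<Rightarrow> real^'n^'n) \<Rightarrow> (real^'n \<Rightarrow> real^'n^'n)) \<Rightarrow> bool" where
  "is_rt_interpolation \<Omega> \<Gamma>\<^sub>D \<Gamma>\<^sub>N M Irt \<longleftrightarrow> (\<forall>\<tau> \<in> Hdiv_N \<Omega> \<Gamma>\<^sub>D. Irt \<tau> \<in> RT_N \<Gamma>\<^sub>N M \<and>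
     (AE x in lebesgue_on \<Omega>. wdiv \<Omega> (Irt \<tau>) x = Pi_h M (wdiv \<Omega> \<tau>) x))"

section \<open>The discrete problem\<close>

definition Ku_h :: "(real^'n) set \<Rightarrow> (real^'n) set \<Rightarrow> (real^'n) set set \<Rightarrow> (real^'n \<Rightarrow> real^'n) set" where
  "Ku_h \<Omega> \<Gamma>\<^sub>D M = {v \<in> CR_D \<Gamma>\<^sub>D M. AE x in lebesgue_on \<Omega>. div_h v x = 0}"

definition primal_h ::
  "(real^'n) set \<Rightarrow> (real^'n) set set \<Rightarrow> real \<Rightarrow> (real^'n \<Rightarrow> real^'n) \<Rightarrow> (real^'n \<Rightarrow> real^'n^'n) \<Rightarrow>
   (real^'n \<Rightarrow> real^'n) \<Rightarrow> (real^'n \<Rightarrow> real^'n) \<Rightarrow> real" where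
  "primal_h \<Omega> M \<nu> fh Fh uDh v =
     \<nu> / 2 * (l2norm \<Omega> (grad_h (\<lambda>x. v x + uDh x)))\<^sup>2 - ip \<Omega> fh (Pi_h M v) - ip \<Omega> Fh (grad_h v)"

definition KT_h ::
  "(real^'n) set \<Rightarrow> (real^'n) set \<Rightarrow> (real^'n) set set \<Rightarrow> (real^'n \<Rightarrow> real^'n) \<Rightarrow> (real^'n \<Rightarrow> real^'n^'n) \<Rightarrow>
   (real^'n \<Rightarrow> real^'n^'n) set" where
  "KT_h \<Omega> \<Gamma>\<^sub>N M fh Fh = {\<tau>. (\<lambda>x. \<tau> x - Fh x) \<in> RT_N \<Gamma>\<^sub>N M \<and>
     (AE x in lebesgue_on \<Omega>. wdiv \<Omega> (\<lambda>x. \<tau> x - Fh x) x = - fh x)}"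

definition dual_h ::
  "(real^'n) set \<Rightarrow> (real^'n) set set \<Rightarrow> real \<Rightarrow> (real^'n \<Rightarrow> real^'n) \<Rightarrow> (real^'n \<Rightarrow> real^'n^'n) \<Rightarrow> real" where
  "dual_h \<Omega> M \<nu> uDh \<tau> =
     - (1 / (2 * \<nu>)) * (l2norm \<Omega> (\<lambda>x. dev (Pi_h M \<tau> x)))\<^sup>2 +
     ip \<Omega> (\<lambda>x. dev (Pi_h M \<tau> x)) (grad_h uDh)"

end

theory Submission imports Defs
begin

text \<open>
  Strong duality holds on both levels: \<open>dev T = \<nu> \<nabla>(u + uD)\<close> and
  \<open>dev (\<Pi> Th) = \<nu> \<nabla>\<^sub>h(uh + uDh)\<close>. In both cases the residual is projected onto the gradients of the
  fields vanishing on the Dirichlet boundary. What remains is an admissible variation of the stress,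
  hence zero; the residual is then a trace-free gradient, hence an admissible variation of the
  velocity, and vanishes too. On the discrete level the remainder is Raviart--Thomas because it is
  tested with the Crouzeix--Raviart function of each side.

  Traces are handled by the cone formula
  \<open>\<integral>\<^sub>T (d u + \<nabla>u (x - v)) = h \<integral>\<^sub>S u\<close> for a vertex \<open>v\<close> of \<open>T\<close> with height \<open>h\<close> over the opposite side \<open>S\<close>.
  Applied to all vertices it yields \<open>\<nabla>\<^sub>h (Icr v) = \<Pi> \<nabla>v\<close>.

  (i) Let \<open>A\<close>, \<open>B\<close>, \<open>C\<close> be the projected deviators of \<open>T - F\<close>, \<open>Irt (T - F)\<close>, \<open>Th - Fh\<close>. Then
  \<open>A - C = \<nu> \<nabla>\<^sub>h(Icr u - uh)\<close>, while \<open>B - C\<close> comes from a divergence-free Raviart--Thomas field, so the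
  two are orthogonal by discrete integration by parts, and Pythagoras applies to \<open>A - B\<close>.

  (ii) Let \<open>s = \<nabla>(u + uD)\<close>, \<open>s' = \<nabla>\<^sub>h(uh + uDh)\<close>, \<open>p = \<nabla>\<^sub>h(vh + uDh)\<close> and \<open>q = dev (\<Pi> \<tau>h) / \<nu>\<close>. By the same
  orthogonality \<open>(p - s', q - s') = 0\<close>, whence \<open>|s - s'|^2 \<le> |s - p|^2 + |s - q|^2\<close>.
\<close>

text \<open>Projecting onto all gradients, and not only onto the trace-free ones, is what keeps a
  pressure out of the argument: the remainder then satisfies the homogeneous stress constraint and
  may be added to the given maximiser. The trace constraint returns only after the residual has
  turned out to be a gradient.

  The price is paid on the continuous level, where the gradients of \<open>H1_D\<close> have to form
  a closed subspace. This rests on a Poincare--Friedrichs inequality, while zero traces are known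
  only through sequences of C1 fields, with a separate sequence for each hyperplane. The inequality
  is therefore started from a cone formula at a single Dirichlet side. That such a side exists has
  to be extracted from \<open>\<Gamma>D\<close> being nonempty and relatively open; a generic
  segment leaving the domain finds it, because it avoids all faces of dimension below
  \<open>d - 1\<close>.

  As each trace comes with its own sequence, facts about several sides of an element are obtained by
  comparing one cone formula per side. Summed over the fields \<open>x - v\<close>, the same formula
  serves as the divergence theorem for Raviart--Thomas fields.\<close>

abbreviation leb :: "('a::euclidean_space) set \<Rightarrow> 'a measure" where "leb \<equiv> lebesgue_on"

section \<open>Square-integrable fields\<close>

lemma L2_spaceD:
 assumes "f \<in> L2_space D"
 shows L2_measurable: "f \<in> borel_measurable (leb D)"
  and L2_norm_sq_integrable: "integrable (leb D) (\<lambda>x. (norm (f x))^2)" using assms by (auto simp: L2_space_def)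

lemma L2_spaceI_bound:
 assumes "f \<in> borel_measurable (leb D)" "integrable (leb D) h"
  and "AE x in leb D. (norm (f x))^2 \<le> h x"
 shows "f \<in> L2_space D"
proof -
 have "integrable (leb D) (\<lambda>x. (norm (f x))^2)" by (rule Bochner_Integration.integrable_bound[OF assms(2)]) (use assms in auto)
 then show ?thesis using assms(1) by (simp add: L2_space_def)
qed

lemma L2_inner_integrable:
 assumes "f \<in> L2_space D" "g \<in> L2_space D"
 shows "integrable (leb D) (\<lambda>x. f x \<bullet> g x)"
proof (rule Bochner_Integration.integrable_bound)
 show "integrable (leb D) (\<lambda>x. (norm (f x))^2 + (norm (g x))^2)" using assms by (simp add: L2_space_def)
 show "(\<lambda>x. f x \<bullet> g x) \<in> borel_measurable (leb D)" using assms by (auto simp: L2_space_def)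
 have "\<bar>f x \<bullet> g x\<bar> \<le> (norm (f x))^2 + (norm (g x))^2" for x
 proof -
  have "\<bar>f x \<bullet> g x\<bar> \<le> norm (f x) * norm (g x)" by (rule Cauchy_Schwarz_ineq2)
  also have "... \<le> (norm (f x))^2 + (norm (g x))^2" using sum_squares_bound[of "norm (f x)" "norm (g x)"]
    mult_nonneg_nonneg[OF norm_ge_zero[of "f x"] norm_ge_zero[of "g x"]] unfolding mult.assoc by linarith
  finally show ?thesis .
 qed
 then show "AE x in leb D. norm (f x \<bullet> g x) \<le> norm ((norm (f x))^2 + (norm (g x))^2)" by (auto intro!: AE_I2)
qed

lemma norm_add_sq_le: "(norm (a + b))^2 \<le> 2 * (norm a)^2 + 2 * (norm (b :: 'a::real_inner))^2"
proof -
 have "(norm (a + b))^2 + (norm (a - b))^2 = 2 * (norm a)^2 + 2 * (norm b)^2" by (simp add: power2_norm_eq_inner inner_simps inner_commute)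
 then show ?thesis using zero_le_power2[of "norm (a - b)"] by linarith
qed

lemma L2_add [simp, intro]:
 assumes "f \<in> L2_space D" "g \<in> L2_space D"
 shows "(\<lambda>x. f x + g x) \<in> L2_space D"
proof (rule L2_spaceI_bound[where h = "\<lambda>x. 2 * (norm (f x))^2 + 2 * (norm (g x))^2"])
 show "integrable (leb D) (\<lambda>x. 2 * (norm (f x))^2 + 2 * (norm (g x))^2)" using assms by (simp add: L2_space_def)
qed (use assms norm_add_sq_le in \<open>auto simp: L2_space_def intro!: AE_I2\<close>)

lemma L2_bounded_linear:
 assumes "f \<in> L2_space D" "bounded_linear h"
 shows "(\<lambda>x. h (f x)) \<in> L2_space D"
proof -
 obtain K where K: "\<And>x. norm (h x) \<le> norm x * K" using bounded_linear.bounded[OF assms(2)] by blast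
 show ?thesis
 proof (rule L2_spaceI_bound[where h = "\<lambda>x. K^2 * (norm (f x))^2"])
  show "(\<lambda>x. h (f x)) \<in> borel_measurable (leb D)" by (rule measurable_compose[OF L2_measurable[OF assms(1)]
     borel_measurable_continuous_onI[OF linear_continuous_on[OF assms(2)]]])
  have "(norm (h (f x)))^2 \<le> K^2 * (norm (f x))^2" for x using power_mono[OF K, of "f x" 2] by (simp add: power_mult_distrib mult.commute)
  then show "AE x in leb D. (norm (h (f x)))^2 \<le> K^2 * (norm (f x))^2" by simp
 qed (use assms in \<open>auto simp: L2_space_def\<close>)
qed

lemma L2_scaleR [simp, intro]: "f \<in> L2_space D \<Longrightarrow> (\<lambda>x. c *\<^sub>R f x) \<in> L2_space D"
 by (erule L2_bounded_linear[OF _ bounded_linear_scaleR_right])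

lemma L2_uminus [simp, intro]: "f \<in> L2_space D \<Longrightarrow> (\<lambda>x. - f x) \<in> L2_space D" using L2_scaleR[of f D "-1"] by simp

lemma L2_diff [simp, intro]:
 "f \<in> L2_space D \<Longrightarrow> g \<in> L2_space D \<Longrightarrow> (\<lambda>x. f x - g x) \<in> L2_space D" using L2_add[of f D "\<lambda>x. - g x"] by simp

lemma L2_zero [simp, intro]: "(\<lambda>x. 0) \<in> L2_space D" by (simp add: L2_space_def)

text \<open>Rests on the completeness of Lebesgue measure: changing a measurable function on a null
  set keeps it measurable. This makes the later constructions insensitive to the representatives
  picked by \<open>wgrad\<close> and \<open>wdiv\<close>.\<close>

lemma measurable_lebesgue_on_cong_AE:
 fixes f g :: "real^'n \<Rightarrow> 'b::euclidean_space"
 assumes "D \<in> sets lebesgue" "f \<in> borel_measurable (leb D)" "AE x in leb D. f x = g x"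
 shows "g \<in> borel_measurable (leb D)"
proof -
 let ?f = "\<lambda>x. if x \<in> D then f x else 0" and ?g = "\<lambda>x. if x \<in> D then g x else 0"
 have "?f \<in> borel_measurable lebesgue" by (rule borel_measurable_if_I[OF assms(2,1)])
 moreover have "AE x in lebesgue. ?f x = ?g x" using assms(1,3) by (simp add: AE_restrict_space_iff)
 ultimately have "?g \<in> borel_measurable lebesgue" by (rule borel_measurable_AE)
 then show ?thesis by (rule borel_measurable_if_D)
qed

lemma L2_cong_AE:
 assumes "D \<in> sets lebesgue" "f \<in> L2_space D" "AE x in leb D. f x = g x"
 shows "g \<in> L2_space D"
proof -
 have g: "g \<in> borel_measurable (leb D)" by (rule measurable_lebesgue_on_cong_AE[OF assms(1) L2_measurable[OF assms(2)] assms(3)])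
 show ?thesis
 proof (rule L2_spaceI_bound[OF g L2_norm_sq_integrable[OF assms(2)]])
  show "AE x in leb D. (norm (g x))^2 \<le> (norm (f x))^2" using assms(3) by eventually_elim simp
 qed
qed

lemma ip_add_left:
 "\<lbrakk>f \<in> L2_space D; g \<in> L2_space D; h \<in> L2_space D\<rbrakk> \<Longrightarrow> ip D (\<lambda>x. f x + g x) h = ip D f h + ip D g h"
 by (simp add: ip_def inner_add_left L2_inner_integrable)

lemma ip_commute: "ip D f g = ip D g f" by (simp add: ip_def inner_commute)

lemma ip_add_right:
 "\<lbrakk>f \<in> L2_space D; g \<in> L2_space D; h \<in> L2_space D\<rbrakk> \<Longrightarrow> ip D h (\<lambda>x. f x + g x) = ip D h f + ip D h g"
 by (simp add: ip_def inner_add_right L2_inner_integrable)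

lemma ip_diff_left:
 "\<lbrakk>f \<in> L2_space D; g \<in> L2_space D; h \<in> L2_space D\<rbrakk> \<Longrightarrow> ip D (\<lambda>x. f x - g x) h = ip D f h - ip D g h"
 by (simp add: ip_def inner_diff_left L2_inner_integrable)

lemma ip_diff_right:
 "\<lbrakk>f \<in> L2_space D; g \<in> L2_space D; h \<in> L2_space D\<rbrakk> \<Longrightarrow> ip D h (\<lambda>x. f x - g x) = ip D h f - ip D h g"
 by (simp add: ip_def inner_diff_right L2_inner_integrable)

lemma ip_scaleR_left: "ip D (\<lambda>x. c *\<^sub>R f x) g = c * ip D f g" by (simp add: ip_def)

lemma ip_scaleR_right: "ip D g (\<lambda>x. c *\<^sub>R f x) = c * ip D g f" by (simp add: ip_def)

lemma ip_uminus_left: "ip D (\<lambda>x. - f x) g = - ip D f g" by (simp add: ip_def)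

lemma ip_zero [simp]: "ip D (\<lambda>x. 0) g = 0" "ip D g (\<lambda>x. 0) = 0" by (simp_all add: ip_def)

lemma ip_uminus_right: "ip D g (\<lambda>x. - f x) = - ip D g f" by (simp add: ip_def)

lemmas ip_linear = ip_add_left ip_add_right ip_diff_left ip_diff_right ip_scaleR_left ip_scaleR_right
 ip_uminus_left ip_uminus_right

text \<open>Holds for arbitrary functions: by completeness \<open>f\<close> and \<open>g\<close> are
  measurable together, and the Bochner integral of a nonmeasurable function is 0 by convention, so
  the two sides agree in that case as well.\<close>

lemma integral_cong_AE_lebesgue_on:
 fixes f g :: "real^'n \<Rightarrow> 'b::euclidean_space"
 assumes "D \<in> sets lebesgue" "AE x in leb D. f x = g x"
 shows "(LINT x|leb D. f x) = (LINT x|leb D. g x)"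
proof -
 have a: "AE x in leb D. g x = f x" using assms(2) by eventually_elim simp
 show ?thesis
 proof (cases "f \<in> borel_measurable (leb D)")
  case True
  then have "g \<in> borel_measurable (leb D)" by (rule measurable_lebesgue_on_cong_AE[OF assms(1) _ assms(2)])
  then show ?thesis using True assms(2) by (intro integral_cong_AE)
 next
  case False
  then have "g \<notin> borel_measurable (leb D)" using measurable_lebesgue_on_cong_AE[OF assms(1) _ a] by auto
  then show ?thesis using False by (metis borel_measurable_integrable not_integrable_integral_eq)
 qed
qed

lemma ip_cong_AE:
 assumes "D \<in> sets lebesgue" "AE x in leb D. f x = f' x" "AE x in leb D. g x = g' x"
 shows "ip D f g = ip D f' g'" unfolding ip_def by (rule integral_cong_AE_lebesgue_on[OF assms(1)]) (use assms(2,3) in \<open>eventually_elim, simp\<close>)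

lemma l2norm_cong_AE:
 assumes "D \<in> sets lebesgue" "AE x in leb D. f x = g x"
 shows "l2norm D f = l2norm D g" unfolding l2norm_def using ip_cong_AE[OF assms(1) assms(2) assms(2)] by simp

lemma ip_self_nonneg [simp]: "0 \<le> ip D f f" by (simp add: ip_def)

lemma l2norm_nonneg [simp]: "0 \<le> l2norm D f" by (simp add: l2norm_def)

lemma l2norm_sq: "(l2norm D f)^2 = ip D f f" by (simp add: l2norm_def)

lemma l2norm_sq_integral: "(l2norm D f)^2 = (LINT x|leb D. (norm (f x))^2)" by (simp add: l2norm_sq ip_def power2_norm_eq_inner)

lemma l2norm_scaleR: "l2norm D (\<lambda>x. c *\<^sub>R f x) = \<bar>c\<bar> * l2norm D f"
 by (simp add: l2norm_def ip_linear real_sqrt_mult mult.assoc[symmetric] real_sqrt_abs2[unfolded power2_eq_square])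

lemma l2norm_minus_commute: "l2norm D (\<lambda>x. f x - g x) = l2norm D (\<lambda>x. g x - f x)" using l2norm_scaleR[of D "-1" "\<lambda>x. f x - g x"] by simp

lemma ip_Cauchy_Schwarz:
 assumes "f \<in> L2_space D" "g \<in> L2_space D"
 shows "\<bar>ip D f g\<bar> \<le> l2norm D f * l2norm D g"
proof -
 let ?a = "ip D f f" let ?b = "ip D f g" let ?c = "ip D g g"
 have q: "0 \<le> ?a + 2 * t * ?b + t^2 * ?c" for t
 proof -
  have "0 \<le> ip D (\<lambda>x. f x + t *\<^sub>R g x) (\<lambda>x. f x + t *\<^sub>R g x)" by simp
  also have "... = ?a + 2 * t * ?b + t^2 * ?c" using assms by (simp add: ip_linear ip_commute[of D g f] algebra_simps power2_eq_square)
  finally show ?thesis .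
 qed
 have "?b^2 \<le> ?a * ?c"
 proof (cases "?c = 0")
  case True
  have "?b = 0"
  proof (rule ccontr)
   assume "?b \<noteq> 0"
   \<comment> \<open>For \<open>?c = 0\<close> the quadratic is affine in \<open>t\<close>, and this
     \<open>t\<close> gives it the value -1.\<close>
   then show False using q[of "-(?a + 1) / (2 * ?b)"] True by (simp add: field_simps)
  qed
  then show ?thesis using True by simp
 next
  case False
  then have "?c > 0" using ip_self_nonneg[of D g] by linarith
  then show ?thesis using q[of "- ?b / ?c"] by (simp add: field_simps power2_eq_square)
 qed
 then have "sqrt (?b^2) \<le> sqrt (?a * ?c)" by (rule real_sqrt_le_mono)
 then show ?thesis by (simp add: l2norm_def real_sqrt_mult)
qed

lemma l2norm_triangle:
 assumes "f \<in> L2_space D" "g \<in> L2_space D"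
 shows "l2norm D (\<lambda>x. f x + g x) \<le> l2norm D f + l2norm D g"
proof (rule power2_le_imp_le)
 have "(l2norm D (\<lambda>x. f x + g x))^2 = ip D f f + 2 * ip D f g + ip D g g" using assms by (simp add: l2norm_sq ip_linear ip_commute[of D g f])
 also have "... \<le> (l2norm D f + l2norm D g)^2" using ip_Cauchy_Schwarz[OF assms] by (simp add: power2_sum l2norm_sq)
 finally show "(l2norm D (\<lambda>x. f x + g x))^2 \<le> (l2norm D f + l2norm D g)^2" .
qed simp

lemma l2norm_triangle_diff:
 assumes "f \<in> L2_space D" "g \<in> L2_space D" "h \<in> L2_space D"
 shows "l2norm D (\<lambda>x. f x - h x) \<le> l2norm D (\<lambda>x. f x - g x) + l2norm D (\<lambda>x. g x - h x)"
 using l2norm_triangle[of "\<lambda>x. f x - g x" D "\<lambda>x. g x - h x"] assms by simp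

lemma l2norm_diff_bound:
 assumes "f \<in> L2_space D" "g \<in> L2_space D"
 shows "\<bar>l2norm D f - l2norm D g\<bar> \<le> l2norm D (\<lambda>x. f x - g x)"
 using l2norm_triangle[of "\<lambda>x. f x - g x" D g] l2norm_triangle[of "\<lambda>x. g x - f x" D f] assms
  l2norm_minus_commute[of D f g] by simp

lemma l2norm_zero_AE:
 assumes "f \<in> L2_space D" "ip D f f = 0"
 shows "AE x in leb D. f x = 0"
proof -
 have "integrable (leb D) (\<lambda>x. (norm (f x))^2)" using assms(1) by (simp add: L2_space_def)
 moreover have "(LINT x|leb D. (norm (f x))^2) = 0" using assms(2) by (simp add: ip_def power2_norm_eq_inner)
 ultimately have "AE x in leb D. (norm (f x))^2 = 0" by (subst (asm) integral_nonneg_eq_0_iff_AE) auto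
 then show ?thesis by eventually_elim simp
qed

lemma ip_tendsto:
 assumes "\<And>k. f k \<in> L2_space D" "g \<in> L2_space D" "h \<in> L2_space D"
  and "(\<lambda>k. l2norm D (\<lambda>x. f k x - g x)) \<longlonglongrightarrow> 0"
 shows "(\<lambda>k. ip D (f k) h) \<longlonglongrightarrow> ip D g h"
proof -
 have "(\<lambda>k. ip D (f k) h - ip D g h) \<longlonglongrightarrow> 0"
 proof (rule Lim_null_comparison)
  show "\<forall>\<^sub>F k in sequentially. norm (ip D (f k) h - ip D g h) \<le> l2norm D (\<lambda>x. f k x - g x) * l2norm D h"
   using ip_Cauchy_Schwarz[of "\<lambda>x. f _ x - g x" D h] assms by (auto simp: ip_linear)
  show "(\<lambda>k. l2norm D (\<lambda>x. f k x - g x) * l2norm D h) \<longlonglongrightarrow> 0" using tendsto_mult_left_zero[OF assms(4)] by simp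
 qed
 then show ?thesis by (simp add: LIM_zero_iff)
qed

lemma L2_component:
 fixes f :: "real^'n \<Rightarrow> 'b::euclidean_space^'m"
 shows "f \<in> L2_space D \<Longrightarrow> (\<lambda>x. f x $ i) \<in> L2_space D" by (rule L2_bounded_linear) (auto intro: bounded_linear_vec_nth)

lemma L2_bounded_function:
 assumes "D \<in> lmeasurable" "f \<in> borel_measurable (leb D)" "\<And>x. x \<in> D \<Longrightarrow> norm (f x) \<le> B"
 shows "f \<in> L2_space D"
proof (rule L2_spaceI_bound[OF assms(2), where h = "\<lambda>x. B^2"])
 show "integrable (leb D) (\<lambda>x. B^2)" using assms(1) finite_measure.integrable_const finite_measure_lebesgue_on by blast
 have "(norm (f x))^2 \<le> B^2" if "x \<in> D" for x using power_mono[OF assms(3)[OF that], of 2] by simp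
 then show "AE x in leb D. (norm (f x))^2 \<le> B^2" by (auto intro!: AE_I2)
qed

lemma L2_integrable:
 assumes "D \<in> lmeasurable" "f \<in> L2_space D"
 shows "integrable (leb D) f"
proof (rule Bochner_Integration.integrable_bound)
 show "integrable (leb D) (\<lambda>x. 1 + (norm (f x))^2)" using finite_measure.integrable_const[OF finite_measure_lebesgue_on[OF assms(1)], of "1::real"]
   L2_norm_sq_integrable[OF assms(2)] by (rule Bochner_Integration.integrable_add)
 have "norm (f x) \<le> 1 + (norm (f x))^2" for x
 proof -
  have "2 * norm (f x) \<le> (norm (f x))^2 + 1" using sum_squares_bound[of "norm (f x)" 1] by simp
  then show ?thesis using norm_ge_zero[of "f x"] zero_le_power2[of "norm (f x)"] by linarith
 qed
 then show "AE x in leb D. norm (f x) \<le> norm (1 + (norm (f x))^2)" by auto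
qed (use assms in \<open>auto simp: L2_space_def\<close>)


lemma nn_integral_l2norm:
 assumes "f \<in> L2_space D"
 shows "(\<integral>\<^sup>+ x. ennreal ((norm (f x))^2) \<partial>leb D) = ennreal ((l2norm D f)^2)"
 unfolding l2norm_sq_integral using L2_norm_sq_integrable[OF assms] by (intro nn_integral_eq_integral) auto

section \<open>Completeness of L2 and orthogonal projection\<close>

text \<open>The squared increments have integral at most \<open>(1/16) ^ k\<close>, so they stay
  summable after multiplication by \<open>4 ^ k\<close>. At almost every point the weighted series
  has a finite sum \<open>B\<close>, whence the increments are at most
  \<open>sqrt B * (1/2) ^ k\<close> and the telescoping series converges.\<close>

lemma L2_Cauchy_fast_subsequence:
 fixes f :: "nat \<Rightarrow> real^'n \<Rightarrow> 'b::euclidean_space"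
 assumes f: "\<And>k. f k \<in> L2_space D"
  and r: "\<And>k. l2norm D (\<lambda>x. f (Suc k) x - f k x) \<le> (1/4) ^ k"
 shows "AE x in leb D. convergent (\<lambda>k. f k x)"
proof -
 let ?d = "\<lambda>k x. f (Suc k) x - f k x"
 let ?u = "\<lambda>k x. ennreal (4 ^ k * (norm (?d k x))^2)"
 have d: "?d k \<in> L2_space D" for k using f by simp
 have dm: "(\<lambda>x. norm (?d k x)) \<in> borel_measurable (leb D)" for k using L2_measurable[OF d[of k]] by measurable
 have um: "?u k \<in> borel_measurable (leb D)" for k using dm[of k] by measurable
 have ui: "(\<integral>\<^sup>+ x. ?u k x \<partial>leb D) \<le> ennreal ((1/4) ^ k)" for k
 proof -
  have "(\<integral>\<^sup>+ x. ?u k x \<partial>leb D)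
    = (\<integral>\<^sup>+ x. ennreal (4 ^ k) * ennreal ((norm (?d k x))^2) \<partial>leb D)" by (simp add: ennreal_mult')
  also have "... = ennreal (4 ^ k) * (\<integral>\<^sup>+ x. ennreal ((norm (?d k x))^2) \<partial>leb D)" by (rule nn_integral_cmult) (use dm[of k] in measurable)
  also have "... = ennreal (4 ^ k * (l2norm D (?d k))^2)" by (simp add: nn_integral_l2norm[OF d] ennreal_mult')
  also have "4 ^ k * (l2norm D (?d k))^2 \<le> 4 ^ k * ((1/4) ^ k)^2" by (intro mult_left_mono power_mono r) auto
  also have "(4::real) ^ k * ((1/4) ^ k)^2 = (1/4) ^ k" by (simp add: power2_eq_square power_mult_distrib[symmetric] mult.assoc[symmetric])
  finally show ?thesis by (simp add: ennreal_leI)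
 qed
 have "(\<integral>\<^sup>+ x. (\<Sum>k. ?u k x) \<partial>leb D) = (\<Sum>k. \<integral>\<^sup>+ x. ?u k x \<partial>leb D)" by (rule nn_integral_suminf[OF um])
 also have "... \<le> (\<Sum>k. ennreal ((1/4) ^ k))" by (rule suminf_le[OF ui]) auto
 also have "... = ennreal (\<Sum>k. (1/4) ^ k)" by (rule suminf_ennreal2) (auto intro: summable_geometric)
 finally have "(\<integral>\<^sup>+ x. (\<Sum>k. ?u k x) \<partial>leb D) \<noteq> \<infinity>" by (metis ennreal_less_top infinity_ennreal_def leD top_unique)
 moreover have "(\<lambda>x. \<Sum>k. ?u k x) \<in> borel_measurable (leb D)" using um by measurable
 ultimately have "AE x in leb D. (\<Sum>k. ?u k x) \<noteq> \<infinity>" by (intro nn_integral_PInf_AE) auto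
 then show ?thesis
 proof eventually_elim
  case (elim x)
  then have "(\<Sum>k. ?u k x) \<noteq> top" by (simp only: infinity_ennreal_def) simp
  then have sm: "summable (\<lambda>k. 4 ^ k * (norm (?d k x))^2)" by (rule summable_suminf_not_top[rotated]) simp
  define B where "B = (\<Sum>k. 4 ^ k * (norm (?d k x))^2)"
  have B: "0 \<le> B" unfolding B_def by (rule suminf_nonneg[OF sm]) simp
  have "norm (?d k x) \<le> sqrt B * (1/2) ^ k" for k
  proof (rule power2_le_imp_le)
   have "4 ^ k * (norm (?d k x))^2 \<le> B" using sum_le_suminf[OF sm, of "{k}"] unfolding B_def by simp
   moreover have "((1/2::real) ^ k)^2 * 4 ^ k = 1" by (simp add: power2_eq_square power_mult_distrib[symmetric])
   ultimately have "((1/2) ^ k)^2 * (4 ^ k * (norm (?d k x))^2) \<le> ((1/2) ^ k)^2 * B" by (intro mult_left_mono) auto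
   then have "(norm (?d k x))^2 \<le> ((1/2) ^ k)^2 * B" using \<open>((1/2::real) ^ k)^2 * 4 ^ k = 1\<close> by (simp only: mult.assoc[symmetric] mult_1)
   then show "(norm (?d k x))^2 \<le> (sqrt B * (1/2) ^ k)^2" using B by (simp add: power_mult_distrib mult.commute)
  qed (use B in simp)
  note le = this
  have "summable (\<lambda>k. sqrt B * (1/2) ^ k)" by (intro summable_mult summable_geometric) simp
  then have "summable (\<lambda>k. ?d k x)" by (rule summable_comparison_test'[where N = 0]) (rule le)
  then have "convergent (\<lambda>n. \<Sum>k<n. ?d k x)" by (simp add: summable_iff_convergent)
  then have "convergent (\<lambda>n. f n x - f 0 x)" by (simp only: sum_lessThan_telescope[of "\<lambda>k. f k x"])
  from convergent_add[OF this convergent_const[of "f 0 x"]] show ?case by simp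
 qed
qed

text \<open>Riesz--Fischer. The pointwise limit of a fast subsequence is the candidate; Fatou's
  lemma carries the Cauchy bound over to it, which gives both its square-integrability and the
  convergence of the full sequence.\<close>

lemma L2_complete:
 fixes f :: "nat \<Rightarrow> real^'n \<Rightarrow> 'b::euclidean_space"
 assumes f: "\<And>k. f k \<in> L2_space D"
  and Cauchy: "\<And>e. e > 0 \<Longrightarrow> \<exists>N. \<forall>m\<ge>N. \<forall>n\<ge>N. l2norm D (\<lambda>x. f m x - f n x) < e"
 obtains g where "g \<in> L2_space D" "(\<lambda>k. l2norm D (\<lambda>x. f k x - g x)) \<longlonglongrightarrow> 0"
proof -
 have "\<forall>k. \<exists>N. \<forall>m\<ge>N. \<forall>n\<ge>N. l2norm D (\<lambda>x. f m x - f n x) < (1/4) ^ k" using Cauchy by simp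
 then obtain N where N: "\<And>k m n. N k \<le> m \<Longrightarrow> N k \<le> n \<Longrightarrow> l2norm D (\<lambda>x. f m x - f n x) < (1/4) ^ k" by metis
 \<comment> \<open>Partial sums give indices that dominate \<open>N k\<close> for every
   \<open>k\<close> up to the current one, as \<open>rN\<close> records.\<close>
 define r where "r k = (\<Sum>i\<le>k. N i)" for k
 have rN: "N k \<le> r m" if "k \<le> m" for k m unfolding r_def by (rule member_le_sum) (use that in auto)
 define g where "g x = lim (\<lambda>k. f (r k) x)" for x
 have conv: "AE x in leb D. (\<lambda>k. f (r k) x) \<longlonglongrightarrow> g x"
 proof -
  have "AE x in leb D. convergent (\<lambda>k. f (r k) x)" by (rule L2_Cauchy_fast_subsequence) (use f N rN in \<open>auto intro!: less_imp_le\<close>)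
  then show ?thesis by eventually_elim (simp add: g_def convergent_LIMSEQ_iff)
 qed
 have gm: "g \<in> borel_measurable (leb D)" unfolding g_def by (rule borel_measurable_lim_metric) (rule L2_measurable[OF f])
 \<comment> \<open>Fatou in \<open>m\<close> with \<open>n\<close> fixed: for
   \<open>m \<ge> k\<close> both indices are beyond \<open>N k\<close>.\<close>
 have fat: "(\<integral>\<^sup>+ x. ennreal ((norm (f n x - g x))^2) \<partial>leb D) \<le> ennreal (((1/4) ^ k)^2)"
  if "N k \<le> n" for k n
 proof -
  let ?v = "\<lambda>m x. ennreal ((norm (f n x - f (r m) x))^2)"
  have fm: "f k \<in> borel_measurable (leb D)" for k by (rule L2_measurable[OF f])
  have "AE x in leb D. ennreal ((norm (f n x - g x))^2) = liminf (\<lambda>m. ?v m x)" using conv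
  proof eventually_elim
   case (elim x)
   have "(\<lambda>m. ?v m x) \<longlonglongrightarrow> ennreal ((norm (f n x - g x))^2)" by (intro tendsto_intros elim tendsto_ennrealI)
   from lim_imp_Liminf[OF _ this] show ?case by simp
  qed
  then have "(\<integral>\<^sup>+ x. ennreal ((norm (f n x - g x))^2) \<partial>leb D)
    = (\<integral>\<^sup>+ x. liminf (\<lambda>m. ?v m x) \<partial>leb D)" by (rule nn_integral_cong_AE)
  also have "... \<le> liminf (\<lambda>m. \<integral>\<^sup>+ x. ?v m x \<partial>leb D)" by (rule nn_integral_liminf) (use fm in measurable)
  also have "... \<le> ennreal (((1/4) ^ k)^2)"
  proof (rule Liminf_le)
   show "\<forall>\<^sub>F m in sequentially. (\<integral>\<^sup>+ x. ?v m x \<partial>leb D) \<le> ennreal (((1/4) ^ k)^2)" using eventually_ge_at_top[of k]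
   proof eventually_elim
    case (elim m)
    have "(\<integral>\<^sup>+ x. ?v m x \<partial>leb D) = ennreal ((l2norm D (\<lambda>x. f n x - f (r m) x))^2)" by (rule nn_integral_l2norm) (use f in simp)
    also have "... \<le> ennreal (((1/4) ^ k)^2)" by (rule ennreal_leI[OF power_mono[OF less_imp_le[OF N[OF that rN[OF elim]]] l2norm_nonneg]])
    finally show ?case .
   qed
  qed simp
  finally show ?thesis .
 qed
 have diff: "(\<lambda>x. f n x - g x) \<in> L2_space D" if "N 0 \<le> n" for n
 proof -
  have m: "(\<lambda>x. f n x - g x) \<in> borel_measurable (leb D)" using L2_measurable[OF f[of n]] gm by measurable
  moreover have "integrable (leb D) (\<lambda>x. (norm (f n x - g x))^2)"
  proof (rule integrableI_bounded)
   show "(\<lambda>x. (norm (f n x - g x))^2) \<in> borel_measurable (leb D)" using m by measurable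
   have "(\<integral>\<^sup>+ x. ennreal (norm ((norm (f n x - g x))^2)) \<partial>leb D) \<le> ennreal (((1/4) ^ 0)^2)" using fat[OF that] by simp
   then show "(\<integral>\<^sup>+ x. ennreal (norm ((norm (f n x - g x))^2)) \<partial>leb D) < \<infinity>" by (rule order.strict_trans1) simp
  qed
  ultimately show ?thesis by (simp add: L2_space_def)
 qed
 have gL2: "g \<in> L2_space D" using L2_diff[OF f[of "N 0"] diff[of "N 0"]] by simp
 have "l2norm D (\<lambda>x. f n x - g x) \<le> (1/4) ^ k" if "N k \<le> n" for k n
 proof (rule power2_le_imp_le)
  show "(l2norm D (\<lambda>x. f n x - g x))^2 \<le> ((1/4) ^ k)^2" using fat[OF that] nn_integral_l2norm[OF L2_diff[OF f[of n] gL2]] by simp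
 qed simp
 moreover have "\<exists>k. (1/4::real) ^ k < e" if "e > 0" for e using real_arch_pow_inv[OF that, of "1/4"] by simp
 ultimately have "(\<lambda>k. l2norm D (\<lambda>x. f k x - g x)) \<longlonglongrightarrow> 0"
  unfolding LIMSEQ_def dist_real_def by (simp add: abs_of_nonneg) (meson le_less_trans)
 with gL2 show ?thesis by (rule that)
qed

lemma L2_sum [simp, intro]: "(\<And>i. i \<in> I \<Longrightarrow> b i \<in> L2_space D) \<Longrightarrow> (\<lambda>x. \<Sum>i\<in>I. b i x) \<in> L2_space D"
 by (induction I rule: infinite_finite_induct) auto

lemma ip_sum_right:
 "f \<in> L2_space D \<Longrightarrow> (\<And>i. i \<in> I \<Longrightarrow> b i \<in> L2_space D) \<Longrightarrow>
  ip D f (\<lambda>x. \<Sum>i\<in>I. b i x) = (\<Sum>i\<in>I. ip D f (b i))" by (induction I rule: infinite_finite_induct) (auto simp: ip_add_right)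

lemma ip_diff_scaleR:
 assumes "f \<in> L2_space D" "g \<in> L2_space D" "h \<in> L2_space D"
 shows "ip D (\<lambda>x. f x - t *\<^sub>R g x) h = ip D f h - t * ip D g h" using assms by (simp add: ip_linear)

text \<open>If \<open>g\<close> vanishes almost everywhere, the quotient is 0 by the convention on
  division, and Cauchy--Schwarz supplies the orthogonality.\<close>

lemma ip_line_projection:
 assumes "f \<in> L2_space D" "g \<in> L2_space D"
 shows "ip D (\<lambda>x. f x - (ip D f g / ip D g g) *\<^sub>R g x) g = 0"
proof (cases "ip D g g = 0")
 case True
 then have "l2norm D g = 0" by (simp add: l2norm_def)
 then show ?thesis using ip_Cauchy_Schwarz[OF assms] True by (simp add: ip_diff_scaleR assms)
next
 case False then show ?thesis by (simp add: ip_diff_scaleR assms)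
qed

lemma l2norm_diff_scaleR_sq:
 assumes "f \<in> L2_space D" "g \<in> L2_space D"
 shows "(l2norm D (\<lambda>x. f x - t *\<^sub>R g x))^2 = (l2norm D f)^2 - 2 * t * ip D f g + t^2 * ip D g g"
 using assms by (simp add: l2norm_sq ip_linear ip_commute[of D g f] power2_eq_square[of t] algebra_simps)

lemma l2norm_parallelogram:
 assumes "f \<in> L2_space D" "g \<in> L2_space D"
 shows "(l2norm D (\<lambda>x. f x + g x))^2 + (l2norm D (\<lambda>x. f x - g x))^2
  = 2 * (l2norm D f)^2 + 2 * (l2norm D g)^2" using assms by (simp add: l2norm_sq ip_linear ip_commute[of D g f])

text \<open>Gram--Schmidt by induction. The \<open>b i\<close> may be linearly dependent: if
  \<open>b k\<close> lies in the span of the others up to a null set,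
  \<open>ip_line_projection\<close> still yields orthogonality.\<close>

lemma L2_finite_projection:
 assumes "finite I" "\<And>i. i \<in> I \<Longrightarrow> b i \<in> L2_space D" "e \<in> L2_space D"
 shows "\<exists>c. \<forall>j\<in>I. ip D (\<lambda>x. e x - (\<Sum>i\<in>I. c i *\<^sub>R b i x)) (b j) = 0" using assms
proof (induction I arbitrary: e rule: finite_induct)
 case empty then show ?case by simp
next
 case (insert k I)
 have b: "b i \<in> L2_space D" if "i \<in> insert k I" for i using insert.prems that by blast
 obtain c where c: "\<And>j. j \<in> I \<Longrightarrow> ip D (\<lambda>x. e x - (\<Sum>i\<in>I. c i *\<^sub>R b i x)) (b j) = 0"
  using insert.IH[of e] insert.prems by auto
 obtain a where a: "\<And>j. j \<in> I \<Longrightarrow> ip D (\<lambda>x. b k x - (\<Sum>i\<in>I. a i *\<^sub>R b i x)) (b j) = 0"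
  using insert.IH[of "b k"] insert.prems by auto
 let ?e = "\<lambda>x. e x - (\<Sum>i\<in>I. c i *\<^sub>R b i x)"
 let ?b = "\<lambda>x. b k x - (\<Sum>i\<in>I. a i *\<^sub>R b i x)"
 define t where "t = ip D ?e ?b / ip D ?b ?b"
 \<comment> \<open>The coefficients of \<open>?e - t ?b\<close> expressed in the original
   \<open>b i\<close>.\<close>
 let ?c = "\<lambda>i. if i = k then t else c i - t * a i"
 have L2e: "?e \<in> L2_space D" using b insert.prems by auto
 have L2b: "?b \<in> L2_space D" using b by auto
 have eq: "(\<lambda>x. e x - (\<Sum>i\<in>insert k I. ?c i *\<^sub>R b i x)) = (\<lambda>x. ?e x - t *\<^sub>R ?b x)"
 proof
  fix x
  have "(\<Sum>i\<in>I. ?c i *\<^sub>R b i x) = (\<Sum>i\<in>I. c i *\<^sub>R b i x - t *\<^sub>R (a i *\<^sub>R b i x))"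
   using insert.hyps by (intro sum.cong) (auto simp: algebra_simps)
  also have "... = (\<Sum>i\<in>I. c i *\<^sub>R b i x) - t *\<^sub>R (\<Sum>i\<in>I. a i *\<^sub>R b i x)" by (simp only: sum_subtractf scaleR_sum_right)
  finally show "e x - (\<Sum>i\<in>insert k I. ?c i *\<^sub>R b i x) = ?e x - t *\<^sub>R ?b x"
   using insert.hyps by (simp only: sum.insert scaleR_diff_right if_True) (simp add: algebra_simps)
 qed
 let ?r = "\<lambda>x. ?e x - t *\<^sub>R ?b x"
 have L2r: "?r \<in> L2_space D" by (rule L2_diff[OF L2e L2_scaleR[OF L2b]])
 have rI: "ip D ?r (b j) = 0" if "j \<in> I" for j
 proof -
  have bj: "b j \<in> L2_space D" using b that by blast
  show ?thesis unfolding ip_diff_scaleR[OF L2e L2b bj] a[OF that] c[OF that] by simp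
 qed
 have rb: "ip D ?r ?b = 0" unfolding t_def by (rule ip_line_projection[OF L2e L2b])
 have rk: "ip D ?r (b k) = 0"
 proof -
  have "ip D ?r (b k) = ip D ?r (\<lambda>x. ?b x + (\<Sum>i\<in>I. a i *\<^sub>R b i x))" by simp
  also have "... = ip D ?r ?b + ip D ?r (\<lambda>x. \<Sum>i\<in>I. a i *\<^sub>R b i x)" by (rule ip_add_right[OF L2b _ L2r]) (use b in auto)
  also have "ip D ?r (\<lambda>x. \<Sum>i\<in>I. a i *\<^sub>R b i x) = (\<Sum>i\<in>I. a i * ip D ?r (b i))"
   using b by (subst ip_sum_right[OF L2r]) (auto simp: ip_scaleR_right)
  finally show ?thesis using rb rI by simp
 qed
 show ?case by (rule exI[of _ ?c]) (use rI rk in \<open>auto simp only: eq insert_iff\<close>)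
qed

text \<open>Projection onto the closure of a subspace that may fail to be closed: a minimising
  sequence inside \<open>V\<close> is Cauchy, and its limit \<open>g\<close> is the nearest point.
  The sequence is returned along with \<open>g\<close>, so that membership of \<open>g\<close> in
  the class behind \<open>V\<close> can be settled afterwards.\<close>

lemma L2_closure_projection:
 fixes V :: "(real^'n \<Rightarrow> 'b::euclidean_space) set"
 assumes V: "V \<subseteq> L2_space D" "(\<lambda>x. 0) \<in> V"
  and add: "\<And>v w. v \<in> V \<Longrightarrow> w \<in> V \<Longrightarrow> (\<lambda>x. v x + w x) \<in> V"
  and scale: "\<And>c v. v \<in> V \<Longrightarrow> (\<lambda>x. c *\<^sub>R v x) \<in> V"
  and e: "e \<in> L2_space D"
 obtains v g where "\<And>k::nat. v k \<in> V" "g \<in> L2_space D"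
  "(\<lambda>k. l2norm D (\<lambda>x. v k x - g x)) \<longlonglongrightarrow> 0" "\<And>w. w \<in> V \<Longrightarrow> ip D (\<lambda>x. e x - g x) w = 0"
proof -
 define Z where "Z = (INF v\<in>V. (l2norm D (\<lambda>x. e x - v x))^2)"
 have bdd: "bdd_below ((\<lambda>v. (l2norm D (\<lambda>x. e x - v x))^2) ` V)" by (rule bdd_belowI2[of _ 0]) simp
 have Dle: "Z \<le> (l2norm D (\<lambda>x. e x - v x))^2" if "v \<in> V" for v unfolding Z_def by (rule cINF_lower[OF bdd that])
 have "\<exists>v\<in>V. (l2norm D (\<lambda>x. e x - v x))^2 < Z + 1 / real (Suc k)" for k
 proof -
  have "Z < Z + 1 / real (Suc k)" by simp
  then show ?thesis using cINF_less_iff[OF _ bdd] V(2) unfolding Z_def by blast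
 qed
 then obtain v where v: "\<And>k. v k \<in> V" "\<And>k. (l2norm D (\<lambda>x. e x - v k x))^2 < Z + 1 / real (Suc k)" by metis
 have vL: "v k \<in> L2_space D" for k using v(1) V(1) by blast
 \<comment> \<open>The midpoint of \<open>v m\<close> and \<open>v n\<close> is a competitor, so by
   the parallelogram law two near-minimisers are close to each other.\<close>
 have par: "(l2norm D (\<lambda>x. v m x - v n x))^2 \<le> 2 / real (Suc m) + 2 / real (Suc n)" for m n
 proof -
  let ?m = "\<lambda>x. (1/2) *\<^sub>R (v m x + v n x)"
  have mV: "?m \<in> V" by (intro scale add v)
  let ?p = "\<lambda>x. e x - v m x" and ?q = "\<lambda>x. e x - v n x"
  have "(\<lambda>x. ?p x - ?q x) = (\<lambda>x. v n x - v m x)" "(\<lambda>x. ?p x + ?q x) = (\<lambda>x. 2 *\<^sub>R (e x - ?m x))"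
   by (simp_all add: fun_eq_iff algebra_simps scaleR_2)
  moreover have "(l2norm D (\<lambda>x. ?p x + ?q x))^2 + (l2norm D (\<lambda>x. ?p x - ?q x))^2
    = 2 * (l2norm D ?p)^2 + 2 * (l2norm D ?q)^2" by (rule l2norm_parallelogram[OF L2_diff[OF e vL] L2_diff[OF e vL]])
  moreover have "l2norm D (\<lambda>x. 2 *\<^sub>R (e x - ?m x)) = 2 * l2norm D (\<lambda>x. e x - ?m x)" by (simp only: l2norm_scaleR abs_numeral)
  ultimately have "(l2norm D (\<lambda>x. v m x - v n x))^2 =
    2 * (l2norm D ?p)^2 + 2 * (l2norm D ?q)^2 - 4 * (l2norm D (\<lambda>x. e x - ?m x))^2" by (simp only: l2norm_minus_commute[of D "v m"] power_mult_distrib) simp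
  then show ?thesis using Dle[OF mV] v(2)[of m] v(2)[of n] by (simp add: add_divide_distrib)
 qed
 have cauchy: "\<exists>N. \<forall>m\<ge>N. \<forall>n\<ge>N. l2norm D (\<lambda>x. v m x - v n x) < \<epsilon>" if "\<epsilon> > 0" for \<epsilon>
 proof -
  obtain N where N: "4 / \<epsilon>^2 < real N" using reals_Archimedean2 by blast
  have "l2norm D (\<lambda>x. v m x - v n x) < \<epsilon>" if mn: "m \<ge> N" "n \<ge> N" for m n
  proof (rule power2_less_imp_less)
   have "real N < real (Suc m)" "real N < real (Suc n)" using mn by auto
   then have "4 < \<epsilon>^2 * real (Suc m)" "4 < \<epsilon>^2 * real (Suc n)"
    using N \<open>\<epsilon> > 0\<close> by (auto simp: pos_divide_less_eq mult.commute elim!: order.strict_trans)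
   then have "2 / real (Suc m) < \<epsilon>^2 / 2" "2 / real (Suc n) < \<epsilon>^2 / 2" by (simp_all add: pos_divide_less_eq)
   then show "(l2norm D (\<lambda>x. v m x - v n x))^2 < \<epsilon>^2" using par[of m n] by linarith
  qed (use \<open>\<epsilon> > 0\<close> in simp)
  then show ?thesis by blast
 qed
 obtain g where g: "g \<in> L2_space D" "(\<lambda>k. l2norm D (\<lambda>x. v k x - g x)) \<longlonglongrightarrow> 0" using L2_complete[of v, OF vL cauchy] by blast
 have lim: "(\<lambda>k. (l2norm D (\<lambda>x. e x - (v k x + w x)))^2) \<longlonglongrightarrow> (l2norm D (\<lambda>x. e x - (g x + w x)))^2"
  if w: "w \<in> L2_space D" for w
 proof (intro tendsto_power)
  have "(\<lambda>k. l2norm D (\<lambda>x. e x - (v k x + w x)) - l2norm D (\<lambda>x. e x - (g x + w x))) \<longlonglongrightarrow> 0"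
  proof (rule Lim_null_comparison[OF _ g(2)], intro always_eventually allI)
   fix k
   have "(\<lambda>x. e x - (v k x + w x) - (e x - (g x + w x))) = (\<lambda>x. g x - v k x)" by (simp add: fun_eq_iff)
   then show "norm (l2norm D (\<lambda>x. e x - (v k x + w x)) - l2norm D (\<lambda>x. e x - (g x + w x)))
     \<le> l2norm D (\<lambda>x. v k x - g x)" using l2norm_diff_bound[of "\<lambda>x. e x - (v k x + w x)" D "\<lambda>x. e x - (g x + w x)"]
     vL e g(1) w by (simp add: l2norm_minus_commute[of D g])
  qed
  then show "(\<lambda>k. l2norm D (\<lambda>x. e x - (v k x + w x))) \<longlonglongrightarrow> l2norm D (\<lambda>x. e x - (g x + w x))" by (simp add: LIM_zero_iff)
 qed
 have upper: "(l2norm D (\<lambda>x. e x - g x))^2 \<le> Z"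
 proof (rule LIMSEQ_le)
  show "(\<lambda>k. (l2norm D (\<lambda>x. e x - v k x))^2) \<longlonglongrightarrow> (l2norm D (\<lambda>x. e x - g x))^2" using lim[of "\<lambda>x. 0"] by simp
  show "(\<lambda>k. Z + 1 / real (Suc k)) \<longlonglongrightarrow> Z" using tendsto_add[OF tendsto_const LIMSEQ_Suc[OF lim_const_over_n[of 1]], of Z] by simp
 qed (use v(2) in \<open>auto intro!: exI[of _ 0] less_imp_le\<close>)
 have orth: "ip D (\<lambda>x. e x - g x) w = 0" if w: "w \<in> V" for w
 proof -
  let ?b = "ip D (\<lambda>x. e x - g x) w"
  have wL: "w \<in> L2_space D" using w V by blast
  have q: "0 \<le> t^2 * ip D w w - 2 * t * ?b" for t
  proof -
   have "Z \<le> (l2norm D (\<lambda>x. e x - (g x + t *\<^sub>R w x)))^2"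
   proof (rule LIMSEQ_le_const[OF lim])
    show "\<exists>N. \<forall>n\<ge>N. Z \<le> (l2norm D (\<lambda>x. e x - (v n x + t *\<^sub>R w x)))^2" using Dle add scale v(1) w by blast
   qed (use wL in simp)
   also have "(\<lambda>x. e x - (g x + t *\<^sub>R w x)) = (\<lambda>x. (e x - g x) - t *\<^sub>R w x)" by (simp add: algebra_simps)
   also have "(l2norm D ...)^2 = (l2norm D (\<lambda>x. e x - g x))^2 - 2 * t * ?b + t^2 * ip D w w" by (rule l2norm_diff_scaleR_sq[OF L2_diff[OF e g(1)] wL])
   finally show ?thesis using upper by linarith
  qed
  show ?thesis
  proof (rule ccontr)
   assume b: "?b \<noteq> 0"
   \<comment> \<open>Adding 1 keeps the divisor positive even if \<open>w\<close> is null;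
     \<open>t = ?b / s\<close> then makes the quadratic in \<open>q\<close> negative.\<close>
   define s where "s = ip D w w + 1"
   have "s > 0" unfolding s_def by (simp add: add_nonneg_pos)
   have "(?b / s)^2 * ip D w w \<le> (?b / s)^2 * s" by (intro mult_left_mono) (auto simp: s_def)
   also have "... = ?b^2 / s" using \<open>s > 0\<close> by (simp add: power2_eq_square field_simps)
   finally have "0 \<le> ?b^2 / s - 2 * (?b^2 / s)" using q[of "?b / s"] by (simp add: power2_eq_square)
   moreover have "?b^2 / s > 0" using b \<open>s > 0\<close> by simp
   ultimately show False by linarith
  qed
 qed
 show ?thesis by (rule that[OF v(1) g orth])
qed

section \<open>Change of variables and surface integrals\<close>

text \<open>The argument for uniqueness of Haar measure. The double integral of \<open>?f\<close> is
  evaluated twice: integrating over \<open>y\<close> first gives the left side; shifting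
  \<open>x\<close> by \<open>R y\<close> first moves \<open>y\<close> from the factor of
  \<open>B\<close> to that of \<open>A\<close>, and gives the right side.\<close>

lemma emeasure_lborel_linear_vimage:
 fixes L :: "real^'n \<Rightarrow> real^'n"
 assumes L: "linear L" and R: "linear R" "\<And>x. L (R x) = x" and A: "A \<in> sets borel" and B: "B \<in> sets borel"
 shows "emeasure lborel (L -` A) * emeasure lborel B = emeasure lborel (L -` B) * emeasure lborel A"
proof -
 have [measurable]: "L \<in> borel_measurable borel" "R \<in> borel_measurable borel"
  using L R by (auto intro!: borel_measurable_continuous_onI linear_continuous_on simp: linear_conv_bounded_linear)
 note [measurable] = A B
 let ?f = "\<lambda>x y. indicator A (L x) * indicator B (L x + y) :: ennreal"
 have aff: "(\<integral>\<^sup>+ x. f (t + c *\<^sub>R x) \<partial>lborel) = (\<integral>\<^sup>+ x. f x \<partial>lborel)"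
  if [measurable]: "f \<in> borel_measurable borel" and c: "\<bar>c\<bar> = 1" for f :: "real^'n \<Rightarrow> ennreal" and t c
  by (subst (2) lborel_affine[of c t]) (use c in \<open>auto simp: nn_integral_density nn_integral_distr\<close>)
 have trans: "(\<integral>\<^sup>+ x. f (x + t) \<partial>lborel) = (\<integral>\<^sup>+ x. f x \<partial>lborel)"
  if "f \<in> borel_measurable borel" for f :: "real^'n \<Rightarrow> ennreal" and t using aff[OF that, of 1 t] by (simp add: add.commute)
 have refl: "(\<integral>\<^sup>+ x. f (t - x) \<partial>lborel) = (\<integral>\<^sup>+ x. f x \<partial>lborel)"
  if "f \<in> borel_measurable borel" for f :: "real^'n \<Rightarrow> ennreal" and t using aff[OF that, of "-1" t] by simp
 have ind: "(\<integral>\<^sup>+ x. indicator X (L x) \<partial>lborel) = emeasure lborel (L -` X)" if "X \<in> sets borel" for X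
 proof -
  have "(\<lambda>x. indicator X (L x) :: ennreal) = indicator (L -` X)" by (auto simp: indicator_def fun_eq_iff)
  moreover have "L -` X \<in> sets lborel" using measurable_sets[of L borel borel X] that by simp
  ultimately show ?thesis by simp
 qed
 have "(\<integral>\<^sup>+ y. (\<integral>\<^sup>+ x. ?f x y \<partial>lborel) \<partial>lborel) = (\<integral>\<^sup>+ x. (\<integral>\<^sup>+ y. ?f x y \<partial>lborel) \<partial>lborel)"
  by (rule lborel_pair.Fubini') measurable
 also have "... = (\<integral>\<^sup>+ x. indicator A (L x) * emeasure lborel B \<partial>lborel)"
 proof (rule nn_integral_cong)
  fix x
  have "(\<integral>\<^sup>+ y. ?f x y \<partial>lborel) = indicator A (L x) * (\<integral>\<^sup>+ y. indicator B (y + L x) \<partial>lborel)"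
   by (simp add: nn_integral_cmult add.commute)
  also have "(\<integral>\<^sup>+ y. indicator B (y + L x) \<partial>lborel) = (\<integral>\<^sup>+ y. indicator B y \<partial>lborel)"
   by (rule trans[of "indicator B" "L x"]) measurable
  also have "... = emeasure lborel B" using B by simp
  finally show "(\<integral>\<^sup>+ y. ?f x y \<partial>lborel) = indicator A (L x) * emeasure lborel B" .
 qed
 also have "... = emeasure lborel (L -` A) * emeasure lborel B" by (subst nn_integral_multc) (simp_all add: ind[OF A])
 finally have 1: "(\<integral>\<^sup>+ y. (\<integral>\<^sup>+ x. ?f x y \<partial>lborel) \<partial>lborel) = emeasure lborel (L -` A) * emeasure lborel B" .
 have "(\<integral>\<^sup>+ y. (\<integral>\<^sup>+ x. ?f x y \<partial>lborel) \<partial>lborel)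
   = (\<integral>\<^sup>+ y. (\<integral>\<^sup>+ x. indicator A (L x - y) * indicator B (L x) \<partial>lborel) \<partial>lborel)"
 proof (rule nn_integral_cong)
  fix y
  have "(\<integral>\<^sup>+ x. ?f x y \<partial>lborel) = (\<integral>\<^sup>+ x. (\<lambda>x. indicator A (L x - y) * indicator B (L x)) (x + R y) \<partial>lborel)"
   by (simp add: linear_add[OF L] R(2))
  also have "... = (\<integral>\<^sup>+ x. indicator A (L x - y) * indicator B (L x) \<partial>lborel)" by (rule trans) measurable
  finally show "(\<integral>\<^sup>+ x. ?f x y \<partial>lborel) = (\<integral>\<^sup>+ x. indicator A (L x - y) * indicator B (L x) \<partial>lborel)" .
 qed
 also have "... = (\<integral>\<^sup>+ x. (\<integral>\<^sup>+ y. indicator A (L x - y) * indicator B (L x) \<partial>lborel) \<partial>lborel)"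
  by (rule lborel_pair.Fubini') measurable
 also have "... = (\<integral>\<^sup>+ x. indicator B (L x) * emeasure lborel A \<partial>lborel)"
 proof (rule nn_integral_cong)
  fix x
  have "(\<integral>\<^sup>+ y. indicator A (L x - y) * indicator B (L x) \<partial>lborel)
    = indicator B (L x) * (\<integral>\<^sup>+ y. indicator A (L x - y) \<partial>lborel)" by (subst nn_integral_cmult[symmetric]) (auto simp: mult.commute)
  also have "(\<integral>\<^sup>+ y. indicator A (L x - y) \<partial>lborel) = (\<integral>\<^sup>+ y. indicator A y \<partial>lborel)"
   by (rule refl[of "indicator A" "L x"]) measurable
  also have "... = emeasure lborel A" using A by simp
  finally show "(\<integral>\<^sup>+ y. indicator A (L x - y) * indicator B (L x) \<partial>lborel) = indicator B (L x) * emeasure lborel A" .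
 qed
 also have "... = emeasure lborel (L -` B) * emeasure lborel A" by (subst nn_integral_multc) (simp_all add: ind[OF B])
 finally show ?thesis using 1 by simp
qed

text \<open>For \<open>B\<close> the unit ball, which is its own preimage and has positive finite
  volume, the common factor in \<open>emeasure_lborel_linear_vimage\<close> cancels.\<close>

lemma distr_lborel_orthogonal:
 fixes Q :: "real^'n \<Rightarrow> real^'n"
 assumes Q: "orthogonal_transformation Q"
 shows "distr lborel borel Q = lborel"
proof (rule measure_eqI)
 fix A assume "A \<in> sets (distr lborel borel Q)"
 then have A: "A \<in> sets borel" by simp
 have lin: "linear Q" using Q orthogonal_transformation_linear by blast
 obtain R where R: "orthogonal_transformation R" "\<And>x. Q (R x) = x" using Q by (metis orthogonal_transformation_surj surj_f_inv_f orthogonal_transformation_inv)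
 have Qm: "Q \<in> borel_measurable borel" using lin by (auto intro!: borel_measurable_continuous_onI linear_continuous_on simp: linear_conv_bounded_linear)
 have ball: "Q -` ball 0 1 = ball 0 1" using Q by (auto simp: orthogonal_transformation)
 have "emeasure lborel (Q -` A) * emeasure lborel (ball (0::real^'n) 1)
   = emeasure lborel (ball (0::real^'n) 1) * emeasure lborel A" using emeasure_lborel_linear_vimage[OF lin _ R(2) A, of "ball 0 1"] R(1)
  by (simp add: ball orthogonal_transformation_linear)
 moreover have "emeasure lborel (ball (0::real^'n) 1) \<noteq> 0" using content_ball_pos[of 1 "0::real^'n"] by (auto simp: measure_def)
 moreover have "emeasure lborel (ball (0::real^'n) 1) \<noteq> \<infinity>" using emeasure_lborel_ball_finite[of 0 1] by (simp add: less_top)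
 ultimately have "emeasure lborel (Q -` A) = emeasure lborel A" by (metis ennreal_mult_cancel_left infinity_ennreal_def mult.commute)
 then show "emeasure (distr lborel borel Q) A = emeasure lborel A" using Qm A by (simp add: emeasure_distr)
qed simp

text \<open>An orthogonal \<open>Q\<close> moves a coordinate axis to \<open>n\<close>. There the
  stretch by \<open>s\<close> is a diagonal scaling with determinant \<open>s\<close>; the shift
  along \<open>n\<close> is absorbed by translation invariance.\<close>

lemma lborel_integral_stretch:
 fixes n :: "real^'n" and f :: "real^'n \<Rightarrow> real"
 assumes n: "norm n = 1" and s: "s > 0" and f: "f \<in> borel_measurable borel"
 shows "(LINT x|lborel. f x) = s * (LINT x|lborel. f (x + ((s - 1) * (n \<bullet> x) + t) *\<^sub>R n))"
proof -
 obtain k :: 'n where True by simp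
 define e where "e = (axis k 1 :: real^'n)"
 have e: "norm e = 1" "e \<in> Basis" by (auto simp: e_def axis_in_Basis_iff)
 obtain Q where Q: "orthogonal_transformation Q" "Q e = n" using orthogonal_transformation_exists[of e n] n e by metis
 have lin: "linear Q" using Q orthogonal_transformation_linear by blast
 let ?Z = "\<lambda>x. x + ((s - 1) * (e \<bullet> x)) *\<^sub>R e"
 let ?g = "\<lambda>x. f (x + t *\<^sub>R n)"
 have inner: "n \<bullet> Q x = e \<bullet> x" for x using Q unfolding orthogonal_transformation_def by metis
 have Z: "?Z x = 0 + (\<Sum>j\<in>Basis. ((if j = e then s else 1) * (x \<bullet> j)) *\<^sub>R j)" for x
 proof -
  have "(\<Sum>j\<in>Basis. ((if j = e then s else 1) * (x \<bullet> j)) *\<^sub>R j)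
    = (\<Sum>j\<in>Basis. (x \<bullet> j) *\<^sub>R j + (if j = e then ((s - 1) * (e \<bullet> x)) *\<^sub>R e else 0))"
   by (intro sum.cong) (auto simp: algebra_simps inner_commute)
  also have "... = (\<Sum>j\<in>Basis. (x \<bullet> j) *\<^sub>R j) + (\<Sum>j\<in>Basis. if j = e then ((s - 1) * (e \<bullet> x)) *\<^sub>R e else 0)"
   by (rule sum.distrib)
  also have "... = ?Z x" using e by (simp add: euclidean_representation)
  finally show ?thesis by simp
 qed
 have Qm [measurable]: "Q \<in> borel_measurable borel" using lin by (auto intro!: borel_measurable_continuous_onI linear_continuous_on simp: linear_conv_bounded_linear)
 note [measurable] = f
 have Dm [measurable]: "?Z \<in> borel_measurable borel" by measurable
 have prod: "(\<Prod>j\<in>Basis. \<bar>if j = e then s else 1\<bar>) = s" using e s by (subst prod.remove[of _ e]) (auto simp: if_distrib cong: if_cong)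
 have "(LINT x|lborel. f x) = (LINT x|lborel. ?g x)" by (subst lborel_distr_plus[of "t *\<^sub>R n", symmetric], subst integral_distr) (auto simp: add.commute f)
 also have "... = (LINT x|lborel. ?g (Q x))" by (subst distr_lborel_orthogonal[OF Q(1), symmetric], subst integral_distr) auto
 also have "... = (LINT x|density (distr lborel borel ?Z) (\<lambda>_. ennreal s). ?g (Q x))"
 proof -
  have "lborel = density (distr lborel borel ?Z) (\<lambda>_. ennreal s)"
   using lborel_affine_euclidean[of "\<lambda>j. if j = e then s else 1" 0, folded Z] s prod by simp
  then show ?thesis by simp
 qed
 also have "... = s * (LINT x|lborel. ?g (Q (?Z x)))" using s by (subst integral_density) (auto simp: integral_distr)
 also have "(LINT x|lborel. ?g (Q (?Z x)))
   = (LINT x|lborel. (\<lambda>x. f (x + ((s - 1) * (n \<bullet> x) + t) *\<^sub>R n)) (Q x))"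
  by (simp only: inner linear_add[OF lin] linear_scale[OF lin] Q(2) scaleR_add_left add.assoc)
 also have "... = (LINT x|distr lborel borel Q. f (x + ((s - 1) * (n \<bullet> x) + t) *\<^sub>R n))" by (subst integral_distr) auto
 also have "... = (LINT x|lborel. f (x + ((s - 1) * (n \<bullet> x) + t) *\<^sub>R n))" by (simp only: distr_lborel_orthogonal[OF Q(1)])
 finally show ?thesis .
qed

lemma closest_point_hyperplane:
 fixes n :: "real^'n"
 assumes n: "norm n = 1"
 shows "closest_point {x. n \<bullet> x = b} z = z - (n \<bullet> z - b) *\<^sub>R n"
  and "infdist z {x. n \<bullet> x = b} = \<bar>n \<bullet> z - b\<bar>"
proof -
 let ?H = "{x. n \<bullet> x = b}" and ?p = "z - (n \<bullet> z - b) *\<^sub>R n"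
 have nn: "n \<bullet> n = 1" using n by (simp add: dot_square_norm)
 have p: "?p \<in> ?H" by (simp add: inner_diff_right nn)
 have dp: "dist z ?p = \<bar>n \<bullet> z - b\<bar>" by (simp add: dist_norm n)
 have min: "dist z ?p \<le> dist z y" if "y \<in> ?H" for y
 proof -
  have "\<bar>n \<bullet> (z - y)\<bar> \<le> norm n * norm (z - y)" by (rule Cauchy_Schwarz_ineq2)
  then show ?thesis using that n by (simp add: dp dist_norm inner_diff_right)
 qed
 show "closest_point ?H z = ?p" by (rule closest_point_unique[symmetric]) (use p min in \<open>auto simp: convex_hyperplane closed_hyperplane\<close>)
 have "infdist z ?H = dist z ?p"
 proof (rule antisym)
  show "infdist z ?H \<le> dist z ?p" by (rule infdist_le[OF p])
  show "dist z ?p \<le> infdist z ?H" using p min by (subst infdist_notempty) (auto intro!: cINF_greatest)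
 qed
 then show "infdist z ?H = \<bar>n \<bullet> z - b\<bar>" by (simp only: dp)
qed

text \<open>The prism of the definition becomes the slab of half-width 1/2 around the hyperplane,
  inside which the integrand is constant in direction \<open>n\<close>.\<close>

lemma surface_integral_hyperplane:
 fixes n :: "real^'n" and f :: "real^'n \<Rightarrow> real"
 assumes n: "norm n = 1" and S: "S \<in> sets borel" and f: "f \<in> borel_measurable borel"
 shows "(LINT x:S|surface_measure {x. n \<bullet> x = b}. f x) =
  (LINT z|lborel. indicator {z. \<bar>n \<bullet> z - b\<bar> \<le> 1/2} z * (indicator S (z - (n \<bullet> z - b) *\<^sub>R n) * f (z - (n \<bullet> z - b) *\<^sub>R n)))"
proof -
 let ?p = "\<lambda>z. z - (n \<bullet> z - b) *\<^sub>R n"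
 have slab: "{z. \<bar>n \<bullet> z - b\<bar> \<le> 1/2} \<in> sets borel" by measurable
 have m: "?p \<in> restrict_space lborel {z. \<bar>n \<bullet> z - b\<bar> \<le> 1/2} \<rightarrow>\<^sub>M borel" by (rule measurable_restrict_space1) measurable
 have eq: "surface_measure {x. n \<bullet> x = b} = distr (restrict_space lborel {z. \<bar>n \<bullet> z - b\<bar> \<le> 1/2}) borel ?p"
  unfolding surface_measure_def closest_point_hyperplane[OF n] ..
 show ?thesis unfolding eq set_lebesgue_integral_def using S f m slab by (subst integral_distr) (auto simp: integral_restrict_space)
qed

lemma sets_surface_measure [simp]: "sets (surface_measure H) = sets borel" "space (surface_measure H) = UNIV" by (simp_all add: surface_measure_def)

lemma lborel_integral_homothety:
 fixes v :: "real^'n" and f :: "real^'n \<Rightarrow> real"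
 assumes r: "r > 0" and f: "f \<in> borel_measurable borel"
 shows "(LINT x|lborel. f x) = r ^ CARD('n) * (LINT x|lborel. f (v + r *\<^sub>R (x - v)))"
proof -
 note [measurable] = f
 have "(LINT x|lborel. f x) = (LINT x|density (distr lborel borel (\<lambda>x. (v - r *\<^sub>R v) + r *\<^sub>R x)) (\<lambda>_. \<bar>r\<bar> ^ DIM(real^'n)). f x)"
  using lborel_affine[of r "v - r *\<^sub>R v"] r by simp
 also have "... = r ^ CARD('n) * (LINT x|lborel. f ((v - r *\<^sub>R v) + r *\<^sub>R x))" using r by (subst integral_density) (auto simp: integral_distr)
 finally show ?thesis by (simp add: algebra_simps)
qed

section \<open>Barycentric coordinates\<close>

text \<open>A nondegenerate simplex, given by its vertices; \<open>fct c\<close> is going to be the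
  facet opposite the vertex \<open>c\<close>.\<close>

locale full_simplex =
 fixes C :: "(real^'n) set"
 assumes aff_indep: "\<not> affine_dependent C" and card_C: "card C = CARD('n) + 1"
begin

abbreviation T :: "(real^'n) set" where "T \<equiv> convex hull C"

abbreviation fct :: "real^'n \<Rightarrow> (real^'n) set" where "fct c \<equiv> convex hull (C - {c})"

lemma finite_C [simp, intro]: "finite C" using aff_indep by (rule aff_independent_finite)

text \<open>The other vertices span a hyperplane that misses \<open>c\<close>; its equation,
  rescaled to take the value 1 at \<open>c\<close>, is the barycentric coordinate.\<close>

lemma ex_coordinate:
 assumes "c \<in> C"
 shows "\<exists>a b. \<forall>d\<in>C. a \<bullet> d - b = (if d = c then 1 else (0::real))"
proof -
 have ind: "\<not> affine_dependent (C - {c})" using aff_indep affine_dependent_subset by blast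
 have "card (C - {c}) = CARD('n)" using card_C assms by simp
 then have "aff_dim (C - {c}) = DIM(real^'n) - 1" using aff_dim_affine_independent[OF ind] by simp
 then obtain a b where ab: "a \<noteq> 0" "affine hull (C - {c}) = {x. a \<bullet> x = b}" using aff_dim_eq_hyperplane[of "C - {c}"] by auto
 have "c \<notin> affine hull (C - {c})" using aff_indep assms by (auto simp: affine_dependent_def)
 then have ne: "a \<bullet> c - b \<noteq> 0" using ab by auto
 have "a \<bullet> d = b" if "d \<in> C" "d \<noteq> c" for d using hull_inc[of d "C - {c}" affine] that ab(2) by auto
 then have "\<forall>d\<in>C. (a /\<^sub>R (a \<bullet> c - b)) \<bullet> d - b / (a \<bullet> c - b) = (if d = c then 1 else 0)" using ne by (auto simp: divide_simps)
 then show ?thesis by blast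
qed

text \<open>Gradient and offset of the barycentric coordinate of \<open>c\<close>. The gradient
  \<open>gr c\<close> is normal to the facet opposite \<open>c\<close>, points into the simplex and
  has the reciprocal of the height over that facet as its length.\<close>

definition cf :: "real^'n \<Rightarrow> (real^'n) \<times> real" where
 "cf c = (SOME p. \<forall>d\<in>C. fst p \<bullet> d - snd p = (if d = c then 1 else 0))"

definition gr :: "real^'n \<Rightarrow> real^'n" where "gr c = fst (cf c)"

definition lam :: "real^'n \<Rightarrow> real^'n \<Rightarrow> real" where "lam c x = gr c \<bullet> x - snd (cf c)"

lemma lam_vertex:
 assumes "c \<in> C" "d \<in> C"
 shows "lam c d = (if d = c then 1 else 0)"
proof -
 have "\<exists>p. \<forall>d\<in>C. fst p \<bullet> d - snd p = (if d = c then 1 else (0::real))" using ex_coordinate[OF assms(1)] by auto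
 then have "\<forall>d\<in>C. fst (cf c) \<bullet> d - snd (cf c) = (if d = c then 1 else 0)" unfolding cf_def by (rule someI_ex)
 then show ?thesis using assms(2) by (simp add: lam_def gr_def)
qed

lemma lam_diff: "lam c x - lam c y = gr c \<bullet> (x - y)" by (simp add: lam_def inner_diff_right)

lemma lam_add: "lam c (x + w) = lam c x + gr c \<bullet> w" by (simp add: lam_def inner_add_right)

lemma continuous_lam [continuous_intros]: "continuous_on X (lam c)" unfolding lam_def by (intro continuous_intros)

lemma lam_affine_comb:
 assumes "c \<in> C" "sum u C = 1"
 shows "lam c (\<Sum>d\<in>C. u d *\<^sub>R d) = u c"
proof -
 have "lam c (\<Sum>d\<in>C. u d *\<^sub>R d) = (\<Sum>d\<in>C. u d * (gr c \<bullet> d)) - sum u C * snd (cf c)" using assms by (simp add: lam_def inner_sum_right)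
 also have "... = (\<Sum>d\<in>C. u d * lam c d)" by (simp add: lam_def sum_distrib_right sum_subtractf right_diff_distrib)
 also have "... = (\<Sum>d\<in>C. if d = c then u d else 0)" by (intro sum.cong) (auto simp: lam_vertex assms)
 also have "... = u c" using assms by simp
 finally show ?thesis .
qed

lemma affine_hull_C: "affine hull C = UNIV"
proof -
 have "aff_dim C = DIM(real^'n)" using aff_dim_affine_independent[OF aff_indep] card_C by simp
 then show ?thesis by (simp only: aff_dim_eq_full)
qed

lemma barycentric:
 shows sum_lam: "(\<Sum>c\<in>C. lam c x) = 1" and sum_lam_vertex: "(\<Sum>c\<in>C. lam c x *\<^sub>R c) = x"
proof -
 have "x \<in> affine hull C" by (simp add: affine_hull_C)
 then obtain u where u: "sum u C = 1" "(\<Sum>d\<in>C. u d *\<^sub>R d) = x" by (auto simp: affine_hull_finite)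
 then have *: "lam c x = u c" if "c \<in> C" for c using lam_affine_comb[OF that u(1)] by simp
 then show "(\<Sum>c\<in>C. lam c x) = 1" using u(1) by simp
 show "(\<Sum>c\<in>C. lam c x *\<^sub>R c) = x" using * u(2) by simp
qed

lemma eq_if_lam_eq: "(\<And>c. c \<in> C \<Longrightarrow> lam c x = lam c y) \<Longrightarrow> x = y"
 using sum_lam_vertex[of x] sum_lam_vertex[of y] by (metis (no_types, lifting) sum.cong)

lemma mem_T: "x \<in> T \<longleftrightarrow> (\<forall>c\<in>C. 0 \<le> lam c x)"
proof
 assume "x \<in> T"
 then obtain u where u: "\<forall>c\<in>C. 0 \<le> u c" "sum u C = 1" "(\<Sum>d\<in>C. u d *\<^sub>R d) = x" by (auto simp: convex_hull_finite)
 then show "\<forall>c\<in>C. 0 \<le> lam c x" using lam_affine_comb[OF _ u(2)] by auto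
next
 assume "\<forall>c\<in>C. 0 \<le> lam c x"
 then show "x \<in> T" by (auto simp: convex_hull_finite intro!: exI[of _ "\<lambda>c. lam c x"] barycentric)
qed

lemma gr_nonzero:
 assumes "c \<in> C" shows "gr c \<noteq> 0"
proof
 assume "gr c = 0"
 have "card (C - {c}) > 0" using card_C assms by simp
 then obtain d where "d \<in> C" "d \<noteq> c" by (metis Diff_iff card_gt_0_iff ex_in_conv singletonI)
 then show False using lam_vertex[OF assms assms] lam_vertex[OF assms \<open>d \<in> C\<close>] \<open>gr c = 0\<close> by (simp add: lam_def)
qed

lemma interior_T: "interior T = {x. \<forall>c\<in>C. 0 < lam c x}"
proof
 have "open (\<Inter>c\<in>C. {x. 0 < lam c x})" by (intro open_INT finite_C ballI open_Collect_less continuous_intros)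
 moreover have "(\<Inter>c\<in>C. {x. 0 < lam c x}) \<subseteq> T" by (auto simp: mem_T less_imp_le)
 ultimately have "(\<Inter>c\<in>C. {x. 0 < lam c x}) \<subseteq> interior T" by (rule interior_maximal[rotated])
 then show "{x. \<forall>c\<in>C. 0 < lam c x} \<subseteq> interior T" by auto
next
 show "interior T \<subseteq> {x. \<forall>c\<in>C. 0 < lam c x}"
 proof (intro subsetI CollectI ballI)
  fix x c assume x: "x \<in> interior T" and c: "c \<in> C"
  obtain e where e: "e > 0" "ball x e \<subseteq> T" using x mem_interior by blast
  \<comment> \<open>A step of length \<open>e / 2\<close> against the gradient stays in the ball and
    lowers \<open>lam c\<close> by the positive amount \<open>t * (gr c \<bullet> gr c)\<close>,
    while the value there is still nonnegative.\<close>
  define t where "t = e / (2 * norm (gr c))"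
  have g: "norm (gr c) > 0" using gr_nonzero[OF c] by simp
  have "dist x (x + (- t) *\<^sub>R gr c) < e" using e(1) g by (simp add: dist_norm t_def)
  then have "0 \<le> lam c (x + (- t) *\<^sub>R gr c)" using e(2) c mem_T by (meson mem_ball subsetD)
  then have "0 \<le> lam c x + gr c \<bullet> ((- t) *\<^sub>R gr c)" by (simp only: lam_add)
  then have "t * (gr c \<bullet> gr c) \<le> lam c x" by simp
  moreover have "0 < t * (gr c \<bullet> gr c)" using e(1) g by (simp add: t_def)
  ultimately show "0 < lam c x" by linarith
 qed
qed

lemma mem_fct:
 assumes "c \<in> C"
 shows "x \<in> fct c \<longleftrightarrow> x \<in> T \<and> lam c x = 0"
proof
 assume "x \<in> fct c"
 then obtain u where u: "\<forall>d\<in>C-{c}. 0 \<le> u d" "sum u (C-{c}) = 1" "(\<Sum>d\<in>C-{c}. u d *\<^sub>R d) = x" by (auto simp: convex_hull_finite)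
 let ?u = "u(c := 0)"
 have s: "sum ?u C = 1" using u(2) assms by (subst sum.remove[of _ c]) (auto intro: sum.cong)
 have x: "(\<Sum>d\<in>C. ?u d *\<^sub>R d) = x" using u(3) assms by (subst sum.remove[of _ c]) (auto intro: sum.cong)
 have "lam c x = 0" using lam_affine_comb[OF assms s] x by simp
 moreover have "x \<in> T" using \<open>x \<in> fct c\<close> hull_mono[of "C - {c}" C convex] by auto
 ultimately show "x \<in> T \<and> lam c x = 0" by simp
next
 assume a: "x \<in> T \<and> lam c x = 0"
 show "x \<in> fct c" unfolding convex_hull_finite[OF finite_Diff[OF finite_C]] mem_Collect_eq
 proof (intro exI conjI)
  show "\<forall>d\<in>C - {c}. 0 \<le> lam d x" using a by (simp add: mem_T)
  show "(\<Sum>d\<in>C - {c}. lam d x) = 1" using sum_lam[of x] a assms by (subst (asm) sum.remove[of _ c]) auto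
  show "(\<Sum>d\<in>C - {c}. lam d x *\<^sub>R d) = x" using sum_lam_vertex[of x] a assms by (subst (asm) sum.remove[of _ c]) auto
 qed
qed

lemma affine_hull_fct:
 assumes "c \<in> C"
 shows "affine hull (fct c) = {x. gr c \<bullet> x = snd (cf c)}"
proof -
 have "affine hull (C - {c}) = {x. lam c x = 0}"
 proof
  show "affine hull (C - {c}) \<subseteq> {x. lam c x = 0}"
  proof (rule hull_minimal)
   have "{x. lam c x = 0} = {x. gr c \<bullet> x = snd (cf c)}" by (auto simp: lam_def)
   then show "affine {x. lam c x = 0}" using affine_hyperplane by simp
  qed (use assms lam_vertex in auto)
  show "{x. lam c x = 0} \<subseteq> affine hull (C - {c})"
  proof
   fix x assume "x \<in> {x. lam c x = 0}"
   then have a: "lam c x = 0" by simp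
   show "x \<in> affine hull (C - {c})" unfolding affine_hull_finite[OF finite_Diff[OF finite_C]] mem_Collect_eq
   proof (intro exI conjI)
    show "(\<Sum>d\<in>C - {c}. lam d x) = 1" using sum_lam[of x] a assms by (subst (asm) sum.remove[of _ c]) auto
    show "(\<Sum>d\<in>C - {c}. lam d x *\<^sub>R d) = x" using sum_lam_vertex[of x] a assms by (subst (asm) sum.remove[of _ c]) auto
   qed
  qed
 qed
 then show ?thesis by (auto simp: affine_hull_convex_hull lam_def)
qed

lemma C_minus_nonempty: "C - {c} \<noteq> {}"
proof
 assume "C - {c} = {}"
 then have "card C \<le> card {c}" by (intro card_mono) auto
 then show False using card_C by simp
qed

lemma fct_nonempty: "fct c \<noteq> {}" using C_minus_nonempty by simp

lemma facet_iff: "S facet_of T \<longleftrightarrow> (\<exists>c\<in>C. S = fct c)"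
 using facet_of_convex_hull_affine_independent[OF aff_indep, of S] fct_nonempty by blast

lemma compact_T [simp]: "compact T" by (simp add: finite_imp_compact_convex_hull)

lemma compact_fct [simp]: "compact (fct c)" by (simp add: finite_imp_compact_convex_hull)

lemma interior_T_nonempty: "interior T \<noteq> {}"
proof -
 let ?x = "\<Sum>d\<in>C. (1 / real (card C)) *\<^sub>R d"
 have s: "sum (\<lambda>d. 1 / real (card C)) C = 1" using card_C by simp
 have "?x \<in> interior T" unfolding interior_T using lam_affine_comb[OF _ s] card_C by auto
 then show ?thesis by blast
qed

lemma measure_interior_T_pos: "measure lebesgue (interior T) > 0"
proof -
 have "interior T \<in> lmeasurable" by (rule lmeasurable_open[OF bounded_subset[OF compact_imp_bounded[OF compact_T] interior_subset] open_interior])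
 moreover have "\<not> negligible (interior T)" using open_not_negligible interior_T_nonempty by blast
 ultimately show ?thesis by (simp add: negligible_iff_measure zero_less_measure_iff)
qed

lemma affine_by_coordinates:
 fixes q :: "real^'n \<Rightarrow> 'b::real_vector"
 assumes "linear A"
 shows "A x + b = (\<Sum>c\<in>C. lam c x *\<^sub>R (A c + b))"
proof -
 have "A x + b = A (\<Sum>c\<in>C. lam c x *\<^sub>R c) + (\<Sum>c\<in>C. lam c x) *\<^sub>R b" by (simp only: barycentric scaleR_one)
 also have "... = (\<Sum>c\<in>C. lam c x *\<^sub>R A c) + (\<Sum>c\<in>C. lam c x *\<^sub>R b)"
  by (simp only: linear_sum[OF assms] linear_scale[OF assms] scaleR_left.sum o_def)
 finally show ?thesis by (simp only: scaleR_add_right sum.distrib)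
qed

text \<open>The coordinates sum to 1, so the \<open>d\<close> of them other than
  \<open>lam i\<close> already fix the remaining one, and all of them together fix the
  point.\<close>

lemma gr_determines:
 assumes "i \<in> C" "\<And>j. j \<in> C \<Longrightarrow> j \<noteq> i \<Longrightarrow> gr j \<bullet> w = 0"
 shows "w = 0"
proof -
 have lamj: "lam j w = lam j 0" if "j \<in> C" "j \<noteq> i" for j using assms(2)[OF that] lam_add[of j 0 w] by simp
 have "lam i w = lam i 0" using sum_lam[of w] sum_lam[of 0] by (simp add: sum.remove[OF finite_C assms(1)] lamj)
 then show "w = 0" using lamj by (intro eq_if_lam_eq) auto
qed

text \<open>The field \<open>x - j\<close> is tangential to every facet containing \<open>j\<close>
  and has constant normal component on the facet opposite \<open>j\<close>; these fields form the
  local Raviart--Thomas basis. At a vertex \<open>i\<close> the facets through \<open>i\<close>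
  determine the value of \<open>r\<close>, by \<open>gr_determines\<close>, and an affine field is
  determined by its vertex values.\<close>

lemma RT_decomposition:
 fixes r :: "real^'n \<Rightarrow> real^'n"
 assumes A: "linear A" and r: "\<And>x. r x = A x + b"
  and const: "\<And>j x. j \<in> C \<Longrightarrow> x \<in> fct j \<Longrightarrow> gr j \<bullet> r x = - \<beta> j"
 shows "r x = (\<Sum>j\<in>C. \<beta> j *\<^sub>R (x - j))"
proof -
 let ?B = "\<lambda>x. sum \<beta> C *\<^sub>R x" and ?b = "- (\<Sum>j\<in>C. \<beta> j *\<^sub>R j)"
 have B: "linear ?B" by (simp add: linear_iff algebra_simps)
 have rB: "(\<Sum>j\<in>C. \<beta> j *\<^sub>R (x - j)) = ?B x + ?b" for x by (simp add: scaleR_diff_right sum_subtractf scaleR_left.sum)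
 have vertex: "r i = ?B i + ?b" if i: "i \<in> C" for i
 proof -
  have "r i - (?B i + ?b) = 0"
  proof (rule gr_determines[OF i])
   fix j assume j: "j \<in> C" "j \<noteq> i"
   have "i \<in> fct j" using i j by (intro hull_inc) auto
   have "gr j \<bullet> (\<Sum>c\<in>C. \<beta> c *\<^sub>R (i - c)) = (\<Sum>c\<in>C. \<beta> c * (lam j i - lam j c))" by (simp add: inner_sum_right lam_diff)
   also have "... = (\<Sum>c\<in>C. if c = j then - \<beta> c else 0)" using i j by (intro sum.cong) (auto simp: lam_vertex)
   also have "... = - \<beta> j" using j by simp
   finally show "gr j \<bullet> (r i - (?B i + ?b)) = 0" unfolding rB[symmetric] inner_diff_right const[OF j(1) \<open>i \<in> fct j\<close>] by simp
  qed
  then show ?thesis by simp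
 qed
 have "r x = (\<Sum>c\<in>C. lam c x *\<^sub>R r c)" using affine_by_coordinates[OF A, of x b] by (simp add: r)
 also have "... = (\<Sum>c\<in>C. lam c x *\<^sub>R (?B c + ?b))" by (intro sum.cong) (auto simp only: vertex)
 also have "... = ?B x + ?b" using affine_by_coordinates[OF B, of x ?b] by simp
 finally show ?thesis by (simp only: rB)
qed

end

lemma simplex_full_simplex:
 fixes S :: "(real^'n) set"
 assumes "int CARD('n) simplex S"
 obtains C where "full_simplex C" "S = convex hull C"
proof -
 obtain C where "\<not> affine_dependent C" "int (card C) = int CARD('n) + 1" "S = convex hull C" using assms unfolding simplex_def by blast
 then have "full_simplex C" unfolding full_simplex_def by linarith
 then show ?thesis using \<open>S = convex hull C\<close> by (rule that)
qed

section \<open>The cone formula for C1 functions\<close>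

definition C1_scalar :: "(real^'n \<Rightarrow> real) \<Rightarrow> (real^'n \<Rightarrow> real^'n) \<Rightarrow> bool" where
 "C1_scalar \<phi> \<gamma> \<longleftrightarrow> (\<forall>x. GDERIV \<phi> x :> \<gamma> x) \<and> continuous_on UNIV \<gamma>"

lemma C1_scalar_continuous: "C1_scalar \<phi> \<gamma> \<Longrightarrow> continuous_on UNIV \<phi>" unfolding C1_scalar_def gderiv_def
 by (meson has_derivative_continuous continuous_at_imp_continuous_on)

lemma C1_scalar_measurable:
 assumes "C1_scalar \<phi> \<gamma>"
 shows "\<phi> \<in> borel_measurable borel" "\<gamma> \<in> borel_measurable borel" using assms C1_scalar_continuous[OF assms]
 by (auto simp: C1_scalar_def intro: borel_measurable_continuous_onI)

text \<open>The frontier of a convex set is negligible. This links the Borel computations behind the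
  cone formula with the Lebesgue integrals over element interiors.\<close>

lemma integral_lborel_indicator_interior:
 fixes f :: "real^'n \<Rightarrow> 'b::euclidean_space"
 assumes K: "convex K" "compact K" and f: "f \<in> borel_measurable borel"
 shows "(LINT x|lborel. indicator K x *\<^sub>R f x) = (LINT x|leb (interior K). f x)"
proof -
 have "(LINT x|lborel. indicator K x *\<^sub>R f x) = (LINT x|lebesgue. indicator K x *\<^sub>R f x)"
  using f compact_imp_closed[OF K(2)] by (intro integral_completion[symmetric]) simp
 also have "... = (LINT x|lebesgue. indicator (interior K) x *\<^sub>R f x)"
 proof (rule integral_cong_AE)
  have m: "f \<in> borel_measurable lebesgue" using f by (simp add: measurable_completion)
  show "(\<lambda>x. indicator K x *\<^sub>R f x) \<in> borel_measurable lebesgue"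
   using m compact_imp_closed[OF K(2)] by (intro borel_measurable_scaleR borel_measurable_indicator) auto
  show "(\<lambda>x. indicator (interior K) x *\<^sub>R f x) \<in> borel_measurable lebesgue" using m by (intro borel_measurable_scaleR borel_measurable_indicator) auto
  have "frontier K \<in> null_sets lebesgue" using negligible_convex_frontier[OF K(1)] by (simp add: negligible_iff_null_sets)
  then have "AE x in lebesgue. x \<notin> frontier K" by (rule AE_not_in)
  then show "AE x in lebesgue. indicator K x *\<^sub>R f x = indicator (interior K) x *\<^sub>R f x"
  proof eventually_elim
   case (elim x)
   then have "x \<in> K \<longleftrightarrow> x \<in> interior K" using closure_subset[of K] interior_subset[of K] by (auto simp: frontier_def)
   then show ?case by (simp add: indicator_def)
  qed
 qed
 also have "... = (LINT x|leb (interior K). f x)" by (rule integral_restrict_space[symmetric]) simp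
 finally show ?thesis .
qed

lemma one_minus_power_bound:
 fixes e :: real assumes "0 < e" "e < 1"
 shows "0 \<le> (1 - (1 - e) ^ d) / e" "(1 - (1 - e) ^ d) / e \<le> real d"
proof -
 show "0 \<le> (1 - (1 - e) ^ d) / e" using assms by (simp add: power_le_one)
 have "1 + real d * (- e) \<le> (1 + (- e)) ^ d" by (rule Bernoulli_inequality) (use assms in simp)
 then have "1 - (1 - e) ^ d \<le> real d * e" by simp
 then show "(1 - (1 - e) ^ d) / e \<le> real d" using assms by (simp add: pos_divide_le_eq)
qed

context full_simplex
begin

definition ht :: "real^'n \<Rightarrow> real" where "ht c = 1 / norm (gr c)"

lemma ht_pos: "c \<in> C \<Longrightarrow> ht c > 0" using gr_nonzero by (simp add: ht_def)

lemma convex_T: "convex T" by (rule convex_convex_hull)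

text \<open>The homothety about \<open>v\<close> with ratio \<open>1 - e\<close> multiplies the
  other coordinates by \<open>1 - e\<close> and sends \<open>lam v\<close> to
  \<open>e + (1 - e) * lam v\<close>. Hence it maps \<open>T\<close> onto \<open>T\<close> without
  the layer at the facet opposite \<open>v\<close>.\<close>

lemma homothety_indicator:
 assumes v: "v \<in> C" and e: "0 < e" "e < 1"
 shows "indicator T (v + (1 - e) *\<^sub>R (x - v)) * indicator {x. lam v x \<ge> e} (v + (1 - e) *\<^sub>R (x - v))
  = (indicator T x :: real)"
proof -
 let ?y = "v + (1 - e) *\<^sub>R (x - v)"
 have lam_y: "lam c ?y = lam c v + (1 - e) * (lam c x - lam c v)" for c by (simp add: lam_add lam_diff)
 have v1: "lam v ?y = e + (1 - e) * lam v x" unfolding lam_y using lam_vertex[OF v v] by (simp add: algebra_simps)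
 have v2: "lam c ?y = (1 - e) * lam c x" if "c \<in> C" "c \<noteq> v" for c unfolding lam_y using lam_vertex[OF that(1) v] that by simp
 have "?y \<in> T \<and> lam v ?y \<ge> e \<longleftrightarrow> x \<in> T"
 proof
  assume a: "?y \<in> T \<and> lam v ?y \<ge> e"
  show "x \<in> T" unfolding mem_T
  proof
   fix c assume c: "c \<in> C"
   show "0 \<le> lam c x"
   proof (cases "c = v")
    case True
    have "0 \<le> (1 - e) * lam v x" using a v1 by simp
    then show ?thesis using e True by (simp add: zero_le_mult_iff)
   next
    case False
    have "0 \<le> lam c ?y" using a c unfolding mem_T by blast
    then have "0 \<le> (1 - e) * lam c x" by (simp only: v2[OF c False])
    then show ?thesis using e by (simp add: zero_le_mult_iff)
   qed
  qed
 next
  assume "x \<in> T"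
  then have x: "0 \<le> lam c x" if "c \<in> C" for c using that by (simp add: mem_T)
  have "e \<le> lam v ?y" unfolding v1 using x[OF v] e by simp
  moreover have "?y \<in> T" unfolding mem_T
  proof
   fix c assume c: "c \<in> C"
   show "0 \<le> lam c ?y" using v1 v2[OF c] x[OF c] e by (cases "c = v") simp_all
  qed
  ultimately show "?y \<in> T \<and> lam v ?y \<ge> e" by simp
 qed
 then show ?thesis by (auto simp: indicator_def)
qed

text \<open>Domination for the limit of small \<open>e\<close>. The quotient splits into a
  difference quotient of \<open>\<phi>\<close>, bounded by a Lipschitz constant on the convex set
  \<open>T\<close>, and a part that stems from the power, bounded by Bernoulli's inequality.\<close>

lemma C1_scalar_homothety_bound:
 assumes c1: "C1_scalar \<phi> \<gamma>" and v: "v \<in> C"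
 obtains B where "\<And>x e. x \<in> T \<Longrightarrow> 0 < e \<Longrightarrow> e < 1 \<Longrightarrow>
  \<bar>(\<phi> x - (1 - e) ^ CARD('n) * \<phi> (v + (1 - e) *\<^sub>R (x - v))) / e\<bar> \<le> B"
proof -
 have cont: "continuous_on T \<phi>" "continuous_on T \<gamma>" using C1_scalar_continuous[OF c1] c1 continuous_on_subset by (auto simp: C1_scalar_def)
 obtain B0 where B0: "\<And>x. x \<in> T \<Longrightarrow> \<bar>\<phi> x\<bar> \<le> B0"
  using compact_imp_bounded[OF compact_continuous_image[OF cont(1) compact_T]] by (auto simp: bounded_iff)
 obtain B1 where B1: "\<And>x. x \<in> T \<Longrightarrow> norm (\<gamma> x) \<le> B1"
  using compact_imp_bounded[OF compact_continuous_image[OF cont(2) compact_T]] by (auto simp: bounded_iff)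
 obtain R where R: "\<And>x. x \<in> T \<Longrightarrow> norm x \<le> R" using compact_imp_bounded[OF compact_T] by (auto simp: bounded_iff)
 have vT: "v \<in> T" using v by (simp add: hull_inc)
 have B1p: "0 \<le> B1" using B1[OF vT] norm_ge_zero order_trans by blast
 have lip: "\<bar>\<phi> x - \<phi> y\<bar> \<le> B1 * norm (x - y)" if "x \<in> T" "y \<in> T" for x y
 proof -
  have "norm (\<phi> x - \<phi> y) \<le> B1 * norm (x - y)"
  proof (rule differentiable_bound[OF convex_T])
   fix z assume z: "z \<in> T"
   show "(\<phi> has_derivative (\<lambda>h. h \<bullet> \<gamma> z)) (at z within T)" using c1 by (auto simp: C1_scalar_def gderiv_def intro: has_derivative_at_withinI)
   show "onorm (\<lambda>h. h \<bullet> \<gamma> z) \<le> B1"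
   proof (rule onorm_le)
    fix h
    have "norm (h \<bullet> \<gamma> z) \<le> norm h * norm (\<gamma> z)" by (simp add: Cauchy_Schwarz_ineq2)
    also have "... \<le> norm h * B1" by (intro mult_left_mono B1 z) simp
    finally show "norm (h \<bullet> \<gamma> z) \<le> B1 * norm h" by (simp add: mult.commute)
   qed
  qed (use that in auto)
  then show ?thesis by simp
 qed
 show ?thesis
 proof (rule that)
  fix x e assume x: "x \<in> T" and e: "0 < e" "(e::real) < 1"
  let ?y = "v + (1 - e) *\<^sub>R (x - v)" and ?p = "(1 - e) ^ CARD('n)"
  have "?y = e *\<^sub>R v + (1 - e) *\<^sub>R x" by (simp add: algebra_simps)
  then have y: "?y \<in> T" using convexD[OF convex_T vT x, of e "1 - e"] e by simp
  have xy: "norm (x - ?y) = e * norm (x - v)"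
  proof -
   have "x - ?y = e *\<^sub>R (x - v)" by (simp add: algebra_simps)
   then show ?thesis using e by simp
  qed
  have "(\<phi> x - ?p * \<phi> ?y) / e = (\<phi> x - \<phi> ?y) / e + ((1 - ?p) / e) * \<phi> ?y" using e by (simp add: field_simps)
  also have "\<bar>...\<bar> \<le> \<bar>(\<phi> x - \<phi> ?y) / e\<bar> + \<bar>((1 - ?p) / e) * \<phi> ?y\<bar>" by (rule abs_triangle_ineq)
  also have "... \<le> B1 * (R + R) + real CARD('n) * B0"
  proof (rule add_mono)
   have "\<bar>\<phi> x - \<phi> ?y\<bar> \<le> B1 * (e * norm (x - v))" using lip[OF x y] xy by simp
   also have "... \<le> B1 * (e * (R + R))"
   proof -
    have "norm (x - v) \<le> R + R" using norm_triangle_ineq4[of x v] R[OF x] R[OF vT] by linarith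
    then show ?thesis using B1p e by (intro mult_left_mono) auto
   qed
   finally show "\<bar>(\<phi> x - \<phi> ?y) / e\<bar> \<le> B1 * (R + R)" using e by (simp add: field_simps)
   have "\<bar>((1 - ?p) / e) * \<phi> ?y\<bar> = ((1 - ?p) / e) * \<bar>\<phi> ?y\<bar>"
    unfolding abs_mult by (simp only: abs_of_nonneg[OF one_minus_power_bound(1)[OF e]])
   also have "... \<le> real CARD('n) * B0" by (intro mult_mono one_minus_power_bound[OF e] B0 y) auto
   finally show "\<bar>((1 - ?p) / e) * \<phi> ?y\<bar> \<le> real CARD('n) * B0" .
  qed
  finally show "\<bar>(\<phi> x - ?p * \<phi> ?y) / e\<bar> \<le> B1 * (R + R) + real CARD('n) * B0" .
 qed
qed

text \<open>The expression is the difference quotient at \<open>t = 0\<close> of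
  \<open>- ((1 - t) ^ d * \<phi> (v + (1 - t) *\<^sub>R (x - v)))\<close>, where \<open>d\<close> is
  the dimension. With \<open>m + 2\<close> in the denominator the parameter stays strictly below
  1.\<close>

lemma C1_scalar_homothety_limit:
 assumes c1: "C1_scalar \<phi> \<gamma>"
 shows "(\<lambda>m. (\<phi> x - (1 - inverse (real (m + 2))) ^ CARD('n) * \<phi> (v + (1 - inverse (real (m + 2))) *\<^sub>R (x - v)))
   / inverse (real (m + 2))) \<longlonglongrightarrow> real CARD('n) * \<phi> x + \<gamma> x \<bullet> (x - v)"
proof -
 let ?g = "\<lambda>t. v + (1 - t) *\<^sub>R (x - v)"
 let ?f = "\<lambda>t::real. - ((1 - t) ^ CARD('n) * \<phi> (?g t))"
 have g: "(?g has_derivative (\<lambda>t. - t *\<^sub>R (x - v))) (at 0)" by (auto intro!: derivative_eq_intros)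
 have "(\<phi> has_derivative (\<lambda>h. h \<bullet> \<gamma> x)) (at (?g 0))" using c1 by (simp add: C1_scalar_def gderiv_def)
 from has_derivative_compose[OF g this]
 have "((\<lambda>t. \<phi> (?g t)) has_derivative (\<lambda>t. (- t *\<^sub>R (x - v)) \<bullet> \<gamma> x)) (at 0)" .
 then have d1: "((\<lambda>t. \<phi> (?g t)) has_real_derivative (- (\<gamma> x \<bullet> (x - v)))) (at 0)"
  unfolding has_field_derivative_def by (rule has_derivative_eq_rhs) (auto simp: fun_eq_iff inner_commute)
 have d2: "((\<lambda>t. (1 - t) ^ CARD('n)) has_real_derivative (- real CARD('n))) (at 0)" by (auto intro!: derivative_eq_intros)
 have "(?f has_real_derivative (real CARD('n) * \<phi> x + \<gamma> x \<bullet> (x - v))) (at 0)" using DERIV_minus[OF DERIV_mult[OF d2 d1]] by (simp add: algebra_simps)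
 then have lim: "(\<lambda>t. (?f (0 + t) - ?f 0) / t) \<midarrow>0\<rightarrow> real CARD('n) * \<phi> x + \<gamma> x \<bullet> (x - v)" unfolding DERIV_def .
 have e: "(\<lambda>m. inverse (real (m + 2))) \<longlonglongrightarrow> 0"
  using LIMSEQ_ignore_initial_segment[OF LIMSEQ_inverse_real_of_nat, of 1] by (simp add: add.commute)
 have "(\<lambda>m. (?f (0 + inverse (real (m + 2))) - ?f 0) / inverse (real (m + 2))) \<longlonglongrightarrow> real CARD('n) * \<phi> x + \<gamma> x \<bullet> (x - v)"
 proof (rule filterlim_compose[OF lim])
  show "filterlim (\<lambda>m. inverse (real (m + 2))) (at 0) sequentially" using e by (auto simp: filterlim_at intro!: always_eventually)
 qed
 then show ?thesis by simp
qed


text \<open>The layer is \<open>T\<close> minus its shrunken copy. Once the copy is transformed back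
  to \<open>T\<close>, the layer integral divided by the thickness is a single integral over
  \<open>T\<close> of a difference quotient, and dominated convergence applies.\<close>

lemma cone_layer_homothety:
 assumes c1: "C1_scalar \<phi> \<gamma>" and v: "v \<in> C"
 shows "(\<lambda>m. (LINT x|lborel. indicator T x * (indicator {x. lam v x < inverse (real (m + 2))} x * \<phi> x)) / inverse (real (m + 2)))
  \<longlonglongrightarrow> (LINT x|lborel. indicator T x * (real CARD('n) * \<phi> x + \<gamma> x \<bullet> (x - v)))"
proof -
 let ?e = "\<lambda>m. inverse (real (m + 2))"
 note [measurable] = C1_scalar_measurable[OF c1]
 have [measurable]: "T \<in> sets borel" by (simp add: compact_imp_closed)
 have [measurable]: "lam v \<in> borel_measurable borel" by (rule borel_measurable_continuous_onI) (rule continuous_lam)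
 have e: "0 < ?e m" "?e m < 1" for m using one_less_inverse_iff[of "real (m + 2)"] by (auto simp: inverse_less_1_iff)
 obtain B where B: "\<And>x e. x \<in> T \<Longrightarrow> 0 < e \<Longrightarrow> e < 1 \<Longrightarrow>
   \<bar>(\<phi> x - (1 - e) ^ CARD('n) * \<phi> (v + (1 - e) *\<^sub>R (x - v))) / e\<bar> \<le> B" using C1_scalar_homothety_bound[OF c1 v] by blast
 let ?s = "\<lambda>m x. indicator T x * ((\<phi> x - (1 - ?e m) ^ CARD('n) * \<phi> (v + (1 - ?e m) *\<^sub>R (x - v))) / ?e m)"
 have cont: "continuous_on UNIV \<phi>" by (rule C1_scalar_continuous[OF c1])
 have int_cont: "integrable lborel (\<lambda>x. indicator T x * f x)" if "continuous_on UNIV f" for f :: "real^'n \<Rightarrow> real"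
  using borel_integrable_compact[OF compact_T continuous_on_subset[OF that]] by (simp add: indicator_scaleR_eq_if[symmetric])
 have eq: "(LINT x|lborel. indicator T x * (indicator {x. lam v x < ?e m} x * \<phi> x)) / ?e m = (LINT x|lborel. ?s m x)" for m
 proof -
  let ?r = "1 - ?e m"
  let ?h = "\<lambda>x. indicator T x * (indicator {x. lam v x \<ge> ?e m} x * \<phi> x)"
  have r: "0 < ?r" using e[of m] by simp
  have i1: "integrable lborel (\<lambda>x. indicator T x * \<phi> x)" by (rule int_cont[OF cont])
  have i2: "integrable lborel ?h" by (rule Bochner_Integration.integrable_bound[OF i1]) (auto simp: indicator_def)
  have i3: "integrable lborel (\<lambda>x. indicator T x * \<phi> (v + ?r *\<^sub>R (x - v)))" by (intro int_cont continuous_on_compose2[OF cont] continuous_intros) auto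
  have hx: "?h (v + ?r *\<^sub>R (x - v)) = indicator T x * \<phi> (v + ?r *\<^sub>R (x - v))" for x
   unfolding mult.assoc[symmetric] homothety_indicator[OF v e(1) e(2)] ..
  have "(LINT x|lborel. ?h x) = ?r ^ CARD('n) * (LINT x|lborel. ?h (v + ?r *\<^sub>R (x - v)))" by (rule lborel_integral_homothety[OF r]) measurable
  then have h: "(LINT x|lborel. ?h x) = ?r ^ CARD('n) * (LINT x|lborel. indicator T x * \<phi> (v + ?r *\<^sub>R (x - v)))" by (simp only: hx)
  have "(LINT x|lborel. indicator T x * (indicator {x. lam v x < ?e m} x * \<phi> x))
    = (LINT x|lborel. indicator T x * \<phi> x - ?h x)" by (rule Bochner_Integration.integral_cong) (auto simp: indicator_def)
  also have "... = (LINT x|lborel. indicator T x * \<phi> x) - (LINT x|lborel. ?h x)" by (rule Bochner_Integration.integral_diff[OF i1 i2])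
  also have "... = (LINT x|lborel. indicator T x * \<phi> x - ?r ^ CARD('n) * (indicator T x * \<phi> (v + ?r *\<^sub>R (x - v))))"
   by (simp only: h Bochner_Integration.integral_diff[OF i1 integrable_mult_right[OF i3]] integral_mult_right_zero)
  finally have "(LINT x|lborel. indicator T x * (indicator {x. lam v x < ?e m} x * \<phi> x)) / ?e m
    = (LINT x|lborel. (indicator T x * \<phi> x - ?r ^ CARD('n) * (indicator T x * \<phi> (v + ?r *\<^sub>R (x - v)))) / ?e m)" by (simp only: integral_divide_zero)
  also have "... = (LINT x|lborel. ?s m x)" by (rule Bochner_Integration.integral_cong) (auto simp: algebra_simps)
  finally show ?thesis .
 qed
 have "(\<lambda>m. LINT x|lborel. ?s m x)
  \<longlonglongrightarrow> (LINT x|lborel. indicator T x * (real CARD('n) * \<phi> x + \<gamma> x \<bullet> (x - v)))"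
 proof (rule integral_dominated_convergence[where w = "\<lambda>x. indicator T x * B"])
  show "integrable lborel (\<lambda>x. indicator T x * B)" by (rule int_cont) simp
  show "AE x in lborel. (\<lambda>m. ?s m x) \<longlonglongrightarrow> indicator T x * (real CARD('n) * \<phi> x + \<gamma> x \<bullet> (x - v))"
   by (intro AE_I2 tendsto_mult tendsto_const C1_scalar_homothety_limit[OF c1])
  show "AE x in lborel. norm (?s m x) \<le> indicator T x * B" for m
  proof (rule AE_I2)
   fix x show "norm (?s m x) \<le> indicator T x * B" using B[OF _ e(1)[of m] e(2)[of m], of x] by (cases "x \<in> T") auto
  qed
 qed measurable
 then show ?thesis by (simp only: eq)
qed

text \<open>The same layer, stretched in normal direction, turns in the limit into the prism of unit
  height over the facet, by which \<open>surface_measure\<close> is defined.\<close>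

lemma cone_layer_surface:
 assumes c1: "C1_scalar \<phi> \<gamma>" and v: "v \<in> C"
 shows "(\<lambda>m. (LINT x|lborel. indicator T x * (indicator {x. lam v x < inverse (real (m + 2))} x * \<phi> x)) / inverse (real (m + 2)))
  \<longlonglongrightarrow> ht v * (LINT x:fct v|surface_measure (affine hull (fct v)). \<phi> x)"
proof -
 let ?e = "\<lambda>m. inverse (real (m + 2))"
 define h where "h = ht v"
 define n where "n = h *\<^sub>R gr v"
 define b where "b = h * snd (cf v)"
 have h: "h > 0" unfolding h_def by (rule ht_pos[OF v])
 have n: "norm n = 1" using h gr_nonzero[OF v] by (simp add: n_def h_def ht_def)
 have nn: "n \<bullet> n = 1" using n by (simp add: dot_square_norm)
 have lamv: "h * lam v x = n \<bullet> x - b" for x by (simp add: lam_def n_def b_def algebra_simps)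
 have hyp: "affine hull (fct v) = {x. n \<bullet> x = b}" unfolding affine_hull_fct[OF v] n_def b_def using h by auto
 note [measurable] = C1_scalar_measurable[OF c1]
 have [measurable]: "T \<in> sets borel" "fct v \<in> sets borel" by (simp_all add: compact_imp_closed)
 have [measurable]: "lam c \<in> borel_measurable borel" for c by (rule borel_measurable_continuous_onI) (rule continuous_lam)
 have e: "0 < ?e m" "?e m < 1" for m by (auto simp: inverse_less_1_iff)
 define p where "p z = z - (n \<bullet> z - b) *\<^sub>R n" for z
 \<comment> \<open>\<open>N m\<close> takes a slab point at signed distance \<open>s\<close> from
   the hyperplane to height \<open>?e m * h * (s + 1/2)\<close> over the facet, so that
   \<open>s\<close> between -1/2 and 1/2 sweeps the layer.\<close>
 define N where "N m z = p z + (?e m * h * (n \<bullet> z - b + 1/2)) *\<^sub>R n" for m z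
 have [measurable]: "p \<in> borel_measurable borel" unfolding p_def by measurable
 have [measurable]: "N m \<in> borel_measurable borel" for m unfolding N_def by measurable
 have np: "n \<bullet> p z = b" for z by (simp add: p_def inner_diff_right nn)
 have lamp: "lam v (p z) = 0" for z using lamv[of "p z"] h by (simp add: np)
 have lamN: "lam v (N m z) = ?e m * (n \<bullet> z - b + 1/2)" for m z
 proof -
  have "h * lam v (N m z) = h * (?e m * (n \<bullet> z - b + 1/2))" by (simp only: lamv) (simp add: N_def inner_add_right np nn)
  then show ?thesis using h by simp
 qed
 let ?F = "\<lambda>m z. indicator T (N m z) * (indicator {x. lam v x < ?e m} (N m z) * \<phi> (N m z))"
 have eq: "(LINT x|lborel. indicator T x * (indicator {x. lam v x < ?e m} x * \<phi> x)) / ?e m = h * (LINT z|lborel. ?F m z)" for m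
 proof -
  have Nz: "z + ((?e m * h - 1) * (n \<bullet> z) + (b + ?e m * h * (1/2 - b))) *\<^sub>R n = N m z" for z
  proof -
   have "(?e m * h - 1) * (n \<bullet> z) + (b + ?e m * h * (1/2 - b)) = - (n \<bullet> z - b) + ?e m * h * (n \<bullet> z - b + 1/2)" by (simp add: algebra_simps)
   then show ?thesis unfolding N_def p_def by (simp only: scaleR_add_left scaleR_minus_left) simp
  qed
  have "(LINT x|lborel. indicator T x * (indicator {x. lam v x < ?e m} x * \<phi> x)) =
   (?e m * h) * (LINT z|lborel. (\<lambda>x. indicator T x * (indicator {x. lam v x < ?e m} x * \<phi> x))
     (z + ((?e m * h - 1) * (n \<bullet> z) + (b + ?e m * h * (1/2 - b))) *\<^sub>R n))"
   by (rule lborel_integral_stretch[OF n]) (use e[of m] h in \<open>simp, measurable\<close>)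
  also have "... = (?e m * h) * (LINT z|lborel. ?F m z)" by (simp only: Nz)
  finally show ?thesis using e[of m] by simp
 qed
 obtain R where R: "\<And>x. x \<in> T \<Longrightarrow> norm x \<le> R" using compact_imp_bounded[OF compact_T] by (auto simp: bounded_iff)
 obtain B where B: "\<And>x. x \<in> T \<Longrightarrow> \<bar>\<phi> x\<bar> \<le> B"
  using compact_imp_bounded[OF compact_continuous_image[OF continuous_on_subset[OF C1_scalar_continuous[OF c1]] compact_T]] by (auto simp: bounded_iff)
 have slab: "\<bar>n \<bullet> z - b\<bar> \<le> 1/2" if "N m z \<in> T" "lam v (N m z) < ?e m" for m z
 proof -
  have "0 \<le> ?e m * (n \<bullet> z - b + 1/2)" "?e m * (n \<bullet> z - b + 1/2) < ?e m * 1" using that v by (auto simp: lamN mem_T)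
  then have "0 \<le> n \<bullet> z - b + 1/2" "n \<bullet> z - b + 1/2 < 1" using e(1)[of m] by (auto simp only: zero_le_mult_iff mult_less_cancel_left_pos)
  then show ?thesis by linarith
 qed
 have bnd: "norm z \<le> R + (1/2 + h)" if "N m z \<in> T" "lam v (N m z) < ?e m" for m z
 proof -
  let ?s = "n \<bullet> z - b"
  have s: "\<bar>?s\<bar> \<le> 1/2" by (rule slab[OF that])
  have "z = N m z + (?s - ?e m * h * (?s + 1/2)) *\<^sub>R n" by (simp add: N_def p_def scaleR_diff_left)
  then have "norm z \<le> norm (N m z) + norm ((?s - ?e m * h * (?s + 1/2)) *\<^sub>R n)" by (metis norm_triangle_ineq)
  also have "norm ((?s - ?e m * h * (?s + 1/2)) *\<^sub>R n) = \<bar>?s - ?e m * h * (?s + 1/2)\<bar>" using n by simp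
  also have "... \<le> \<bar>?s\<bar> + \<bar>?e m * h * (?s + 1/2)\<bar>" by (rule abs_triangle_ineq4)
  also have "\<bar>?e m * h * (?s + 1/2)\<bar> \<le> 1 * h * 1"
  proof -
   have "\<bar>?e m * h * (?s + 1/2)\<bar> = ?e m * h * \<bar>?s + 1/2\<bar>" using e(1)[of m] h by (simp add: abs_mult)
   also have "... \<le> 1 * h * 1"
   proof (intro mult_mono)
    show "\<bar>?s + 1/2\<bar> \<le> 1" using s by linarith
   qed (use e[of m] h in auto)
   finally show ?thesis .
  qed
  finally show ?thesis using R[OF that(1)] s by linarith
 qed
 have enull: "(\<lambda>m. ?e m) \<longlonglongrightarrow> 0" using LIMSEQ_ignore_initial_segment[OF LIMSEQ_inverse_real_of_nat, of 1] by (simp add: add.commute)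
 have Nlim: "(\<lambda>m. N m z) \<longlonglongrightarrow> p z" for z
 proof -
  have "(\<lambda>m. p z + (?e m * h * (n \<bullet> z - b + 1/2)) *\<^sub>R n) \<longlonglongrightarrow> p z + (0 * h * (n \<bullet> z - b + 1/2)) *\<^sub>R n"
   by (intro tendsto_intros enull)
  then show ?thesis unfolding N_def by simp
 qed
 have lamNlim: "(\<lambda>m. lam c (N m z)) \<longlonglongrightarrow> lam c (p z)" for c z unfolding lam_def by (intro tendsto_intros Nlim)
 have philim: "(\<lambda>m. \<phi> (N m z)) \<longlonglongrightarrow> \<phi> (p z)" for z using C1_scalar_continuous[OF c1] Nlim[of z]
  by (auto simp: continuous_on_eq_continuous_at intro: isCont_tendsto_compose)
 let ?G = "\<lambda>z. indicator {z. \<bar>n \<bullet> z - b\<bar> \<le> 1/2} z * (indicator (fct v) (p z) * \<phi> (p z))"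
 have null_hyp: "AE z in lborel. a \<bullet> z \<noteq> d" if "a \<noteq> 0" for a :: "real^'n" and d
 proof -
  have "negligible {z. a \<bullet> z = d}" using negligible_hyperplane[of a d] that by simp
  then have "{z. a \<bullet> z = d} \<in> null_sets lebesgue" by (simp add: negligible_iff_null_sets)
  moreover have "{z. a \<bullet> z = d} \<in> sets lborel" using closed_hyperplane[of a d] by simp
  ultimately have "{z. a \<bullet> z = d} \<in> null_sets lborel" by (simp add: null_sets_def)
  then have "AE z in lborel. z \<notin> {z. a \<bullet> z = d}" by (rule AE_not_in)
  then show ?thesis by simp
 qed
 \<comment> \<open>Convergence of the indicators can fail only where the foot point
   \<open>p z\<close> lies on the hyperplane of another facet, which happens on a null set. A
   vanishing \<open>?a\<close> occurs only in dimension one, where \<open>lam c\<close> is 1 at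
   every foot point.\<close>
 have edge: "AE z in lborel. lam c (p z) \<noteq> 0" if c: "c \<in> C" "c \<noteq> v" for c
 proof -
  let ?a = "gr c - (gr c \<bullet> n) *\<^sub>R n"
  have lp: "lam c (p z) = ?a \<bullet> z - (snd (cf c) - b * (gr c \<bullet> n))" for z
   by (simp add: lam_def p_def inner_diff_left inner_diff_right algebra_simps inner_commute)
  show ?thesis
  proof (cases "?a = 0")
   case True
   have "p c = c" using lamv[of c] lam_vertex[OF v c(1)] c(2) by (simp add: p_def)
   then have "lam c (p z) = 1" for z using lp[of z] lp[of c] lam_vertex[OF c(1) c(1)] True by simp
   then show ?thesis by simp
  next
   case False
   then show ?thesis using null_hyp[of ?a "snd (cf c) - b * (gr c \<bullet> n)"] by (simp add: lp)
  qed
 qed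
 have "AE z in lborel. \<forall>c\<in>C - {v}. lam c (p z) \<noteq> 0" using edge by (subst AE_ball_countable) (auto intro: countable_finite)
 moreover have "AE z in lborel. n \<bullet> z \<noteq> b + 1/2" "AE z in lborel. n \<bullet> z \<noteq> b - 1/2" using n by (auto intro!: null_hyp)
 ultimately have lim: "AE z in lborel. (\<lambda>m. ?F m z) \<longlonglongrightarrow> ?G z"
 proof eventually_elim
  case (elim z)
  show ?case
  proof (cases "\<bar>n \<bullet> z - b\<bar> \<le> 1/2")
   case False
   then have F0: "?F m z = 0" for m using slab[of m z] by (auto simp: indicator_def)
   have G0: "?G z = 0" using False by (simp add: indicator_def)
   show ?thesis unfolding F0 G0 by (rule tendsto_const)
  next
   case True
   then have s: "0 < n \<bullet> z - b + 1/2" "n \<bullet> z - b + 1/2 < 1" using elim by linarith+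
   have lv: "0 < lam v (N m z)" "lam v (N m z) < ?e m" for m
   proof -
    show "0 < lam v (N m z)" unfolding lamN using e(1)[of m] s(1) by (rule mult_pos_pos)
    have "?e m * (n \<bullet> z - b + 1/2) < ?e m * 1" using e(1)[of m] s(2) by (simp only: mult_less_cancel_left_pos)
    then show "lam v (N m z) < ?e m" unfolding lamN by simp
   qed
   show ?thesis
   proof (cases "\<forall>c\<in>C - {v}. 0 < lam c (p z)")
    case pos: True
    have "\<forall>\<^sub>F m in sequentially. \<forall>c\<in>C - {v}. 0 < lam c (N m z)"
     using pos by (intro eventually_ball_finite ballI order_tendstoD(1)[OF lamNlim]) auto
    then have "\<forall>\<^sub>F m in sequentially. \<phi> (N m z) = ?F m z"
    proof eventually_elim
     case (elim m)
     have "0 < lam c (N m z)" if "c \<in> C" for c using elim lv(1)[of m] that by (cases "c = v") auto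
     then have "N m z \<in> T" by (simp add: mem_T less_imp_le)
     then show ?case using lv(2)[of m] by simp
    qed
    then have "(\<lambda>m. ?F m z) \<longlonglongrightarrow> \<phi> (p z)" by (rule Lim_transform_eventually[OF philim])
    moreover have "p z \<in> fct v" unfolding mem_fct[OF v] mem_T using pos lamp[of z] by (metis Diff_iff less_imp_le order_refl singletonD)
    ultimately show ?thesis using True by simp
   next
    case False
    then obtain c where c: "c \<in> C" "lam c (p z) < 0" using elim by (metis DiffD1 linorder_less_linear)
    have "\<forall>\<^sub>F m in sequentially. lam c (N m z) < 0" by (rule order_tendstoD(2)[OF lamNlim c(2)])
    then have "\<forall>\<^sub>F m in sequentially. ?F m z = 0" by eventually_elim (use c in \<open>auto simp: mem_T indicator_def not_le\<close>)
    then have "(\<lambda>m. ?F m z) \<longlonglongrightarrow> 0" by (rule tendsto_eventually)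
    moreover have "p z \<notin> fct v" unfolding mem_fct[OF v] mem_T using c by (meson not_le)
    ultimately show ?thesis by simp
   qed
  qed
 qed
 have "(\<lambda>m. LINT z|lborel. ?F m z) \<longlonglongrightarrow> (LINT z|lborel. ?G z)"
 proof (rule integral_dominated_convergence[where w = "\<lambda>z. indicator (cball 0 (R + (1/2 + h))) z * B"])
  show "integrable lborel (\<lambda>z. indicator (cball 0 (R + (1/2 + h))) z * B :: real)"
   using borel_integrable_compact[OF compact_cball continuous_on_const[of "cball 0 (R + (1/2 + h))" B]] by (simp add: indicator_scaleR_eq_if[symmetric])
  show "AE z in lborel. norm (?F m z) \<le> indicator (cball 0 (R + (1/2 + h))) z * B" for m
  proof (rule AE_I2)
   fix z
   have B0: "0 \<le> B" using B[of v] v by (meson abs_ge_zero hull_inc order_trans)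
   show "norm (?F m z) \<le> indicator (cball 0 (R + (1/2 + h))) z * B" using bnd[of m z] B[of "N m z"] B0 by (auto simp: indicator_def)
  qed
  show "AE z in lborel. (\<lambda>m. ?F m z) \<longlonglongrightarrow> ?G z" by (rule lim)
 qed measurable
 then have "(\<lambda>m. h * (LINT z|lborel. ?F m z)) \<longlonglongrightarrow> h * (LINT z|lborel. ?G z)" by (rule tendsto_mult_left)
 moreover have "(LINT z|lborel. ?G z) = (LINT x:fct v|surface_measure (affine hull (fct v)). \<phi> x)"
  unfolding hyp p_def by (rule surface_integral_hyperplane[OF n, symmetric]) measurable
 ultimately show ?thesis by (simp only: eq h_def[symmetric])
qed

text \<open>Both sides are the limit of the integral over the layer divided by its relative
  thickness.\<close>

theorem cone_formula:
 assumes c1: "C1_scalar \<phi> \<gamma>" and v: "v \<in> C"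
 shows "(LINT x|leb (interior T). real CARD('n) * \<phi> x + \<gamma> x \<bullet> (x - v))
  = ht v * (LINT x:fct v|surface_measure (affine hull (fct v)). \<phi> x)"
proof -
 have "(\<lambda>x. real CARD('n) * \<phi> x + \<gamma> x \<bullet> (x - v)) \<in> borel_measurable borel" using C1_scalar_measurable[OF c1] by measurable
 from integral_lborel_indicator_interior[OF convex_T compact_T this] have "(LINT x|leb (interior T). real CARD('n) * \<phi> x + \<gamma> x \<bullet> (x - v))
  = (LINT x|lborel. indicator T x * (real CARD('n) * \<phi> x + \<gamma> x \<bullet> (x - v)))" by simp
 then show ?thesis using LIMSEQ_unique[OF cone_layer_homothety[OF c1 v] cone_layer_surface[OF c1 v]] by simp
qed

end

section \<open>Side integrals, normals and integration by parts on one simplex\<close>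

lemma C1_fieldD:
 assumes "C1_field \<phi>"
 shows "C1_scalar (\<lambda>x. \<phi> x $ i) (\<lambda>x. jacobian \<phi> (at x) $ i)" unfolding C1_scalar_def
proof (intro conjI allI)
 fix x
 have "(\<phi> has_derivative (\<lambda>h. jacobian \<phi> (at x) *v h)) (at x)" using assms jacobian_works[of \<phi> "at x"] by (auto simp: C1_field_def)
 then have "((\<lambda>x. \<phi> x $ i) has_derivative (\<lambda>h. (jacobian \<phi> (at x) *v h) $ i)) (at x)"
  by (rule bounded_linear.has_derivative[OF bounded_linear_vec_nth])
 then show "GDERIV (\<lambda>x. \<phi> x $ i) x :> jacobian \<phi> (at x) $ i" by (simp add: gderiv_def matrix_vector_mult_def inner_vec_def mult.commute)
next
 have "continuous_on UNIV (\<lambda>x. jacobian \<phi> (at x))" using assms by (simp add: C1_field_def)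
 then show "continuous_on UNIV (\<lambda>x. jacobian \<phi> (at x) $ i)" by (intro continuous_intros)
qed

lemma C1_field_continuous: "C1_field \<phi> \<Longrightarrow> continuous_on UNIV \<phi>" unfolding C1_field_def
 by (meson differentiable_imp_continuous_within continuous_at_imp_continuous_on)

definition sint :: "(real^'n) set \<Rightarrow> (real^'n \<Rightarrow> 'b::euclidean_space) \<Rightarrow> 'b" where
 "sint S f = (LINT x:S|surface_measure (affine hull S). f x)"

definition smeas :: "(real^'n) set \<Rightarrow> real" where
 "smeas S = measure (surface_measure (affine hull S)) S"

lemma side_mean_sint: "side_mean S g = sint S g /\<^sub>R smeas S" by (simp add: side_mean_def sint_def smeas_def)

definition outer_normal :: "(real^'n) set \<Rightarrow> (real^'n) set \<Rightarrow> real^'n" where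
 "outer_normal T S = (SOME n. side_normal S n \<and> (\<forall>x\<in>T. \<forall>y\<in>S. n \<bullet> x \<le> n \<bullet> y))"

lemma sint_cong: "(\<And>x. x \<in> S \<Longrightarrow> f x = g x) \<Longrightarrow> sint S f = sint S g" unfolding sint_def set_lebesgue_integral_def
 by (rule Bochner_Integration.integral_cong) (auto simp: indicator_def)

lemma integrable_continuous_interior:
 fixes f :: "real^'n \<Rightarrow> 'b::euclidean_space"
 assumes K: "compact K" and f: "continuous_on K f"
 shows "integrable (leb (interior K)) f"
proof -
 have "f absolutely_integrable_on K" using absolutely_integrable_continuous_real absolutely_integrable_on_def K f
  by (metis borel_integrable_compact set_integrable_def integrable_completion indicator_scaleR_eq_if
    borel_measurable_integrable)
 then have "f absolutely_integrable_on interior K" by (rule set_integrable_subset) (auto simp: interior_subset)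
 then show ?thesis by (simp add: set_integrable_def integrable_restrict_space)
qed

lemma square_integral_le:
 fixes f :: "'a \<Rightarrow> real"
 assumes S: "S \<in> sets M" "emeasure M S \<noteq> \<infinity>" and f: "f \<in> borel_measurable M"
  and i: "set_integrable M S (\<lambda>x. (f x)^2)"
 shows "set_integrable M S f" "(LINT x:S|M. f x)^2 \<le> measure M S * (LINT x:S|M. (f x)^2)"
proof -
 have c: "set_integrable M S (\<lambda>x. c)" for c :: real unfolding set_integrable_def using S by (simp add: less_top)
 have "set_integrable M S (\<lambda>x. 1 + (f x)^2)" by (rule set_integral_add[OF c i])
 then show I: "set_integrable M S f" unfolding set_integrable_def
 proof (rule Bochner_Integration.integrable_bound)
  show "(\<lambda>x. indicat_real S x *\<^sub>R f x) \<in> borel_measurable M" using S f by measurable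
  have "\<bar>f x\<bar> \<le> 1 + (f x)^2" for x using sum_squares_bound[of "\<bar>f x\<bar>" 1] zero_le_power2[of "f x"] by simp
  then show "AE x in M. norm (indicat_real S x *\<^sub>R f x) \<le> norm (indicat_real S x *\<^sub>R (1 + (f x)^2))" by (auto simp: indicator_def intro!: AE_I2)
 qed
 let ?m = "measure M S" let ?I = "LINT x:S|M. f x" let ?J = "LINT x:S|M. (f x)^2"
 have cst: "(LINT x:S|M. c) = c * ?m" for c :: real using S by (subst set_integral_const) auto
 have q: "0 \<le> ?J - 2 * t * ?I + t^2 * ?m" for t
 proof -
  have "0 \<le> (LINT x:S|M. (f x - t)^2)" unfolding set_lebesgue_integral_def by (rule integral_nonneg_AE) auto
  also have "... = (LINT x:S|M. (f x)^2 - (2 * t) * f x + t^2)" by (simp add: power2_diff algebra_simps)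
  also have "... = ?J - (2 * t) * ?I + t^2 * ?m"
  proof -
   have j: "set_integrable M S (\<lambda>x. (2 * t) * f x)" by (rule set_integrable_mult_right) (use I in simp)
   show ?thesis by (subst set_integral_add(2)[OF set_integral_diff(1)[OF i j] c], subst set_integral_diff(2)[OF i j])
      (simp add: cst)
  qed
  finally show ?thesis by simp
 qed
 show "?I^2 \<le> ?m * ?J"
 proof (cases "?m = 0")
  case True
  have "?I = 0"
  proof (rule ccontr)
   assume "?I \<noteq> 0"
   then show False using q[of "(?J + 1) / (2 * ?I)"] True by (simp add: field_simps)
  qed
  then show ?thesis using True by simp
 next
  case False
  then have "?m > 0" by (simp add: less_le)
  then show ?thesis using q[of "?I / ?m"] by (simp add: field_simps power2_eq_square)
 qed
qed

context full_simplex
begin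

lemma hyperplane_normals:
 assumes c: "c \<in> C"
 shows "side_normal (fct c) n \<longleftrightarrow> n = ht c *\<^sub>R gr c \<or> n = - (ht c *\<^sub>R gr c)"
proof
 let ?g = "ht c *\<^sub>R gr c"
 have g1: "norm ?g = 1" using gr_nonzero[OF c] by (simp add: ht_def)
 have gg: "?g \<bullet> ?g = 1" using g1 by (simp add: dot_square_norm)
 have sub: "fct c \<subseteq> {x. ?g \<bullet> x = ht c * snd (cf c)}" using mem_fct[OF c] by (auto simp: lam_def)
 {
  assume "n = ?g \<or> n = - ?g"
  then show "side_normal (fct c) n"
  proof
   assume "n = ?g" then show ?thesis using g1 sub unfolding side_normal_def by blast
  next
   assume n: "n = - ?g"
   have "fct c \<subseteq> {x. n \<bullet> x = - (ht c * snd (cf c))}" using sub n by auto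
   then show ?thesis using g1 n unfolding side_normal_def by (metis norm_minus_cancel)
  qed
 next
  assume "side_normal (fct c) n"
  then obtain k where n: "norm n = 1" "fct c \<subseteq> {x. n \<bullet> x = k}" by (auto simp: side_normal_def)
  have hull: "{x. gr c \<bullet> x = snd (cf c)} \<subseteq> {x. n \<bullet> x = k}"
   unfolding affine_hull_fct[OF c, symmetric] by (rule hull_minimal[OF n(2)]) (rule affine_hyperplane)
  obtain y where y: "y \<in> fct c" using fct_nonempty by blast
  then have gy: "gr c \<bullet> y = snd (cf c)" using mem_fct[OF c] by (auto simp: lam_def)
  \<comment> \<open>The part of \<open>n\<close> tangential to the facet. Moving along it stays in
    the affine hull, where \<open>n \<bullet> x\<close> is constant, so it is orthogonal to
    \<open>n\<close> and therefore to itself.\<close>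
  let ?w = "n - (n \<bullet> ?g) *\<^sub>R ?g"
  have "?g \<bullet> ?w = 0" using gg by (simp add: inner_diff_right inner_commute)
  then have "gr c \<bullet> ?w = 0" using ht_pos[OF c] by simp
  then have "gr c \<bullet> (y + ?w) = snd (cf c)" using gy by (simp only: inner_add_right add_0_right)
  then have "n \<bullet> (y + ?w) = k" "n \<bullet> y = k" using hull gy by blast+
  then have "n \<bullet> ?w = 0" by (simp add: inner_add_right)
  moreover have "?w \<bullet> ?w = n \<bullet> ?w - (n \<bullet> ?g) * (?g \<bullet> ?w)" by (simp only: inner_diff_left inner_scaleR_left)
  ultimately have "?w \<bullet> ?w = 0" using \<open>?g \<bullet> ?w = 0\<close> by simp
  then have w: "n = (n \<bullet> ?g) *\<^sub>R ?g" by simp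
  then have "\<bar>n \<bullet> ?g\<bar> = 1" using n(1) g1 by (metis mult.right_neutral norm_scaleR)
  then have "n \<bullet> ?g = 1 \<or> n \<bullet> ?g = -1" by linarith
  then show "n = ?g \<or> n = - ?g" by (metis w scaleR_minus1_left scaleR_one)
 }
qed

lemma outer_normal_fct:
 assumes c: "c \<in> C"
 shows "outer_normal T (fct c) = - (ht c *\<^sub>R gr c)" unfolding outer_normal_def
proof (rule some_equality)
 have le: "gr c \<bullet> y \<le> gr c \<bullet> x" if "x \<in> T" "y \<in> fct c" for x y
 proof -
  have "0 \<le> lam c x" "lam c y = 0" using that c mem_fct[OF c] by (auto simp: mem_T)
  then show ?thesis by (simp add: lam_def)
 qed
 show "side_normal (fct c) (- (ht c *\<^sub>R gr c)) \<and> (\<forall>x\<in>T. \<forall>y\<in>fct c. - (ht c *\<^sub>R gr c) \<bullet> x \<le> - (ht c *\<^sub>R gr c) \<bullet> y)"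
  using hyperplane_normals[OF c] ht_pos[OF c] le by auto
 fix n assume n: "side_normal (fct c) n \<and> (\<forall>x\<in>T. \<forall>y\<in>fct c. n \<bullet> x \<le> n \<bullet> y)"
 have "n \<noteq> ht c *\<^sub>R gr c"
 proof
  assume n': "n = ht c *\<^sub>R gr c"
  obtain y where y: "y \<in> fct c" using fct_nonempty by blast
  have "c \<in> T" using c by (simp add: hull_inc)
  then have "ht c * (gr c \<bullet> c) \<le> ht c * (gr c \<bullet> y)" using n n' y by auto
  then have "gr c \<bullet> c \<le> gr c \<bullet> y" using ht_pos[OF c] by simp
  moreover have "lam c y = 0" using y mem_fct[OF c] by simp
  ultimately show False using lam_vertex[OF c c] by (simp add: lam_def)
 qed
 then show "n = - (ht c *\<^sub>R gr c)" using n hyperplane_normals[OF c] by blast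
qed

lemma C1_scalar_affine: "C1_scalar (\<lambda>x. g \<bullet> x + b) (\<lambda>x. g)" unfolding C1_scalar_def gderiv_def
 by (auto intro!: derivative_eq_intros simp: inner_commute)

text \<open>The cone formula for the constant 1. It is also the source of the positivity and
  finiteness of the surface measure of facets.\<close>

lemma area_formula:
 assumes c: "c \<in> C"
 shows "real CARD('n) * measure lebesgue (interior T) = ht c * smeas (fct c)"
proof -
 have "C1_scalar (\<lambda>x::real^'n. 1) (\<lambda>x. 0)" using C1_scalar_affine[of 0 1] by simp
 from cone_formula[OF this c]
 have "(LINT x|leb (interior T). real CARD('n)) = ht c * sint (fct c) (\<lambda>x. 1)" by (simp add: sint_def)
 moreover have "sint (fct c) (\<lambda>x. 1 :: real) = smeas (fct c)" by (simp add: sint_def smeas_def set_lebesgue_integral_def)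
 moreover have "(LINT x|leb (interior T). real CARD('n)) = real CARD('n) * measure lebesgue (interior T)" by (simp add: measure_restrict_space)
 ultimately show ?thesis by simp
qed

lemma smeas_pos: "c \<in> C \<Longrightarrow> smeas (fct c) > 0" using area_formula[of c] measure_interior_T_pos ht_pos[of c]
 by (metis mult_pos_pos of_nat_0_less_iff zero_less_card_finite zero_less_mult_pos)

lemma fct_sets: "fct c \<in> sets (surface_measure H)" by (simp add: compact_imp_closed)

lemma fct_finite: "c \<in> C \<Longrightarrow> emeasure (surface_measure (affine hull (fct c))) (fct c) \<noteq> \<infinity>"
 using smeas_pos[of c] by (auto simp: smeas_def measure_def)

lemma continuous_set_integrable_fct:
 fixes f :: "real^'n \<Rightarrow> real"
 assumes c: "c \<in> C" and f: "continuous_on UNIV f"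
 shows "set_integrable (surface_measure (affine hull (fct c))) (fct c) f"
proof -
 obtain B where B: "\<And>x. x \<in> fct c \<Longrightarrow> \<bar>f x\<bar> \<le> B"
  using compact_imp_bounded[OF compact_continuous_image[OF continuous_on_subset[OF f subset_UNIV] compact_fct[of c]]] by (auto simp: bounded_iff)
 have [measurable]: "f \<in> borel_measurable borel" "fct c \<in> sets borel" using f by (auto intro: borel_measurable_continuous_onI simp: compact_imp_closed)
 show ?thesis unfolding set_integrable_def
 proof (rule Bochner_Integration.integrable_bound)
  show "integrable (surface_measure (affine hull (fct c))) (\<lambda>x. indicator (fct c) x * B :: real)" using fct_finite[OF c] by (simp add: less_top)
  show "(\<lambda>x. indicat_real (fct c) x *\<^sub>R f x) \<in> borel_measurable (surface_measure (affine hull (fct c)))" unfolding surface_measure_def by measurable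
 qed (use B in \<open>auto simp: indicator_def intro!: AE_I2 order_trans[OF _ abs_ge_self]\<close>)
qed

text \<open>The cone formula applied to \<open>lam j\<close> itself, whose gradient term is
  \<open>lam j x - lam j v\<close>. The vertex \<open>v = j\<close>, where the facet integral
  vanishes, yields the volume integral; any other vertex then yields its facet integral.\<close>

lemma integral_lam:
 assumes j: "j \<in> C"
 shows "(real CARD('n) + 1) * (LINT x|leb (interior T). lam j x) = measure lebesgue (interior T)"
  and "v \<in> C \<Longrightarrow> v \<noteq> j \<Longrightarrow> ht v * sint (fct v) (lam j) = measure lebesgue (interior T)"
proof -
 have c1: "C1_scalar (lam j) (\<lambda>x. gr j)" using C1_scalar_affine[of "gr j" "- snd (cf j)"] by (simp add: lam_def[abs_def])
 let ?I = "LINT x|leb (interior T). lam j x"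
 have il: "integrable (leb (interior T)) (lam j)" by (rule integrable_continuous_interior[OF compact_T continuous_lam])
 have ic: "integrable (leb (interior T)) (\<lambda>x. k :: real)" for k by (rule integrable_continuous_interior[OF compact_T]) simp
 have eq: "(real CARD('n) + 1) * ?I - lam j v * measure lebesgue (interior T) = ht v * sint (fct v) (lam j)"
  if v: "v \<in> C" for v
 proof -
  have "(LINT x|leb (interior T). real CARD('n) * lam j x + gr j \<bullet> (x - v))
   = (LINT x|leb (interior T). (real CARD('n) + 1) * lam j x - lam j v)" unfolding lam_diff[symmetric] by (simp only: distrib_right mult_1 add_diff_eq)
  also have "... = (real CARD('n) + 1) * ?I - lam j v * measure lebesgue (interior T)" using il ic[of "lam j v"] by (simp add: measure_restrict_space)
  finally show ?thesis using cone_formula[OF c1 v] by (simp add: sint_def)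
 qed
 have "sint (fct j) (lam j) = sint (fct j) (\<lambda>x. 0)" by (rule sint_cong) (use mem_fct[OF j] in simp)
 then show 1: "(real CARD('n) + 1) * ?I = measure lebesgue (interior T)" using eq[OF j] lam_vertex[OF j j] by (simp add: sint_def)
 show "ht v * sint (fct v) (lam j) = measure lebesgue (interior T)" if "v \<in> C" "v \<noteq> j" using eq[OF that(1)] 1 lam_vertex[OF j that(1)] that by simp
qed

text \<open>On a facet through \<open>j\<close> the mean of \<open>lam j\<close> is
  \<open>1 / d\<close>, so the integrand is the local Crouzeix--Raviart basis function of the facet
  opposite \<open>j\<close>.\<close>

lemma CR_basis_mean:
 assumes "j \<in> C" "v \<in> C" "v \<noteq> j"
 shows "sint (fct v) (\<lambda>x. 1 - real CARD('n) * lam j x) = 0"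
proof -
 let ?M = "surface_measure (affine hull (fct v))"
 have s1: "set_integrable ?M (fct v) (\<lambda>x. 1 :: real)" by (rule continuous_set_integrable_fct[OF assms(2)]) simp
 have s2: "set_integrable ?M (fct v) (\<lambda>x. real CARD('n) * lam j x)" by (rule continuous_set_integrable_fct[OF assms(2)]) (intro continuous_intros)
 have one: "sint (fct v) (\<lambda>x. 1 :: real) = smeas (fct v)" by (simp add: sint_def smeas_def set_lebesgue_integral_def)
 have "sint (fct v) (\<lambda>x. 1 - real CARD('n) * lam j x) = smeas (fct v) - real CARD('n) * sint (fct v) (lam j)"
  unfolding sint_def using set_integral_diff(2)[OF s1 s2] one by (simp add: sint_def)
 then have "ht v * sint (fct v) (\<lambda>x. 1 - real CARD('n) * lam j x)
   = ht v * smeas (fct v) - real CARD('n) * (ht v * sint (fct v) (lam j))"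
  unfolding \<open>sint (fct v) (\<lambda>x. 1 - real CARD('n) * lam j x) = _\<close> by (simp add: right_diff_distrib)
 also have "... = 0" by (simp only: integral_lam(2)[OF assms] area_formula[OF assms(2), symmetric] diff_self)
 finally show ?thesis using ht_pos[OF assms(2)] by simp
qed

text \<open>Written in the basis \<open>x - j\<close>, the divergence theorem for \<open>r\<close>
  is a weighted sum of cone formulas, one per vertex; each basis field has divergence
  \<open>d\<close>.\<close>

lemma simplex_integration_by_parts:
 assumes A: "linear A" and r: "\<And>x. r x = A x + b"
  and flux: "\<And>j x. j \<in> C \<Longrightarrow> x \<in> fct j \<Longrightarrow> r x \<bullet> outer_normal T (fct j) = \<kappa> j"
  and c1: "C1_scalar \<phi> \<gamma>"
 shows "(LINT x|leb (interior T). r x \<bullet> \<gamma> x + trace (matrix A) * \<phi> x) = (\<Sum>j\<in>C. \<kappa> j * sint (fct j) \<phi>)"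
proof -
 define \<beta> where "\<beta> j = \<kappa> j / ht j" for j
 have gr: "gr j \<bullet> r x = - \<beta> j" if j: "j \<in> C" "x \<in> fct j" for j x
  using flux[OF j] ht_pos[OF j(1)] by (simp add: outer_normal_fct[OF j(1)] \<beta>_def inner_commute field_simps)
 have dec: "r x = (\<Sum>j\<in>C. \<beta> j *\<^sub>R (x - j))" for x by (rule RT_decomposition[OF A r gr])
 have Ax: "A x = sum \<beta> C *\<^sub>R x" for x
 proof -
  have "A x = r x - r 0" using r linear_0[OF A] by simp
  also have "... = (\<Sum>j\<in>C. \<beta> j *\<^sub>R (x - j) - \<beta> j *\<^sub>R (0 - j))" unfolding dec by (simp only: sum_subtractf)
  also have "... = (\<Sum>j\<in>C. \<beta> j *\<^sub>R x)" by (simp add: algebra_simps)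
  finally show ?thesis by (simp add: scaleR_left.sum)
 qed
 have tr: "trace (matrix A) = real CARD('n) * sum \<beta> C" by (simp add: trace_def matrix_def Ax axis_def)
 have cont: "continuous_on UNIV \<phi>" "continuous_on UNIV \<gamma>" using C1_scalar_continuous[OF c1] c1 by (auto simp: C1_scalar_def)
 have int: "integrable (leb (interior T)) (\<lambda>x. real CARD('n) * \<phi> x + \<gamma> x \<bullet> (x - j))" for j
  by (rule integrable_continuous_interior[OF compact_T])
    (intro continuous_intros continuous_on_subset[OF cont(1)] continuous_on_subset[OF cont(2)]; simp)
 have "(LINT x|leb (interior T). r x \<bullet> \<gamma> x + trace (matrix A) * \<phi> x)
  = (LINT x|leb (interior T). (\<Sum>j\<in>C. \<beta> j * (real CARD('n) * \<phi> x + \<gamma> x \<bullet> (x - j))))"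
 proof (rule Bochner_Integration.integral_cong[OF refl])
  fix x
  have r\<gamma>: "r x \<bullet> \<gamma> x = (\<Sum>j\<in>C. \<beta> j * (\<gamma> x \<bullet> (x - j)))" unfolding inner_commute[of "r x"] unfolding dec by (simp only: inner_sum_right inner_scaleR_right)
  show "r x \<bullet> \<gamma> x + trace (matrix A) * \<phi> x = (\<Sum>j\<in>C. \<beta> j * (real CARD('n) * \<phi> x + \<gamma> x \<bullet> (x - j)))"
  proof -
   have "trace (matrix A) * \<phi> x = (\<Sum>j\<in>C. \<beta> j * (real CARD('n) * \<phi> x))" by (simp add: tr sum_distrib_right[symmetric] mult_ac)
   then show ?thesis using r\<gamma> by (simp only: distrib_left sum.distrib add.commute)
  qed
 qed
 also have "... = (\<Sum>j\<in>C. \<beta> j * (LINT x|leb (interior T). real CARD('n) * \<phi> x + \<gamma> x \<bullet> (x - j)))"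
  using int by (subst Bochner_Integration.integral_sum) (auto simp del: Bochner_Integration.integral_add)
 also have "... = (\<Sum>j\<in>C. \<kappa> j * sint (fct j) \<phi>)"
 proof (rule sum.cong[OF refl])
  fix j assume j: "j \<in> C"
  show "\<beta> j * (LINT x|leb (interior T). real CARD('n) * \<phi> x + \<gamma> x \<bullet> (x - j)) = \<kappa> j * sint (fct j) \<phi>"
   using cone_formula[OF c1 j] ht_pos[OF j] by (simp add: \<beta>_def sint_def)
 qed
 finally show ?thesis .
qed

end

section \<open>Uniqueness of weak derivatives\<close>

lemma GDERIV_compose_real:
 assumes "GDERIV f x :> Z" "(h has_real_derivative h') (at (f x))"
 shows "GDERIV (\<lambda>x. h (f x)) x :> h' *\<^sub>R Z" using GDERIV_DERIV_compose[OF assms] .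

lemma has_real_derivative_max0_sq: "((\<lambda>t. (max 0 t)^2) has_real_derivative 2 * max 0 x) (at x)"
proof -
 consider "x > 0" | "x < 0" | "x = 0" by linarith
 then show ?thesis
 proof cases
  case 1
  have "((\<lambda>t. t^2) has_real_derivative 2 * x) (at x)" by (auto intro!: derivative_eq_intros)
  then have "((\<lambda>t. (max 0 t)^2) has_real_derivative 2 * x) (at x)"
   by (rule has_field_derivative_transform_within[where d = x]) (use 1 in \<open>auto simp: dist_real_def\<close>)
  then show ?thesis using 1 by simp
 next
  case 2
  have "((\<lambda>t. 0) has_real_derivative 0) (at x)" by simp
  then have "((\<lambda>t. (max 0 t)^2) has_real_derivative 0) (at x)"
   by (rule has_field_derivative_transform_within[where d = "- x"]) (use 2 in \<open>auto simp: dist_real_def\<close>)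
  then show ?thesis using 2 by simp
 next
  case 3
  have "(\<lambda>t. ((max 0 (0 + t))^2 - (max 0 0)^2) / t) \<midarrow>0\<rightarrow> (0::real)"
  proof (rule Lim_null_comparison)
   show "\<forall>\<^sub>F t in at 0. norm (((max 0 (0 + t))^2 - (max 0 0)^2) / t) \<le> \<bar>t\<bar>" by (auto simp: max_def power2_eq_square intro!: always_eventually)
   show "(\<lambda>t. \<bar>t\<bar>) \<midarrow>0\<rightarrow> (0::real)" by (simp add: tendsto_rabs_zero_iff)
  qed
  then show ?thesis using 3 by (simp add: DERIV_def)
 qed
qed

text \<open>Squaring the positive part makes the function C1, which is the regularity that
  \<open>test_fun\<close> asks for.\<close>

definition ball_bump :: "real^'n \<Rightarrow> real \<Rightarrow> real^'n \<Rightarrow> real" where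
 "ball_bump c r x = (max 0 (r^2 - (x - c) \<bullet> (x - c)))^2"

definition ball_bump_grad :: "real^'n \<Rightarrow> real \<Rightarrow> real^'n \<Rightarrow> real^'n" where
 "ball_bump_grad c r x = (2 * max 0 (r^2 - (x - c) \<bullet> (x - c))) *\<^sub>R ((- 2) *\<^sub>R (x - c))"

lemma GDERIV_ball_bump: "GDERIV (ball_bump c r) x :> ball_bump_grad c r x"
proof -
 have "GDERIV (\<lambda>x. r^2 - (x - c) \<bullet> (x - c)) x :> (- 2) *\<^sub>R (x - c)" unfolding gderiv_def by (auto intro!: derivative_eq_intros simp: inner_commute)
 from GDERIV_compose_real[OF this has_real_derivative_max0_sq] show ?thesis unfolding ball_bump_def[abs_def] ball_bump_grad_def .
qed

lemma continuous_ball_bump_grad: "continuous_on UNIV (ball_bump_grad c r)" unfolding ball_bump_grad_def[abs_def] by (intro continuous_intros)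

lemma ball_bump_pos_iff: "r > 0 \<Longrightarrow> ball_bump c r x > 0 \<longleftrightarrow> x \<in> ball c r"
proof -
 assume r: "r > 0"
 have "ball_bump c r x > 0 \<longleftrightarrow> (norm (x - c))^2 < r^2" by (auto simp: ball_bump_def power2_norm_eq_inner max_def zero_less_power2)
 also have "... \<longleftrightarrow> norm (x - c) < r" using r by (meson less_imp_le norm_ge_zero pos2 power2_less_imp_less power_strict_mono)
 finally show ?thesis by (simp add: dist_norm norm_minus_commute)
qed

lemma ball_bump_nonneg: "0 \<le> ball_bump c r x" by (simp add: ball_bump_def)

text \<open>Sums of bumps over countably many balls that exhaust \<open>U\<close> are positive
  exactly on the part of \<open>U\<close> covered so far. Taking balls whose closures lie in
  \<open>U\<close> keeps the supports compact in \<open>D\<close>.\<close>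

lemma test_fun_approximates_open:
 fixes U :: "(real^'n) set"
 assumes U: "open U" "U \<subseteq> D"
 obtains \<phi> \<gamma> where "\<And>k::nat. test_fun D (\<phi> k) (\<gamma> k)" "\<And>k x. 0 \<le> \<phi> k x \<and> \<phi> k x \<le> 1"
  "\<And>x. (\<lambda>k. \<phi> k x) \<longlonglongrightarrow> indicator U x"
proof -
 define F where "F = {B. \<exists>c r. r > 0 \<and> cball c r \<subseteq> U \<and> B = ball (c::real^'n) r}"
 have FU: "\<Union>F = U"
 proof
  show "\<Union>F \<subseteq> U" unfolding F_def using ball_subset_cball by blast
  show "U \<subseteq> \<Union>F"
  proof
   fix x assume "x \<in> U"
   then obtain r where "r > 0" "cball x r \<subseteq> U" using U(1) open_contains_cball by blast
   then show "x \<in> \<Union>F" unfolding F_def by (auto intro!: exI[of _ "ball x r"])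
  qed
 qed
 obtain F' where F': "F' \<subseteq> F" "countable F'" "\<Union>F' = \<Union>F" using Lindelof[of F] unfolding F_def by auto
 have "\<exists>c r. r > 0 \<and> cball c r \<subseteq> U \<and> from_nat_into F' i = ball c r" if "F' \<noteq> {}" for i
  using from_nat_into[OF that, of i] F'(1) unfolding F_def by blast
 then obtain c r where cr: "\<And>i. F' \<noteq> {} \<Longrightarrow> r i > 0 \<and> cball (c i) (r i) \<subseteq> U \<and> from_nat_into F' i = ball (c i) (r i)"
  by metis
 \<comment> \<open>An empty \<open>F'\<close> means that \<open>U\<close> is empty;
   \<open>from_nat_into\<close> enumerates nothing in that case.\<close>
 define s where "s k x = (if F' = {} then 0 else \<Sum>i<k. ball_bump (c i) (r i) x)" for k x
 define s' where "s' k x = (if F' = {} then 0 else \<Sum>i<k. ball_bump_grad (c i) (r i) x)" for k x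
 have s0: "0 \<le> s k x" for k x unfolding s_def by (simp add: sum_nonneg ball_bump_nonneg)
 have sG: "GDERIV (s k) x :> s' k x" for k x
 proof (cases "F' = {}")
  case True then show ?thesis by (simp add: s_def[abs_def] s'_def GDERIV_const)
 next
  case False
  have "GDERIV (\<lambda>x. \<Sum>i<k. ball_bump (c i) (r i) x) x :> (\<Sum>i<k. ball_bump_grad (c i) (r i) x)"
  proof (induction k)
   case 0 then show ?case by (simp add: GDERIV_const)
  next
   case (Suc k) then show ?case using GDERIV_add[OF Suc GDERIV_ball_bump] by simp
  qed
  then show ?thesis using False by (simp add: s_def[abs_def] s'_def)
 qed
 have s'c: "continuous_on UNIV (s' k)" for k unfolding s'_def[abs_def] by (cases "F' = {}") (auto intro!: continuous_intros continuous_ball_bump_grad)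
 have sc: "continuous_on UNIV (s k)" for k using sG unfolding gderiv_def by (meson has_derivative_continuous continuous_at_imp_continuous_on)
 \<comment> \<open>Zero where \<open>s k\<close> is zero, below 1 everywhere, and tending to 1 where
   \<open>s k x\<close> is eventually bounded below, since the factor \<open>k\<close> drives the
   denominator to infinity.\<close>
 define \<phi> where "\<phi> k x = 1 - inverse (1 + real k * s k x)" for k x
 define \<gamma> where "\<gamma> k x = (real k * inverse ((1 + real k * s k x)^2)) *\<^sub>R s' k x" for k x
 have pos: "0 < 1 + real k * s k x" for k x using s0[of k x] by (simp add: add_pos_nonneg)
 show ?thesis
 proof (rule that)
  fix k x
  show "0 \<le> \<phi> k x \<and> \<phi> k x \<le> 1" unfolding \<phi>_def using pos[of k x] s0[of k x] by (auto simp: inverse_eq_divide)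
 next
  fix k
  show "test_fun D (\<phi> k) (\<gamma> k)" unfolding test_fun_def
  proof (intro conjI allI)
   fix x
   have "((\<lambda>t. 1 - inverse (1 + real k * t)) has_real_derivative (real k * inverse ((1 + real k * s k x)^2))) (at (s k x))"
    using pos[of k x] by (auto intro!: derivative_eq_intros simp: power2_eq_square)
   from GDERIV_compose_real[OF sG this] show "GDERIV (\<phi> k) x :> \<gamma> k x" unfolding \<phi>_def[abs_def] \<gamma>_def .
   show "continuous_on UNIV (\<gamma> k)"
    unfolding \<gamma>_def[abs_def] by (intro continuous_intros sc s'c) (use pos in \<open>auto simp: less_imp_neq[symmetric]\<close>)
   show "\<exists>K. compact K \<and> K \<subseteq> D \<and> (\<forall>x. x \<notin> K \<longrightarrow> \<phi> k x = 0)"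
   proof (cases "F' = {}")
    case True
    then show ?thesis by (intro exI[of _ "{}"]) (auto simp: \<phi>_def s_def)
   next
    case False
    let ?K = "\<Union>i<k. cball (c i) (r i)"
    have "compact ?K" by (intro compact_UN) auto
    moreover have "?K \<subseteq> D" using cr[OF False] U(2) by blast
    moreover have "\<phi> k x = 0" if "x \<notin> ?K" for x
    proof -
     have "ball_bump (c i) (r i) x = 0" if "i < k" for i
     proof -
      have "x \<notin> ball (c i) (r i)" using \<open>x \<notin> ?K\<close> that ball_subset_cball by blast
      then show ?thesis using ball_bump_pos_iff[of "r i" "c i" x] cr[OF False, of i] ball_bump_nonneg[of "c i" "r i" x] by (metis less_eq_real_def)
     qed
     then show ?thesis by (simp add: \<phi>_def s_def)
    qed
    ultimately show ?thesis by blast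
   qed
  qed
 next
  fix x
  show "(\<lambda>k. \<phi> k x) \<longlonglongrightarrow> indicator U x"
  proof (cases "x \<in> U")
   case False
   have "s k x = 0" for k
   proof (cases "F' = {}")
    case F: False
    have "ball_bump (c i) (r i) x = 0" for i
    proof -
     have "x \<notin> ball (c i) (r i)" using False cr[OF F, of i] ball_subset_cball by blast
     then show ?thesis using ball_bump_pos_iff[of "r i" "c i" x] cr[OF F, of i] ball_bump_nonneg[of "c i" "r i" x] by (metis less_eq_real_def)
    qed
    then show ?thesis by (simp add: s_def)
   qed (simp add: s_def)
   then show ?thesis using False by (simp add: \<phi>_def)
  next
   case True
   then have F: "F' \<noteq> {}" using F' FU by auto
   obtain B where "B \<in> F'" "x \<in> B" using True F' FU by blast
   then obtain i where "x \<in> from_nat_into F' i" using from_nat_into_surj[OF F'(2)] by metis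
   then have x: "x \<in> ball (c i) (r i)" using cr[OF F, of i] by simp
   define \<delta> where "\<delta> = ball_bump (c i) (r i) x"
   have d: "\<delta> > 0" unfolding \<delta>_def using x cr[OF F, of i] ball_bump_pos_iff by blast
   have lower: "\<delta> \<le> s k x" if "k \<ge> Suc i" for k
   proof -
    have "ball_bump (c i) (r i) x \<le> (\<Sum>i<k. ball_bump (c i) (r i) x)" by (rule member_le_sum) (use that in \<open>auto simp: ball_bump_nonneg\<close>)
    then show ?thesis using F by (simp add: s_def \<delta>_def)
   qed
   have "(\<lambda>k. inverse (1 + real k * s k x)) \<longlonglongrightarrow> 0"
   proof (rule Lim_null_comparison)
    show "\<forall>\<^sub>F k in sequentially. norm (inverse (1 + real k * s k x)) \<le> inverse \<delta> * inverse (real k)" using eventually_ge_at_top[of "Suc i"]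
    proof eventually_elim
     case (elim k)
     have "real k * \<delta> \<le> 1 + real k * s k x" using lower[OF elim] by (simp add: add_increasing mult_left_mono)
     moreover have "0 < real k * \<delta>" using elim d by simp
     ultimately have "inverse (1 + real k * s k x) \<le> inverse (real k * \<delta>)" by (rule le_imp_inverse_le)
     then show ?case using pos[of k x] by (simp add: mult.commute)
    qed
    show "(\<lambda>k. inverse \<delta> * inverse (real k)) \<longlonglongrightarrow> 0" by (rule tendsto_mult_right_zero[OF lim_inverse_n])
   qed
   from tendsto_diff[OF tendsto_const[of 1] this] show ?thesis using True by (simp add: \<phi>_def)
  qed
 qed
qed

lemma test_fun_continuous: "test_fun D \<phi> \<gamma> \<Longrightarrow> continuous_on UNIV \<phi>"
 unfolding test_fun_def gderiv_def by (meson has_derivative_continuous continuous_at_imp_continuous_on)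

text \<open>The complement of the compact \<open>K\<close> is open and \<open>\<phi>\<close>
  vanishes on it, hence so does the gradient.\<close>

lemma test_fun_zero_outside:
 assumes "test_fun D \<phi> \<gamma>"
 obtains K where "compact K" "K \<subseteq> D" "\<And>x. x \<notin> K \<Longrightarrow> \<phi> x = 0" "\<And>x. x \<notin> K \<Longrightarrow> \<gamma> x = 0"
proof -
 obtain K where K: "compact K" "K \<subseteq> D" "\<And>x. x \<notin> K \<Longrightarrow> \<phi> x = 0" using assms unfolding test_fun_def by blast
 have "\<gamma> x = 0" if x: "x \<notin> K" for x
 proof -
  have d: "(\<phi> has_derivative (\<lambda>h. h \<bullet> \<gamma> x)) (at x)" using assms by (simp add: test_fun_def gderiv_def)
  have "((\<lambda>x. 0) has_derivative (\<lambda>h. h \<bullet> \<gamma> x)) (at x)" by (rule has_derivative_transform_within_open[OF d, of "- K"])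
     (use K x compact_imp_closed[OF K(1)] in auto)
  from has_derivative_unique[OF this has_derivative_const] have "\<gamma> x \<bullet> \<gamma> x = 0" by metis
  then show ?thesis by simp
 qed
 with K show ?thesis using that by blast
qed

lemma test_fun_L2:
 fixes D :: "(real^'n) set"
 assumes D: "D \<in> sets lebesgue" and t: "test_fun D \<phi> \<gamma>"
 shows "\<phi> \<in> L2_space D" "\<gamma> \<in> L2_space D"
proof -
 obtain K where K: "compact K" "K \<subseteq> D" "\<And>x. x \<notin> K \<Longrightarrow> \<phi> x = 0" "\<And>x. x \<notin> K \<Longrightarrow> \<gamma> x = 0"
  using test_fun_zero_outside[OF t] by blast
 have main: "f \<in> L2_space D" if c: "continuous_on UNIV f" and z: "\<And>x. x \<notin> K \<Longrightarrow> f x = 0"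
  for f :: "real^'n \<Rightarrow> 'b::euclidean_space"
 proof -
  have fm: "f \<in> borel_measurable lebesgue" using c by (simp add: borel_measurable_continuous_onI measurable_completion)
  have "integrable lborel (\<lambda>x. indicator K x *\<^sub>R (norm (f x))^2)"
  proof -
   have "continuous_on K (\<lambda>x. (norm (f x))^2)" by (intro continuous_intros continuous_on_subset[OF c subset_UNIV])
   from borel_integrable_compact[OF K(1) this] show ?thesis by (simp only: indicator_scaleR_eq_if)
  qed
  also have "(\<lambda>x. indicator K x *\<^sub>R (norm (f x))^2) = (\<lambda>x. (norm (f x))^2)" using z by (auto simp: indicator_def fun_eq_iff)
  finally have "integrable lebesgue (\<lambda>x. (norm (f x))^2)"
   using c by (subst integrable_completion) (auto intro!: borel_measurable_continuous_onI continuous_intros)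
  then have i: "integrable lebesgue (\<lambda>x. (norm (f x))^2)" .
  show ?thesis unfolding L2_space_def
  proof (intro CollectI conjI)
   show "f \<in> borel_measurable (leb D)" by (rule measurable_restrict_space1[OF fm])
   show "integrable (leb D) (\<lambda>x. (norm (f x))^2)" using integrable_mult_indicator[OF D i] D by (simp add: integrable_restrict_space)
  qed
 qed
 show "\<phi> \<in> L2_space D" by (rule main[OF test_fun_continuous[OF t] K(3)])
 show "\<gamma> \<in> L2_space D" by (rule main[OF _ K(4)]) (use t in \<open>simp add: test_fun_def\<close>)
qed


lemma L2_scaleR_integrable:
 fixes f :: "real^'n \<Rightarrow> 'b::euclidean_space"
 assumes "\<phi> \<in> L2_space D" "f \<in> L2_space D"
 shows "integrable (leb D) (\<lambda>x. \<phi> x *\<^sub>R f x)"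
proof (rule Bochner_Integration.integrable_bound)
 show "integrable (leb D) (\<lambda>x. (norm (\<phi> x))^2 + (norm (f x))^2)" using assms by (simp add: L2_space_def)
 show "(\<lambda>x. \<phi> x *\<^sub>R f x) \<in> borel_measurable (leb D)" using L2_measurable[OF assms(1)] L2_measurable[OF assms(2)] by measurable
 have "\<bar>\<phi> x\<bar> * norm (f x) \<le> (norm (\<phi> x))^2 + (norm (f x))^2" for x
  using sum_squares_bound[of "\<bar>\<phi> x\<bar>" "norm (f x)"] mult_nonneg_nonneg[OF abs_ge_zero[of "\<phi> x"] norm_ge_zero[of "f x"]]
  unfolding mult.assoc real_norm_def by linarith
 then show "AE x in leb D. norm (\<phi> x *\<^sub>R f x) \<le> norm ((norm (\<phi> x))^2 + (norm (f x))^2)" by (auto intro!: AE_I2)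
qed

text \<open>Open sets are stable under intersection and generate the Borel sets, so the integral of
  \<open>g\<close> over every Borel set is 0; uniqueness of densities concludes.\<close>

lemma AE_zero_if_zero_on_open:
 fixes g :: "real^'n \<Rightarrow> real"
 assumes g: "integrable lborel g" and zero: "\<And>U. open U \<Longrightarrow> (LINT x:U|lborel. g x) = 0"
 shows "AE x in lborel. g x = 0"
proof -
 have all: "(LINT x:A|lborel. g x) = 0" if "A \<in> sets lborel" for A
 proof -
  have A: "A \<in> sigma_sets UNIV (Collect open)" using that by (simp add: borel_def)
  have si: "set_integrable lborel A g" if "A \<in> sets borel" for A unfolding set_integrable_def using integrable_mult_indicator[of A lborel g] that g by simp
  have "Int_stable (Collect (open :: (real^'n) set \<Rightarrow> bool))" by (auto simp: Int_stable_def)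
  moreover have "Collect (open :: (real^'n) set \<Rightarrow> bool) \<subseteq> Pow UNIV" by simp
  ultimately show ?thesis using A
  proof (induction rule: sigma_sets_induct_disjoint)
   case (basic A) then show ?case using zero by simp
  next
   case empty then show ?case by (simp add: set_lebesgue_integral_def)
  next
   case (compl A)
   then have A: "A \<in> sets borel" by (simp add: borel_def)
   have "(LINT x:UNIV - A|lborel. g x) = (LINT x:UNIV|lborel. g x) - (LINT x:A|lborel. g x)" using set_integral_Un[of A "UNIV - A" lborel g, OF _ si[OF A] si] A by simp
   then show ?case using compl zero by simp
  next
   case (union A)
   then have A: "A i \<in> sets borel" for i by (auto simp: borel_def)
   have "(LINT x:(\<Union>i. A i)|lborel. g x) = (\<Sum>i. (LINT x:(A i)|lborel. g x))"
    using A union(1) by (intro lebesgue_integral_countable_add si) (auto simp: disjoint_family_on_def)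
   then show ?case using union by simp
  qed
 qed
 show ?thesis by (rule density_unique_real[of lborel g "\<lambda>x. 0"]) (use g all in \<open>simp_all add: set_lebesgue_integral_def\<close>)
qed

text \<open>Dominated convergence along cut-off functions of an open \<open>U\<close> turns the
  hypothesis into vanishing integrals over open sets.\<close>

lemma fundamental_lemma:
 fixes g :: "real^'n \<Rightarrow> real"
 assumes D: "open D" "bounded D" and g: "g \<in> L2_space D"
  and zero: "\<And>\<phi> \<gamma>. test_fun D \<phi> \<gamma> \<Longrightarrow> (LINT x|leb D. \<phi> x * g x) = 0"
 shows "AE x in leb D. g x = 0"
proof -
 have lm: "D \<in> lmeasurable" using D by (simp add: lmeasurable_open)
 then have Ds: "D \<in> sets lebesgue" by (rule fmeasurableD)
 have gi: "integrable (leb D) g" by (rule L2_integrable[OF lm g])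
 have U0: "(LINT x|leb D. indicator U x * g x) = 0" if U: "open U" "U \<subseteq> D" for U
 proof -
  obtain \<phi> \<gamma> where t: "\<And>k::nat. test_fun D (\<phi> k) (\<gamma> k)" and b: "\<And>k x. 0 \<le> \<phi> k x \<and> \<phi> k x \<le> 1"
   and l: "\<And>x. (\<lambda>k. \<phi> k x) \<longlonglongrightarrow> indicator U x" using test_fun_approximates_open[OF U] by blast
  have "(\<lambda>k. LINT x|leb D. \<phi> k x * g x) \<longlonglongrightarrow> (LINT x|leb D. indicator U x * g x)"
  proof (rule integral_dominated_convergence[where w = "\<lambda>x. norm (g x)"])
   show "(\<lambda>x. indicator U x * g x) \<in> borel_measurable (leb D)"
   proof -
    have "indicator U \<in> borel_measurable (leb D)" by (rule measurable_restrict_space1) (use U in \<open>auto intro!: borel_measurable_indicator\<close>)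
    then show ?thesis using L2_measurable[OF g] by measurable
   qed
   show "(\<lambda>x. \<phi> k x * g x) \<in> borel_measurable (leb D)" for k using L2_measurable[OF g] L2_measurable[OF test_fun_L2(1)[OF Ds t[of k]]] by measurable
   show "AE x in leb D. (\<lambda>k. \<phi> k x * g x) \<longlonglongrightarrow> indicator U x * g x" by (intro AE_I2 tendsto_intros l)
   show "AE x in leb D. norm (\<phi> k x * g x) \<le> norm (g x)" for k using b by (auto intro!: AE_I2 simp: abs_mult mult_left_le_one_le)
  qed (use gi in simp)
  then have "(\<lambda>k::nat. 0) \<longlonglongrightarrow> (LINT x|leb D. indicator U x * g x)" unfolding zero[OF t] .
  from LIMSEQ_unique[OF tendsto_const this] show ?thesis by simp
 qed
 let ?g = "\<lambda>x. indicator D x * g x"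
 have g0: "integrable lebesgue ?g" using gi Ds by (simp add: integrable_restrict_space)
 then have "?g \<in> borel_measurable lebesgue" by (rule borel_measurable_integrable)
 \<comment> \<open>Extended by zero and replaced by a Borel function that agrees almost everywhere,
   since the argument with open sets works in \<open>lborel\<close>.\<close>
 from completion_ex_borel_measurable_real[OF this]
 obtain g' where g': "g' \<in> borel_measurable lborel" "AE x in lborel. ?g x = g' x" by blast
 have ae: "AE x in lebesgue. ?g x = g' x" using g'(2) by (rule AE_completion)
 have g'l: "g' \<in> borel_measurable lebesgue" using g'(1) by (rule measurable_completion)
 have "integrable lebesgue g'" using integrable_cong_AE[OF _ g'l ae] g0 by (simp add: borel_measurable_integrable)
 then have g'i: "integrable lborel g'" using integrable_completion[OF g'(1)] by simp
 have "AE x in lborel. g' x = 0"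
 proof (rule AE_zero_if_zero_on_open[OF g'i])
  fix U :: "(real^'n) set" assume U: "open U"
  have "(LINT x:U|lborel. g' x) = (LINT x|lebesgue. indicator U x * g' x)" unfolding set_lebesgue_integral_def using g'(1) U by (subst integral_completion) auto
  also have "... = (LINT x|lebesgue. indicator U x * ?g x)"
  proof (rule integral_cong_AE)
   show "(\<lambda>x. indicator U x * g' x) \<in> borel_measurable lebesgue" "(\<lambda>x. indicator U x * ?g x) \<in> borel_measurable lebesgue"
    using g'l borel_measurable_integrable[OF g0] U by (auto intro!: borel_measurable_times borel_measurable_indicator simp: mult.assoc)
   show "AE x in lebesgue. indicator U x * g' x = indicator U x * ?g x" using ae by eventually_elim simp
  qed
  also have "... = (LINT x|lebesgue. indicator D x *\<^sub>R (indicator (U \<inter> D) x * g x))"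
   by (rule Bochner_Integration.integral_cong) (auto simp: indicator_def)
  also have "... = (LINT x|leb D. indicator (U \<inter> D) x * g x)" using Ds by (simp add: integral_restrict_space)
  also have "... = 0" by (rule U0) (use U D in auto)
  finally show "(LINT x:U|lborel. g' x) = 0" .
 qed
 then have "AE x in lebesgue. g' x = 0" by (rule AE_completion)
 with ae have "AE x in lebesgue. ?g x = 0" by eventually_elim simp
 then have "AE x in lebesgue. x \<in> D \<longrightarrow> g x = 0" by eventually_elim (auto simp: indicator_def)
 then show ?thesis using Ds by (simp add: AE_restrict_space_iff)
qed

lemma fundamental_lemma_eq:
 fixes g h :: "real^'n \<Rightarrow> real"
 assumes D: "open D" "bounded D" and g: "g \<in> L2_space D" "h \<in> L2_space D"
  and eq: "\<And>\<phi> \<gamma>. test_fun D \<phi> \<gamma> \<Longrightarrow> (LINT x|leb D. \<phi> x * g x) = (LINT x|leb D. \<phi> x * h x)"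
 shows "AE x in leb D. g x = h x"
proof -
 have Ds: "D \<in> sets lebesgue" using D by simp
 have "AE x in leb D. g x - h x = 0"
 proof (rule fundamental_lemma[OF D L2_diff[OF g]])
  fix \<phi> \<gamma> assume t: "test_fun D \<phi> \<gamma>"
  have "integrable (leb D) (\<lambda>x. \<phi> x * g x)" "integrable (leb D) (\<lambda>x. \<phi> x * h x)"
   using L2_scaleR_integrable[OF test_fun_L2(1)[OF Ds t] g(1)] L2_scaleR_integrable[OF test_fun_L2(1)[OF Ds t] g(2)] by simp_all
  then show "(LINT x|leb D. \<phi> x * (g x - h x)) = 0" using eq[OF t] by (simp add: right_diff_distrib)
 qed
 then show ?thesis by eventually_elim simp
qed

lemma integral_vec_component:
 fixes f :: "'a \<Rightarrow> 'b::euclidean_space^'m"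
 assumes "integrable M f" shows "(LINT x|M. f x) $ i = (LINT x|M. f x $ i)" by (rule integral_bounded_linear[OF bounded_linear_vec_nth assms, symmetric])

lemma weak_grad_unique:
 assumes D: "open D" "bounded D" and G: "is_weak_grad D v G" "is_weak_grad D v G'"
 shows "AE x in leb D. G x = G' x"
proof -
 have Ds: "D \<in> sets lebesgue" using D by simp
 have L: "(\<lambda>x. G x $ i) \<in> L2_space D" "(\<lambda>x. G' x $ i) \<in> L2_space D" for i using G by (auto simp: is_weak_grad_def intro: L2_component)
 have "AE x in leb D. G x $ i $ j = G' x $ i $ j" for i j
 proof (rule fundamental_lemma_eq[OF D L2_component[OF L(1)] L2_component[OF L(2)]])
  fix \<phi> \<gamma> assume t: "test_fun D \<phi> \<gamma>"
  have "(LINT x|leb D. \<phi> x *\<^sub>R (G x $ i)) $ j = (LINT x|leb D. \<phi> x *\<^sub>R (G' x $ i)) $ j"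
   using G[unfolded is_weak_grad_def, THEN conjunct2, rule_format, OF t, of i] by simp
  then show "(LINT x|leb D. \<phi> x * (G x $ i $ j)) = (LINT x|leb D. \<phi> x * (G' x $ i $ j))"
   using integral_vec_component[OF L2_scaleR_integrable[OF test_fun_L2(1)[OF Ds t] L(1)[of i]], of j]
    integral_vec_component[OF L2_scaleR_integrable[OF test_fun_L2(1)[OF Ds t] L(2)[of i]], of j] by simp
 qed
 then have "AE x in leb D. \<forall>i j. G x $ i $ j = G' x $ i $ j" by (simp add: AE_all_countable)
 then show ?thesis by eventually_elim (simp add: vec_eq_iff)
qed

lemma weak_div_unique:
 assumes D: "open D" "bounded D" and G: "is_weak_div D v G" "is_weak_div D v G'"
 shows "AE x in leb D. G x = G' x"
proof -
 have L: "(\<lambda>x. G x $ i) \<in> L2_space D" "(\<lambda>x. G' x $ i) \<in> L2_space D" for i using G by (auto simp: is_weak_div_def intro: L2_component)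
 have "AE x in leb D. G x $ i = G' x $ i" for i
 proof (rule fundamental_lemma_eq[OF D L])
  fix \<phi> \<gamma> assume t: "test_fun D \<phi> \<gamma>"
  show "(LINT x|leb D. \<phi> x * (G x $ i)) = (LINT x|leb D. \<phi> x * (G' x $ i))" using G[unfolded is_weak_div_def, THEN conjunct2, rule_format, OF t, of i] by simp
 qed
 then have "AE x in leb D. \<forall>i. G x $ i = G' x $ i" by (simp add: AE_all_countable)
 then show ?thesis by eventually_elim (simp add: vec_eq_iff)
qed

section \<open>Linearity of weak derivatives\<close>

lemma is_weak_grad_lincomb:
 assumes D: "D \<in> sets lebesgue" and v: "v \<in> L2_space D" "w \<in> L2_space D"
  and G: "is_weak_grad D v G" "is_weak_grad D w H"
 shows "is_weak_grad D (\<lambda>x. a *\<^sub>R v x + b *\<^sub>R w x) (\<lambda>x. a *\<^sub>R G x + b *\<^sub>R H x)" unfolding is_weak_grad_def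
proof (intro conjI allI impI)
 have L: "G \<in> L2_space D" "H \<in> L2_space D" using G by (auto simp: is_weak_grad_def)
 show "(\<lambda>x. a *\<^sub>R G x + b *\<^sub>R H x) \<in> L2_space D" using L by (intro L2_add L2_scaleR)
 fix \<phi> \<gamma> i assume t: "test_fun D \<phi> \<gamma>"
 note tL = test_fun_L2[OF D t]
 have i1: "integrable (leb D) (\<lambda>x. (v x $ i) *\<^sub>R \<gamma> x)" "integrable (leb D) (\<lambda>x. (w x $ i) *\<^sub>R \<gamma> x)"
  by (rule L2_scaleR_integrable[OF L2_component tL(2)], rule v)+
 have i2: "integrable (leb D) (\<lambda>x. \<phi> x *\<^sub>R (G x $ i))" "integrable (leb D) (\<lambda>x. \<phi> x *\<^sub>R (H x $ i))"
  by (rule L2_scaleR_integrable[OF tL(1) L2_component], rule L)+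
 have "(LINT x|leb D. ((a *\<^sub>R v x + b *\<^sub>R w x) $ i) *\<^sub>R \<gamma> x)
  = (LINT x|leb D. a *\<^sub>R ((v x $ i) *\<^sub>R \<gamma> x) + b *\<^sub>R ((w x $ i) *\<^sub>R \<gamma> x))" by (simp add: scaleR_add_left)
 also have "... = a *\<^sub>R (LINT x|leb D. (v x $ i) *\<^sub>R \<gamma> x) + b *\<^sub>R (LINT x|leb D. (w x $ i) *\<^sub>R \<gamma> x)"
  using i1 by (simp add: Bochner_Integration.integral_add integrable_scaleR_right del: scaleR_scaleR)
 also have "... = - (a *\<^sub>R (LINT x|leb D. \<phi> x *\<^sub>R (G x $ i)) + b *\<^sub>R (LINT x|leb D. \<phi> x *\<^sub>R (H x $ i)))"
  using G t by (simp add: is_weak_grad_def)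
 also have "a *\<^sub>R (LINT x|leb D. \<phi> x *\<^sub>R (G x $ i)) + b *\<^sub>R (LINT x|leb D. \<phi> x *\<^sub>R (H x $ i))
   = (LINT x|leb D. a *\<^sub>R (\<phi> x *\<^sub>R (G x $ i)) + b *\<^sub>R (\<phi> x *\<^sub>R (H x $ i)))"
  using i2 by (simp add: Bochner_Integration.integral_add integrable_scaleR_right del: scaleR_scaleR)
 also have "... = (LINT x|leb D. \<phi> x *\<^sub>R ((a *\<^sub>R G x + b *\<^sub>R H x) $ i))"
  by (rule Bochner_Integration.integral_cong) (simp_all add: algebra_simps)
 finally show "(LINT x|leb D. ((a *\<^sub>R v x + b *\<^sub>R w x) $ i) *\<^sub>R \<gamma> x)
  = - (LINT x|leb D. \<phi> x *\<^sub>R ((a *\<^sub>R G x + b *\<^sub>R H x) $ i))" .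
qed

lemma is_weak_div_lincomb:
 assumes D: "D \<in> sets lebesgue" and v: "v \<in> L2_space D" "w \<in> L2_space D"
  and G: "is_weak_div D v G" "is_weak_div D w H"
 shows "is_weak_div D (\<lambda>x. a *\<^sub>R v x + b *\<^sub>R w x) (\<lambda>x. a *\<^sub>R G x + b *\<^sub>R H x)" unfolding is_weak_div_def
proof (intro conjI allI impI)
 have L: "G \<in> L2_space D" "H \<in> L2_space D" using G by (auto simp: is_weak_div_def)
 show "(\<lambda>x. a *\<^sub>R G x + b *\<^sub>R H x) \<in> L2_space D" using L by (intro L2_add L2_scaleR)
 fix \<phi> \<gamma> i assume t: "test_fun D \<phi> \<gamma>"
 note tL = test_fun_L2[OF D t]
 have i1: "integrable (leb D) (\<lambda>x. (v x $ i) \<bullet> \<gamma> x)" "integrable (leb D) (\<lambda>x. (w x $ i) \<bullet> \<gamma> x)"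
  by (rule L2_inner_integrable[OF L2_component tL(2)], rule v)+
 have i2: "integrable (leb D) (\<lambda>x. \<phi> x * (G x $ i))" "integrable (leb D) (\<lambda>x. \<phi> x * (H x $ i))"
  using L2_scaleR_integrable[OF tL(1) L2_component[OF L(1), of i]] L2_scaleR_integrable[OF tL(1) L2_component[OF L(2), of i]] by (simp_all add: real_scaleR_def)
 have "(LINT x|leb D. ((a *\<^sub>R v x + b *\<^sub>R w x) $ i) \<bullet> \<gamma> x)
  = a * (LINT x|leb D. (v x $ i) \<bullet> \<gamma> x) + b * (LINT x|leb D. (w x $ i) \<bullet> \<gamma> x)" using i1 by (simp add: inner_add_left)
 also have "... = - (a * (LINT x|leb D. \<phi> x * (G x $ i)) + b * (LINT x|leb D. \<phi> x * (H x $ i)))" using G t by (simp add: is_weak_div_def)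
 also have "a * (LINT x|leb D. \<phi> x * (G x $ i)) + b * (LINT x|leb D. \<phi> x * (H x $ i))
   = (LINT x|leb D. a * (\<phi> x * (G x $ i)) + b * (\<phi> x * (H x $ i)))" using i2 by simp
 also have "... = (LINT x|leb D. \<phi> x * ((a *\<^sub>R G x + b *\<^sub>R H x) $ i))" by (rule Bochner_Integration.integral_cong) (simp_all add: algebra_simps)
 finally show "(LINT x|leb D. ((a *\<^sub>R v x + b *\<^sub>R w x) $ i) \<bullet> \<gamma> x)
  = - (LINT x|leb D. \<phi> x * ((a *\<^sub>R G x + b *\<^sub>R H x) $ i))" .
qed

lemma H1D:
 assumes "v \<in> H1 D"
 shows "v \<in> L2_space D" "is_weak_grad D v (wgrad D v)" "wgrad D v \<in> L2_space D"
proof -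
 show "v \<in> L2_space D" using assms by (simp add: H1_def)
 have "\<exists>G. is_weak_grad D v G" using assms by (simp add: H1_def)
 then show g: "is_weak_grad D v (wgrad D v)" unfolding wgrad_def by (rule someI_ex)
 then show "wgrad D v \<in> L2_space D" by (simp add: is_weak_grad_def)
qed

lemma HdivD:
 assumes "v \<in> Hdiv D"
 shows "v \<in> L2_space D" "is_weak_div D v (wdiv D v)" "wdiv D v \<in> L2_space D"
proof -
 show "v \<in> L2_space D" using assms by (simp add: Hdiv_def)
 have "\<exists>G. is_weak_div D v G" using assms by (simp add: Hdiv_def)
 then show g: "is_weak_div D v (wdiv D v)" unfolding wdiv_def by (rule someI_ex)
 then show "wdiv D v \<in> L2_space D" by (simp add: is_weak_div_def)
qed

lemma wgrad_eq:
 assumes "open D" "bounded D" "is_weak_grad D v G"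
 shows "AE x in leb D. wgrad D v x = G x"
proof -
 have "\<exists>G. is_weak_grad D v G" using assms(3) by blast
 then have "is_weak_grad D v (wgrad D v)" unfolding wgrad_def by (rule someI_ex)
 then show ?thesis by (rule weak_grad_unique[OF assms(1,2) _ assms(3)])
qed

lemma wdiv_eq:
 assumes "open D" "bounded D" "is_weak_div D v G"
 shows "AE x in leb D. wdiv D v x = G x"
proof -
 have "\<exists>g. is_weak_div D v g" using assms(3) by blast
 then have "is_weak_div D v (wdiv D v)" unfolding wdiv_def by (rule someI_ex)
 then show ?thesis by (rule weak_div_unique[OF assms(1,2) _ assms(3)])
qed

lemma H1_lincomb:
 assumes D: "open D" "bounded D" and v: "v \<in> H1 D" "w \<in> H1 D"
 shows "(\<lambda>x. a *\<^sub>R v x + b *\<^sub>R w x) \<in> H1 D"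
  and "AE x in leb D. wgrad D (\<lambda>x. a *\<^sub>R v x + b *\<^sub>R w x) x = a *\<^sub>R wgrad D v x + b *\<^sub>R wgrad D w x"
proof -
 have "D \<in> sets lebesgue" using D by simp
 note g = is_weak_grad_lincomb[OF this H1D(1)[OF v(1)] H1D(1)[OF v(2)] H1D(2)[OF v(1)] H1D(2)[OF v(2)], of a b]
 show "(\<lambda>x. a *\<^sub>R v x + b *\<^sub>R w x) \<in> H1 D" unfolding H1_def using g L2_add[OF L2_scaleR[OF H1D(1)[OF v(1)]] L2_scaleR[OF H1D(1)[OF v(2)]]] by auto
 show "AE x in leb D. wgrad D (\<lambda>x. a *\<^sub>R v x + b *\<^sub>R w x) x = a *\<^sub>R wgrad D v x + b *\<^sub>R wgrad D w x" by (rule wgrad_eq[OF D g])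
qed

lemma Hdiv_lincomb:
 assumes D: "open D" "bounded D" and v: "v \<in> Hdiv D" "w \<in> Hdiv D"
 shows "(\<lambda>x. a *\<^sub>R v x + b *\<^sub>R w x) \<in> Hdiv D"
  and "AE x in leb D. wdiv D (\<lambda>x. a *\<^sub>R v x + b *\<^sub>R w x) x = a *\<^sub>R wdiv D v x + b *\<^sub>R wdiv D w x"
proof -
 have "D \<in> sets lebesgue" using D by simp
 note g = is_weak_div_lincomb[OF this HdivD(1)[OF v(1)] HdivD(1)[OF v(2)] HdivD(2)[OF v(1)] HdivD(2)[OF v(2)], of a b]
 show "(\<lambda>x. a *\<^sub>R v x + b *\<^sub>R w x) \<in> Hdiv D"
  unfolding Hdiv_def using g L2_add[OF L2_scaleR[OF HdivD(1)[OF v(1)]] L2_scaleR[OF HdivD(1)[OF v(2)]]] by auto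
 show "AE x in leb D. wdiv D (\<lambda>x. a *\<^sub>R v x + b *\<^sub>R w x) x = a *\<^sub>R wdiv D v x + b *\<^sub>R wdiv D w x" by (rule wdiv_eq[OF D g])
qed

section \<open>The Poincare inequality on convex sets\<close>

lemma norm_matrix_vector_mult_le:
 fixes A :: "real^'n^'m" shows "norm (A *v x) \<le> norm A * norm x"
proof (rule power2_le_imp_le)
 have "(norm (A *v x))^2 = (\<Sum>i\<in>UNIV. ((A *v x) $ i)^2)" by (simp only: power2_norm_eq_inner inner_vec_def) (simp add: power2_eq_square)
 also have "... \<le> (\<Sum>i\<in>UNIV. (norm (A $ i))^2 * (norm x)^2)"
 proof (rule sum_mono)
  fix i
  have "(A *v x) $ i = A $ i \<bullet> x" by (simp add: matrix_vector_mult_def inner_vec_def)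
  then show "((A *v x) $ i)^2 \<le> (norm (A $ i))^2 * (norm x)^2" using Cauchy_Schwarz_ineq[of "A $ i" x] by (simp add: power2_norm_eq_inner)
 qed
 also have "... = (norm A * norm x)^2"
  by (simp only: power_mult_distrib power2_norm_eq_inner[of A] inner_vec_def[of A] power2_norm_eq_inner[of "A $ _"] sum_distrib_right)
 finally show "(norm (A *v x))^2 \<le> (norm A * norm x)^2" .
qed simp

lemma nn_integral_lborel_homothety:
 fixes v :: "real^'n" and f :: "real^'n \<Rightarrow> ennreal"
 assumes r: "r > 0" and f: "f \<in> borel_measurable borel"
 shows "(\<integral>\<^sup>+ x. f x \<partial>lborel) = ennreal (r ^ CARD('n)) * (\<integral>\<^sup>+ x. f (v + r *\<^sub>R (x - v)) \<partial>lborel)"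
proof -
 note [measurable] = f
 have "(\<integral>\<^sup>+ x. f x \<partial>lborel) = (\<integral>\<^sup>+ x. f x \<partial>density (distr lborel borel (\<lambda>x. (v - r *\<^sub>R v) + r *\<^sub>R x)) (\<lambda>_. \<bar>r\<bar> ^ DIM(real^'n)))"
  using lborel_affine[of r "v - r *\<^sub>R v"] r by simp
 also have "... = ennreal (r ^ CARD('n)) * (\<integral>\<^sup>+ x. f ((v - r *\<^sub>R v) + r *\<^sub>R x) \<partial>lborel)"
  using r by (subst nn_integral_density) (auto simp: nn_integral_distr nn_integral_cmult)
 finally show ?thesis by (simp add: algebra_simps)
qed

text \<open>The substitution of \<open>x + t *\<^sub>R (y - x)\<close> for \<open>y\<close> costs
  the reciprocal of \<open>t ^ d\<close>, which is at most \<open>2 ^ d\<close> as long as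
  \<open>t \<ge> 1/2\<close>; convexity keeps the new point in \<open>C\<close>.\<close>

lemma segment_energy_le:
 fixes C :: "(real^'n) set" and H :: "real^'n \<Rightarrow> ennreal"
 assumes C: "convex C" "C \<in> sets borel" and [measurable]: "H \<in> borel_measurable borel"
  and t: "1/2 \<le> t" "t \<le> 1" and x: "x \<in> C"
 shows "(\<integral>\<^sup>+ y. indicator C y * H (x + t *\<^sub>R (y - x)) \<partial>lborel) \<le> ennreal (2 ^ CARD('n)) * (\<integral>\<^sup>+ y. indicator C y * H y \<partial>lborel)"
proof -
 note [measurable] = C(2)
 let ?I = "\<integral>\<^sup>+ y. indicator C (x + t *\<^sub>R (y - x)) * H (x + t *\<^sub>R (y - x)) \<partial>lborel"
 have "(\<integral>\<^sup>+ y. indicator C y * H (x + t *\<^sub>R (y - x)) \<partial>lborel) \<le> ?I"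
 proof (rule nn_integral_mono)
  fix y
  have "x + t *\<^sub>R (y - x) = (1 - t) *\<^sub>R x + t *\<^sub>R y" by (simp add: algebra_simps)
  then have "y \<in> C \<Longrightarrow> x + t *\<^sub>R (y - x) \<in> C" using convexD[OF C(1) x, of y "1 - t" t] t by simp
  then show "indicator C y * H (x + t *\<^sub>R (y - x)) \<le> indicator C (x + t *\<^sub>R (y - x)) * H (x + t *\<^sub>R (y - x))" by (auto simp: indicator_def)
 qed
 also have "?I \<le> ennreal (2 ^ CARD('n)) * (ennreal (t ^ CARD('n)) * ?I)"
 proof -
  have "(1::real) = (2 * (1/2)) ^ CARD('n)" by simp
  also have "... \<le> (2 * t) ^ CARD('n)" using t by (intro power_mono) auto
  finally have "1 \<le> ennreal (2 ^ CARD('n) * t ^ CARD('n))" by (simp add: power_mult_distrib ennreal_leI flip: ennreal_1)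
  then have "1 * ?I \<le> ennreal (2 ^ CARD('n) * t ^ CARD('n)) * ?I" by (rule mult_right_mono) simp
  then show ?thesis using t by (simp add: ennreal_mult' mult.assoc)
 qed
 also have "ennreal (t ^ CARD('n)) * ?I = (\<integral>\<^sup>+ y. indicator C y * H y \<partial>lborel)" using t by (subst nn_integral_lborel_homothety[of t _ x]) auto
 finally show ?thesis .
qed

text \<open>For \<open>t < 1/2\<close> the roles of \<open>x\<close> and \<open>y\<close> are
  exchanged, which replaces \<open>t\<close> by \<open>1 - t\<close> and avoids the Jacobian that
  degenerates at 0.\<close>

lemma pair_energy_le:
 fixes C :: "(real^'n) set" and H :: "real^'n \<Rightarrow> ennreal"
 assumes C: "convex C" "C \<in> sets borel" and [measurable]: "H \<in> borel_measurable borel"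
  and t: "0 \<le> t" "t \<le> 1"
 shows "(\<integral>\<^sup>+ x. (\<integral>\<^sup>+ y. indicator C x * (indicator C y * H (x + t *\<^sub>R (y - x))) \<partial>lborel) \<partial>lborel)
  \<le> emeasure lborel C * (ennreal (2 ^ CARD('n)) * (\<integral>\<^sup>+ y. indicator C y * H y \<partial>lborel))"
proof -
 note [measurable] = C(2)
 let ?E = "ennreal (2 ^ CARD('n)) * (\<integral>\<^sup>+ y. indicator C y * H y \<partial>lborel)"
 have half: "(\<integral>\<^sup>+ x. (\<integral>\<^sup>+ y. indicator C x * (indicator C y * H (x + s *\<^sub>R (y - x))) \<partial>lborel) \<partial>lborel) \<le> emeasure lborel C * ?E"
  if s: "1/2 \<le> s" "s \<le> 1" for s
 proof -
  have "(\<integral>\<^sup>+ x. (\<integral>\<^sup>+ y. indicator C x * (indicator C y * H (x + s *\<^sub>R (y - x))) \<partial>lborel) \<partial>lborel) \<le> (\<integral>\<^sup>+ x. indicator C x * ?E \<partial>lborel)"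
  proof (rule nn_integral_mono)
   fix x
   have "(\<integral>\<^sup>+ y. indicator C x * (indicator C y * H (x + s *\<^sub>R (y - x))) \<partial>lborel)
    = indicator C x * (\<integral>\<^sup>+ y. indicator C y * H (x + s *\<^sub>R (y - x)) \<partial>lborel)" by (rule nn_integral_cmult) measurable
   also have "... \<le> indicator C x * ?E" using segment_energy_le[OF C _ s, of H x] by (cases "x \<in> C") auto
   finally show "(\<integral>\<^sup>+ y. indicator C x * (indicator C y * H (x + s *\<^sub>R (y - x))) \<partial>lborel) \<le> indicator C x * ?E" .
  qed
  also have "... = emeasure lborel C * ?E" using C(2) by (simp add: nn_integral_multc)
  finally show ?thesis .
 qed
 show ?thesis
 proof (cases "1/2 \<le> t")
  case True then show ?thesis using half t by simp
 next
  case False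
  have "(\<integral>\<^sup>+ x. (\<integral>\<^sup>+ y. indicator C x * (indicator C y * H (x + t *\<^sub>R (y - x))) \<partial>lborel) \<partial>lborel)
    = (\<integral>\<^sup>+ y. (\<integral>\<^sup>+ x. indicator C x * (indicator C y * H (x + t *\<^sub>R (y - x))) \<partial>lborel) \<partial>lborel)"
   by (rule lborel_pair.Fubini'[symmetric]) measurable
  also have "... = (\<integral>\<^sup>+ y. (\<integral>\<^sup>+ x. indicator C y * (indicator C x * H (y + (1 - t) *\<^sub>R (x - y))) \<partial>lborel) \<partial>lborel)"
   by (intro nn_integral_cong) (simp add: mult.left_commute algebra_simps)
  also have "... \<le> emeasure lborel C * ?E" by (rule half) (use False t in auto)
  finally show ?thesis .
 qed
qed

lemma convex_pair_energy_le:
 fixes C :: "(real^'n) set" and H :: "real^'n \<Rightarrow> ennreal"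
 assumes C: "convex C" "C \<in> sets borel" and H: "H \<in> borel_measurable borel"
 shows "(\<integral>\<^sup>+ x. (\<integral>\<^sup>+ y. indicator C x * (indicator C y * (\<integral>\<^sup>+ t. indicator {0..1} t * H (x + t *\<^sub>R (y - x)) \<partial>lborel)) \<partial>lborel) \<partial>lborel)
  \<le> emeasure lborel C * (ennreal (2 ^ CARD('n)) * (\<integral>\<^sup>+ y. indicator C y * H y \<partial>lborel))"
proof -
 note [measurable] = C(2) H
 let ?E = "emeasure lborel C * (ennreal (2 ^ CARD('n)) * (\<integral>\<^sup>+ y. indicator C y * H y \<partial>lborel))"
 let ?W = "\<lambda>x y t. indicator {0..1} (t::real) * (indicator C x * (indicator C y * H (x + t *\<^sub>R (y - x))))"
 have "(\<integral>\<^sup>+ x. (\<integral>\<^sup>+ y. indicator C x * (indicator C y * (\<integral>\<^sup>+ t. indicator {0..1} t * H (x + t *\<^sub>R (y - x)) \<partial>lborel)) \<partial>lborel) \<partial>lborel)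
  = (\<integral>\<^sup>+ x. (\<integral>\<^sup>+ y. (\<integral>\<^sup>+ t. ?W x y t \<partial>lborel) \<partial>lborel) \<partial>lborel)"
  by (intro nn_integral_cong) (simp add: nn_integral_cmult[symmetric] mult_ac)
 also have "... = (\<integral>\<^sup>+ x. (\<integral>\<^sup>+ t. (\<integral>\<^sup>+ y. ?W x y t \<partial>lborel) \<partial>lborel) \<partial>lborel)"
  by (intro nn_integral_cong lborel_pair.Fubini') measurable
 also have "... = (\<integral>\<^sup>+ t. (\<integral>\<^sup>+ x. (\<integral>\<^sup>+ y. ?W x y t \<partial>lborel) \<partial>lborel) \<partial>lborel)"
  by (rule lborel_pair.Fubini') measurable
 also have "... \<le> (\<integral>\<^sup>+ t. indicator {0..1} (t::real) * ?E \<partial>lborel)"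
 proof (rule nn_integral_mono)
  fix t :: real
  show "(\<integral>\<^sup>+ x. (\<integral>\<^sup>+ y. ?W x y t \<partial>lborel) \<partial>lborel) \<le> indicator {0..1} t * ?E"
   using pair_energy_le[OF C H, of t] by (cases "t \<in> {0..1}") auto
 qed
 also have "... = ?E" by (simp add: nn_integral_multc)
 finally show ?thesis .
qed

lemma continuous_L2:
 fixes f :: "real^'n \<Rightarrow> 'b::euclidean_space"
 assumes D: "D \<in> sets lebesgue" "bounded D" and f: "continuous_on UNIV f"
 shows "f \<in> L2_space D"
proof -
 have "compact (closure D)" using D(2) by simp
 then obtain B where B: "\<And>x. x \<in> closure D \<Longrightarrow> norm (f x) \<le> B"
  using compact_imp_bounded[OF compact_continuous_image[OF continuous_on_subset[OF f subset_UNIV, of "closure D"]]] by (auto simp: bounded_iff)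
 show ?thesis
 proof (rule L2_bounded_function)
  show "D \<in> lmeasurable" using D by (simp add: bounded_set_imp_lmeasurable)
  show "f \<in> borel_measurable (leb D)" using f by (intro measurable_restrict_space1 measurable_completion) (simp add: borel_measurable_continuous_onI)
 qed (use B closure_subset in blast)
qed

lemma L2_subset:
 assumes "C \<in> sets lebesgue" "D \<in> sets lebesgue" "C \<subseteq> D" "f \<in> L2_space D"
 shows "f \<in> L2_space C" "l2norm C f \<le> l2norm D f"
proof -
 have i: "integrable lebesgue (\<lambda>x. indicator D x *\<^sub>R (norm (f x))^2)"
  using L2_norm_sq_integrable[OF assms(4)] assms(2) by (simp add: integrable_restrict_space)
 have m: "f \<in> borel_measurable (leb C)" by (rule measurable_lebesgue_cong[THEN iffD1, OF _ measurable_restrict_mono[OF L2_measurable[OF assms(4)] assms(3)]]) simp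
 have "integrable lebesgue (\<lambda>x. indicator C x *\<^sub>R (indicator D x *\<^sub>R (norm (f x))^2))" by (rule integrable_mult_indicator[OF assms(1) i])
 also have "(\<lambda>x. indicator C x *\<^sub>R (indicator D x *\<^sub>R (norm (f x))^2)) = (\<lambda>x. indicator C x *\<^sub>R (norm (f x))^2)"
  using assms(3) by (auto simp: indicator_def fun_eq_iff)
 finally have iC: "integrable lebesgue (\<lambda>x. indicator C x *\<^sub>R (norm (f x))^2)" .
 then show "f \<in> L2_space C" using m assms(1) by (simp add: L2_space_def integrable_restrict_space)
 have "(l2norm C f)^2 \<le> (l2norm D f)^2"
 proof -
  have eq: "(LINT x|leb S. (norm (f x))^2) = (LINT x|lebesgue. indicator S x *\<^sub>R (norm (f x))^2)"
   if "S \<in> sets lebesgue" for S by (rule integral_restrict_space) (use that in simp)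
  show ?thesis unfolding l2norm_sq_integral eq[OF assms(1)] eq[OF assms(2)] by (rule integral_mono[OF iC i]) (use assms(3) in \<open>auto simp: indicator_def\<close>)
 qed
 then show "l2norm C f \<le> l2norm D f" by (rule power2_le_imp_le) simp
qed

lemma L2_norm_integral_le:
 fixes f :: "real^'n \<Rightarrow> 'b::euclidean_space"
 assumes A: "A \<in> lmeasurable" and f: "f \<in> L2_space A"
 shows "norm (LINT x|leb A. f x) \<le> sqrt (measure lebesgue A) * l2norm A f"
proof -
 have one: "(\<lambda>x. 1 :: real) \<in> L2_space A" by (rule L2_bounded_function[OF A, of _ 1]) auto
 have nf: "(\<lambda>x. norm (f x)) \<in> L2_space A" using f L2_measurable[OF f] by (auto simp: L2_space_def)
 have "norm (LINT x|leb A. f x) \<le> (LINT x|leb A. norm (f x))" by (rule integral_norm_bound)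
 also have "... = ip A (\<lambda>x. 1) (\<lambda>x. norm (f x))" by (simp add: ip_def)
 also have "... \<le> l2norm A (\<lambda>x. 1 :: real) * l2norm A (\<lambda>x. norm (f x))" using ip_Cauchy_Schwarz[OF one nf] by linarith
 also have "l2norm A (\<lambda>x. norm (f x)) = l2norm A f" by (simp add: l2norm_def ip_def power2_norm_eq_inner[symmetric] power2_eq_square)
 also have "l2norm A (\<lambda>x. 1 :: real) = sqrt (measure lebesgue A)" using A by (simp add: l2norm_def ip_def measure_restrict_space fmeasurableD)
 finally show ?thesis .
qed

lemma L2_integral_tendsto:
 fixes f :: "nat \<Rightarrow> real^'n \<Rightarrow> 'b::euclidean_space"
 assumes A: "A \<in> lmeasurable" and f: "\<And>k. f k \<in> L2_space A" "g \<in> L2_space A"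
  and lim: "(\<lambda>k. l2norm A (\<lambda>x. f k x - g x)) \<longlonglongrightarrow> 0"
 shows "(\<lambda>k. LINT x|leb A. f k x) \<longlonglongrightarrow> (LINT x|leb A. g x)"
proof -
 have "(\<lambda>k. (LINT x|leb A. f k x) - (LINT x|leb A. g x)) \<longlonglongrightarrow> 0"
 proof (rule Lim_null_comparison)
  show "\<forall>\<^sub>F k in sequentially. norm ((LINT x|leb A. f k x) - (LINT x|leb A. g x))
    \<le> sqrt (measure lebesgue A) * l2norm A (\<lambda>x. f k x - g x)"
  proof (intro always_eventually allI)
   fix k
   have "(LINT x|leb A. f k x) - (LINT x|leb A. g x) = (LINT x|leb A. f k x - g x)"
    by (rule Bochner_Integration.integral_diff[symmetric]) (rule L2_integrable[OF A], rule f)+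
   then show "norm ((LINT x|leb A. f k x) - (LINT x|leb A. g x))
    \<le> sqrt (measure lebesgue A) * l2norm A (\<lambda>x. f k x - g x)" using L2_norm_integral_le[OF A L2_diff[OF f(1)[of k] f(2)]] by simp
  qed
  show "(\<lambda>k. sqrt (measure lebesgue A) * l2norm A (\<lambda>x. f k x - g x)) \<longlonglongrightarrow> 0" by (rule tendsto_mult_right_zero[OF lim])
 qed
 then show ?thesis by (simp add: LIM_zero_iff)
qed

lemma l2norm_tendsto:
 assumes f: "\<And>k. f k \<in> L2_space A" "g \<in> L2_space A"
  and lim: "(\<lambda>k. l2norm A (\<lambda>x. f k x - g x)) \<longlonglongrightarrow> 0"
 shows "(\<lambda>k. l2norm A (f k)) \<longlonglongrightarrow> l2norm A g"
proof -
 have "(\<lambda>k. l2norm A (f k) - l2norm A g) \<longlonglongrightarrow> 0" by (rule Lim_null_comparison[OF _ lim]) (use l2norm_diff_bound[OF f] in auto)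
 then show ?thesis by (simp add: LIM_zero_iff)
qed

lemma nn_integral_lborel_lebesgue_on:
 fixes h :: "real^'n \<Rightarrow> real"
 assumes C: "open C" "bounded C" and h: "continuous_on UNIV h" "\<And>x. 0 \<le> h x"
 shows "(\<integral>\<^sup>+ x. indicator C x * ennreal (h x) \<partial>lborel) = ennreal (LINT x|leb C. h x)"
proof -
 have Cs: "C \<in> sets lebesgue" "C \<in> lmeasurable" using C by (auto simp: lmeasurable_open)
 have "integrable (leb C) h" by (rule L2_integrable[OF Cs(2) continuous_L2[OF Cs(1) C(2) h(1)]])
 then have "ennreal (LINT x|leb C. h x) = (\<integral>\<^sup>+ x. ennreal (h x) \<partial>leb C)" using h(2) by (intro nn_integral_eq_integral[symmetric]) auto
 also have "... = (\<integral>\<^sup>+ x. ennreal (h x) * indicator C x \<partial>lebesgue)" using Cs by (simp add: nn_integral_restrict_space)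
 also have "... = (\<integral>\<^sup>+ x. ennreal (h x) * indicator C x \<partial>lborel)" using C h(1) by (intro nn_integral_completion) 
 finally show ?thesis by (simp add: mult.commute)
qed

text \<open>The fundamental theorem along the segment, followed by Cauchy--Schwarz in
  \<open>t\<close> to bring the square under the integral.\<close>

lemma jacobian_line_integral:
 assumes \<phi>: "C1_field \<phi>"
 shows "ennreal ((norm (\<phi> y - \<phi> x))^2) \<le> ennreal ((norm (y - x))^2) *
  (\<integral>\<^sup>+ t. indicator {0..1} t * ennreal ((norm (jacobian \<phi> (at (x + t *\<^sub>R (y - x)))))^2) \<partial>lborel)"
proof -
 let ?p = "\<lambda>t::real. x + t *\<^sub>R (y - x)"
 let ?h = "\<lambda>t. norm (jacobian \<phi> (at (?p t)))"
 have Jc: "continuous_on UNIV (\<lambda>z. jacobian \<phi> (at z))" using \<phi> by (simp add: C1_field_def)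
 have hc: "continuous_on UNIV ?h" by (intro continuous_intros continuous_on_compose2[OF Jc]) auto
 have hi: "set_integrable lborel {0..1} ?h" "set_integrable lborel {0..1} (\<lambda>t. (?h t)^2)" unfolding set_integrable_def
  by (rule borel_integrable_compact; auto intro!: continuous_intros continuous_on_subset[OF hc])+
 have "((\<lambda>t. jacobian \<phi> (at (?p t)) *v (y - x)) has_integral (\<phi> (?p 1) - \<phi> (?p 0))) {0..1}"
 proof (rule fundamental_theorem_of_calculus)
  fix t :: real assume "t \<in> {0..1}"
  have "(\<phi> has_derivative (\<lambda>h. jacobian \<phi> (at (?p t)) *v h)) (at (?p t))"
   using \<phi> jacobian_works[of \<phi> "at (?p t)"] by (auto simp: C1_field_def)
  moreover have "(?p has_derivative (\<lambda>s. s *\<^sub>R (y - x))) (at t within {0..1})" by (auto intro!: derivative_eq_intros)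
  ultimately have "((\<lambda>t. \<phi> (?p t)) has_derivative (\<lambda>s. jacobian \<phi> (at (?p t)) *v (s *\<^sub>R (y - x)))) (at t within {0..1})"
   by (rule has_derivative_compose[rotated])
  then show "((\<lambda>t. \<phi> (?p t)) has_vector_derivative jacobian \<phi> (at (?p t)) *v (y - x)) (at t within {0..1})"
   by (simp add: has_vector_derivative_def matrix_vector_mult_scaleR)
 qed simp
 then have ftc: "((\<lambda>t. jacobian \<phi> (at (?p t)) *v (y - x)) has_integral (\<phi> y - \<phi> x)) {0..1}" by simp
 have HK: "(?h has_integral (LINT t:{0..1}|lborel. ?h t)) {0..1}" unfolding set_borel_integral_eq_integral(2)[OF hi(1)]
  using set_borel_integral_eq_integral(1)[OF hi(1)] by (rule integrable_integral)
 have "norm (\<phi> y - \<phi> x) \<le> (LINT t:{0..1}|lborel. ?h t) * norm (y - x)"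
 proof -
  have "norm (integral {0..1} (\<lambda>t. jacobian \<phi> (at (?p t)) *v (y - x))) \<le> integral {0..1} (\<lambda>t. ?h t * norm (y - x))"
  proof (rule integral_norm_bound_integral)
   show "(\<lambda>t. jacobian \<phi> (at (?p t)) *v (y - x)) integrable_on {0..1}" using ftc by blast
   show "(\<lambda>t. ?h t * norm (y - x)) integrable_on {0..1}" using has_integral_mult_left[OF HK] by blast
  qed (rule norm_matrix_vector_mult_le)
  then show ?thesis unfolding integral_unique[OF ftc] integral_unique[OF has_integral_mult_left[OF HK, of "norm (y - x)"]] .
 qed
 then have "(norm (\<phi> y - \<phi> x))^2 \<le> ((LINT t:{0..1}|lborel. ?h t) * norm (y - x))^2" by (rule power_mono) simp
 also have "... = (norm (y - x))^2 * (LINT t:{0..1}|lborel. ?h t)^2" by (simp add: power_mult_distrib mult.commute)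
 also have "(LINT t:{0..1}|lborel. ?h t)^2 \<le> measure lborel {0..1::real} * (LINT t:{0..1}|lborel. (?h t)^2)"
  by (rule square_integral_le(2)) (use hi hc in \<open>auto intro: borel_measurable_continuous_onI\<close>)
 finally have le: "(norm (\<phi> y - \<phi> x))^2 \<le> (norm (y - x))^2 * (LINT t:{0..1}|lborel. (?h t)^2)" by (simp add: mult_left_mono)
 have "ennreal (LINT t:{0..1}|lborel. (?h t)^2) = (\<integral>\<^sup>+ t. ennreal (indicator {0..1} t *\<^sub>R (?h t)^2) \<partial>lborel)"
  unfolding set_lebesgue_integral_def by (rule nn_integral_eq_integral[symmetric]) (use hi(2) in \<open>auto simp: set_integrable_def\<close>)
 also have "... = (\<integral>\<^sup>+ t. indicator {0..1} t * ennreal ((?h t)^2) \<partial>lborel)" by (intro nn_integral_cong) (auto simp: indicator_def)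
 finally show ?thesis using ennreal_leI[OF le] by (simp add: ennreal_mult')
qed

text \<open>The mean over a subset \<open>A\<close> instead of \<open>C\<close> is what later lets
  bounds spread from set to set. Up to the factor \<open>a\<close>, the value
  \<open>\<phi> x\<close> is the integral over \<open>A\<close> minus the integral of
  \<open>\<phi> y - \<phi> x\<close> over \<open>A\<close>, and the squared differences over all
  pairs are controlled by \<open>convex_pair_energy_le\<close>.\<close>

lemma poincare_C1_field:
 fixes C A :: "(real^'n) set"
 assumes C: "open C" "convex C" "bounded C" and A: "open A" "A \<noteq> {}" "A \<subseteq> C"
 obtains K1 K2 where "0 \<le> K1" "0 \<le> K2" "\<And>\<phi>. C1_field \<phi> \<Longrightarrow>
  (l2norm C \<phi>)^2 \<le> K1 * (l2norm C (\<lambda>x. jacobian \<phi> (at x)))^2 + K2 * (norm (LINT x|leb A. \<phi> x))^2"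
proof -
 have Am: "A \<in> lmeasurable" "A \<in> sets borel" "A \<in> sets lebesgue" and Cm: "C \<in> lmeasurable" "C \<in> sets borel" "C \<in> sets lebesgue"
  and Ab: "bounded A" using A C bounded_subset[OF C(3) A(3)] by (auto simp: lmeasurable_open)
 define a where "a = measure lebesgue A"
 define m where "m = measure lebesgue C"
 have a: "a > 0" using open_not_negligible[OF A(1,2)] Am(1) unfolding a_def by (simp add: negligible_iff_measure zero_less_measure_iff)
 have m0: "m \<ge> 0" by (simp add: m_def)
 obtain Z where Z: "\<And>x y. x \<in> C \<Longrightarrow> y \<in> C \<Longrightarrow> norm (y - x) \<le> Z"
  using C(3) diameter_bounded_bound[of C] by (auto simp: dist_norm norm_minus_commute)
 have Cem: "emeasure lborel C = ennreal m"
 proof -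
  have "emeasure lborel C = emeasure lebesgue C" using Cm(2) by simp
  then show ?thesis using Cm(1) by (simp add: m_def emeasure_eq_measure2 fmeasurableD2 emeasure_eq_ennreal_measure)
 qed
 \<comment> \<open>The factors 2 come from squaring a sum of two terms, \<open>Z\<close> bounds the
   distances in \<open>C\<close>, and \<open>2 ^ CARD('n)\<close> comes from the pair energy;
   division by \<open>a^2\<close> undoes the averaging over \<open>A\<close>.\<close>
 let ?K1 = "2 * Z^2 * m * 2 ^ CARD('n) / a" and ?K2 = "2 * m / a^2"
 show ?thesis
 proof (rule that)
  show "0 \<le> ?K1" "0 \<le> ?K2" using a m0 by auto
  fix \<phi> :: "real^'n \<Rightarrow> real^'n" assume \<phi>: "C1_field \<phi>"
  let ?J = "\<lambda>x. jacobian \<phi> (at x)"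
  let ?H = "\<lambda>x. ennreal ((norm (?J x))^2)"
  have \<phi>c: "continuous_on UNIV \<phi>" by (rule C1_field_continuous[OF \<phi>])
  have Jc: "continuous_on UNIV ?J" using \<phi> by (simp add: C1_field_def)
  have [measurable]: "\<phi> \<in> borel_measurable borel" "?J \<in> borel_measurable borel" using \<phi>c Jc by (auto intro: borel_measurable_continuous_onI)
  note [measurable] = Am(2) Cm(2)
  define I where "I = (LINT x|leb A. \<phi> x)"
  have pt: "ennreal (a^2 * (norm (\<phi> x))^2) \<le> ennreal (2 * a) * (\<integral>\<^sup>+ y. indicator A y * ennreal ((norm (\<phi> y - \<phi> x))^2) \<partial>lborel)
    + ennreal (2 * (norm I)^2)" for x
  proof -
   let ?d = "\<lambda>y. \<phi> y - \<phi> x"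
   have dc: "continuous_on UNIV ?d" by (intro continuous_intros \<phi>c)
   have dL: "?d \<in> L2_space A" by (rule continuous_L2[OF Am(3) Ab dc])
   have i: "integrable (leb A) \<phi>" by (rule L2_integrable[OF Am(1) continuous_L2[OF Am(3) Ab \<phi>c]])
   have ic: "integrable (leb A) (\<lambda>y. \<phi> x)" by (rule L2_integrable[OF Am(1) continuous_L2[OF Am(3) Ab]]) simp
   have "(LINT y|leb A. ?d y) = I - a *\<^sub>R \<phi> x"
    unfolding I_def using Bochner_Integration.integral_diff[OF i ic] Am(3) by (simp add: a_def measure_restrict_space)
   then have "a *\<^sub>R \<phi> x = - (LINT y|leb A. ?d y) + I" by simp
   then have "(norm (a *\<^sub>R \<phi> x))^2 \<le> 2 * (norm (LINT y|leb A. ?d y))^2 + 2 * (norm I)^2"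
    using norm_add_sq_le[of "- (LINT y|leb A. ?d y)" I] by (simp only: norm_minus_cancel)
   also have "(norm (LINT y|leb A. ?d y))^2 \<le> (sqrt a * l2norm A ?d)^2" using L2_norm_integral_le[OF Am(1) dL] unfolding a_def by (rule power_mono) simp
   also have "(sqrt a * l2norm A ?d)^2 = a * (LINT y|leb A. (norm (?d y))^2)" using a by (simp add: power_mult_distrib l2norm_sq_integral)
   finally have "a^2 * (norm (\<phi> x))^2 \<le> 2 * a * (LINT y|leb A. (norm (?d y))^2) + 2 * (norm I)^2" by (simp add: power_mult_distrib)
   then have "ennreal (a^2 * (norm (\<phi> x))^2) \<le> ennreal (2 * a * (LINT y|leb A. (norm (?d y))^2) + 2 * (norm I)^2)" by (rule ennreal_leI)
   also have "... = ennreal (2 * a) * ennreal (LINT y|leb A. (norm (?d y))^2) + ennreal (2 * (norm I)^2)" using a by (simp add: ennreal_mult' ennreal_plus)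
   also have "ennreal (LINT y|leb A. (norm (?d y))^2) = (\<integral>\<^sup>+ y. indicator A y * ennreal ((norm (?d y))^2) \<partial>lborel)"
    by (rule nn_integral_lborel_lebesgue_on[OF A(1) Ab, symmetric]) (auto intro!: continuous_intros dc)
   finally show ?thesis .
  qed
  have energy: "(\<integral>\<^sup>+ x. indicator C x * (\<integral>\<^sup>+ y. indicator A y * ennreal ((norm (\<phi> y - \<phi> x))^2) \<partial>lborel) \<partial>lborel)
   \<le> ennreal (Z^2) * (ennreal m * (ennreal (2 ^ CARD('n)) * (\<integral>\<^sup>+ y. indicator C y * ?H y \<partial>lborel)))"
  proof -
   have "(\<integral>\<^sup>+ x. indicator C x * (\<integral>\<^sup>+ y. indicator A y * ennreal ((norm (\<phi> y - \<phi> x))^2) \<partial>lborel) \<partial>lborel)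
    = (\<integral>\<^sup>+ x. (\<integral>\<^sup>+ y. indicator C x * (indicator A y * ennreal ((norm (\<phi> y - \<phi> x))^2)) \<partial>lborel) \<partial>lborel)"
    by (intro nn_integral_cong nn_integral_cmult[symmetric]) measurable
   also have "... \<le> (\<integral>\<^sup>+ x. (\<integral>\<^sup>+ y. ennreal (Z^2) * (indicator C x * (indicator C y *
     (\<integral>\<^sup>+ t. indicator {0..1} t * ?H (x + t *\<^sub>R (y - x)) \<partial>lborel))) \<partial>lborel) \<partial>lborel)"
   proof (intro nn_integral_mono)
    fix x y
    show "indicator C x * (indicator A y * ennreal ((norm (\<phi> y - \<phi> x))^2)) \<le> ennreal (Z^2) * (indicator C x * (indicator C y *
     (\<integral>\<^sup>+ t. indicator {0..1} t * ?H (x + t *\<^sub>R (y - x)) \<partial>lborel)))"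
    proof (cases "x \<in> C \<and> y \<in> A")
     case True
     then have xy: "x \<in> C" "y \<in> C" using A(3) by auto
     have "ennreal ((norm (y - x))^2) \<le> ennreal (Z^2)" by (intro ennreal_leI power_mono Z xy) simp
     then have "ennreal ((norm (\<phi> y - \<phi> x))^2) \<le> ennreal (Z^2) * (\<integral>\<^sup>+ t. indicator {0..1} t * ?H (x + t *\<^sub>R (y - x)) \<partial>lborel)"
      by (rule order_trans[OF jacobian_line_integral[OF \<phi>, of y x] mult_right_mono]) simp
     then show ?thesis using True xy by simp
    qed (auto simp: indicator_def)
   qed
   also have "... = ennreal (Z^2) * (\<integral>\<^sup>+ x. (\<integral>\<^sup>+ y. indicator C x * (indicator C y *
     (\<integral>\<^sup>+ t. indicator {0..1} t * ?H (x + t *\<^sub>R (y - x)) \<partial>lborel)) \<partial>lborel) \<partial>lborel)" by (simp add: nn_integral_cmult)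
   also have "... \<le> ennreal (Z^2) * (ennreal m * (ennreal (2 ^ CARD('n)) * (\<integral>\<^sup>+ y. indicator C y * ?H y \<partial>lborel)))"
    unfolding Cem[symmetric] by (intro mult_left_mono convex_pair_energy_le[OF C(2) Cm(2)]) auto
   finally show ?thesis .
  qed
  have "ennreal (a^2 * (l2norm C \<phi>)^2) = ennreal (a^2) * (\<integral>\<^sup>+ x. indicator C x * ennreal ((norm (\<phi> x))^2) \<partial>lborel)"
   unfolding l2norm_sq_integral by (subst nn_integral_lborel_lebesgue_on[OF C(1,3)]) (auto intro!: continuous_intros \<phi>c simp: ennreal_mult')
  also have "... = (\<integral>\<^sup>+ x. indicator C x * ennreal (a^2 * (norm (\<phi> x))^2) \<partial>lborel)"
   by (subst nn_integral_cmult[symmetric]) (auto simp: ennreal_mult' mult_ac)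
  also have "... \<le> (\<integral>\<^sup>+ x. ennreal (2 * a) * (indicator C x * (\<integral>\<^sup>+ y. indicator A y * ennreal ((norm (\<phi> y - \<phi> x))^2) \<partial>lborel))
    + ennreal (2 * (norm I)^2) * indicator C x \<partial>lborel)" using pt by (intro nn_integral_mono) (auto simp: indicator_def)
  also have "... = ennreal (2 * a) * (\<integral>\<^sup>+ x. indicator C x * (\<integral>\<^sup>+ y. indicator A y * ennreal ((norm (\<phi> y - \<phi> x))^2) \<partial>lborel) \<partial>lborel)
    + ennreal (2 * (norm I)^2) * ennreal m" by (subst nn_integral_add) (auto simp: nn_integral_cmult Cem)
  also have "... \<le> ennreal (2 * a) * (ennreal (Z^2) * (ennreal m * (ennreal (2 ^ CARD('n)) * (\<integral>\<^sup>+ y. indicator C y * ?H y \<partial>lborel))))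
    + ennreal (2 * (norm I)^2) * ennreal m" by (intro add_right_mono mult_left_mono energy) simp
  also have "(\<integral>\<^sup>+ y. indicator C y * ?H y \<partial>lborel) = ennreal ((l2norm C ?J)^2)" unfolding l2norm_sq_integral
   by (rule nn_integral_lborel_lebesgue_on[OF C(1,3)]) (auto intro!: continuous_intros Jc)
  also have "ennreal (2 * a) * (ennreal (Z^2) * (ennreal m * (ennreal (2 ^ CARD('n)) * ennreal ((l2norm C ?J)^2))))
    + ennreal (2 * (norm I)^2) * ennreal m
   = ennreal (2 * a * (Z^2 * (m * (2 ^ CARD('n) * (l2norm C ?J)^2))) + 2 * (norm I)^2 * m)" using a m0 by (simp add: ennreal_mult' ennreal_plus)
  finally have "a^2 * (l2norm C \<phi>)^2 \<le> 2 * a * (Z^2 * (m * (2 ^ CARD('n) * (l2norm C ?J)^2))) + 2 * (norm I)^2 * m"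
   using a m0 by (subst (asm) ennreal_le_iff) auto
  then have "(l2norm C \<phi>)^2 \<le> (2 * a * (Z^2 * (m * (2 ^ CARD('n) * (l2norm C ?J)^2))) + 2 * (norm I)^2 * m) / a^2"
   using a by (simp add: pos_le_divide_eq mult.commute)
  also have "... = ?K1 * (l2norm C ?J)^2 + ?K2 * (norm I)^2" using a by (simp add: field_simps power2_eq_square)
  finally show "(l2norm C \<phi>)^2 \<le> ?K1 * (l2norm C ?J)^2 + ?K2 * (norm (LINT x|leb A. \<phi> x))^2" by (simp add: I_def)
 qed
qed


text \<open>\<open>has_trace\<close> without its condition on the hyperplane: every field that has
  some trace has such a sequence.\<close>

definition C1_approximable :: "(real^'n) set \<Rightarrow> (real^'n \<Rightarrow> real^'n) \<Rightarrow> (nat \<Rightarrow> real^'n \<Rightarrow> real^'n) \<Rightarrow> bool" where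
 "C1_approximable D v \<phi> \<longleftrightarrow> (\<forall>k. C1_field (\<phi> k)) \<and> (\<lambda>k. l2norm D (\<lambda>x. \<phi> k x - v x)) \<longlonglongrightarrow> 0 \<and>
   (\<lambda>k. l2norm D (\<lambda>x. jacobian (\<phi> k) (at x) - wgrad D v x)) \<longlonglongrightarrow> 0"

lemma C1_approximable_subset:
 fixes D C :: "(real^'n) set"
 assumes D: "D \<in> sets lebesgue" "bounded D" and C: "C \<in> sets lebesgue" "C \<subseteq> D"
  and v: "v \<in> H1 D" and ap: "C1_approximable D v \<phi>"
 shows "\<phi> k \<in> L2_space C" "(\<lambda>x. jacobian (\<phi> k) (at x)) \<in> L2_space C" "v \<in> L2_space C" "wgrad D v \<in> L2_space C"
  "(\<lambda>k. l2norm C (\<lambda>x. \<phi> k x - v x)) \<longlonglongrightarrow> 0" "(\<lambda>k. l2norm C (\<lambda>x. jacobian (\<phi> k) (at x) - wgrad D v x)) \<longlonglongrightarrow> 0"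
proof -
 have c1: "C1_field (\<phi> k)" for k using ap by (simp add: C1_approximable_def)
 have L: "\<phi> k \<in> L2_space D" "(\<lambda>x. jacobian (\<phi> k) (at x)) \<in> L2_space D" for k
  using c1[of k] C1_field_continuous by (auto intro!: continuous_L2[OF D] simp: C1_field_def)
 show "\<phi> k \<in> L2_space C" "(\<lambda>x. jacobian (\<phi> k) (at x)) \<in> L2_space C" "v \<in> L2_space C" "wgrad D v \<in> L2_space C"
  using L2_subset(1)[OF C(1) D(1) C(2)] L H1D[OF v] by blast+
 have lim: "(\<lambda>k. l2norm C (f k)) \<longlonglongrightarrow> 0" if "(\<lambda>k. l2norm D (f k)) \<longlonglongrightarrow> 0" "\<And>k. f k \<in> L2_space D"
  for f :: "nat \<Rightarrow> real^'n \<Rightarrow> 'z::euclidean_space" by (rule Lim_null_comparison[OF _ that(1)]) (use L2_subset(2)[OF C(1) D(1) C(2) that(2)] in auto)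
 show "(\<lambda>k. l2norm C (\<lambda>x. \<phi> k x - v x)) \<longlonglongrightarrow> 0" "(\<lambda>k. l2norm C (\<lambda>x. jacobian (\<phi> k) (at x) - wgrad D v x)) \<longlonglongrightarrow> 0"
  using ap L H1D[OF v] by (auto intro!: lim simp: C1_approximable_def)
qed

text \<open>All terms of the inequality for C1 fields are continuous under the convergence in
  \<open>C1_approximable\<close>. The constants depend on the sets alone, hence come before
  \<open>v\<close> and its sequence.\<close>

lemma poincare_H1:
 fixes C A D :: "(real^'n) set"
 assumes D: "D \<in> sets lebesgue" "bounded D"
  and C: "open C" "convex C" "C \<subseteq> D" and A: "open A" "A \<noteq> {}" "A \<subseteq> C"
 obtains K1 K2 where "0 \<le> K1" "0 \<le> K2" "\<And>v \<phi>. v \<in> H1 D \<Longrightarrow> C1_approximable D v \<phi> \<Longrightarrow>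
  (l2norm C v)^2 \<le> K1 * (l2norm D (wgrad D v))^2 + K2 * (norm (LINT x|leb A. v x))^2"
proof -
 have Cb: "bounded C" using D(2) C(3) by (rule bounded_subset)
 have Ab: "bounded A" using Cb A(3) by (rule bounded_subset)
 have Cs: "C \<in> sets lebesgue" using C(1) by simp
 have As: "A \<in> sets lebesgue" "A \<in> lmeasurable" using A(1) Ab by (auto simp: lmeasurable_open)
 obtain K1 K2 where K: "0 \<le> K1" "0 \<le> K2" "\<And>\<phi>. C1_field \<phi> \<Longrightarrow>
  (l2norm C \<phi>)^2 \<le> K1 * (l2norm C (\<lambda>x. jacobian \<phi> (at x)))^2 + K2 * (norm (LINT x|leb A. \<phi> x))^2"
  using poincare_C1_field[OF C(1,2) Cb A] by blast
 show ?thesis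
 proof (rule that[OF K(1,2)])
  fix v \<phi> assume v: "v \<in> H1 D" and ap: "C1_approximable D v \<phi>"
  note c = C1_approximable_subset[OF D Cs C(3) v ap]
  note a = C1_approximable_subset[OF D As(1) order_trans[OF A(3) C(3)] v ap]
  have "(l2norm C v)^2 \<le> K1 * (l2norm C (wgrad D v))^2 + K2 * (norm (LINT x|leb A. v x))^2"
  proof (rule LIMSEQ_le)
   show "(\<lambda>k. (l2norm C (\<phi> k))^2) \<longlonglongrightarrow> (l2norm C v)^2" by (intro tendsto_power l2norm_tendsto c)
   show "(\<lambda>k. K1 * (l2norm C (\<lambda>x. jacobian (\<phi> k) (at x)))^2 + K2 * (norm (LINT x|leb A. \<phi> k x))^2)
    \<longlonglongrightarrow> K1 * (l2norm C (wgrad D v))^2 + K2 * (norm (LINT x|leb A. v x))^2" by (intro tendsto_intros l2norm_tendsto L2_integral_tendsto As c a)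
   show "\<exists>N. \<forall>n\<ge>N. (l2norm C (\<phi> n))^2 \<le> K1 * (l2norm C (\<lambda>x. jacobian (\<phi> n) (at x)))^2 + K2 * (norm (LINT x|leb A. \<phi> n x))^2"
    using K(3) ap by (auto simp: C1_approximable_def)
  qed
  also have "... \<le> K1 * (l2norm D (wgrad D v))^2 + K2 * (norm (LINT x|leb A. v x))^2" using L2_subset(2)[OF Cs D(1) C(3) H1D(3)[OF v]] K(1)
   by (intro add_right_mono mult_left_mono power_mono) auto
  finally show "(l2norm C v)^2 \<le> K1 * (l2norm D (wgrad D v))^2 + K2 * (norm (LINT x|leb A. v x))^2" .
 qed
qed

section \<open>The cone formula for traces\<close>

lemma set_integral_vec_component:
 fixes f :: "'a \<Rightarrow> real^'m"
 assumes "set_integrable M A f" shows "(LINT x:A|M. f x) $ i = (LINT x:A|M. f x $ i)" using integral_vec_component[OF assms[unfolded set_integrable_def], of i]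
 by (simp add: set_lebesgue_integral_def)

context full_simplex
begin

lemma continuous_set_integrable_fct':
 fixes f :: "real^'n \<Rightarrow> 'b::euclidean_space"
 assumes c: "c \<in> C" and f: "continuous_on UNIV f"
 shows "set_integrable (surface_measure (affine hull (fct c))) (fct c) f"
proof -
 have m: "f \<in> borel_measurable borel" "fct c \<in> sets borel" using f by (auto intro: borel_measurable_continuous_onI simp: compact_imp_closed)
 have "set_integrable (surface_measure (affine hull (fct c))) (fct c) (\<lambda>x. norm (f x))" by (rule continuous_set_integrable_fct[OF c]) (intro continuous_intros f)
 then show ?thesis unfolding set_integrable_def
 proof (rule Bochner_Integration.integrable_bound)
  show "(\<lambda>x. indicat_real (fct c) x *\<^sub>R f x) \<in> borel_measurable (surface_measure (affine hull (fct c)))"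
   unfolding surface_measure_def measurable_distr_eq1 using m by measurable
 qed (auto simp: indicator_def)
qed

lemma cone_formula_field:
 assumes \<phi>: "C1_field \<phi>" and v: "v \<in> C"
 shows "(LINT x|leb (interior T). real CARD('n) *\<^sub>R \<phi> x + jacobian \<phi> (at x) *v (x - v)) = ht v *\<^sub>R sint (fct v) \<phi>"
proof -
 have \<phi>c: "continuous_on UNIV \<phi>" by (rule C1_field_continuous[OF \<phi>])
 have Jc: "continuous_on UNIV (\<lambda>x. jacobian \<phi> (at x))" using \<phi> by (simp add: C1_field_def)
 have mv: "jacobian \<phi> (at x) *v (x - v) = (\<chi> i. jacobian \<phi> (at x) $ i \<bullet> (x - v))" for x by (simp add: matrix_vector_mult_def inner_vec_def)
 have "continuous_on UNIV (\<lambda>x. real CARD('n) *\<^sub>R \<phi> x + jacobian \<phi> (at x) *v (x - v))" unfolding mv by (intro continuous_intros \<phi>c Jc)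
 then have i: "integrable (leb (interior T)) (\<lambda>x. real CARD('n) *\<^sub>R \<phi> x + jacobian \<phi> (at x) *v (x - v))"
  by (rule integrable_continuous_interior[OF compact_T continuous_on_subset[OF _ subset_UNIV]])
 show ?thesis
 proof (rule vec_eq_iff[THEN iffD2], rule allI)
  fix i
  have "(LINT x|leb (interior T). real CARD('n) *\<^sub>R \<phi> x + jacobian \<phi> (at x) *v (x - v)) $ i
   = (LINT x|leb (interior T). real CARD('n) * (\<phi> x $ i) + jacobian \<phi> (at x) $ i \<bullet> (x - v))" unfolding integral_vec_component[OF i] by (simp add: mv)
  also have "... = ht v * sint (fct v) (\<lambda>x. \<phi> x $ i)" using cone_formula[OF C1_fieldD[OF \<phi>, of i] v] by (simp add: sint_def)
  also have "sint (fct v) (\<lambda>x. \<phi> x $ i) = sint (fct v) \<phi> $ i"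
   unfolding sint_def by (rule set_integral_vec_component[OF continuous_set_integrable_fct'[OF v \<phi>c], symmetric])
  finally show "(LINT x|leb (interior T). real CARD('n) *\<^sub>R \<phi> x + jacobian \<phi> (at x) *v (x - v)) $ i = (ht v *\<^sub>R sint (fct v) \<phi>) $ i" by simp
 qed
qed

text \<open>Square mean convergence on a side of finite measure implies convergence of the
  integrals. Of \<open>w\<close> only measurability is given: its integrability follows from that of
  \<open>\<phi> k\<close> and of the difference, as soon as the squared distance is finite.\<close>

lemma sint_tendsto:
 fixes \<phi> :: "nat \<Rightarrow> real^'n \<Rightarrow> real^'n"
 assumes v: "v \<in> C" and \<phi>: "\<And>k. continuous_on UNIV (\<phi> k)" and w: "w \<in> borel_measurable borel"
  and lim: "(\<lambda>k. set_nn_integral (surface_measure (affine hull (fct v))) (fct v) (\<lambda>x. ennreal ((norm (\<phi> k x - w x))^2))) \<longlonglongrightarrow> 0"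
 shows "(\<lambda>k. sint (fct v) (\<phi> k)) \<longlonglongrightarrow> sint (fct v) w"
proof -
 let ?M = "surface_measure (affine hull (fct v))" and ?S = "fct v"
 let ?n = "\<lambda>k. set_nn_integral ?M ?S (\<lambda>x. ennreal ((norm (\<phi> k x - w x))^2))"
 have S: "?S \<in> sets ?M" "emeasure ?M ?S \<noteq> \<infinity>" using fct_sets fct_finite[OF v] by auto
 have \<phi>m: "\<phi> k \<in> borel_measurable borel" for k by (rule borel_measurable_continuous_onI[OF \<phi>])
 have mm: "f \<in> borel_measurable ?M" if "f \<in> borel_measurable borel" for f :: "real^'n \<Rightarrow> 'z::euclidean_space"
  using that by (simp add: surface_measure_def measurable_distr_eq1)
 have ev: "\<forall>\<^sub>F k in sequentially. ?n k < 1" by (rule order_tendstoD(2)[OF lim]) simp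
 have bound: "norm (sint ?S (\<phi> k) - sint ?S w) \<le> sqrt (measure ?M ?S * enn2real (?n k))" if fin: "?n k < 1" for k
 proof -
  let ?d = "\<lambda>x. \<phi> k x - w x"
  have dm: "?d \<in> borel_measurable borel" using \<phi>m[of k] w by measurable
  have nd: "(\<lambda>x. norm (?d x)) \<in> borel_measurable ?M" "(\<lambda>x. (norm (?d x))^2) \<in> borel_measurable ?M" using dm by (intro mm; measurable)+
  have eq: "?n k = (\<integral>\<^sup>+ x. ennreal (indicator ?S x *\<^sub>R (norm (?d x))^2) \<partial>?M)" by (intro nn_integral_cong) (auto simp: indicator_def)
  have i2: "set_integrable ?M ?S (\<lambda>x. (norm (?d x))^2)" unfolding set_integrable_def
  proof (rule integrableI_nonneg)
   show "(\<lambda>x. indicator ?S x *\<^sub>R (norm (?d x))^2) \<in> borel_measurable ?M" using nd S by measurable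
   show "(\<integral>\<^sup>+ x. ennreal (indicator ?S x *\<^sub>R (norm (?d x))^2) \<partial>?M) < \<infinity>" by (rule less_trans[OF fin[unfolded eq]]) simp
  qed (auto simp: indicator_def)
  have n2: "enn2real (?n k) = (LINT x:?S|?M. (norm (?d x))^2)" unfolding eq set_lebesgue_integral_def
   by (subst nn_integral_eq_integral) (use i2 in \<open>auto simp: set_integrable_def indicator_def intro!: integral_nonneg_AE\<close>)
  note sq = square_integral_le[OF S nd(1) i2]
  have id: "set_integrable ?M ?S ?d" unfolding set_integrable_def by (rule Bochner_Integration.integrable_bound[OF sq(1)[unfolded set_integrable_def]])
     (rule borel_measurable_scaleR[OF borel_measurable_indicator[OF S(1)] mm[OF dm]], simp)
  have i\<phi>: "set_integrable ?M ?S (\<phi> k)" by (rule continuous_set_integrable_fct'[OF v \<phi>])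
  have "set_integrable ?M ?S (\<lambda>x. \<phi> k x - ?d x)" by (rule set_integral_diff(1)[OF i\<phi> id])
  then have iw: "set_integrable ?M ?S w" by simp
  have "sint ?S (\<phi> k) - sint ?S w = (LINT x:?S|?M. ?d x)" unfolding sint_def by (rule set_integral_diff(2)[OF i\<phi> iw, symmetric])
  then have "norm (sint ?S (\<phi> k) - sint ?S w) \<le> (LINT x:?S|?M. norm (?d x))" unfolding set_lebesgue_integral_def
   using integral_norm_bound[of ?M "\<lambda>x. indicator ?S x *\<^sub>R ?d x"] by simp
  then have "(norm (sint ?S (\<phi> k) - sint ?S w))^2 \<le> (LINT x:?S|?M. norm (?d x))^2" by (rule power_mono) simp
  also have "... \<le> measure ?M ?S * enn2real (?n k)" unfolding n2 by (rule sq(2))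
  finally show ?thesis by (rule real_le_rsqrt)
 qed
 have "(\<lambda>k. enn2real (?n k)) \<longlonglongrightarrow> 0" by (rule tendsto_enn2real) (use lim in simp_all)
 then have "(\<lambda>k. sqrt (measure ?M ?S * enn2real (?n k))) \<longlonglongrightarrow> sqrt (measure ?M ?S * 0)"
  by (rule tendsto_real_sqrt[OF tendsto_mult[OF tendsto_const]])
 then have "(\<lambda>k. sqrt (measure ?M ?S * enn2real (?n k))) \<longlonglongrightarrow> 0" by (simp only: mult_zero_right real_sqrt_zero)
 moreover have evb: "\<forall>\<^sub>F k in sequentially. norm (sint ?S (\<phi> k) - sint ?S w) \<le> sqrt (measure ?M ?S * enn2real (?n k))"
  using ev by (rule eventually_mono) (rule bound)
 ultimately have "(\<lambda>k. sint ?S (\<phi> k) - sint ?S w) \<longlonglongrightarrow> 0" by (intro Lim_null_comparison[OF evb])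
 then show ?thesis by (simp add: LIM_zero_iff)
qed

lemma matrix_vector_L2:
 fixes v :: "real^'n"
 obtains R where "0 \<le> R" "\<And>G :: real^'n \<Rightarrow> real^'n^'n. G \<in> L2_space (interior T) \<Longrightarrow> (\<lambda>x. G x *v (x - v)) \<in> L2_space (interior T)"
  "\<And>G :: real^'n \<Rightarrow> real^'n^'n. G \<in> L2_space (interior T) \<Longrightarrow>
   l2norm (interior T) (\<lambda>x. G x *v (x - v)) \<le> R * l2norm (interior T) G"
proof -
 obtain B where B: "\<And>x. x \<in> T \<Longrightarrow> norm x \<le> B" using compact_imp_bounded[OF compact_T] by (auto simp: bounded_iff)
 define R where "R = \<bar>B\<bar> + norm v"
 have R: "norm (x - v) \<le> R" if "x \<in> interior T" for x
 proof -
  have "norm x \<le> \<bar>B\<bar>" using B[of x] that interior_subset[of T] by fastforce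
  then show ?thesis using norm_triangle_ineq4[of x v] by (simp add: R_def)
 qed
 have mvc: "continuous_on UNIV (\<lambda>p :: (real^'n^'n) \<times> (real^'n). fst p *v snd p)"
 proof -
  have "fst p *v snd p = (\<chi> i. fst p $ i \<bullet> snd p)" for p :: "(real^'n^'n) \<times> (real^'n)" by (simp add: matrix_vector_mult_def inner_vec_def)
  then show ?thesis by (simp only:) (intro continuous_intros)
 qed
 have *: "(\<lambda>x. G x *v (x - v)) \<in> L2_space (interior T) \<and>
   l2norm (interior T) (\<lambda>x. G x *v (x - v)) \<le> R * l2norm (interior T) G"
  if G: "G \<in> L2_space (interior T)" for G :: "real^'n \<Rightarrow> real^'n^'n"
 proof
  have le: "(norm (G x *v (x - v)))^2 \<le> R^2 * (norm (G x))^2" if "x \<in> interior T" for x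
  proof -
   have "norm (G x *v (x - v)) \<le> norm (G x) * norm (x - v)" by (rule norm_matrix_vector_mult_le)
   also have "... \<le> norm (G x) * R" using R[OF that] by (rule mult_left_mono) simp
   finally have "(norm (G x *v (x - v)))^2 \<le> (norm (G x) * R)^2" by (rule power_mono) simp
   then show ?thesis by (simp add: power_mult_distrib mult.commute)
  qed
  have m: "(\<lambda>x. G x *v (x - v)) \<in> borel_measurable (leb (interior T))"
  proof (rule borel_measurable_continuous_Pair[OF L2_measurable[OF G] _ mvc])
   show "(\<lambda>x. x - v) \<in> borel_measurable (leb (interior T))" by (intro measurable_restrict_space1 measurable_completion) simp
  qed
  have i: "integrable (leb (interior T)) (\<lambda>x. R^2 * (norm (G x))^2)" using L2_norm_sq_integrable[OF G] by simp
  show L: "(\<lambda>x. G x *v (x - v)) \<in> L2_space (interior T)" by (rule L2_spaceI_bound[OF m i]) (use le in \<open>auto intro!: AE_I2\<close>)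
  have "(l2norm (interior T) (\<lambda>x. G x *v (x - v)))^2 \<le> (LINT x|leb (interior T). R^2 * (norm (G x))^2)"
   unfolding l2norm_sq_integral by (rule integral_mono[OF L2_norm_sq_integrable[OF L] i]) (use le in simp)
  also have "... = (R * l2norm (interior T) G)^2" by (simp add: power_mult_distrib l2norm_sq_integral)
  finally show "l2norm (interior T) (\<lambda>x. G x *v (x - v)) \<le> R * l2norm (interior T) G" by (rule power2_le_imp_le) (simp add: R_def)
 qed
 show ?thesis by (rule that[of R]) (use * in \<open>auto simp: R_def\<close>)
qed

text \<open>The formula for C1 fields passes to the limit. Its left side does not involve
  \<open>w\<close>, hence all traces of \<open>u\<close> on a side have the same integral, whichever
  sequence produced them.\<close>

theorem cone_formula_trace:
 assumes D: "D \<in> sets lebesgue" "bounded D" and sub: "interior T \<subseteq> D" and v: "v \<in> C"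
  and u: "u \<in> H1 D" and tr: "has_trace D (affine hull (fct v)) (fct v) u w"
 shows "(LINT x|leb (interior T). real CARD('n) *\<^sub>R u x + wgrad D u x *v (x - v)) = ht v *\<^sub>R sint (fct v) w"
proof -
 obtain \<phi> where w: "w \<in> borel_measurable borel" and ap: "C1_approximable D u \<phi>"
  and lim: "(\<lambda>k. set_nn_integral (surface_measure (affine hull (fct v))) (fct v) (\<lambda>x. ennreal ((norm (\<phi> k x - w x))^2))) \<longlonglongrightarrow> 0"
  using tr unfolding has_trace_def C1_approximable_def by blast
 have c1: "C1_field (\<phi> k)" for k using ap by (simp add: C1_approximable_def)
 have Is: "interior T \<in> sets lebesgue" by simp
 have Im: "interior T \<in> lmeasurable" by (rule lmeasurable_open[OF bounded_subset[OF D(2) sub] open_interior])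
 note a = C1_approximable_subset[OF D Is sub u ap]
 obtain R where R: "0 \<le> R" "\<And>G :: real^'n \<Rightarrow> real^'n^'n. G \<in> L2_space (interior T) \<Longrightarrow> (\<lambda>x. G x *v (x - v)) \<in> L2_space (interior T)"
  "\<And>G :: real^'n \<Rightarrow> real^'n^'n. G \<in> L2_space (interior T) \<Longrightarrow>
   l2norm (interior T) (\<lambda>x. G x *v (x - v)) \<le> R * l2norm (interior T) G" using matrix_vector_L2[of v] by blast
 let ?J = "\<lambda>k x. jacobian (\<phi> k) (at x)"
 let ?d = "real CARD('n)"
 have "(\<lambda>k. LINT x|leb (interior T). ?d *\<^sub>R \<phi> k x + ?J k x *v (x - v))
   \<longlonglongrightarrow> (LINT x|leb (interior T). ?d *\<^sub>R u x + wgrad D u x *v (x - v))"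
 proof (rule L2_integral_tendsto[OF Im])
  show "(\<lambda>x. ?d *\<^sub>R \<phi> k x + ?J k x *v (x - v)) \<in> L2_space (interior T)" for k by (intro L2_add L2_scaleR R(2) a)
  show "(\<lambda>x. ?d *\<^sub>R u x + wgrad D u x *v (x - v)) \<in> L2_space (interior T)" by (intro L2_add L2_scaleR R(2) a)
  show "(\<lambda>k. l2norm (interior T) (\<lambda>x. ?d *\<^sub>R \<phi> k x + ?J k x *v (x - v) - (?d *\<^sub>R u x + wgrad D u x *v (x - v)))) \<longlonglongrightarrow> 0"
  proof (rule Lim_null_comparison)
   show "\<forall>\<^sub>F k in sequentially. norm (l2norm (interior T) (\<lambda>x. ?d *\<^sub>R \<phi> k x + ?J k x *v (x - v) - (?d *\<^sub>R u x + wgrad D u x *v (x - v))))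
    \<le> ?d * l2norm (interior T) (\<lambda>x. \<phi> k x - u x) + R * l2norm (interior T) (\<lambda>x. ?J k x - wgrad D u x)"
   proof (intro always_eventually allI)
    fix k
    have Z: "(\<lambda>x. \<phi> k x - u x) \<in> L2_space (interior T)" "(\<lambda>x. ?J k x - wgrad D u x) \<in> L2_space (interior T)" by (intro L2_diff a)+
    have "(\<lambda>x. ?d *\<^sub>R \<phi> k x + ?J k x *v (x - v) - (?d *\<^sub>R u x + wgrad D u x *v (x - v)))
     = (\<lambda>x. ?d *\<^sub>R (\<phi> k x - u x) + (?J k x - wgrad D u x) *v (x - v))" by (simp add: fun_eq_iff scaleR_diff_right matrix_vector_mult_diff_rdistrib)
    then show "norm (l2norm (interior T) (\<lambda>x. ?d *\<^sub>R \<phi> k x + ?J k x *v (x - v) - (?d *\<^sub>R u x + wgrad D u x *v (x - v))))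
    \<le> ?d * l2norm (interior T) (\<lambda>x. \<phi> k x - u x) + R * l2norm (interior T) (\<lambda>x. ?J k x - wgrad D u x)"
     using l2norm_triangle[OF L2_scaleR[OF Z(1), of ?d] R(2)[OF Z(2)]] R(3)[OF Z(2)] by (simp add: l2norm_scaleR)
   qed
   show "(\<lambda>k. ?d * l2norm (interior T) (\<lambda>x. \<phi> k x - u x) + R * l2norm (interior T) (\<lambda>x. ?J k x - wgrad D u x)) \<longlonglongrightarrow> 0"
    using tendsto_add[OF tendsto_mult_right_zero[OF a(5), of ?d] tendsto_mult_right_zero[OF a(6), of R]] by simp
  qed
 qed
 moreover have "(\<lambda>k. LINT x|leb (interior T). ?d *\<^sub>R \<phi> k x + ?J k x *v (x - v)) \<longlonglongrightarrow> ht v *\<^sub>R sint (fct v) w"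
  unfolding cone_formula_field[OF c1 v] by (intro tendsto_intros sint_tendsto[OF v C1_field_continuous[OF c1] w lim])
 ultimately show ?thesis by (rule LIMSEQ_unique)
qed

end

section \<open>Geometry of the mesh\<close>

context full_simplex
begin

lemma facet_center:
 assumes v: "v \<in> C"
 obtains z where "lam v z = 0" "\<And>c. c \<in> C - {v} \<Longrightarrow> 0 < lam c z"
proof -
 let ?u = "\<lambda>d. if d = v then 0 else 1 / real CARD('n)"
 have "sum ?u C = sum ?u (C - {v})" using v by (simp add: sum.remove[OF finite_C v])
 also have "... = 1" using card_C v by simp
 finally have s: "sum ?u C = 1" .
 show thesis by (rule that[of "\<Sum>d\<in>C. ?u d *\<^sub>R d"]) (use lam_affine_comb[OF _ s] v in auto)
qed

lemma rel_interior_fct: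
 assumes v: "v \<in> C" and z: "lam v z = 0" "\<And>c. c \<in> C - {v} \<Longrightarrow> 0 < lam c z"
 shows "z \<in> rel_interior (fct v)"
proof -
 have ind: "\<not> affine_dependent (C - {v})" using aff_indep affine_dependent_subset by blast
 have s: "(\<Sum>c\<in>C - {v}. lam c z) = 1" "(\<Sum>c\<in>C - {v}. lam c z *\<^sub>R c) = z"
  using sum_lam[of z] sum_lam_vertex[of z] z(1) by (simp_all add: sum.remove[OF finite_C v])
 show ?thesis unfolding rel_interior_convex_hull_explicit[OF ind] mem_Collect_eq by (rule exI[of _ "\<lambda>c. lam c z"], intro conjI ballI z(2) s)
qed

lemma aff_dim_T: "aff_dim T = int CARD('n)" using aff_dim_affine_independent[OF aff_indep] card_C by (simp add: aff_dim_convex_hull)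

text \<open>Two facets of a simplex are not parallel in dimension at least two: there is a third
  vertex \<open>e\<close>, and the differences \<open>c - e\<close> and \<open>c' - e\<close> each
  see only one of the two gradients.\<close>

lemma gr_independent:
 assumes d: "CARD('n) \<ge> 2" and c: "c \<in> C" "c' \<in> C" "c \<noteq> c'" and eq: "k *\<^sub>R gr c = k' *\<^sub>R gr c'"
 shows "k = 0 \<and> k' = 0"
proof -
 have "card (C - {c, c'}) = CARD('n) - 1" using card_C c by (simp add: card_Diff_subset)
 then have "card (C - {c, c'}) \<noteq> 0" using d by linarith
 then have "C - {c, c'} \<noteq> {}" by (intro notI) simp
 then obtain e where e: "e \<in> C" "e \<noteq> c" "e \<noteq> c'" by blast
 have "k * (lam c c - lam c e) = k' * (lam c' c - lam c' e)"
  unfolding lam_diff using arg_cong[OF eq, of "\<lambda>w. w \<bullet> (c - e)"] by (simp only: inner_scaleR_left)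
 moreover have "k * (lam c c' - lam c e) = k' * (lam c' c' - lam c' e)"
  unfolding lam_diff using arg_cong[OF eq, of "\<lambda>w. w \<bullet> (c' - e)"] by (simp only: inner_scaleR_left)
 ultimately show ?thesis using c e by (simp add: lam_vertex)
qed

lemma open_positive_coords: "open {y. \<forall>c\<in>C - {v}. 0 < lam c y}"
proof -
 have "open (\<Inter>c\<in>C - {v}. {y. 0 < lam c y})" by (intro open_INT finite_Diff finite_C ballI open_Collect_less continuous_intros)
 moreover have "(\<Inter>c\<in>C - {v}. {y. 0 < lam c y}) = {y. \<forall>c\<in>C - {v}. 0 < lam c y}" by auto
 ultimately show ?thesis by simp
qed

lemma mem_T_if_positive_coords:
 assumes "\<forall>c\<in>C - {v}. 0 < lam c y" "0 \<le> lam v y"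
 shows "y \<in> T" using assms unfolding mem_T by (metis Diff_iff less_imp_le singletonD)

end

section \<open>Conformity of the mesh\<close>

locale mesh =
 fixes D :: "(real^'n) set" and M :: "(real^'n) set set"
 assumes dim: "CARD('n) \<ge> 2"
  and domain: "polyhedral_lipschitz_domain D"
  and mesh: "simplicial_mesh D M"
begin

lemma domain_facts: "open D" "connected D" "bounded D" "D \<noteq> {}" "lipschitz_boundary D" using domain by (auto simp: polyhedral_lipschitz_domain_def)

lemma dom_sets: "D \<in> sets lebesgue" "D \<in> lmeasurable" using domain_facts by (auto simp: lmeasurable_open)

lemma finite_M [simp]: "finite M" using mesh by (simp add: simplicial_mesh_def triangulation_def)

lemma Union_M: "\<Union>M = closure D" using mesh by (simp add: simplicial_mesh_def)

lemma element_simplex: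
 assumes "T \<in> M"
 obtains C where "full_simplex C" "T = convex hull C" using mesh assms simplex_full_simplex unfolding simplicial_mesh_def by metis

lemma element_facet:
 assumes "T \<in> M" "S facet_of T"
 obtains C v where "full_simplex C" "T = convex hull C" "v \<in> C" "S = convex hull (C - {v})"
 using element_simplex[OF assms(1)] full_simplex.facet_iff assms(2) by metis

lemma element_compact: "T \<in> M \<Longrightarrow> compact T" by (metis element_simplex full_simplex.compact_T)

lemma element_face: "T \<in> M \<Longrightarrow> T' \<in> M \<Longrightarrow> (T \<inter> T') face_of T" using mesh by (auto simp: simplicial_mesh_def triangulation_def)

lemma element_convex: "T \<in> M \<Longrightarrow> convex T" by (metis element_simplex convex_convex_hull)

text \<open>The intersection is a face of \<open>T\<close>, and a face that meets the interior is
  all of \<open>T\<close>. Then \<open>T\<close> is a face of \<open>T'\<close> of the same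
  dimension, which forces equality.\<close>

lemma interior_element_disjoint:
 assumes "T \<in> M" "T' \<in> M" "T \<noteq> T'"
 shows "interior T \<inter> T' = {}"
proof (rule ccontr)
 assume ne: "interior T \<inter> T' \<noteq> {}"
 then have "interior T \<noteq> {}" by blast
 then have ri: "rel_interior T = interior T" by (rule rel_interior_nonempty_interior)
 have "T \<subseteq> T \<inter> T'"
 proof (rule subset_of_face_of[OF element_face[OF assms(1,2)]])
  have "(T \<inter> T') \<inter> interior T \<noteq> {}" using ne interior_subset[of T] by blast
  then show "(T \<inter> T') \<inter> rel_interior T \<noteq> {}" by (simp only: ri not_False_eq_True)
 qed simp
 then have "T \<inter> T' = T" by blast
 then have f: "T face_of T'" using element_face[OF assms(2,1)] by (simp add: Int_commute)
 obtain C C' where "full_simplex C" "T = convex hull C" "full_simplex C'" "T' = convex hull C'" using element_simplex assms by metis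
 then have "aff_dim T = aff_dim T'" using full_simplex.aff_dim_T by metis
 then show False using face_of_aff_dim_lt[OF element_convex[OF assms(2)] f assms(3)] by simp
qed

text \<open>A Lipschitz domain lies on one side of its boundary: just below a boundary point, in the
  direction \<open>e\<close> of its chart, there are points that the closure does not reach. This
  excludes slits, which would disappear in the closure.\<close>

lemma interior_closure: "interior (closure D) = D"
proof
 show "D \<subseteq> interior (closure D)" by (rule interior_maximal[OF closure_subset domain_facts(1)])
 show "interior (closure D) \<subseteq> D"
 proof
  fix z assume z: "z \<in> interior (closure D)"
  show "z \<in> D"
  proof (rule ccontr)
   assume nz: "z \<notin> D"
   then have "z \<in> frontier D" using z interior_subset domain_facts(1) by (auto simp: frontier_def interior_open)
   then obtain U e L g where U: "open U" "z \<in> U" and e: "norm e = 1" and g: "L-lipschitz_on UNIV g"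
    and chart: "D \<inter> U = {y \<in> U. (g (y - (y \<bullet> e) *\<^sub>R e) :: real) < y \<bullet> e}"
    using domain_facts(5)[unfolded lipschitz_boundary_def, rule_format, OF \<open>z \<in> frontier D\<close>] by (elim exE conjE)
   have ee: "e \<bullet> e = 1" using e by (simp add: dot_square_norm)
   have gc: "continuous_on UNIV g" using g by (rule lipschitz_on_continuous_on)
   let ?O = "U \<inter> {y. y \<bullet> e < g (y - (y \<bullet> e) *\<^sub>R e)}"
   have "open {y. y \<bullet> e < g (y - (y \<bullet> e) *\<^sub>R e)}" by (intro open_Collect_less continuous_intros continuous_on_compose2[OF gc]) auto
   then have O: "open ?O" using U(1) by blast
   have "?O \<inter> D = {}"
   proof (rule equals0I)
    fix y assume "y \<in> ?O \<inter> D"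
    then have "y \<in> D \<inter> U" "y \<bullet> e < g (y - (y \<bullet> e) *\<^sub>R e)" by auto
    then show False unfolding chart by simp
   qed
   then have Ocl: "?O \<inter> closure D = {}" using open_Int_closure_eq_empty[OF O] by blast
   have "open (U \<inter> interior (closure D))" "z \<in> U \<inter> interior (closure D)" using U z by auto
   then obtain r where r: "r > 0" "ball z r \<subseteq> U \<inter> interior (closure D)" using open_contains_ball by blast
   let ?y = "z - (r/2) *\<^sub>R e"
   have "?y \<in> ball z r" using r e by (simp add: dist_norm)
   then have y: "?y \<in> U" "?y \<in> closure D" using r(2) interior_subset by blast+
   have proj: "?y - (?y \<bullet> e) *\<^sub>R e = z - (z \<bullet> e) *\<^sub>R e" by (simp add: inner_diff_left ee algebra_simps)
   have "z \<bullet> e \<le> g (z - (z \<bullet> e) *\<^sub>R e)" 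
   proof (rule ccontr)
    assume "\<not> z \<bullet> e \<le> g (z - (z \<bullet> e) *\<^sub>R e)"
    then have "z \<in> {y \<in> U. g (y - (y \<bullet> e) *\<^sub>R e) < y \<bullet> e}" using U(2) by simp
    then show False using chart nz by blast
   qed
   then have "?y \<bullet> e < g (?y - (?y \<bullet> e) *\<^sub>R e)" unfolding proj using r(1) by (simp add: inner_diff_left ee)
   then have "?y \<in> ?O" using y by blast
   then show False using Ocl y by blast
  qed
 qed
qed

lemma interior_element_subset: "T \<in> M \<Longrightarrow> interior T \<subseteq> D" using interior_mono[of T "closure D"] Union_M interior_closure by blast

lemma AE_in_element: "AE x in leb D. \<exists>T\<in>M. x \<in> interior T"
proof -
 have "negligible (\<Union>T\<in>M. frontier T)" by (intro negligible_Union) (auto intro: negligible_convex_frontier element_convex)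
 then have "(\<Union>T\<in>M. frontier T) \<in> null_sets lebesgue" by (simp add: negligible_iff_null_sets)
 then have "AE x in lebesgue. x \<notin> (\<Union>T\<in>M. frontier T)" by (rule AE_not_in)
 then have "AE x in lebesgue. x \<in> D \<longrightarrow> (\<exists>T\<in>M. x \<in> interior T)"
 proof eventually_elim
  case (elim x)
  show ?case
  proof
   assume "x \<in> D"
   then obtain T where "T \<in> M" "x \<in> T" using closure_subset Union_M by blast
   then show "\<exists>T\<in>M. x \<in> interior T" using elim closure_subset[of T] by (auto simp: frontier_def)
  qed
 qed
 then show ?thesis using dom_sets by (simp add: AE_restrict_space_iff)
qed

text \<open>The intersection is a face of \<open>T\<close> that meets the relative interior of
  \<open>S\<close>, hence contains \<open>S\<close>; being proper, it cannot have larger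
  dimension.\<close>

lemma common_facet_Int:
 assumes "T \<in> M" "T' \<in> M" "T \<noteq> T'" and S: "S facet_of T" "z \<in> rel_interior S" "z \<in> T'"
 shows "T \<inter> T' = S" "S facet_of T'"
proof -
 obtain C v where C: "full_simplex C" "T = convex hull C" "v \<in> C" "S = convex hull (C - {v})" using element_facet[OF assms(1) S(1)] by blast
 obtain C' where C': "full_simplex C'" "T' = convex hull C'" using element_simplex[OF assms(2)] by blast
 let ?F = "T \<inter> T'"
 have fF: "?F face_of T" by (rule element_face[OF assms(1,2)])
 have ST: "S \<subseteq> T" "S face_of T" using S(1) by (auto simp: facet_of_def dest: face_of_imp_subset)
 have "z \<in> S" using S(2) rel_interior_subset by blast
 have SF: "S \<subseteq> ?F" by (rule subset_of_face_of[OF fF ST(1)]) (use S ST \<open>z \<in> S\<close> in blast)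
 have FT: "?F \<noteq> T"
 proof
  assume "?F = T"
  then have "interior T \<inter> T' = interior T" using interior_subset by blast
  then show False using interior_element_disjoint[OF assms(1-3)] full_simplex.interior_T_nonempty[OF C(1)] C(2) by simp
 qed
 have dimT: "aff_dim T = int CARD('n)" "aff_dim T' = int CARD('n)" using full_simplex.aff_dim_T C(1,2) C' by auto
 have "aff_dim ?F < aff_dim T" by (rule face_of_aff_dim_lt[OF element_convex[OF assms(1)] fF FT])
 moreover have "aff_dim S = aff_dim T - 1" using S(1) by (simp add: facet_of_def)
 moreover have "S face_of ?F" by (rule face_of_subset[OF ST(2) SF]) auto
 moreover have "convex ?F" using element_convex assms by (simp add: convex_Int)
 ultimately show FS: "?F = S" using face_of_aff_dim_lt[of ?F S] by force
 have "S face_of T'" using element_face[OF assms(2,1)] FS by (simp add: Int_commute)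
 then show "S facet_of T'" using S(1) dimT by (simp add: facet_of_def)
qed

text \<open>With equal normals the two simplices would lie on the same side of \<open>S\<close> and
  overlap near a relatively interior point. With opposite normals they together cover a
  neighbourhood of each such point, which places it in the interior of the closure of the
  domain.\<close>

lemma common_facet_opposite:
 assumes "T \<in> M" "T' \<in> M" "T \<noteq> T'" and S: "S facet_of T" "S facet_of T'"
 shows "outer_normal T' S = - outer_normal T S" "rel_interior S \<subseteq> D"
proof -
 obtain C v where C: "full_simplex C" "T = convex hull C" "v \<in> C" "S = convex hull (C - {v})" using element_facet[OF assms(1) S(1)] by blast
 obtain C' v' where C': "full_simplex C'" "T' = convex hull C'" "v' \<in> C'" "S = convex hull (C' - {v'})" using element_facet[OF assms(2) S(2)] by blast
 interpret s: full_simplex C by fact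
 interpret s': full_simplex C' by fact
 let ?n = "s.ht v *\<^sub>R s.gr v" and ?n' = "s'.ht v' *\<^sub>R s'.gr v'"
 have on: "outer_normal T S = - ?n" "outer_normal T' S = - ?n'" using s.outer_normal_fct[OF C(3)] s'.outer_normal_fct[OF C'(3)] C(2,4) C'(2,4) by simp_all
 have "side_normal S ?n'" using s'.hyperplane_normals[OF C'(3)] C'(4) by simp
 then have alt: "?n' = ?n \<or> ?n' = - ?n" using s.hyperplane_normals[OF C(3)] C(4) by simp
 have hp: "s.ht v > 0" "s'.ht v' > 0" using s.ht_pos C(3) s'.ht_pos C'(3) by auto
 have coords: "(\<forall>c\<in>C - {v}. 0 < s.lam c z) \<and> s.lam v z = 0 \<and> (\<forall>c\<in>C' - {v'}. 0 < s'.lam c z) \<and> s'.lam v' z = 0"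
  if z: "z \<in> rel_interior S" for z
 proof -
  have zS: "z \<in> S" using z rel_interior_subset by blast
  have pos: "0 < full_simplex.lam Z c z"
   if Z: "full_simplex Z" "w \<in> Z" "S = convex hull (Z - {w})" "c \<in> Z - {w}" for Z w c
  proof -
   interpret d: full_simplex Z by fact
   have ind: "\<not> affine_dependent (Z - {w})" using d.aff_indep affine_dependent_subset by blast
   obtain u where u: "\<forall>x\<in>Z - {w}. 0 < u x" "sum u (Z - {w}) = 1" "(\<Sum>x\<in>Z - {w}. u x *\<^sub>R x) = z"
    using z unfolding Z(3) rel_interior_convex_hull_explicit[OF ind] mem_Collect_eq by (elim exE conjE)
   let ?u = "u(w := 0)"
   have s: "sum ?u Z = 1" "(\<Sum>x\<in>Z. ?u x *\<^sub>R x) = z" using u(2,3) by (simp_all add: sum.remove[OF d.finite_C Z(2)] cong: sum.cong_simp)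
   then show ?thesis using d.lam_affine_comb[of c ?u] Z(4) u(1) by auto
  qed
  show ?thesis using pos[OF C(1,3,4)] pos[OF C'(1,3,4)] zS s.mem_fct[OF C(3)] s'.mem_fct[OF C'(3)] C(4) C'(4) by auto
 qed
 \<comment> \<open>Up to sign, both products are the signed distance of \<open>y\<close> to the
   hyperplane of \<open>S\<close>.\<close>
 have side: "s'.lam v' y * s'.ht v' = (if ?n' = ?n then 1 else -1) * (s.lam v y * s.ht v)" if z: "z \<in> rel_interior S" for y z
 proof -
  have 1: "s'.lam v' y * s'.ht v' = ?n' \<bullet> (y - z)" using s'.lam_diff[of v' y z] coords[OF z] by (simp only: inner_scaleR_left mult.commute[of "s'.ht v'"]) simp
  have 2: "s.lam v y * s.ht v = ?n \<bullet> (y - z)" using s.lam_diff[of v y z] coords[OF z] by (simp only: inner_scaleR_left mult.commute[of "s.ht v"]) simp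
  show ?thesis
  proof (cases "?n' = ?n")
   case True
   show ?thesis unfolding 1 2 using True by (simp only: simp_thms if_True mult_1)
  next
   case False
   then have "?n' = - ?n" using alt by blast
   then show ?thesis unfolding 1 2 using False by (simp only: simp_thms if_False inner_minus_left mult_minus1)
  qed
 qed
 obtain z where z: "z \<in> rel_interior S" using s.facet_center[OF C(3)] s.rel_interior_fct[OF C(3)] C(4) by metis
 have ne: "?n' \<noteq> ?n"
 proof
  assume eq: "?n' = ?n"
  obtain x where x: "x \<in> interior T" using s.interior_T_nonempty C(2) by blast
  have "open {y. \<forall>c\<in>C' - {v'}. 0 < s'.lam c y}" by (rule s'.open_positive_coords)
  moreover have "z \<in> {y. \<forall>c\<in>C' - {v'}. 0 < s'.lam c y}" using coords[OF z] by simp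
  ultimately obtain r where r: "r > 0" "ball z r \<subseteq> {y. \<forall>c\<in>C' - {v'}. 0 < s'.lam c y}" using open_contains_ball by blast
  \<comment> \<open>Small enough that the point on the way from \<open>z\<close> to the interior
    point \<open>x\<close> of \<open>T\<close> keeps the remaining coordinates with respect to
    \<open>T'\<close> positive.\<close>
  define t where "t = min 1 (r / (2 * (norm (x - z) + 1)))"
  have t: "0 < t" "t \<le> 1" using r(1) by (auto simp: t_def add_nonneg_pos)
  let ?y = "z + t *\<^sub>R (x - z)"
  have "t * norm (x - z) < r"
  proof -
   have "t * norm (x - z) \<le> r / (2 * (norm (x - z) + 1)) * (norm (x - z) + 1)" by (intro mult_mono) (auto simp: t_def r(1) less_imp_le)
   also have "... = r / 2" by (simp add: field_simps add_nonneg_eq_0_iff)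
   finally show ?thesis using r(1) by simp
  qed
  then have "?y \<in> ball z r" using t by (simp add: dist_norm)
  then have pos': "\<forall>c\<in>C' - {v'}. 0 < s'.lam c ?y" using r(2) by blast
  have lamy: "s.lam c ?y = (1 - t) * s.lam c z + t * s.lam c x" for c by (simp only: s.lam_add inner_scaleR_right s.lam_diff[symmetric]) (simp add: algebra_simps)
  have lx: "0 < s.lam c x" if "c \<in> C" for c using x C(2) s.interior_T that by auto
  have yint: "0 < s.lam c ?y" if c: "c \<in> C" for c
  proof -
   have "0 \<le> s.lam c z" using coords[OF z] c by (cases "c = v") (auto intro: less_imp_le)
   then have "0 \<le> (1 - t) * s.lam c z" using t by simp
   moreover have "0 < t * s.lam c x" using t lx[OF c] by simp
   ultimately show ?thesis unfolding lamy by linarith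
  qed
  then have "?y \<in> interior T" using C(2) s.interior_T by auto
  moreover have "0 \<le> s'.lam v' ?y"
  proof -
   have "0 < s'.lam v' ?y * s'.ht v'" unfolding side[OF z, of ?y] using eq mult_pos_pos[OF yint[OF C(3)] hp(1)] by (simp only: simp_thms if_True mult_1)
   then show ?thesis using hp(2) by (simp add: zero_less_mult_iff)
  qed
  then have "?y \<in> T'" using s'.mem_T_if_positive_coords[OF pos'] C'(2) by simp
  ultimately show False using interior_element_disjoint[OF assms(1-3)] by blast
 qed
 then show "outer_normal T' S = - outer_normal T S" using alt on by simp
 show "rel_interior S \<subseteq> D"
 proof
  fix z assume z: "z \<in> rel_interior S"
  \<comment> \<open>On this neighbourhood only the coordinates of the two opposite vertices can be
    negative, and by the opposite normals never both at once.\<close>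
  let ?O = "{y. \<forall>c\<in>C - {v}. 0 < s.lam c y} \<inter> {y. \<forall>c\<in>C' - {v'}. 0 < s'.lam c y}"
  have O: "open ?O" using s.open_positive_coords s'.open_positive_coords by (rule open_Int)
  have "?O \<subseteq> T \<union> T'"
  proof
   fix y assume y: "y \<in> ?O"
   show "y \<in> T \<union> T'"
   proof (cases "0 \<le> s.lam v y")
    case True
    then show ?thesis using s.mem_T_if_positive_coords[of v y] y C(2) by auto
   next
    case False
    then have "s.lam v y * s.ht v < 0" using hp by (simp add: mult_neg_pos)
    then have "0 < s'.lam v' y * s'.ht v'" using side[OF z, of y] ne by simp
    then have "0 \<le> s'.lam v' y" using hp by (simp add: zero_less_mult_iff)
    then show ?thesis using s'.mem_T_if_positive_coords[of v' y] y C'(2) by auto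
   qed
  qed
  also have "... \<subseteq> closure D" using assms(1,2) Union_M by blast
  finally have "?O \<subseteq> interior (closure D)" using O by (rule interior_maximal)
  moreover have "z \<in> ?O" using coords[OF z] by simp
  ultimately show "z \<in> D" using interior_closure by blast
 qed
qed

text \<open>Three elements at one facet would have pairwise opposite normals there, which makes the
  normal its own negative.\<close>

lemma common_facet_unique:
 assumes "T \<in> M" "T' \<in> M" "T'' \<in> M" "T \<noteq> T'" "T \<noteq> T''" "S facet_of T" "S facet_of T'" "S facet_of T''"
 shows "T' = T''"
proof (rule ccontr)
 assume ne: "T' \<noteq> T''"
 have "outer_normal T' S = - outer_normal T S" "outer_normal T'' S = - outer_normal T S" "outer_normal T'' S = - outer_normal T' S"
  using common_facet_opposite(1) assms ne by blast+
 then have "outer_normal T S + outer_normal T S = 0" by (metis add.right_inverse minus_equation_iff)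
 then have "2 *\<^sub>R outer_normal T S = 0" by (simp add: scaleR_2)
 then have z: "outer_normal T S = 0" by simp
 obtain C v where C: "full_simplex C" "T = convex hull C" "v \<in> C" "S = convex hull (C - {v})" using element_facet[OF assms(1,6)] by blast
 interpret full_simplex C by fact
 show False using outer_normal_fct[OF C(3)] z C(2,4) ht_pos[OF C(3)] gr_nonzero[OF C(3)] by simp
qed

lemma facet_not_frontier:
 assumes "T \<in> M" "T' \<in> M" "T \<noteq> T'" and S: "S facet_of T" "S facet_of T'"
 shows "\<not> S \<subseteq> frontier D"
proof
 assume a: "S \<subseteq> frontier D"
 have "convex S" "S \<noteq> {}" using S(1) element_convex[OF assms(1)] by (auto simp: facet_of_def dest: face_of_imp_convex)
 then obtain z where z: "z \<in> rel_interior S" using rel_interior_eq_empty by blast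
 then have "z \<in> D" using common_facet_opposite(2)[OF assms] by blast
 moreover have "z \<in> frontier D" using z a rel_interior_subset by blast
 ultimately show False using domain_facts(1) by (simp add: frontier_def interior_open)
qed

text \<open>The elements that miss \<open>z\<close> are finitely many closed sets, so some
  neighbourhood of \<open>z\<close> avoids them all.\<close>

lemma near_elements_contain:
 obtains B where "open B" "z \<in> B" "\<And>T. T \<in> M \<Longrightarrow> T \<inter> B \<noteq> {} \<Longrightarrow> z \<in> T"
proof -
 let ?B = "- \<Union>{T \<in> M. z \<notin> T}"
 have "closed (\<Union>{T \<in> M. z \<notin> T})" by (intro closed_Union) (auto intro: compact_imp_closed element_compact)
 then have "open ?B" by (rule open_Compl)
 then show ?thesis using that[of ?B] by blast
qed

text \<open>A point of the domain in the relative interior of \<open>S\<close> is found first; just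
  across \<open>S\<close> from it lies another element, which must contain that point and then
  shares the whole facet.\<close>

lemma facet_neighbor:
 assumes T: "T \<in> M" and S: "S facet_of T" and nf: "\<not> S \<subseteq> frontier D"
 obtains T' where "T' \<in> M" "T' \<noteq> T" "S facet_of T'"
proof -
 obtain C v where C: "full_simplex C" "T = convex hull C" "v \<in> C" "S = convex hull (C - {v})" using element_facet[OF T S] by blast
 interpret full_simplex C by fact
 obtain x where x: "x \<in> S" "x \<notin> frontier D" using nf by blast
 have "S \<subseteq> closure D" using S T Union_M facet_of_imp_subset by blast
 then have xD: "x \<in> D" using x domain_facts(1) by (auto simp: frontier_def interior_open)
 have xc: "lam v x = 0" "\<And>c. c \<in> C \<Longrightarrow> 0 \<le> lam c x" using x(1) C(4) mem_fct[OF C(3)] by (auto simp: mem_T)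
 obtain b where b: "lam v b = 0" "\<And>c. c \<in> C - {v} \<Longrightarrow> 0 < lam c b" using facet_center[OF C(3)] by blast
 obtain r where r: "r > 0" "ball x r \<subseteq> D" using xD domain_facts(1) open_contains_ball by blast
 \<comment> \<open>\<open>x\<close> may lie on the relative boundary of \<open>S\<close>. A short
   move towards the centre \<open>b\<close> reaches the relative interior without leaving the
   domain.\<close>
 define t where "t = min 1 (r / (2 * (norm (b - x) + 1)))"
 have t: "0 < t" "t \<le> 1" using r(1) by (auto simp: t_def add_nonneg_pos)
 define z where "z = x + t *\<^sub>R (b - x)"
 have "t * norm (b - x) < r"
 proof -
  have "t * norm (b - x) \<le> r / (2 * (norm (b - x) + 1)) * (norm (b - x) + 1)" by (intro mult_mono) (auto simp: t_def r(1) less_imp_le)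
  also have "... = r / 2" by (simp add: field_simps add_nonneg_eq_0_iff)
  finally show ?thesis using r(1) by simp
 qed
 then have "z \<in> ball x r" using t by (simp add: z_def dist_norm)
 then have zD: "z \<in> D" using r(2) by blast
 have lamz: "lam c z = (1 - t) * lam c x + t * lam c b" for c unfolding z_def by (simp only: lam_add inner_scaleR_right lam_diff[symmetric]) (simp add: algebra_simps)
 have zv: "lam v z = 0" using xc(1) b(1) by (simp add: lamz)
 have zc: "0 < lam c z" if "c \<in> C - {v}" for c using t xc(2)[of c] b(2)[OF that] that unfolding lamz by (intro add_nonneg_pos) auto
 have zri: "z \<in> rel_interior S" using rel_interior_fct[OF C(3) zv zc] C(4) by simp
 obtain B where B: "open B" "z \<in> B" "\<And>T. T \<in> M \<Longrightarrow> T \<inter> B \<noteq> {} \<Longrightarrow> z \<in> T" using near_elements_contain by blast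
 have "open (B \<inter> D)" "z \<in> B \<inter> D" using B domain_facts(1) zD by auto
 then obtain s where s: "s > 0" "ball z s \<subseteq> B \<inter> D" using open_contains_ball by blast
 \<comment> \<open>A point just beyond \<open>S\<close>, so close to \<open>z\<close> that it lies
   in the domain and every element containing it also contains \<open>z\<close>.\<close>
 let ?y = "z - (s / (2 * norm (gr v))) *\<^sub>R gr v"
 have gv: "norm (gr v) > 0" using gr_nonzero[OF C(3)] by simp
 have "?y \<in> ball z s" using s gv by (simp add: dist_norm)
 then have y: "?y \<in> B" "?y \<in> D" using s(2) by auto
 have "lam v ?y = - (s / (2 * norm (gr v))) * (gr v \<bullet> gr v)" using lam_diff[of v ?y z] zv by simp
 also have "... < 0" using s(1) gv by (simp add: mult_neg_pos)
 finally have nT: "?y \<notin> T" using C(2,3) by (auto simp: mem_T not_le)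
 obtain T' where T': "T' \<in> M" "?y \<in> T'" using y(2) closure_subset Union_M by blast
 then have ne: "T' \<noteq> T" using nT by blast
 have "z \<in> T'" using B(3)[OF T'(1)] T'(2) y(1) by blast
 then have "S facet_of T'" using common_facet_Int(2)[OF T T'(1) _ S zri] ne by blast
 then show ?thesis using that T'(1) ne by blast
qed

text \<open>Around the centre of a boundary side the frontier consists of that side alone: every
  nearby element contains the centre, and any element but \<open>T\<close> would share the side,
  which then could not lie on the frontier.\<close>

lemma frontier_near_facet:
 assumes T: "T \<in> M" and S: "S facet_of T" "S \<subseteq> frontier D"
 obtains B z where "open B" "z \<in> B" "z \<in> S" "B \<inter> frontier D \<subseteq> S"
proof -
 obtain C v where C: "full_simplex C" "T = convex hull C" "v \<in> C" "S = convex hull (C - {v})" using element_facet[OF T S(1)] by blast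
 interpret full_simplex C by fact
 obtain z where z: "lam v z = 0" "\<And>c. c \<in> C - {v} \<Longrightarrow> 0 < lam c z" using facet_center[OF C(3)] by blast
 have zri: "z \<in> rel_interior S" using rel_interior_fct[OF C(3) z] C(4) by simp
 obtain B where B: "open B" "z \<in> B" "\<And>T. T \<in> M \<Longrightarrow> T \<inter> B \<noteq> {} \<Longrightarrow> z \<in> T" using near_elements_contain by blast
 let ?B = "B \<inter> {y. \<forall>c\<in>C - {v}. 0 < lam c y}"
 show ?thesis
 proof (rule that[of ?B z])
  show "open ?B" using B(1) open_positive_coords by blast
  show "z \<in> ?B" using B(2) z by blast
  show "z \<in> S" using zri rel_interior_subset by blast
  show "?B \<inter> frontier D \<subseteq> S"
  proof
   fix y assume y: "y \<in> ?B \<inter> frontier D"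
   then have "y \<in> closure D" by (simp add: frontier_def)
   then obtain T' where T': "T' \<in> M" "y \<in> T'" using Union_M by blast
   have "z \<in> T'" using B(3)[OF T'(1)] T'(2) y by blast
   have "T' = T"
   proof (rule ccontr)
    assume ne: "T' \<noteq> T"
    have "S facet_of T'" using common_facet_Int(2)[OF T T'(1) _ S(1) zri \<open>z \<in> T'\<close>] ne by blast
    then show False using facet_not_frontier[OF T T'(1) _ S(1)] ne S(2) by blast
   qed
   then have yT: "y \<in> T" using T' by simp
   have "y \<notin> interior T" using interior_element_subset[OF T] y domain_facts(1) by (auto simp: frontier_def interior_open)
   then have "\<not> 0 < lam v y" using y unfolding C(2) interior_T by blast
   then have "lam v y = 0" using yT C(2,3) by (auto simp: mem_T not_less antisym)
   then show "y \<in> S" using yT C(2,4) mem_fct[OF C(3)] by simp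
  qed
 qed
qed


section \<open>Existence of a side on the Dirichlet boundary\<close>

text \<open>The endpoint \<open>p\<close> is chosen outside finitely many hyperplanes, such that the
  segment meets elements only in interior points or in relatively interior points of facets. Since
  \<open>q\<close> lies off the closure, no point of the segment in an element is \<open>q\<close>
  itself.\<close>

lemma generic_segment:
 assumes U: "open U" "U \<noteq> {}" and q: "q \<notin> closure D"
 obtains p where "p \<in> U" "\<And>y T C c c'. y \<in> closed_segment p q \<Longrightarrow> full_simplex C \<Longrightarrow> convex hull C \<in> M \<Longrightarrow>
  y \<in> convex hull C \<Longrightarrow> c \<in> C \<Longrightarrow> c' \<in> C \<Longrightarrow> c \<noteq> c' \<Longrightarrow>
  \<not> (full_simplex.lam C c y = 0 \<and> full_simplex.lam C c' y = 0)"
proof -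
 define I where "I = {(C, c, c'). full_simplex C \<and> convex hull C \<in> M \<and> c \<in> C \<and> c' \<in> C \<and> c \<noteq> c'}"
 \<comment> \<open>The bad endpoints. \<open>N1\<close>: \<open>p\<close> lies on the hyperplane of
   a facet. \<open>N2\<close>: the line through \<open>q\<close> and \<open>p\<close> meets two
   facet hyperplanes of one element at once; eliminating the parameter of the line from the two
   equations leaves one linear equation for \<open>p\<close>. If both coordinates vanish at
   \<open>q\<close>, that equation is void and \<open>N1\<close> settles the case.\<close>
 define N1 where "N1 = (\<lambda>(C :: (real^'n) set, c, c' :: real^'n). {x. full_simplex.lam C c x = 0})"
 define N2 where "N2 = (\<lambda>(C :: (real^'n) set, c, c'). if full_simplex.lam C c q = 0 \<and> full_simplex.lam C c' q = 0 then {} else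
  {x. full_simplex.lam C c' q * full_simplex.lam C c x = full_simplex.lam C c q * full_simplex.lam C c' x})"
 have finI: "finite I"
 proof -
  have "finite {C. full_simplex C \<and> convex hull C \<in> M}"
  proof (rule finite_imageD)
   show "finite ((\<lambda>C. convex hull C) ` {C. full_simplex C \<and> convex hull C \<in> M})" by (rule finite_subset[OF _ finite_M]) auto
   \<comment> \<open>The vertices are recovered from an element as its extreme points.\<close>
   show "inj_on (\<lambda>C. convex hull C) {C. full_simplex C \<and> convex hull C \<in> M}"
   proof (rule inj_onI)
    fix C Z :: "(real^'n) set"
    assume C: "C \<in> {C. full_simplex C \<and> convex hull C \<in> M}" and Z: "Z \<in> {C. full_simplex C \<and> convex hull C \<in> M}"
     and eq: "convex hull C = convex hull Z"
    have ext: "x extreme_point_of (convex hull E) \<longleftrightarrow> x \<in> E" if "full_simplex E" for x and E :: "(real^'n) set"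
     by (rule extreme_point_of_convex_hull_affine_independent[OF full_simplex.aff_indep[OF that]])
    show "C = Z"
    proof (rule set_eqI)
     fix x
     have "full_simplex C" "full_simplex Z" using C Z by simp_all
     then show "x \<in> C \<longleftrightarrow> x \<in> Z" using ext[of C x] ext[of Z x] eq by simp
    qed
   qed
  qed
  then have "finite (\<Union>C\<in>{C. full_simplex C \<and> convex hull C \<in> M}. {C} \<times> (C \<times> C))"
   by (intro finite_UN_I) (auto intro: full_simplex.finite_C)
  then show ?thesis by (rule finite_subset[rotated]) (auto simp: I_def)
 qed
 have neg: "negligible (N1 i)" "negligible (N2 i)" if i: "i \<in> I" for i
 proof -
  obtain C c c' where i': "i = (C, c, c')" "full_simplex C" "c \<in> C" "c' \<in> C" "c \<noteq> c'" using i by (auto simp: I_def)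
  interpret full_simplex C by fact
  have "{x. lam c x = 0} = {x. gr c \<bullet> x = snd (cf c)}" by (auto simp: lam_def)
  then show "negligible (N1 i)" using negligible_hyperplane[of "gr c"] gr_nonzero[OF i'(3)] by (simp add: N1_def i'(1))
  show "negligible (N2 i)"
  proof (cases "lam c q = 0 \<and> lam c' q = 0")
   case True then show ?thesis by (simp add: N2_def i'(1))
  next
   case False
   let ?a = "lam c' q *\<^sub>R gr c - lam c q *\<^sub>R gr c'"
   have "?a \<noteq> 0" using gr_independent[OF dim i'(3,4,5)] False by (metis eq_iff_diff_eq_0)
   moreover have "{x. lam c' q * lam c x = lam c q * lam c' x} = {x. ?a \<bullet> x = lam c' q * snd (cf c) - lam c q * snd (cf c')}"
    by (auto simp: lam_def inner_diff_left algebra_simps)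
   ultimately show ?thesis using negligible_hyperplane[of ?a] False by (simp add: N2_def i'(1))
  qed
 qed
 have "negligible (\<Union>i\<in>I. N1 i \<union> N2 i)" using finI neg by (intro negligible_Union) auto
 moreover have "\<not> negligible U" using open_not_negligible[OF U] .
 ultimately have "\<not> U \<subseteq> (\<Union>i\<in>I. N1 i \<union> N2 i)" using negligible_subset by blast
 then obtain p where p: "p \<in> U" "p \<notin> (\<Union>i\<in>I. N1 i \<union> N2 i)" by blast
 show ?thesis
 proof (rule that[OF p(1)])
  fix y T C c c'
  assume y: "y \<in> closed_segment p q" and C: "full_simplex C" "convex hull C \<in> M" "y \<in> convex hull C"
   and c: "c \<in> C" "c' \<in> C" "c \<noteq> c'"
  interpret full_simplex C by fact
  have iI: "(C, c, c') \<in> I" using C c by (simp add: I_def)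
  then have np: "lam c p \<noteq> 0" using p(2) by (force simp: N1_def)
  have np2: "lam c' q * lam c p \<noteq> lam c q * lam c' p" if "\<not> (lam c q = 0 \<and> lam c' q = 0)" using p(2) iI that by (force simp: N2_def)
  obtain s where s: "0 \<le> s" "s \<le> 1" "y = (1 - s) *\<^sub>R q + s *\<^sub>R p" using y by (metis closed_segment_commute in_segment(1))
  have "y \<in> closure D" using C(2,3) Union_M by blast
  then have "s \<noteq> 0" using s(3) q by auto
  have lamy: "lam e y = (1 - s) * lam e q + s * lam e p" for e by (simp add: s(3) lam_def inner_add_right algebra_simps)
  show "\<not> (lam c y = 0 \<and> lam c' y = 0)"
  proof
   assume a: "lam c y = 0 \<and> lam c' y = 0"
   show False
   proof (cases "lam c q = 0 \<and> lam c' q = 0")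
    case True then show False using a lamy[of c] np \<open>s \<noteq> 0\<close> by simp
   next
    case False
    have e1: "s * lam c p = - (1 - s) * lam c q" and e2: "s * lam c' p = - (1 - s) * lam c' q"
    proof -
     have "0 = (1 - s) * lam c q + s * lam c p" "0 = (1 - s) * lam c' q + s * lam c' p" using a lamy[of c] lamy[of c'] by simp_all
     then show "s * lam c p = - (1 - s) * lam c q" "s * lam c' p = - (1 - s) * lam c' q" unfolding mult_minus_left by linarith+
    qed
    have "s * (lam c' q * lam c p) = lam c' q * (s * lam c p)" by simp
    also have "... = lam c q * (s * lam c' p)" unfolding e1 e2 by simp
    also have "... = s * (lam c q * lam c' p)" by simp
    finally show False using np2[OF False] \<open>s \<noteq> 0\<close> by simp
   qed
  qed
 qed
qed

context
 fixes \<Gamma>D \<Gamma>N :: "(real^'n) set"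
 assumes parts: "boundary_parts D \<Gamma>D \<Gamma>N" and res: "mesh_resolves_boundary D \<Gamma>D \<Gamma>N M"
begin

lemma Dirichlet_not_closure_Neumann: "y \<in> \<Gamma>D \<Longrightarrow> y \<notin> closure \<Gamma>N"
proof
 assume y: "y \<in> \<Gamma>D" "y \<in> closure \<Gamma>N"
 obtain U where U: "open U" "\<Gamma>D = frontier D \<inter> U" using parts by (auto simp: boundary_parts_def openin_open)
 have "U \<inter> \<Gamma>N \<noteq> {}" using open_Int_closure_eq_empty[OF U(1), of \<Gamma>N] y U(2) by blast
 moreover have "\<Gamma>N \<subseteq> frontier D" using parts openin_imp_subset unfolding boundary_parts_def by blast
 ultimately have "\<Gamma>D \<inter> \<Gamma>N \<noteq> {}" using U(2) by blast
 then show False using parts by (simp add: boundary_parts_def)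
qed

lemma closure_Dirichlet_subset: "closure \<Gamma>D \<subseteq> frontier D" "closure \<Gamma>N \<subseteq> frontier D"
 using parts unfolding boundary_parts_def by blast+

text \<open>Near its centre a boundary side is the whole frontier, so a side in the closure of
  \<open>\<Gamma>D\<close> contains points of \<open>\<Gamma>D\<close> itself, and these stay away
  from the closure of \<open>\<Gamma>N\<close>.\<close>

lemma facet_not_both:
 assumes "T \<in> M" "S facet_of T" "S \<subseteq> closure \<Gamma>D" "S \<subseteq> closure \<Gamma>N"
 shows False
proof -
 have "S \<subseteq> frontier D" using assms(3) closure_Dirichlet_subset by blast
 then obtain B z where B: "open B" "z \<in> B" "z \<in> S" "B \<inter> frontier D \<subseteq> S" using frontier_near_facet[OF assms(1,2)] by blast
 have "B \<inter> \<Gamma>D \<noteq> {}" using open_Int_closure_eq_empty[OF B(1), of \<Gamma>D] B(2,3) assms(3) by blast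
 then obtain y where y: "y \<in> B" "y \<in> \<Gamma>D" by blast
 then have "y \<in> S" using B(4) closure_Dirichlet_subset(1) closure_subset by blast
 then show False using Dirichlet_not_closure_Neumann[OF y(2)] assms(4) by blast
qed

text \<open>Near a point of \<open>\<Gamma>D\<close> the closure of \<open>\<Gamma>N\<close> is
  absent. A generic segment inside such a ball, from the domain to its exterior, crosses the
  frontier in the relative interior of a facet; that facet lies on the frontier and, if it is not a
  Dirichlet side, in the closure of \<open>\<Gamma>N\<close>.\<close>

lemma ex_Dirichlet_facet:
 obtains T S where "T \<in> M" "S facet_of T" "S \<subseteq> closure \<Gamma>D"
proof (rule ccontr)
 assume "\<not> thesis"
 then have none: "\<not> S \<subseteq> closure \<Gamma>D" if "T \<in> M" "S facet_of T" for T S using that \<open>\<And>T S. T \<in> M \<Longrightarrow> S facet_of T \<Longrightarrow> S \<subseteq> closure \<Gamma>D \<Longrightarrow> thesis\<close> by blast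
 obtain z where z: "z \<in> \<Gamma>D" using parts by (auto simp: boundary_parts_def)
 have "open (- closure \<Gamma>N)" "z \<in> - closure \<Gamma>N" using Dirichlet_not_closure_Neumann[OF z] by auto
 then obtain r where r: "r > 0" "ball z r \<subseteq> - closure \<Gamma>N" using open_contains_ball by blast
 have "z \<in> frontier D" using z closure_Dirichlet_subset closure_subset by blast
 then have zcl: "z \<in> closure D" "z \<notin> interior (closure D)" using interior_closure domain_facts(1) by (auto simp: frontier_def interior_open)
 \<comment> \<open>Exterior points exist arbitrarily close to \<open>z\<close> because the domain is
   the interior of its closure.\<close>
 have "\<not> ball z r \<subseteq> closure D" using zcl(2) r(1) mem_interior by blast
 then obtain q where q: "q \<in> ball z r" "q \<notin> closure D" by blast
 have U: "open (ball z r \<inter> D)" "ball z r \<inter> D \<noteq> {}"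
 proof -
  show "open (ball z r \<inter> D)" using domain_facts(1) by blast
  have "z \<in> ball z r" using r(1) by simp
  then show "ball z r \<inter> D \<noteq> {}" using zcl(1) open_Int_closure_eq_empty[OF open_ball[of z r], of D] by blast
 qed
 obtain p where p: "p \<in> ball z r \<inter> D" and gen: "\<And>y T C c c'. y \<in> closed_segment p q \<Longrightarrow> full_simplex C \<Longrightarrow> convex hull C \<in> M \<Longrightarrow>
  y \<in> convex hull C \<Longrightarrow> c \<in> C \<Longrightarrow> c' \<in> C \<Longrightarrow> c \<noteq> c' \<Longrightarrow>
  \<not> (full_simplex.lam C c y = 0 \<and> full_simplex.lam C c' y = 0)" using generic_segment[OF U q(2)] by metis
 have "closed_segment p q \<inter> frontier D \<noteq> {}"
 proof (rule connected_Int_frontier)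
  show "closed_segment p q \<inter> D \<noteq> {}" using p by auto
  show "closed_segment p q - D \<noteq> {}" using q(2) closure_subset by auto
 qed simp
 then obtain y where y: "y \<in> closed_segment p q" "y \<in> frontier D" by blast
 have yB: "y \<in> ball z r" using y(1) p q(1) convex_ball[of z r] by (meson IntD1 convex_contains_segment subsetD)
 have "y \<in> closure D" using y(2) by (simp add: frontier_def)
 then obtain T where T: "T \<in> M" "y \<in> T" using Union_M by blast
 obtain C where C: "full_simplex C" "T = convex hull C" using element_simplex[OF T(1)] by blast
 interpret full_simplex C by fact
 have yn: "y \<notin> D" using y(2) domain_facts(1) by (simp add: frontier_def interior_open)
 then have "y \<notin> interior T" using interior_element_subset[OF T(1)] by blast
 then obtain v where v: "v \<in> C" "\<not> 0 < lam v y" unfolding C(2) interior_T by blast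
 have ylam: "0 \<le> lam c y" if "c \<in> C" for c using T(2) C(2) that by (simp add: mem_T)
 have yv: "lam v y = 0" using v ylam[OF v(1)] by simp
 have yc: "0 < lam c y" if "c \<in> C - {v}" for c
 proof -
  have "lam c y \<noteq> 0" using gen[OF y(1) C(1) _ _ _ v(1), of c] T C(2) that yv by auto
  then show ?thesis using ylam[of c] that by simp
 qed
 let ?S = "fct v"
 have S: "?S facet_of T" using facet_iff C(2) v(1) by blast
 have yri: "y \<in> rel_interior ?S" by (rule rel_interior_fct[OF v(1) yv yc])
 have "?S \<subseteq> frontier D"
 proof (rule ccontr)
  assume "\<not> ?S \<subseteq> frontier D"
  then obtain T' where T': "T' \<in> M" "T' \<noteq> T" "?S facet_of T'" using facet_neighbor[OF T(1) S] by blast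
  then have "y \<in> D" using common_facet_opposite(2)[OF T(1) T'(1) _ S T'(3)] yri by blast
  then show False using yn by simp
 qed
 then have "?S \<subseteq> closure \<Gamma>N" using res T(1) S none[OF T(1) S] by (auto simp: mesh_resolves_boundary_def)
 then have "y \<in> closure \<Gamma>N" using yri rel_interior_subset by blast
 then show False using yB r(2) by blast
qed

end

end

section \<open>Element-wise affine fields\<close>

lemma affine_eq_on_open:
 fixes A B :: "real^'n \<Rightarrow> 'b::euclidean_space"
 assumes "linear A" "linear B" "open U" "U \<noteq> {}" and eq: "\<And>x. x \<in> U \<Longrightarrow> A x + a = B x + b"
 shows "A = B" "a = b"
proof -
 obtain x r where x: "x \<in> U" "r > 0" "ball x r \<subseteq> U" using assms(3,4) open_contains_ball by blast
 show AB: "A = B"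
 proof
  fix y :: "real^'n"
  define t where "t = r / (2 * (norm y + 1))"
  have t: "t > 0" using x(2) by (simp add: t_def add_nonneg_pos)
  have "t * norm y \<le> r / (2 * (norm y + 1)) * (norm y + 1)" unfolding t_def using x(2) by (intro mult_left_mono) auto
  also have "... = r / 2" by (simp add: field_simps add_nonneg_eq_0_iff)
  finally have "t * norm y < r" using x(2) by linarith
  then have "x + t *\<^sub>R y \<in> U" using x(3) t by (auto simp: dist_norm subset_eq)
  from eq[OF this] have "t *\<^sub>R A y + (A x + a) = t *\<^sub>R B y + (B x + b)"
   by (simp add: linear_add[OF assms(1)] linear_add[OF assms(2)] linear_scale[OF assms(1)] linear_scale[OF assms(2)] add_ac)
  then have "t *\<^sub>R A y = t *\<^sub>R B y" using eq[OF x(1)] by simp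
  then show "A y = B y" using t by simp
 qed
 show "a = b" using eq[OF x(1)] AB by simp
qed

text \<open>The affine extension to the whole space of the restriction of \<open>f\<close> to the
  interior of \<open>T\<close>; unlike \<open>f\<close> itself it may be evaluated and integrated on
  the sides.\<close>

definition ea :: "(real^'n) set \<Rightarrow> (real^'n \<Rightarrow> 'b::euclidean_space) \<Rightarrow> real^'n \<Rightarrow> 'b" where
 "ea T f = (SOME q. (\<exists>A b. linear A \<and> q = (\<lambda>x. A x + b)) \<and> (\<forall>x\<in>interior T. f x = q x))"

definition facets :: "(real^'n) set \<Rightarrow> (real^'n) set set" where "facets T = {S. S facet_of T}"

text \<open>The element-wise row divergence; \<open>RT_weak_div\<close> identifies it with the weak
  one for Raviart--Thomas fields.\<close>

definition rt_div :: "(real^'n \<Rightarrow> real^'n^'n) \<Rightarrow> real^'n \<Rightarrow> real^'n" where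
 "rt_div \<tau> x = (\<chi> i. trace (jacobian (\<lambda>y. \<tau> y $ i) (at x)))"

definition P0 :: "(real^'n) set set \<Rightarrow> (real^'n \<Rightarrow> 'b::euclidean_space) set" where
 "P0 M = {f. \<forall>T\<in>M. \<exists>c. \<forall>x\<in>interior T. f x = c}"

lemma linear_continuous_UNIV:
 fixes A :: "real^'n \<Rightarrow> 'b::euclidean_space"
 shows "linear A \<Longrightarrow> continuous_on UNIV (\<lambda>x. A x + b)" by (intro continuous_intros linear_continuous_on) (simp add: linear_conv_bounded_linear)

context mesh
begin

lemma interior_element_nonempty: "T \<in> M \<Longrightarrow> interior T \<noteq> {}" by (metis element_simplex full_simplex.interior_T_nonempty)

lemma measure_element_pos: "T \<in> M \<Longrightarrow> measure lebesgue (interior T) > 0" by (metis element_simplex full_simplex.measure_interior_T_pos)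

lemma interior_lmeasurable: "T \<in> M \<Longrightarrow> interior T \<in> lmeasurable" "interior T \<in> sets lebesgue"
 using bounded_subset[OF domain_facts(3) interior_element_subset] by (auto intro: lmeasurable_open)

lemma ea_P1:
 assumes "f \<in> P1 M" "T \<in> M"
 obtains A b where "linear A" "ea T f = (\<lambda>x. A x + b)" "\<And>x. x \<in> interior T \<Longrightarrow> f x = ea T f x"
proof -
 obtain A b where "linear A" "\<forall>x\<in>interior T. f x = A x + b" using assms unfolding P1_def by blast
 then have "\<exists>q. (\<exists>A b. linear A \<and> q = (\<lambda>x. A x + b)) \<and> (\<forall>x\<in>interior T. f x = q x)" by blast
 from someI_ex[OF this] show ?thesis unfolding ea_def[symmetric] using that by blast
qed

lemma ea_eq:
 assumes "f \<in> P1 M" "T \<in> M" "linear A" "\<And>x. x \<in> interior T \<Longrightarrow> f x = A x + b"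
 shows "ea T f = (\<lambda>x. A x + b)"
proof -
 obtain A' b' where a: "linear A'" "ea T f = (\<lambda>x. A' x + b')" "\<And>x. x \<in> interior T \<Longrightarrow> f x = ea T f x" using ea_P1[OF assms(1,2)] by blast
 have "A' = A" "b' = b" using affine_eq_on_open[OF a(1) assms(3) open_interior interior_element_nonempty[OF assms(2)], of b' b] a(2,3) assms(4) by auto
 then show ?thesis using a(2) by simp
qed

lemma ea_continuous:
 assumes "f \<in> P1 M" "T \<in> M" shows "continuous_on UNIV (ea T f)"
proof -
 obtain A b where "linear A" "ea T f = (\<lambda>x. A x + b)" using ea_P1[OF assms] by blast
 then show ?thesis using linear_continuous_UNIV[of A b] by simp
qed

text \<open>The interior is dense in the convex set \<open>T\<close>, so the limit defining
  \<open>elem_val\<close> is taken along a nontrivial filter and picks up the affine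
  extension.\<close>

lemma elem_val_ea:
 assumes f: "f \<in> P1 M" and T: "T \<in> M" and x: "x \<in> T"
 shows "elem_val T f x = ea T f x"
proof -
 obtain A b where a: "linear A" "ea T f = (\<lambda>x. A x + b)" "\<And>x. x \<in> interior T \<Longrightarrow> f x = ea T f x" using ea_P1[OF f T] by blast
 have "(ea T f \<longlongrightarrow> ea T f x) (at x within interior T)" using ea_continuous[OF f T] by (meson continuous_on_def UNIV_I subset_UNIV tendsto_within_subset)
 then have lim: "(f \<longlongrightarrow> ea T f x) (at x within interior T)"
  by (rule Lim_transform_eventually) (auto simp: eventually_at_filter a(3) intro!: always_eventually)
 have "closure (interior T) = closure T" by (rule convex_closure_interior[OF element_convex[OF T] interior_element_nonempty[OF T]])
 then have "x \<in> closure (interior T)" using x closure_subset by blast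
 then have "x islimpt interior T" using interior_limit_point[of x "interior T"] by (auto simp: closure_def)
 then have "\<not> trivial_limit (at x within interior T)" by (simp add: trivial_limit_within)
 then show ?thesis unfolding elem_val_def using lim by (rule tendsto_Lim)
qed

lemma P1_add [intro]: "f \<in> P1 M \<Longrightarrow> g \<in> P1 M \<Longrightarrow> (\<lambda>x. f x + g x) \<in> P1 M"
 and ea_add: "f \<in> P1 M \<Longrightarrow> g \<in> P1 M \<Longrightarrow> T \<in> M \<Longrightarrow> ea T (\<lambda>x. f x + g x) = (\<lambda>x. ea T f x + ea T g x)"
proof -
 have *: "\<exists>A b. linear A \<and> (\<lambda>x. ea T f x + ea T g x) = (\<lambda>x. A x + b) \<and> (\<forall>x\<in>interior T. f x + g x = A x + b)"
  if f: "f \<in> P1 M" and g: "g \<in> P1 M" and T: "T \<in> M" for T f g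
 proof -
  obtain A b where a: "linear A" "ea T f = (\<lambda>x. A x + b)" "\<And>x. x \<in> interior T \<Longrightarrow> f x = ea T f x" using ea_P1[OF f T] by blast
  obtain A' b' where a': "linear A'" "ea T g = (\<lambda>x. A' x + b')" "\<And>x. x \<in> interior T \<Longrightarrow> g x = ea T g x" using ea_P1[OF g T] by blast
  show ?thesis by (rule exI[of _ "\<lambda>x. A x + A' x"], rule exI[of _ "b + b'"]) (use a a' in \<open>auto simp: linear_compose_add\<close>)
 qed
 show P: "f \<in> P1 M \<Longrightarrow> g \<in> P1 M \<Longrightarrow> (\<lambda>x. f x + g x) \<in> P1 M" unfolding P1_def[of M] mem_Collect_eq
  using * unfolding P1_def[of M] mem_Collect_eq by blast
 show "f \<in> P1 M \<Longrightarrow> g \<in> P1 M \<Longrightarrow> T \<in> M \<Longrightarrow> ea T (\<lambda>x. f x + g x) = (\<lambda>x. ea T f x + ea T g x)"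
 proof -
  assume fg: "f \<in> P1 M" "g \<in> P1 M" and T: "T \<in> M"
  obtain A b where a: "linear A" "(\<lambda>x. ea T f x + ea T g x) = (\<lambda>x. A x + b)" "\<And>x. x \<in> interior T \<Longrightarrow> f x + g x = A x + b"
   using *[OF fg T] by blast
  show "ea T (\<lambda>x. f x + g x) = (\<lambda>x. ea T f x + ea T g x)" using ea_eq[OF P[OF fg] T a(1,3)] a(2) by simp
 qed
qed

lemma P1_bounded_linear:
 assumes f: "f \<in> P1 M" and h: "linear h"
 shows "(\<lambda>x. h (f x)) \<in> P1 M" and "T \<in> M \<Longrightarrow> ea T (\<lambda>x. h (f x)) = (\<lambda>x. h (ea T f x))"
proof -
 have *: "\<exists>A b. linear A \<and> (\<lambda>x. h (ea T f x)) = (\<lambda>x. A x + b) \<and> (\<forall>x\<in>interior T. h (f x) = A x + b)"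
  if T: "T \<in> M" for T
 proof -
  obtain A b where a: "linear A" "ea T f = (\<lambda>x. A x + b)" "\<And>x. x \<in> interior T \<Longrightarrow> f x = ea T f x" using ea_P1[OF f T] by blast
  show ?thesis by (rule exI[of _ "h \<circ> A"], rule exI[of _ "h b"]) (use a in \<open>auto simp: linear_compose[OF a(1) h] linear_add[OF h]\<close>)
 qed
 show P: "(\<lambda>x. h (f x)) \<in> P1 M" unfolding P1_def[of M] mem_Collect_eq using * by blast
 assume T: "T \<in> M"
 obtain A b where a: "linear A" "(\<lambda>x. h (ea T f x)) = (\<lambda>x. A x + b)" "\<And>x. x \<in> interior T \<Longrightarrow> h (f x) = A x + b"
  using *[OF T] by blast
 show "ea T (\<lambda>x. h (f x)) = (\<lambda>x. h (ea T f x))" using ea_eq[OF P T a(1,3)] a(2) by simp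
qed

lemma P1_scaleR: "f \<in> P1 M \<Longrightarrow> (\<lambda>x. c *\<^sub>R f x) \<in> P1 M"
 and ea_scaleR: "f \<in> P1 M \<Longrightarrow> T \<in> M \<Longrightarrow> ea T (\<lambda>x. c *\<^sub>R f x) = (\<lambda>x. c *\<^sub>R ea T f x)"
 using P1_bounded_linear[of f "\<lambda>x. c *\<^sub>R x"] by (auto simp: linear_scaleR)

lemma P1_row: "\<tau> \<in> P1 M \<Longrightarrow> (\<lambda>x. \<tau> x $ i) \<in> P1 M"
 and ea_row: "\<tau> \<in> P1 M \<Longrightarrow> T \<in> M \<Longrightarrow> ea T (\<lambda>x. \<tau> x $ i) = (\<lambda>x. ea T \<tau> x $ i)"
 using P1_bounded_linear[of \<tau> "\<lambda>x. x $ i"] by (auto simp: bounded_linear.linear[OF bounded_linear_vec_nth])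

lemma P0_subset_P1: "f \<in> P0 M \<Longrightarrow> f \<in> P1 M" unfolding P0_def P1_def mem_Collect_eq
proof
 fix T assume "\<forall>T\<in>M. \<exists>c. \<forall>x\<in>interior T. f x = c" "T \<in> M"
 then obtain c where c: "\<forall>x\<in>interior T. f x = c" by blast
 show "\<exists>A b. linear A \<and> (\<forall>x\<in>interior T. f x = A x + b)" by (rule exI[of _ "\<lambda>x. 0"], rule exI[of _ c]) (use c linear_zero in auto)
qed

lemma jacobian_P1:
 assumes f: "f \<in> P1 M" and T: "T \<in> M" and A: "linear A" "ea T f = (\<lambda>x. A x + b)" and x: "x \<in> interior T"
 shows "jacobian f (at x) = matrix A"
proof -
 have "((\<lambda>x. A x + b) has_derivative A) (at x)" using linear_imp_has_derivative[OF A(1)] by (auto intro!: derivative_eq_intros)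
 then have "(f has_derivative A) (at x)"
 proof (rule has_derivative_transform_within_open[OF _ open_interior x])
  fix y assume "y \<in> interior T"
  then show "A y + b = f y" using ea_P1[OF f T] A(2) by metis
 qed
 then have "frechet_derivative f (at x) = A" by (rule frechet_derivative_at[symmetric])
 then show ?thesis by (simp add: jacobian_def)
qed

lemma grad_h_P1:
 assumes f: "f \<in> P1 M" and T: "T \<in> M"
 obtains A b where "linear A" "ea T f = (\<lambda>x. A x + b)" "\<And>x. x \<in> interior T \<Longrightarrow> f x = A x + b"
  "\<And>x. x \<in> interior T \<Longrightarrow> grad_h f x = matrix A"
proof -
 obtain A b where a: "linear A" "ea T f = (\<lambda>x. A x + b)" "\<And>x. x \<in> interior T \<Longrightarrow> f x = ea T f x"
  by (rule ea_P1[OF f T]) (rule that; assumption)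
 show ?thesis by (rule that[OF a(1,2)]) (use a jacobian_P1[OF f T a(1,2)] in \<open>auto simp: grad_h_def\<close>)
qed

lemma grad_h_P0:
 assumes "f \<in> P1 M" shows "grad_h f \<in> P0 M" unfolding P0_def mem_Collect_eq
proof
 fix T assume T: "T \<in> M"
 obtain A b where "linear A" "ea T f = (\<lambda>x. A x + b)" "\<And>x. x \<in> interior T \<Longrightarrow> f x = A x + b"
  and g: "\<And>x. x \<in> interior T \<Longrightarrow> grad_h f x = matrix A" by (rule grad_h_P1[OF assms T]) (rule that; assumption)
 from g show "\<exists>c. \<forall>x\<in>interior T. grad_h f x = c" by blast
qed

lemma P0_map: "f \<in> P0 M \<Longrightarrow> (\<lambda>x. h (f x)) \<in> P0 M" unfolding P0_def by fastforce

lemma P0_map2: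
 assumes "f \<in> P0 M" "g \<in> P0 M" shows "(\<lambda>x. h (f x) (g x)) \<in> P0 M" unfolding P0_def mem_Collect_eq
proof
 fix T assume T: "T \<in> M"
 obtain c d where "\<forall>x\<in>interior T. f x = c" "\<forall>x\<in>interior T. g x = d" using assms T unfolding P0_def by blast
 then show "\<exists>c. \<forall>x\<in>interior T. h (f x) (g x) = c" by (intro exI[of _ "h c d"]) simp
qed

lemma grad_h_add:
 assumes "f \<in> P1 M" "g \<in> P1 M" "T \<in> M" "x \<in> interior T"
 shows "grad_h (\<lambda>x. f x + g x) x = grad_h f x + grad_h g x"
proof -
 obtain A b where a: "linear A" "ea T f = (\<lambda>x. A x + b)" and "\<And>x. x \<in> interior T \<Longrightarrow> f x = A x + b"
  and a3: "\<And>x. x \<in> interior T \<Longrightarrow> grad_h f x = matrix A" by (rule grad_h_P1[OF assms(1,3)]) (rule that; assumption)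
 obtain B c where b: "linear B" "ea T g = (\<lambda>x. B x + c)" and "\<And>x. x \<in> interior T \<Longrightarrow> g x = B x + c"
  and b3: "\<And>x. x \<in> interior T \<Longrightarrow> grad_h g x = matrix B" by (rule grad_h_P1[OF assms(2,3)]) (rule that; assumption)
 have "ea T (\<lambda>x. f x + g x) = (\<lambda>x. (A x + B x) + (b + c))" using ea_add[OF assms(1,2,3)] a(2) b(2) by (simp add: fun_eq_iff)
 then have "grad_h (\<lambda>x. f x + g x) x = matrix (\<lambda>x. A x + B x)"
  unfolding grad_h_def by (rule jacobian_P1[OF P1_add[OF assms(1,2)] assms(3) linear_compose_add[OF a(1) b(1)] _ assms(4)])
 then show ?thesis using a3 b3 assms(4) by (simp add: matrix_def vec_eq_iff)
qed

lemma grad_h_scaleR: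
 assumes "f \<in> P1 M" "T \<in> M" "x \<in> interior T"
 shows "grad_h (\<lambda>x. c *\<^sub>R f x) x = c *\<^sub>R grad_h f x"
proof -
 obtain A b where a: "linear A" "ea T f = (\<lambda>x. A x + b)" and "\<And>x. x \<in> interior T \<Longrightarrow> f x = A x + b"
  and a3: "\<And>x. x \<in> interior T \<Longrightarrow> grad_h f x = matrix A" by (rule grad_h_P1[OF assms(1,2)]) (rule that; assumption)
 have "ea T (\<lambda>x. c *\<^sub>R f x) = (\<lambda>x. c *\<^sub>R A x + c *\<^sub>R b)" using ea_scaleR[OF assms(1,2)] a(2) by (simp add: scaleR_add_right)
 then have "grad_h (\<lambda>x. c *\<^sub>R f x) x = matrix (\<lambda>x. c *\<^sub>R A x)"
  unfolding grad_h_def by (rule jacobian_P1[OF P1_scaleR[OF assms(1)] assms(2) linear_compose_scale_right[OF a(1)] _ assms(3)])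
 then show ?thesis using a3 assms(3) by (simp add: matrix_def vec_eq_iff)
qed

section \<open>Integrals and means over elements\<close>

lemma integral_split:
 fixes f :: "real^'n \<Rightarrow> 'b::euclidean_space"
 assumes f: "integrable (leb D) f"
 shows "(LINT x|leb D. f x) = (\<Sum>T\<in>M. LINT x|leb (interior T). f x)"
proof -
 have i: "integrable lebesgue (\<lambda>x. indicator D x *\<^sub>R f x)" using f dom_sets by (simp add: integrable_restrict_space)
 have iT: "integrable lebesgue (\<lambda>x. indicator (interior T) x *\<^sub>R (indicator D x *\<^sub>R f x))" if "T \<in> M" for T
  by (rule integrable_mult_indicator[OF _ i]) simp
 have ae0: "AE x in lebesgue. x \<in> D \<longrightarrow> (\<exists>T\<in>M. x \<in> interior T)" using AE_in_element dom_sets by (simp add: AE_restrict_space_iff)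
 have ae: "AE x in lebesgue. indicator D x *\<^sub>R f x = (\<Sum>T\<in>M. indicator (interior T) x *\<^sub>R (indicator D x *\<^sub>R f x))" using ae0
 proof eventually_elim
  case (elim x)
  show ?case
  proof (cases "x \<in> D")
   case True
   then obtain T where T: "T \<in> M" "x \<in> interior T" using elim by auto
   have "(\<Sum>T\<in>M. indicator (interior T) x *\<^sub>R (indicator D x *\<^sub>R f x)) = (\<Sum>T'\<in>M. if T' = T then f x else 0)"
   proof (rule sum.cong[OF refl])
    fix T' assume "T' \<in> M"
    then show "indicator (interior T') x *\<^sub>R (indicator D x *\<^sub>R f x) = (if T' = T then f x else 0)"
     using T True interior_element_disjoint[OF T(1), of T'] interior_subset[of T'] by (auto simp: indicator_def)
   qed
   then show ?thesis using T True by simp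
  qed simp
 qed
 have "(LINT x|leb D. f x) = (LINT x|lebesgue. indicator D x *\<^sub>R f x)" by (rule integral_restrict_space) (use dom_sets in simp)
 also have "... = (LINT x|lebesgue. (\<Sum>T\<in>M. indicator (interior T) x *\<^sub>R (indicator D x *\<^sub>R f x)))"
  by (rule integral_cong_AE[OF borel_measurable_integrable[OF i] _ ae]) (intro borel_measurable_sum borel_measurable_integrable iT)
 also have "... = (\<Sum>T\<in>M. LINT x|lebesgue. indicator (interior T) x *\<^sub>R (indicator D x *\<^sub>R f x))"
  by (rule Bochner_Integration.integral_sum) (rule iT)
 also have "... = (\<Sum>T\<in>M. LINT x|leb (interior T). f x)"
 proof (rule sum.cong[OF refl])
  fix T assume T: "T \<in> M"
  have "(LINT x|lebesgue. indicator (interior T) x *\<^sub>R (indicator D x *\<^sub>R f x)) = (LINT x|lebesgue. indicator (interior T) x *\<^sub>R f x)"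
   by (rule Bochner_Integration.integral_cong) (use interior_element_subset[OF T] in \<open>auto simp: indicator_def\<close>)
  also have "... = (LINT x|leb (interior T). f x)" by (rule integral_restrict_space[symmetric]) simp
  finally show "(LINT x|lebesgue. indicator (interior T) x *\<^sub>R (indicator D x *\<^sub>R f x)) = (LINT x|leb (interior T). f x)" .
 qed
 finally show ?thesis .
qed

lemma piecewise_L2:
 fixes f :: "real^'n \<Rightarrow> 'b::euclidean_space"
 assumes "\<And>T. T \<in> M \<Longrightarrow> \<exists>q. continuous_on UNIV q \<and> (\<forall>x\<in>interior T. f x = q x)"
 shows "f \<in> L2_space D"
proof -
 obtain q where q: "\<And>T. T \<in> M \<Longrightarrow> continuous_on UNIV (q T)" "\<And>T x. T \<in> M \<Longrightarrow> x \<in> interior T \<Longrightarrow> f x = q T x"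
  using assms by metis
 have iL: "(\<lambda>x. indicator (interior T) x *\<^sub>R q T x) \<in> L2_space D" if T: "T \<in> M" for T
 proof -
  have qL: "q T \<in> L2_space D" by (rule continuous_L2[OF dom_sets(1) domain_facts(3) q(1)[OF T]])
  show ?thesis
  proof (rule L2_spaceI_bound[OF _ L2_norm_sq_integrable[OF qL]])
   show "(\<lambda>x. indicator (interior T) x *\<^sub>R q T x) \<in> borel_measurable (leb D)"
    by (rule borel_measurable_scaleR[OF measurable_restrict_space1[OF borel_measurable_indicator[OF interior_lmeasurable(2)]] L2_measurable[OF qL]])
  qed (auto simp: indicator_def)
 qed
 show ?thesis
 proof (rule L2_cong_AE[OF dom_sets(1)])
  show "(\<lambda>x. \<Sum>T\<in>M. indicator (interior T) x *\<^sub>R q T x) \<in> L2_space D" by (rule L2_sum) (rule iL)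
  show "AE x in leb D. (\<Sum>T\<in>M. indicator (interior T) x *\<^sub>R q T x) = f x" using AE_in_element
  proof eventually_elim
   case (elim x)
   then obtain T where T: "T \<in> M" "x \<in> interior T" by blast
   have "(\<Sum>T\<in>M. indicator (interior T) x *\<^sub>R q T x) = (\<Sum>T'\<in>M. if T' = T then f x else 0)"
   proof (rule sum.cong[OF refl])
    fix T' assume "T' \<in> M"
    then show "indicator (interior T') x *\<^sub>R q T' x = (if T' = T then f x else 0)"
     using T q(2) interior_element_disjoint[OF T(1), of T'] interior_subset[of T'] by (auto simp: indicator_def)
   qed
   then show ?case using T by simp
  qed
 qed
qed

lemma P1_L2:
 assumes "f \<in> P1 M" shows "f \<in> L2_space D"
proof (rule piecewise_L2)
 fix T assume T: "T \<in> M"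
 have "\<forall>x\<in>interior T. f x = ea T f x" using ea_P1[OF assms T] by blast
 then show "\<exists>q. continuous_on UNIV q \<and> (\<forall>x\<in>interior T. f x = q x)" using ea_continuous[OF assms T] by blast
qed

lemma P0_L2: "f \<in> P0 M \<Longrightarrow> f \<in> L2_space D" by (rule P1_L2[OF P0_subset_P1])

lemma Pi_h_interior:
 assumes "T \<in> M" "x \<in> interior T"
 shows "Pi_h M f x = (LINT y|leb (interior T). f y) /\<^sub>R measure lebesgue (interior T)"
proof -
 have "Pi_h M f x = (\<Sum>T'\<in>M. if T' = T then (LINT y|leb (interior T). f y) /\<^sub>R measure lebesgue (interior T) else 0)" unfolding Pi_h_def
 proof (rule sum.cong[OF refl])
  fix T' assume "T' \<in> M"
  then show "indicator (interior T') x *\<^sub>R ((LINT y|leb (interior T'). f y) /\<^sub>R measure lebesgue (interior T')) =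
    (if T' = T then (LINT y|leb (interior T). f y) /\<^sub>R measure lebesgue (interior T) else 0)"
   using assms interior_element_disjoint[OF assms(1), of T'] interior_subset[of T'] by (auto simp: indicator_def)
 qed
 then show ?thesis using assms(1) by simp
qed

lemma Pi_h_P0: "Pi_h M f \<in> P0 M" unfolding P0_def using Pi_h_interior by blast

lemma Pi_h_L2: "Pi_h M f \<in> L2_space D" by (rule P0_L2[OF Pi_h_P0])

lemma L2_element: "f \<in> L2_space D \<Longrightarrow> T \<in> M \<Longrightarrow> f \<in> L2_space (interior T)"
 by (rule L2_subset(1)[OF _ dom_sets(1) interior_element_subset]) auto

lemma L2_element_integrable: "f \<in> L2_space D \<Longrightarrow> T \<in> M \<Longrightarrow> integrable (leb (interior T)) f"
 by (rule L2_integrable[OF interior_lmeasurable(1) L2_element])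

lemma AE_elementI: "(\<And>T x. T \<in> M \<Longrightarrow> x \<in> interior T \<Longrightarrow> P x) \<Longrightarrow> AE x in leb D. P x"
 using AE_in_element by eventually_elim blast

lemma Pi_h_add:
 assumes "f \<in> L2_space D" "g \<in> L2_space D" "T \<in> M" "x \<in> interior T"
 shows "Pi_h M (\<lambda>x. f x + g x) x = Pi_h M f x + Pi_h M g x" using L2_element_integrable[OF assms(1,3)] L2_element_integrable[OF assms(2,3)]
 by (simp add: Pi_h_interior[OF assms(3,4)] scaleR_add_right)

lemma Pi_h_bounded_linear:
 assumes "f \<in> L2_space D" "bounded_linear h" "T \<in> M" "x \<in> interior T"
 shows "Pi_h M (\<lambda>x. h (f x)) x = h (Pi_h M f x)" using integral_bounded_linear[OF assms(2) L2_element_integrable[OF assms(1,3)]]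
 by (simp add: Pi_h_interior[OF assms(3,4)] linear_scale[OF bounded_linear.linear[OF assms(2)]])

lemma Pi_h_of_P0:
 assumes "f \<in> P0 M" "T \<in> M" "x \<in> interior T"
 shows "Pi_h M f x = f x"
proof -
 obtain c where c: "\<And>x. x \<in> interior T \<Longrightarrow> f x = c" using assms(1,2) unfolding P0_def by blast
 have "(LINT y|leb (interior T). f y) = (LINT y|leb (interior T). c)" by (rule Bochner_Integration.integral_cong) (auto simp: c)
 also have "... = measure lebesgue (interior T) *\<^sub>R c" by (simp add: measure_restrict_space)
 finally show ?thesis using measure_element_pos[OF assms(2)] c[OF assms(3)] by (simp add: Pi_h_interior[OF assms(2,3)])
qed

lemma Pi_h_cong_AE:
 assumes "AE x in leb D. f x = g x" "T \<in> M" "x \<in> interior T"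
 shows "Pi_h M f x = Pi_h M g x"
proof -
 have "AE x in lebesgue. x \<in> D \<longrightarrow> f x = g x" using assms(1) dom_sets by (simp add: AE_restrict_space_iff)
 then have "AE x in lebesgue. x \<in> interior T \<longrightarrow> f x = g x" by eventually_elim (use interior_element_subset[OF assms(2)] in blast)
 then have "AE x in leb (interior T). f x = g x" by (simp add: AE_restrict_space_iff)
 then show ?thesis using integral_cong_AE_lebesgue_on[of "interior T" f g] by (simp add: Pi_h_interior[OF assms(2,3)])
qed

text \<open>Element means are the orthogonal projection onto element-wise constants.\<close>

lemma ip_Pi_h:
 assumes f: "f \<in> L2_space D" and g: "g \<in> P0 M"
 shows "ip D (Pi_h M f) g = ip D f g"
proof -
 have gL: "g \<in> L2_space D" by (rule P0_L2[OF g])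
 have "(LINT x|leb (interior T). Pi_h M f x \<bullet> g x) = (LINT x|leb (interior T). f x \<bullet> g x)" if T: "T \<in> M" for T
 proof -
  obtain c where c: "\<And>x. x \<in> interior T \<Longrightarrow> g x = c" using g T unfolding P0_def by blast
  let ?m = "(LINT y|leb (interior T). f y) /\<^sub>R measure lebesgue (interior T)"
  have "(LINT x|leb (interior T). Pi_h M f x \<bullet> g x) = (LINT x|leb (interior T). ?m \<bullet> c)"
   by (rule Bochner_Integration.integral_cong) (simp_all add: Pi_h_interior[OF T] c)
  also have "... = (LINT y|leb (interior T). f y) \<bullet> c" using measure_element_pos[OF T] by (simp add: measure_restrict_space)
  also have "... = (LINT y|leb (interior T). f y \<bullet> c)" using L2_element_integrable[OF f T] by simp
  also have "... = (LINT y|leb (interior T). f y \<bullet> g y)" by (rule Bochner_Integration.integral_cong) (simp_all add: c)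
  finally show ?thesis .
 qed
 then show ?thesis unfolding ip_def using integral_split[OF L2_inner_integrable[OF Pi_h_L2 gL]] integral_split[OF L2_inner_integrable[OF f gL]] by (simp cong: sum.cong)
qed

end

section \<open>Discrete integration by parts\<close>

text \<open>Meant for fields whose normal component is constant on \<open>S\<close>, where the
  choice of the evaluation point does not matter.\<close>

definition flux :: "(real^'n \<Rightarrow> real^'n^'n) \<Rightarrow> (real^'n) set \<Rightarrow> (real^'n) set \<Rightarrow> real^'n" where
 "flux \<tau> T S = ea T \<tau> (SOME x. x \<in> S) *v outer_normal T S"

lemma matrix_vector_mult_component: "(m *v x) $ i = m $ i \<bullet> (x :: real^'n)" by (simp add: matrix_vector_mult_def inner_vec_def)

lemma matrix_works':
 fixes A :: "real^'n \<Rightarrow> real^'m" shows "linear A \<Longrightarrow> matrix A *v x = A x" using fun_cong[OF matrix_vector_mul(2)[of A], of x] by simp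

context mesh
begin

lemma facet_facts:
 assumes "T \<in> M" "S facet_of T"
 shows smeas_facet_pos: "smeas S > 0" and facet_nonempty: "S \<noteq> {}" and facet_subset: "S \<subseteq> T"
  and side_normal_facet: "side_normal S n \<longleftrightarrow> n = outer_normal T S \<or> n = - outer_normal T S"
  and facet_set_integrable: "continuous_on UNIV f \<Longrightarrow> set_integrable (surface_measure (affine hull S)) S (f :: real^'n \<Rightarrow> 'b::euclidean_space)"
proof -
 obtain C v where C: "full_simplex C" "T = convex hull C" "v \<in> C" "S = convex hull (C - {v})" using element_facet[OF assms] by blast
 interpret full_simplex C by fact
 show "smeas S > 0" using smeas_pos[OF C(3)] C(4) by simp
 show "S \<noteq> {}" using fct_nonempty C(4) by simp
 show "S \<subseteq> T" using assms(2) facet_of_imp_subset by blast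
 show "side_normal S n \<longleftrightarrow> n = outer_normal T S \<or> n = - outer_normal T S"
  unfolding C(2,4) hyperplane_normals[OF C(3)] outer_normal_fct[OF C(3)] by auto
 show "continuous_on UNIV f \<Longrightarrow> set_integrable (surface_measure (affine hull S)) S f" using continuous_set_integrable_fct'[OF C(3)] C(4) by simp
qed

lemma elem_val_facet:
 assumes "f \<in> P1 M" "T \<in> M" "S facet_of T" "x \<in> S"
 shows "elem_val T f x = ea T f x" by (rule elem_val_ea[OF assms(1,2)]) (use facet_subset[OF assms(2,3)] assms(4) in blast)

lemma sint_component:
 fixes f :: "real^'n \<Rightarrow> real^'m"
 assumes "T \<in> M" "S facet_of T" "continuous_on UNIV f"
 shows "sint S f $ i = sint S (\<lambda>x. f x $ i)" unfolding sint_def by (rule set_integral_vec_component[OF facet_set_integrable[OF assms]])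

lemma sint_diff:
 fixes f g :: "real^'n \<Rightarrow> 'b::euclidean_space"
 assumes "T \<in> M" "S facet_of T" "continuous_on UNIV f" "continuous_on UNIV g"
 shows "sint S (\<lambda>x. f x - g x) = sint S f - sint S g"
 unfolding sint_def by (rule set_integral_diff(2)[OF facet_set_integrable[OF assms(1,2,3)] facet_set_integrable[OF assms(1,2,4)]])

lemma sint_add:
 fixes f g :: "real^'n \<Rightarrow> 'b::euclidean_space"
 assumes "T \<in> M" "S facet_of T" "continuous_on UNIV f" "continuous_on UNIV g"
 shows "sint S (\<lambda>x. f x + g x) = sint S f + sint S g"
 unfolding sint_def by (rule set_integral_add(2)[OF facet_set_integrable[OF assms(1,2,3)] facet_set_integrable[OF assms(1,2,4)]])

lemma sint_scaleR:
 fixes f :: "real^'n \<Rightarrow> 'b::euclidean_space"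
 assumes "T \<in> M" "S facet_of T" "continuous_on UNIV f"
 shows "sint S (\<lambda>x. c *\<^sub>R f x) = c *\<^sub>R sint S f"
proof -
 have "(\<lambda>x. indicat_real S x *\<^sub>R (c *\<^sub>R f x)) = (\<lambda>x. c *\<^sub>R (indicat_real S x *\<^sub>R f x))" by (simp add: fun_eq_iff)
 then show ?thesis unfolding sint_def set_lebesgue_integral_def by (simp only: integral_scaleR_right)
qed

lemma sint_const:
 assumes "T \<in> M" "S facet_of T"
 shows "sint S (\<lambda>x. c :: real) = c * smeas S"
 using sint_scaleR[OF assms, of "\<lambda>x. 1 :: real" c] by (simp add: sint_def smeas_def set_lebesgue_integral_def)

lemma sint_zero [simp]: "sint S (\<lambda>x. 0) = 0" by (simp add: sint_def)

lemma side_mean_eq_0_iff: "T \<in> M \<Longrightarrow> S facet_of T \<Longrightarrow> side_mean S g = 0 \<longleftrightarrow> sint S g = 0"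
 using smeas_facet_pos[of T S] by (simp add: side_mean_sint)

lemma sum_facets:
 assumes "full_simplex C" "T = convex hull C"
 shows "(\<Sum>S\<in>facets T. F S) = (\<Sum>c\<in>C. F (convex hull (C - {c})))" and "finite (facets T)"
proof -
 interpret full_simplex C by fact
 have eq: "facets T = fct ` C" using facet_iff assms(2) by (auto simp: facets_def)
 then show "finite (facets T)" by simp
 have "inj_on fct C"
 proof (rule inj_onI)
  fix c d assume cd: "c \<in> C" "d \<in> C" "fct c = fct d"
  show "c = d"
  proof (rule ccontr)
   assume "c \<noteq> d"
   then have "d \<in> fct c" using cd by (intro hull_inc) auto
   then have "d \<in> fct d" using cd by simp
   then show False using mem_fct[OF cd(2)] lam_vertex[OF cd(2,2)] by simp
  qed
 qed
 then show "(\<Sum>S\<in>facets T. F S) = (\<Sum>c\<in>C. F (fct c))" unfolding eq by (simp add: sum.reindex)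
qed

lemma finite_facets:
 assumes "T \<in> M" shows "finite (facets T)"
proof -
 obtain C where C: "full_simplex C" "T = convex hull C" using element_simplex[OF assms] by blast
 show ?thesis by (rule sum_facets(2)[OF C])
qed

lemma elementwise_ibp:
 assumes T: "T \<in> M" and A: "linear A" and r: "\<And>x. r x = A x + b"
  and \<kappa>: "\<And>S x. S facet_of T \<Longrightarrow> x \<in> S \<Longrightarrow> r x \<bullet> outer_normal T S = \<kappa> S" and c1: "C1_scalar \<phi> \<gamma>"
 shows "(LINT x|leb (interior T). r x \<bullet> \<gamma> x + trace (matrix A) * \<phi> x) = (\<Sum>S\<in>facets T. \<kappa> S * sint S \<phi>)"
proof -
 obtain C where C: "full_simplex C" "T = convex hull C" using element_simplex[OF T] by blast
 interpret full_simplex C by fact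
 show ?thesis unfolding sum_facets(1)[OF C] unfolding C(2)
  by (rule simplex_integration_by_parts[where \<kappa> = "\<lambda>j. \<kappa> (fct j)", OF A r _ c1]) (use \<kappa> facet_iff C(2) in auto)
qed

text \<open>The sums are exchanged; a side off the frontier belongs to exactly two elements.\<close>

lemma facet_sum_cancel:
 fixes F :: "(real^'n) set \<Rightarrow> (real^'n) set \<Rightarrow> real"
 assumes int: "\<And>T T' S. T \<in> M \<Longrightarrow> T' \<in> M \<Longrightarrow> T \<noteq> T' \<Longrightarrow> S facet_of T \<Longrightarrow> S facet_of T' \<Longrightarrow> F T S + F T' S = 0"
  and bdry: "\<And>T S. T \<in> M \<Longrightarrow> S facet_of T \<Longrightarrow> S \<subseteq> frontier D \<Longrightarrow> F T S = 0"
 shows "(\<Sum>T\<in>M. \<Sum>S\<in>facets T. F T S) = 0"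
proof -
 let ?A = "\<Union>T\<in>M. facets T"
 have fin: "finite ?A" using finite_facets by auto
 have "(\<Sum>T\<in>M. \<Sum>S\<in>facets T. F T S) = (\<Sum>T\<in>M. \<Sum>S\<in>{S \<in> ?A. S facet_of T}. F T S)" by (intro sum.cong) (auto simp: facets_def)
 also have "... = (\<Sum>S\<in>?A. \<Sum>T\<in>{T \<in> M. S facet_of T}. F T S)" by (rule sum.swap_restrict[OF finite_M fin])
 also have "... = 0"
 proof (rule sum.neutral, rule ballI)
  fix S assume "S \<in> ?A"
  then obtain T where T: "T \<in> M" "S facet_of T" by (auto simp: facets_def)
  show "(\<Sum>T\<in>{T \<in> M. S facet_of T}. F T S) = 0"
  proof (cases "S \<subseteq> frontier D")
   case True
   then show ?thesis using bdry by (intro sum.neutral) auto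
  next
   case False
   obtain T' where T': "T' \<in> M" "T' \<noteq> T" "S facet_of T'" using facet_neighbor[OF T False] by blast
   have "{T \<in> M. S facet_of T} = {T, T'}" using T T' common_facet_unique[OF T(1) T'(1) _ _ _ T(2) T'(3)] by blast
   then show ?thesis using int[OF T(1) T'(1) _ T(2) T'(3)] T'(2) by simp
  qed
 qed
 finally show ?thesis .
qed

section \<open>Raviart--Thomas fields\<close>

lemma RT_P1: "\<tau> \<in> RT M \<Longrightarrow> \<tau> \<in> P1 M" by (simp add: RT_def)

lemma RT_flux:
 assumes \<tau>: "\<tau> \<in> RT M" and T: "T \<in> M" "S facet_of T" "x \<in> S"
 shows "ea T \<tau> x *v outer_normal T S = flux \<tau> T S"
proof -
 have "side_normal S (outer_normal T S)" using side_normal_facet[OF T(1,2)] by simp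
 then obtain c where c: "\<forall>x\<in>S. elem_val T \<tau> x *v outer_normal T S = c"
  using \<tau>[unfolded RT_def mem_Collect_eq, THEN conjunct2, THEN conjunct1, rule_format, OF T(1) conjI[OF T(2)]] by blast
 then have "ea T \<tau> y *v outer_normal T S = c" if "y \<in> S" for y
  using bspec[OF _ that, of "\<lambda>x. elem_val T \<tau> x *v outer_normal T S = c"] elem_val_facet[OF RT_P1[OF \<tau>] T(1,2) that] by simp
 moreover have "(SOME x. x \<in> S) \<in> S" using T(3) by (rule someI)
 ultimately show ?thesis using T(3) unfolding flux_def by simp
qed

lemma RT_flux_opposite:
 assumes \<tau>: "\<tau> \<in> RT M" and T: "T \<in> M" "T' \<in> M" "T \<noteq> T'" "S facet_of T" "S facet_of T'"
 shows "flux \<tau> T' S = - flux \<tau> T S"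
proof -
 obtain x where x: "x \<in> S" using facet_nonempty[OF T(1,4)] by blast
 have sn: "side_normal S (outer_normal T S)" using side_normal_facet[OF T(1,4)] by simp
 have "elem_val T \<tau> x *v outer_normal T S = elem_val T' \<tau> x *v outer_normal T S"
  by (rule \<tau>[unfolded RT_def mem_Collect_eq, THEN conjunct2, THEN conjunct2, rule_format, OF T(1,2)]) (use T sn x in auto)
 then have "ea T \<tau> x *v outer_normal T S = ea T' \<tau> x *v outer_normal T S"
  by (simp only: elem_val_facet[OF RT_P1[OF \<tau>] T(1,4) x] elem_val_facet[OF RT_P1[OF \<tau>] T(2,5) x])
 moreover have "ea T' \<tau> x *v outer_normal T' S = - (ea T' \<tau> x *v outer_normal T S)"
  unfolding common_facet_opposite(1)[OF T] by (simp add: vec_eq_iff matrix_vector_mult_component)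
 ultimately show ?thesis using RT_flux[OF \<tau> T(1,4) x] RT_flux[OF \<tau> T(2,5) x] by simp
qed

lemma rt_div_interior:
 assumes \<tau>: "\<tau> \<in> P1 M" and T: "T \<in> M" and A: "linear A" "ea T (\<lambda>x. \<tau> x $ i) = (\<lambda>x. A x + b)" and x: "x \<in> interior T"
 shows "rt_div \<tau> x $ i = trace (matrix A)" using jacobian_P1[OF P1_row[OF \<tau>] T A x] by (simp add: rt_div_def)

lemma rt_div_P0:
 assumes \<tau>: "\<tau> \<in> P1 M" shows "rt_div \<tau> \<in> P0 M" unfolding P0_def mem_Collect_eq
proof
 fix T assume T: "T \<in> M"
 have "\<exists>c. \<forall>x\<in>interior T. rt_div \<tau> x $ i = c" for i
 proof -
  obtain A b where a: "linear A" "ea T (\<lambda>x. \<tau> x $ i) = (\<lambda>x. A x + b)"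
   "\<And>x. x \<in> interior T \<Longrightarrow> \<tau> x $ i = ea T (\<lambda>x. \<tau> x $ i) x" by (rule ea_P1[OF P1_row[OF \<tau>] T]) (rule that; assumption)
  show ?thesis using rt_div_interior[OF \<tau> T a(1,2)] by blast
 qed
 then have "\<forall>i. \<exists>c. \<forall>x\<in>interior T. rt_div \<tau> x $ i = c" by blast
 then obtain c where "\<And>i x. x \<in> interior T \<Longrightarrow> rt_div \<tau> x $ i = c i" unfolding choice_iff by blast
 then show "\<exists>c. \<forall>x\<in>interior T. rt_div \<tau> x = c" by (intro exI[of _ "\<chi> i. c i"]) (simp add: vec_eq_iff)
qed

lemma RT_element_ibp:
 assumes P: "\<tau> \<in> P1 M" and T: "T \<in> M"
  and fl: "\<And>S x. S facet_of T \<Longrightarrow> x \<in> S \<Longrightarrow> ea T \<tau> x *v outer_normal T S = flux \<tau> T S" and c1: "C1_scalar \<phi> \<gamma>"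
 shows "(LINT x|leb (interior T). (\<tau> x $ i) \<bullet> \<gamma> x + (rt_div \<tau> x $ i) * \<phi> x) = (\<Sum>S\<in>facets T. (flux \<tau> T S $ i) * sint S \<phi>)"
proof -
 obtain A b where a: "linear A" "ea T (\<lambda>x. \<tau> x $ i) = (\<lambda>x. A x + b)" "\<And>x. x \<in> interior T \<Longrightarrow> \<tau> x $ i = ea T (\<lambda>x. \<tau> x $ i) x"
  by (rule ea_P1[OF P1_row[OF P] T]) (rule that; assumption)
 have "(LINT x|leb (interior T). (\<tau> x $ i) \<bullet> \<gamma> x + (rt_div \<tau> x $ i) * \<phi> x)
  = (LINT x|leb (interior T). (A x + b) \<bullet> \<gamma> x + trace (matrix A) * \<phi> x)"
  by (rule Bochner_Integration.integral_cong) (use a rt_div_interior[OF P T a(1,2)] in auto)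
 also have "... = (\<Sum>S\<in>facets T. (flux \<tau> T S $ i) * sint S \<phi>)"
 proof (rule elementwise_ibp[OF T a(1) refl _ c1])
  fix S x assume S: "S facet_of T" "x \<in> S"
  have "(A x + b) = ea T \<tau> x $ i" using fun_cong[OF a(2), of x] fun_cong[OF ea_row[OF P T, of i], of x] by simp
  then show "(A x + b) \<bullet> outer_normal T S = flux \<tau> T S $ i" using fl[OF S] matrix_vector_mult_component[of "ea T \<tau> x" "outer_normal T S" i] by simp
 qed
 finally show ?thesis .
qed

lemma test_fun_C1_scalar: "test_fun D \<phi> \<gamma> \<Longrightarrow> C1_scalar \<phi> \<gamma>" by (simp add: test_fun_def C1_scalar_def)

text \<open>Element by element, only constant fluxes against side integrals of the test function
  remain. They cancel across interior sides by continuity of the normal component and vanish on the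
  frontier, where the test function is zero.\<close>

lemma RT_weak_div:
 assumes \<tau>: "\<tau> \<in> RT M" shows "is_weak_div D \<tau> (rt_div \<tau>)" unfolding is_weak_div_def
proof (intro conjI allI impI)
 note P = RT_P1[OF \<tau>]
 have \<tau>L: "\<tau> \<in> L2_space D" by (rule P1_L2[OF P])
 show dL: "rt_div \<tau> \<in> L2_space D" by (rule P0_L2[OF rt_div_P0[OF P]])
 fix \<phi> \<gamma> i assume t: "test_fun D \<phi> \<gamma>"
 note tL = test_fun_L2[OF dom_sets(1) t]
 have i1: "integrable (leb D) (\<lambda>x. (\<tau> x $ i) \<bullet> \<gamma> x)" by (rule L2_inner_integrable[OF L2_component[OF \<tau>L] tL(2)])
 have i2: "integrable (leb D) (\<lambda>x. (rt_div \<tau> x $ i) * \<phi> x)" using L2_inner_integrable[OF L2_component[OF dL, of i] tL(1)] by simp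
 have "(LINT x|leb D. (\<tau> x $ i) \<bullet> \<gamma> x) + (LINT x|leb D. (rt_div \<tau> x $ i) * \<phi> x)
   = (LINT x|leb D. (\<tau> x $ i) \<bullet> \<gamma> x + (rt_div \<tau> x $ i) * \<phi> x)" using i1 i2 by simp
 also have "... = (\<Sum>T\<in>M. LINT x|leb (interior T). (\<tau> x $ i) \<bullet> \<gamma> x + (rt_div \<tau> x $ i) * \<phi> x)"
  by (rule integral_split) (use i1 i2 in simp)
 also have "... = (\<Sum>T\<in>M. \<Sum>S\<in>facets T. (flux \<tau> T S $ i) * sint S \<phi>)"
  by (intro sum.cong refl RT_element_ibp[OF RT_P1[OF \<tau>] _ RT_flux[OF \<tau>] test_fun_C1_scalar[OF t]])
 also have "... = 0"
 proof (rule facet_sum_cancel)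
  fix T T' S assume "T \<in> M" "T' \<in> M" "T \<noteq> T'" "S facet_of T" "S facet_of T'"
  from RT_flux_opposite[OF \<tau> this] show "flux \<tau> T S $ i * sint S \<phi> + flux \<tau> T' S $ i * sint S \<phi> = 0" by simp
 next
  fix T S assume S: "T \<in> M" "S facet_of T" "S \<subseteq> frontier D"
  obtain K where K: "K \<subseteq> D" "\<And>x. x \<notin> K \<Longrightarrow> \<phi> x = 0" using t unfolding test_fun_def by blast
  have "frontier D \<inter> D = {}" using domain_facts(1) by (auto simp: frontier_def interior_open)
  then have "sint S \<phi> = sint S (\<lambda>x. 0)" using S(3) K by (intro sint_cong) blast
  then show "flux \<tau> T S $ i * sint S \<phi> = 0" by simp
 qed
 finally show "(LINT x|leb D. (\<tau> x $ i) \<bullet> \<gamma> x) = - (LINT x|leb D. \<phi> x * (rt_div \<tau> x $ i))" by (simp add: mult.commute)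
qed

lemma RT_Hdiv: "\<tau> \<in> RT M \<Longrightarrow> \<tau> \<in> Hdiv D" using RT_weak_div P1_L2 RT_P1 by (auto simp: Hdiv_def)

lemma RT_wdiv: "\<tau> \<in> RT M \<Longrightarrow> AE x in leb D. wdiv D \<tau> x = rt_div \<tau> x" by (rule wdiv_eq[OF domain_facts(1,3) RT_weak_div])

section \<open>Crouzeix--Raviart fields and membership criteria\<close>

lemma CR_P1: "v \<in> CR M \<Longrightarrow> v \<in> P1 M" by (simp add: CR_def)

lemma CR_jump:
 assumes v: "v \<in> CR M" and T: "T \<in> M" "T' \<in> M" "T \<noteq> T'" "S facet_of T" "S facet_of T'"
 shows "sint S (ea T v) = sint S (ea T' v)"
proof -
 have "side_mean S (\<lambda>x. elem_val T v x - elem_val T' v x) = 0" 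
  by (rule v[unfolded CR_def mem_Collect_eq, THEN conjunct2, rule_format, OF T(1,2)]) (use T in auto)
 then have "sint S (\<lambda>x. elem_val T v x - elem_val T' v x) = 0" using side_mean_eq_0_iff[OF T(1,4)] by blast
 also have "sint S (\<lambda>x. elem_val T v x - elem_val T' v x) = sint S (\<lambda>x. ea T v x - ea T' v x)"
 proof (rule sint_cong)
  fix x assume "x \<in> S"
  then have "x \<in> T" "x \<in> T'" using facet_subset[OF T(1,4)] facet_subset[OF T(2,5)] by blast+
  then show "elem_val T v x - elem_val T' v x = ea T v x - ea T' v x" by (simp add: elem_val_ea[OF CR_P1[OF v] T(1)] elem_val_ea[OF CR_P1[OF v] T(2)])
 qed
 also have "... = sint S (ea T v) - sint S (ea T' v)" by (rule sint_diff[OF T(1,4)]) (use ea_continuous[OF CR_P1[OF v]] T in auto)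
 finally show ?thesis by simp
qed

lemma CR_D_boundary:
 assumes v: "v \<in> CR_D \<Gamma> M" and T: "T \<in> M" "S facet_of T" "S \<subseteq> closure \<Gamma>"
 shows "sint S (ea T v) = 0"
proof -
 have "side_mean S (elem_val T v) = 0"  by (rule v[unfolded CR_D_def mem_Collect_eq, THEN conjunct2, rule_format, OF T(1)]) (use T in auto)
 then have "sint S (elem_val T v) = 0" using side_mean_eq_0_iff[OF T(1,2)] by blast
 also have "sint S (elem_val T v) = sint S (ea T v)" by (rule sint_cong) (rule elem_val_facet[OF CR_P1 T(1,2)], use v in \<open>simp_all add: CR_D_def\<close>)
 finally show ?thesis .
qed

lemma CR_I:
 assumes P: "v \<in> P1 M"
  and jump: "\<And>T T' S. T \<in> M \<Longrightarrow> T' \<in> M \<Longrightarrow> T \<noteq> T' \<Longrightarrow> S facet_of T \<Longrightarrow> S facet_of T' \<Longrightarrow> sint S (ea T v) = sint S (ea T' v)"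
 shows "v \<in> CR M" unfolding CR_def
proof (intro CollectI conjI P ballI allI impI)
 fix T T' S assume T: "T \<in> M" "T' \<in> M" and "T \<noteq> T' \<and> S facet_of T \<and> S facet_of T'"
 then have S: "T \<noteq> T'" "S facet_of T" "S facet_of T'" by auto
 have "sint S (\<lambda>x. elem_val T v x - elem_val T' v x) = sint S (\<lambda>x. ea T v x - ea T' v x)"
 proof (rule sint_cong)
  fix x assume "x \<in> S"
  then have "x \<in> T" "x \<in> T'" using facet_subset[OF T(1) S(2)] facet_subset[OF T(2) S(3)] by blast+
  then show "elem_val T v x - elem_val T' v x = ea T v x - ea T' v x" by (simp add: elem_val_ea[OF P T(1)] elem_val_ea[OF P T(2)])
 qed
 also have "... = sint S (ea T v) - sint S (ea T' v)" by (rule sint_diff[OF T(1) S(2)]) (use ea_continuous[OF P] T in auto)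
 finally show "side_mean S (\<lambda>x. elem_val T v x - elem_val T' v x) = 0" using jump[OF T S] side_mean_eq_0_iff[OF T(1) S(2)] by simp
qed

lemma CR_D_I:
 assumes v: "v \<in> CR M" and bdry: "\<And>T S. T \<in> M \<Longrightarrow> S facet_of T \<Longrightarrow> S \<subseteq> closure \<Gamma> \<Longrightarrow> sint S (ea T v) = 0"
 shows "v \<in> CR_D \<Gamma> M" unfolding CR_D_def
proof (intro CollectI conjI v ballI allI impI)
 fix T S assume T: "T \<in> M" and "S facet_of T \<and> S \<subseteq> closure \<Gamma>"
 then have S: "S facet_of T" "S \<subseteq> closure \<Gamma>" by auto
 have "sint S (elem_val T v) = sint S (ea T v)" by (rule sint_cong) (rule elem_val_facet[OF CR_P1[OF v] T S(1)])
 then show "side_mean S (elem_val T v) = 0" using bdry[OF T S] side_mean_eq_0_iff[OF T S(1)] by simp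
qed

lemma CR_D_lincomb:
 assumes v: "v \<in> CR_D \<Gamma> M" and w: "w \<in> CR_D \<Gamma> M"
 shows "(\<lambda>x. v x + c *\<^sub>R w x) \<in> CR_D \<Gamma> M"
proof -
 have vC: "v \<in> CR M" and wC: "w \<in> CR M" using v w by (auto simp: CR_D_def)
 note P = CR_P1[OF vC] CR_P1[OF wC]
 have P': "(\<lambda>x. v x + c *\<^sub>R w x) \<in> P1 M" by (intro P1_add P1_scaleR P)
 have eq: "sint S (ea T (\<lambda>x. v x + c *\<^sub>R w x)) = sint S (ea T v) + c *\<^sub>R sint S (ea T w)" if T: "T \<in> M" "S facet_of T" for T S
 proof -
  have "ea T (\<lambda>x. v x + c *\<^sub>R w x) = (\<lambda>x. ea T v x + c *\<^sub>R ea T w x)"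
   using ea_add[OF P(1) P1_scaleR[OF P(2)] T(1)] ea_scaleR[OF P(2) T(1)] by simp
  then show ?thesis using sint_add[OF T ea_continuous[OF P(1) T(1)], of "\<lambda>x. c *\<^sub>R ea T w x"] sint_scaleR[OF T ea_continuous[OF P(2) T(1)], of c]
    ea_continuous[OF P(2) T(1)] by (simp add: continuous_on_scaleR)
 qed
 show ?thesis
 proof (rule CR_D_I[OF CR_I[OF P']])
  fix T T' S assume a: "T \<in> M" "T' \<in> M" "T \<noteq> T'" "S facet_of T" "S facet_of T'"
  then show "sint S (ea T (\<lambda>x. v x + c *\<^sub>R w x)) = sint S (ea T' (\<lambda>x. v x + c *\<^sub>R w x))" using eq CR_jump[OF vC a] CR_jump[OF wC a] by simp
 next
  fix T S assume a: "T \<in> M" "S facet_of T" "S \<subseteq> closure \<Gamma>"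
  then show "sint S (ea T (\<lambda>x. v x + c *\<^sub>R w x)) = 0" using eq CR_D_boundary[OF v a] CR_D_boundary[OF w a] by simp
 qed
qed

lemma RT_N_flux_zero:
 assumes \<tau>: "\<tau> \<in> RT_N \<Gamma> M" and T: "T \<in> M" "S facet_of T" "S \<subseteq> closure \<Gamma>"
 shows "flux \<tau> T S = 0"
proof -
 have R: "\<tau> \<in> RT M" using \<tau> by (simp add: RT_N_def)
 obtain x where x: "x \<in> S" using facet_nonempty[OF T(1,2)] by blast
 have "side_normal S (outer_normal T S)" using side_normal_facet[OF T(1,2)] by simp
 then have "elem_val T \<tau> x *v outer_normal T S = 0"  using \<tau>[unfolded RT_N_def mem_Collect_eq, THEN conjunct2, rule_format, OF T(1) _ x] T by auto
 then show ?thesis using RT_flux[OF R T(1,2) x] elem_val_facet[OF RT_P1[OF R] T(1,2) x] by simp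
qed

text \<open>The definition of \<open>RT\<close> quantifies over both unit normals of a side. They
  are distinct and opposite, so conditions on outer normals carry over, with a sign, to either of
  them.\<close>

lemma RT_N_I:
 assumes P: "\<tau> \<in> P1 M"
  and const: "\<And>T S x. T \<in> M \<Longrightarrow> S facet_of T \<Longrightarrow> x \<in> S \<Longrightarrow> ea T \<tau> x *v outer_normal T S = \<kappa> T S"
  and opp: "\<And>T T' S. T \<in> M \<Longrightarrow> T' \<in> M \<Longrightarrow> T \<noteq> T' \<Longrightarrow> S facet_of T \<Longrightarrow> S facet_of T' \<Longrightarrow> \<kappa> T' S = - \<kappa> T S"
  and zero: "\<And>T S. T \<in> M \<Longrightarrow> S facet_of T \<Longrightarrow> S \<subseteq> closure \<Gamma> \<Longrightarrow> \<kappa> T S = 0"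
 shows "\<tau> \<in> RT_N \<Gamma> M"
proof -
 have minus: "m *v (- n) = - (m *v n)" for m :: "real^'n^'n" and n by (simp add: vec_eq_iff matrix_vector_mult_component)
 have val: "elem_val T \<tau> x *v n = (if n = outer_normal T S then \<kappa> T S else - \<kappa> T S)"
  if T: "T \<in> M" "S facet_of T" "side_normal S n" "x \<in> S" for T S n x
 proof -
  have "elem_val T \<tau> x = ea T \<tau> x" by (rule elem_val_ea[OF P T(1)]) (use facet_subset[OF T(1,2)] T(4) in blast)
  then show ?thesis using const[OF T(1,2,4)] side_normal_facet[OF T(1,2), of n] T(3) by (auto simp: minus)
 qed
 have n0: "n \<noteq> - n" if "T \<in> M" "side_normal S n" for T S and n :: "real^'n"
 proof
  assume "n = - n"
  then have "n + n = 0" by (simp add: eq_neg_iff_add_eq_0)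
  then have "2 *\<^sub>R n = 0" by (simp only: scaleR_2)
  then have "n = 0" by simp
  then show False using that(2) by (simp add: side_normal_def)
 qed
 show ?thesis unfolding RT_N_def RT_def
 proof (intro CollectI conjI P ballI allI impI)
  fix T S n assume "T \<in> M" "S facet_of T \<and> side_normal S n"
  then show "\<exists>c. \<forall>x\<in>S. elem_val T \<tau> x *v n = c" using val by blast
 next
  fix T T' S n x assume T: "T \<in> M" "T' \<in> M" and "T \<noteq> T' \<and> S facet_of T \<and> S facet_of T' \<and> side_normal S n" and x: "x \<in> S"
  then have S: "T \<noteq> T'" "S facet_of T" "S facet_of T'" "side_normal S n" by auto
  have o: "outer_normal T' S = - outer_normal T S" by (rule common_facet_opposite(1)[OF T S(1,2,3)])
  have k: "\<kappa> T' S = - \<kappa> T S" by (rule opp[OF T S(1,2,3)])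
  consider "n = outer_normal T S" | "n = - outer_normal T S" using side_normal_facet[OF T(1) S(2)] S(4) by blast
  then show "elem_val T \<tau> x *v n = elem_val T' \<tau> x *v n" using val[OF T(1) S(2,4) x] val[OF T(2) S(3,4) x] o k n0[OF T(1) S(4)] by cases auto
 next
  fix T S n x assume "T \<in> M" "S facet_of T \<and> S \<subseteq> closure \<Gamma> \<and> side_normal S n" "x \<in> S"
  then show "elem_val T \<tau> x *v n = 0" using val zero by auto
 qed
qed

lemma RT_N_lincomb:
 assumes \<tau>: "\<tau> \<in> RT_N \<Gamma> M" and \<sigma>: "\<sigma> \<in> RT_N \<Gamma> M"
 shows "(\<lambda>x. \<tau> x + c *\<^sub>R \<sigma> x) \<in> RT_N \<Gamma> M"
proof -
 have R: "\<tau> \<in> RT M" "\<sigma> \<in> RT M" using \<tau> \<sigma> by (auto simp: RT_N_def)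
 note P = RT_P1[OF R(1)] RT_P1[OF R(2)]
 have lin: "(m + c *\<^sub>R m') *v n = m *v n + c *\<^sub>R (m' *v n)" for m m' :: "real^'n^'n" and n
  by (simp add: vec_eq_iff matrix_vector_mult_component inner_add_left)
 show ?thesis
 proof (rule RT_N_I[where \<kappa> = "\<lambda>T S. flux \<tau> T S + c *\<^sub>R flux \<sigma> T S"])
  show "(\<lambda>x. \<tau> x + c *\<^sub>R \<sigma> x) \<in> P1 M" by (intro P1_add P1_scaleR P)
 next
  fix T S x assume T: "T \<in> M" "S facet_of T" "x \<in> S"
  have "ea T (\<lambda>x. \<tau> x + c *\<^sub>R \<sigma> x) x = ea T \<tau> x + c *\<^sub>R ea T \<sigma> x"
   using ea_add[OF P(1) P1_scaleR[OF P(2)] T(1)] ea_scaleR[OF P(2) T(1)] by simp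
  then show "ea T (\<lambda>x. \<tau> x + c *\<^sub>R \<sigma> x) x *v outer_normal T S = flux \<tau> T S + c *\<^sub>R flux \<sigma> T S"
   using RT_flux[OF R(1) T] RT_flux[OF R(2) T] by (simp add: lin)
 next
  fix T T' S assume a: "T \<in> M" "T' \<in> M" "T \<noteq> T'" "S facet_of T" "S facet_of T'"
  then show "flux \<tau> T' S + c *\<^sub>R flux \<sigma> T' S = - (flux \<tau> T S + c *\<^sub>R flux \<sigma> T S)"
   using RT_flux_opposite[OF R(1) a] RT_flux_opposite[OF R(2) a] by simp
 next
  fix T S assume a: "T \<in> M" "S facet_of T" "S \<subseteq> closure \<Gamma>"
  then show "flux \<tau> T S + c *\<^sub>R flux \<sigma> T S = 0" using RT_N_flux_zero[OF \<tau> a] RT_N_flux_zero[OF \<sigma> a] by simp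
 qed
qed

lemma inner_matrix_rows: "(m :: real^'n^'m) \<bullet> m' = (\<Sum>i\<in>UNIV. m $ i \<bullet> m' $ i)" by (simp add: inner_vec_def)

section \<open>Pairing of stresses with broken gradients\<close>

text \<open>The flux hypothesis concerns each element separately and asks for no continuity, so the
  formula also covers the element-wise constant fields in \<open>P0_grad_pairing\<close>.\<close>

lemma normal_trace_pairing:
 assumes P: "\<tau> \<in> P1 M" "v \<in> P1 M"
  and fl: "\<And>T S x. T \<in> M \<Longrightarrow> S facet_of T \<Longrightarrow> x \<in> S \<Longrightarrow> ea T \<tau> x *v outer_normal T S = flux \<tau> T S"
 shows "ip D \<tau> (grad_h v) + ip D (rt_div \<tau>) v = (\<Sum>T\<in>M. \<Sum>S\<in>facets T. flux \<tau> T S \<bullet> sint S (ea T v))"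
proof -
 have L: "\<tau> \<in> L2_space D" "v \<in> L2_space D" "grad_h v \<in> L2_space D" "rt_div \<tau> \<in> L2_space D"
  using P1_L2[OF P(1)] P1_L2[OF P(2)] P0_L2[OF grad_h_P0[OF P(2)]] P0_L2[OF rt_div_P0[OF P(1)]] by auto
 have int: "integrable (leb D) (\<lambda>x. (\<tau> x $ i) \<bullet> (grad_h v x $ i) + (rt_div \<tau> x $ i) * (v x $ i))" for i
  using L2_inner_integrable[OF L2_component[OF L(1), of i] L2_component[OF L(3), of i]]
   L2_inner_integrable[OF L2_component[OF L(4), of i] L2_component[OF L(2), of i]] by simp
 have comp: "(LINT x|leb D. (\<tau> x $ i) \<bullet> (grad_h v x $ i) + (rt_div \<tau> x $ i) * (v x $ i))
  = (\<Sum>T\<in>M. \<Sum>S\<in>facets T. (flux \<tau> T S $ i) * (sint S (ea T v) $ i))" for i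
 proof -
  have "(LINT x|leb D. (\<tau> x $ i) \<bullet> (grad_h v x $ i) + (rt_div \<tau> x $ i) * (v x $ i))
   = (\<Sum>T\<in>M. LINT x|leb (interior T). (\<tau> x $ i) \<bullet> (grad_h v x $ i) + (rt_div \<tau> x $ i) * (v x $ i))" by (rule integral_split[OF int])
  also have "... = (\<Sum>T\<in>M. \<Sum>S\<in>facets T. (flux \<tau> T S $ i) * (sint S (ea T v) $ i))"
  proof (rule sum.cong[OF refl])
   fix T assume T: "T \<in> M"
   obtain A b where a: "linear A" "ea T v = (\<lambda>x. A x + b)" "\<And>x. x \<in> interior T \<Longrightarrow> v x = A x + b"
    "\<And>x. x \<in> interior T \<Longrightarrow> grad_h v x = matrix A" by (rule grad_h_P1[OF P(2) T]) (rule that; assumption)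
   have comp_v: "(A x + b) $ i = matrix A $ i \<bullet> x + b $ i" for x using matrix_works'[OF a(1), of x] matrix_vector_mult_component[of "matrix A" x i] by simp
   have c1: "C1_scalar (\<lambda>x. (A x + b) $ i) (\<lambda>x. matrix A $ i)"
   proof -
    have "C1_scalar (\<lambda>x. matrix A $ i \<bullet> x + b $ i) (\<lambda>x. matrix A $ i)"
     unfolding C1_scalar_def gderiv_def by (auto intro!: derivative_eq_intros simp: inner_commute)
    then show ?thesis by (simp only: comp_v)
   qed
   have "(LINT x|leb (interior T). (\<tau> x $ i) \<bullet> (grad_h v x $ i) + (rt_div \<tau> x $ i) * (v x $ i))
    = (LINT x|leb (interior T). (\<tau> x $ i) \<bullet> (matrix A $ i) + (rt_div \<tau> x $ i) * ((A x + b) $ i))"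
    by (rule Bochner_Integration.integral_cong) (use a(3,4) in auto)
   also have "... = (\<Sum>S\<in>facets T. (flux \<tau> T S $ i) * sint S (\<lambda>x. (A x + b) $ i))" by (rule RT_element_ibp[OF P(1) T fl[OF T] c1])
   also have "... = (\<Sum>S\<in>facets T. (flux \<tau> T S $ i) * (sint S (ea T v) $ i))"
   proof (rule sum.cong[OF refl])
    fix S assume "S \<in> facets T"
    then have "S facet_of T" by (simp add: facets_def)
    then show "flux \<tau> T S $ i * sint S (\<lambda>x. (A x + b) $ i) = flux \<tau> T S $ i * (sint S (ea T v) $ i)"
     using sint_component[OF T _ ea_continuous[OF P(2) T], of S i] a(2) by simp
   qed
   finally show "(LINT x|leb (interior T). (\<tau> x $ i) \<bullet> (grad_h v x $ i) + (rt_div \<tau> x $ i) * (v x $ i))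
    = (\<Sum>S\<in>facets T. (flux \<tau> T S $ i) * (sint S (ea T v) $ i))" .
  qed
  finally show ?thesis .
 qed
 have "ip D \<tau> (grad_h v) + ip D (rt_div \<tau>) v = (LINT x|leb D. \<tau> x \<bullet> grad_h v x + rt_div \<tau> x \<bullet> v x)"
  unfolding ip_def using L2_inner_integrable[OF L(1,3)] L2_inner_integrable[OF L(4,2)] by simp
 also have "... = (LINT x|leb D. (\<Sum>i\<in>UNIV. (\<tau> x $ i) \<bullet> (grad_h v x $ i) + (rt_div \<tau> x $ i) * (v x $ i)))"
  by (simp add: inner_vec_def[of "\<tau> _"] inner_vec_def[of "rt_div \<tau> _"] sum.distrib)
 also have "... = (\<Sum>i\<in>UNIV. LINT x|leb D. (\<tau> x $ i) \<bullet> (grad_h v x $ i) + (rt_div \<tau> x $ i) * (v x $ i))"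
  by (rule Bochner_Integration.integral_sum) (rule int)
 also have "... = (\<Sum>T\<in>M. \<Sum>i\<in>UNIV. \<Sum>S\<in>facets T. (flux \<tau> T S $ i) * (sint S (ea T v) $ i))" unfolding comp by (rule sum.swap)
 also have "... = (\<Sum>T\<in>M. \<Sum>S\<in>facets T. flux \<tau> T S \<bullet> sint S (ea T v))"
  unfolding inner_vec_def inner_real_def by (intro sum.cong refl sum.swap)
 finally show ?thesis .
qed

text \<open>A constant flux sees only the mean of \<open>v\<close> over the side. Across interior
  sides the means agree and the fluxes are opposite; on a boundary side one of the two factors is
  zero.\<close>

lemma RT_CR_ibp:
 assumes parts: "boundary_parts D \<Gamma>D \<Gamma>N" and res: "mesh_resolves_boundary D \<Gamma>D \<Gamma>N M"
  and \<tau>: "\<tau> \<in> RT_N \<Gamma>N M" and v: "v \<in> CR_D \<Gamma>D M"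
 shows "ip D \<tau> (grad_h v) + ip D (rt_div \<tau>) v = 0"
proof -
 have R: "\<tau> \<in> RT M" using \<tau> by (simp add: RT_N_def)
 have vC: "v \<in> CR M" using v by (simp add: CR_D_def)
 note P = RT_P1[OF R] CR_P1[OF vC]
 note normal_trace_pairing[OF P RT_flux[OF R]]
 also have "(\<Sum>T\<in>M. \<Sum>S\<in>facets T. flux \<tau> T S \<bullet> sint S (ea T v)) = 0"
 proof (rule facet_sum_cancel)
  fix T T' S assume a: "T \<in> M" "T' \<in> M" "T \<noteq> T'" "S facet_of T" "S facet_of T'"
  show "flux \<tau> T S \<bullet> sint S (ea T v) + flux \<tau> T' S \<bullet> sint S (ea T' v) = 0" using RT_flux_opposite[OF R a] CR_jump[OF vC a] by simp
 next
  fix T S assume a: "T \<in> M" "S facet_of T" "S \<subseteq> frontier D"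
  then have "S \<subseteq> closure \<Gamma>D \<or> S \<subseteq> closure \<Gamma>N" using res unfolding mesh_resolves_boundary_def by blast
  then show "flux \<tau> T S \<bullet> sint S (ea T v) = 0" using CR_D_boundary[OF v a(1,2)] RT_N_flux_zero[OF \<tau> a(1,2)] by auto
 qed
 finally show ?thesis .
qed

end

section \<open>Fields with vanishing trace on the Dirichlet boundary\<close>

locale stokes_mesh = mesh +
 fixes \<Gamma>D \<Gamma>N :: "(real^'n) set"
 assumes parts: "boundary_parts D \<Gamma>D \<Gamma>N" and res: "mesh_resolves_boundary D \<Gamma>D \<Gamma>N M"

lemma C1_field_has_derivative:
 "C1_field \<phi> \<Longrightarrow> (\<phi> has_derivative (\<lambda>h. jacobian \<phi> (at x) *v h)) (at x)"
 using jacobian_works[of \<phi> "at x"] by (auto simp: C1_field_def)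

lemma jacobian_eqI:
 fixes \<phi> :: "real^'n \<Rightarrow> real^'m"
 assumes "(\<phi> has_derivative (\<lambda>h. m *v h)) (at x)" shows "jacobian \<phi> (at x) = m" using frechet_derivative_at[OF assms] unfolding jacobian_def
 by (metis matrix_of_matrix_vector_mul)

lemma C1_fieldI:
 fixes \<phi> :: "real^'n \<Rightarrow> real^'n"
 assumes d: "\<And>x. (\<phi> has_derivative (\<lambda>h. m x *v h)) (at x)" and c: "continuous_on UNIV m"
 shows "C1_field \<phi>" "jacobian \<phi> (at x) = m x"
proof -
 show j: "jacobian \<phi> (at x) = m x" for x by (rule jacobian_eqI[OF d])
 show "C1_field \<phi>" unfolding C1_field_def using d c by (auto simp: j differentiable_def)
qed

lemma C1_field_lincomb:
 assumes \<phi>: "C1_field \<phi>" and \<psi>: "C1_field \<psi>"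
 shows "C1_field (\<lambda>x. a *\<^sub>R \<phi> x + b *\<^sub>R \<psi> x)"
  "jacobian (\<lambda>x. a *\<^sub>R \<phi> x + b *\<^sub>R \<psi> x) (at x) = a *\<^sub>R jacobian \<phi> (at x) + b *\<^sub>R jacobian \<psi> (at x)"
proof -
 have d: "((\<lambda>x. a *\<^sub>R \<phi> x + b *\<^sub>R \<psi> x) has_derivative (\<lambda>h. (a *\<^sub>R jacobian \<phi> (at x) + b *\<^sub>R jacobian \<psi> (at x)) *v h)) (at x)" for x
 proof -
  have "(a *\<^sub>R A + b *\<^sub>R B) *v h = a *\<^sub>R (A *v h) + b *\<^sub>R (B *v h)" for A B :: "real^'a^'a" and h
   by (simp add: vec_eq_iff matrix_vector_mult_component inner_add_left)
  then show ?thesis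
   using has_derivative_add[OF has_derivative_scaleR_right[OF C1_field_has_derivative[OF \<phi>]] has_derivative_scaleR_right[OF C1_field_has_derivative[OF \<psi>]]]
   by simp
 qed
 have c: "continuous_on UNIV (\<lambda>x. a *\<^sub>R jacobian \<phi> (at x) + b *\<^sub>R jacobian \<psi> (at x))"
  using \<phi> \<psi> unfolding C1_field_def by (intro continuous_intros) auto
 show "C1_field (\<lambda>x. a *\<^sub>R \<phi> x + b *\<^sub>R \<psi> x)"
  "jacobian (\<lambda>x. a *\<^sub>R \<phi> x + b *\<^sub>R \<psi> x) (at x) = a *\<^sub>R jacobian \<phi> (at x) + b *\<^sub>R jacobian \<psi> (at x)"
  by (rule C1_fieldI[OF d c])+
qed

lemma l2norm_component_le:
 fixes f :: "real^'n \<Rightarrow> 'b::euclidean_space^'m"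
 assumes "f \<in> L2_space D" shows "l2norm D (\<lambda>x. f x $ i) \<le> l2norm D f"
proof (rule power2_le_imp_le)
 show "(l2norm D (\<lambda>x. f x $ i))^2 \<le> (l2norm D f)^2" unfolding l2norm_sq_integral
  by (rule integral_mono[OF L2_norm_sq_integrable[OF L2_component[OF assms]] L2_norm_sq_integrable[OF assms]])
    (intro power_mono Finite_Cartesian_Product.norm_nth_le norm_ge_zero)
qed simp

lemma ennreal_cmult_tendsto_0:
 assumes "(f \<longlonglongrightarrow> (0::ennreal))" shows "(\<lambda>k. ennreal c * f k) \<longlonglongrightarrow> 0"
 using ennreal_tendsto_cmult[OF _ assms, of "ennreal c"] by simp

lemma tendsto_0_le_ennreal:
 assumes "\<And>k::nat. f k \<le> g k" "g \<longlonglongrightarrow> (0::ennreal)" shows "f \<longlonglongrightarrow> 0"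
 by (rule tendsto_sandwich[OF _ _ tendsto_const assms(2)]) (use assms(1) in auto)

context mesh
begin

lemma H1_C1_L2: "C1_field \<phi> \<Longrightarrow> \<phi> \<in> L2_space D" "C1_field \<phi> \<Longrightarrow> (\<lambda>x. jacobian \<phi> (at x)) \<in> L2_space D"
 by (auto intro!: continuous_L2[OF dom_sets(1) domain_facts(3)] C1_field_continuous simp: C1_field_def)

lemma l2norm_lincomb_tendsto_0:
 fixes f g :: "nat \<Rightarrow> real^'n \<Rightarrow> 'b::euclidean_space"
 assumes "\<And>k. f k \<in> L2_space D" "\<And>k. g k \<in> L2_space D"
  and "(\<lambda>k. l2norm D (f k)) \<longlonglongrightarrow> 0" "(\<lambda>k. l2norm D (g k)) \<longlonglongrightarrow> 0"
 shows "(\<lambda>k. l2norm D (\<lambda>x. a *\<^sub>R f k x + b *\<^sub>R g k x)) \<longlonglongrightarrow> 0"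
proof (rule Lim_null_comparison)
 show "\<forall>\<^sub>F k in sequentially. norm (l2norm D (\<lambda>x. a *\<^sub>R f k x + b *\<^sub>R g k x)) \<le> \<bar>a\<bar> * l2norm D (f k) + \<bar>b\<bar> * l2norm D (g k)"
  using l2norm_triangle[OF L2_scaleR[OF assms(1)] L2_scaleR[OF assms(2)]] by (simp add: l2norm_scaleR)
 show "(\<lambda>k. \<bar>a\<bar> * l2norm D (f k) + \<bar>b\<bar> * l2norm D (g k)) \<longlonglongrightarrow> 0"
  using tendsto_add[OF tendsto_mult_right_zero[OF assms(3), of "\<bar>a\<bar>"] tendsto_mult_right_zero[OF assms(4), of "\<bar>b\<bar>"]] by simp
qed

text \<open>The approximating sequences are combined accordingly; \<open>norm_add_sq_le\<close>
  bounds the surface term by those of the two sequences.\<close>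

lemma has_zero_trace_lincomb:
 assumes v: "v \<in> H1 D" "w \<in> H1 D" and A: "A \<in> sets borel"
  and tr: "has_trace D H A v (\<lambda>_. 0)" "has_trace D H A w (\<lambda>_. 0)"
 shows "has_trace D H A (\<lambda>x. a *\<^sub>R v x + b *\<^sub>R w x) (\<lambda>_. 0)"
proof -
 let ?N = "\<lambda>\<phi> :: real^'n \<Rightarrow> real^'n. set_nn_integral (surface_measure H) A (\<lambda>x. ennreal ((norm (\<phi> x - 0))^2))"
 obtain \<phi> where \<phi>: "\<forall>k. C1_field (\<phi> k)" "(\<lambda>k. l2norm D (\<lambda>x. \<phi> k x - v x)) \<longlonglongrightarrow> 0"
  "(\<lambda>k. l2norm D (\<lambda>x. jacobian (\<phi> k) (at x) - wgrad D v x)) \<longlonglongrightarrow> 0" "(\<lambda>k. ?N (\<phi> k)) \<longlonglongrightarrow> 0"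
  using tr(1) unfolding has_trace_def by (elim conjE exE)
 obtain \<psi> where \<psi>: "\<forall>k. C1_field (\<psi> k)" "(\<lambda>k. l2norm D (\<lambda>x. \<psi> k x - w x)) \<longlonglongrightarrow> 0"
  "(\<lambda>k. l2norm D (\<lambda>x. jacobian (\<psi> k) (at x) - wgrad D w x)) \<longlonglongrightarrow> 0" "(\<lambda>k. ?N (\<psi> k)) \<longlonglongrightarrow> 0"
  using tr(2) unfolding has_trace_def by (elim conjE exE)
 let ?u = "\<lambda>x. a *\<^sub>R v x + b *\<^sub>R w x"
 let ?\<chi> = "\<lambda>k x. a *\<^sub>R \<phi> k x + b *\<^sub>R \<psi> k x"
 note cl = C1_field_lincomb[OF spec[OF \<phi>(1)] spec[OF \<psi>(1)]]
 have c1: "\<forall>k. C1_field (?\<chi> k)" using cl(1) by blast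
 have l1: "(\<lambda>k. l2norm D (\<lambda>x. ?\<chi> k x - ?u x)) \<longlonglongrightarrow> 0"
 proof -
  have "(\<lambda>x. ?\<chi> k x - ?u x) = (\<lambda>x. a *\<^sub>R (\<phi> k x - v x) + b *\<^sub>R (\<psi> k x - w x))" for k by (simp add: fun_eq_iff algebra_simps)
  then show ?thesis using l2norm_lincomb_tendsto_0[OF L2_diff[OF H1_C1_L2(1)[OF spec[OF \<phi>(1)]] H1D(1)[OF v(1)]]
     L2_diff[OF H1_C1_L2(1)[OF spec[OF \<psi>(1)]] H1D(1)[OF v(2)]] \<phi>(2) \<psi>(2), of a b] by simp
 qed
 have l2: "(\<lambda>k. l2norm D (\<lambda>x. jacobian (?\<chi> k) (at x) - wgrad D ?u x)) \<longlonglongrightarrow> 0"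
 proof -
  have "l2norm D (\<lambda>x. jacobian (?\<chi> k) (at x) - wgrad D ?u x)
   = l2norm D (\<lambda>x. a *\<^sub>R (jacobian (\<phi> k) (at x) - wgrad D v x) + b *\<^sub>R (jacobian (\<psi> k) (at x) - wgrad D w x))" for k
  proof (rule l2norm_cong_AE[OF dom_sets(1)])
   show "AE x in leb D. jacobian (?\<chi> k) (at x) - wgrad D ?u x
    = a *\<^sub>R (jacobian (\<phi> k) (at x) - wgrad D v x) + b *\<^sub>R (jacobian (\<psi> k) (at x) - wgrad D w x)" using H1_lincomb(2)[OF domain_facts(1,3) v, of a b]
    by eventually_elim (simp add: cl(2) algebra_simps)
  qed
  then show ?thesis using l2norm_lincomb_tendsto_0[OF L2_diff[OF H1_C1_L2(2)[OF spec[OF \<phi>(1)]] H1D(3)[OF v(1)]]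
     L2_diff[OF H1_C1_L2(2)[OF spec[OF \<psi>(1)]] H1D(3)[OF v(2)]] \<phi>(3) \<psi>(3), of a b] by simp
 qed
 have l3: "(\<lambda>k. ?N (?\<chi> k)) \<longlonglongrightarrow> 0"
 proof (rule tendsto_0_le_ennreal)
  fix k
  have m: "(\<lambda>x. ennreal ((norm (\<theta> x - 0))^2) * indicator A x) \<in> borel_measurable (surface_measure H)"
   if "C1_field \<theta>" for \<theta> :: "real^'n \<Rightarrow> real^'n"
  proof -
   have "\<theta> \<in> borel_measurable borel" by (rule borel_measurable_continuous_onI[OF C1_field_continuous[OF that]])
   then show ?thesis unfolding surface_measure_def measurable_distr_eq1 using A by measurable
  qed
  have "?N (?\<chi> k) \<le> (\<integral>\<^sup>+ x. ennreal (2 * a^2) * (ennreal ((norm (\<phi> k x - 0))^2) * indicator A x)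
    + ennreal (2 * b^2) * (ennreal ((norm (\<psi> k x - 0))^2) * indicator A x) \<partial>surface_measure H)"
  proof (rule nn_integral_mono)
   fix x
   have "(norm (?\<chi> k x))^2 \<le> 2 * a^2 * (norm (\<phi> k x))^2 + 2 * b^2 * (norm (\<psi> k x))^2"
    using norm_add_sq_le[of "a *\<^sub>R \<phi> k x" "b *\<^sub>R \<psi> k x"] by (simp add: power_mult_distrib)
   then have "ennreal ((norm (?\<chi> k x))^2) \<le> ennreal (2 * a^2 * (norm (\<phi> k x))^2 + 2 * b^2 * (norm (\<psi> k x))^2)" by (rule ennreal_leI)
   also have "... = ennreal (2 * a^2) * ennreal ((norm (\<phi> k x))^2) + ennreal (2 * b^2) * ennreal ((norm (\<psi> k x))^2)"
    by (simp add: ennreal_plus ennreal_mult')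
   finally show "ennreal ((norm (?\<chi> k x - 0))^2) * indicator A x \<le> ennreal (2 * a^2) * (ennreal ((norm (\<phi> k x - 0))^2) * indicator A x)
    + ennreal (2 * b^2) * (ennreal ((norm (\<psi> k x - 0))^2) * indicator A x)" by (simp add: indicator_def)
  qed
  also have "... = ennreal (2 * a^2) * ?N (\<phi> k) + ennreal (2 * b^2) * ?N (\<psi> k)"
  proof -
   note m1 = m[OF spec[OF \<phi>(1), of k]] and m2 = m[OF spec[OF \<psi>(1), of k]]
   have t: "(\<lambda>x. ennreal c * h x) \<in> borel_measurable (surface_measure H)"
    if "h \<in> borel_measurable (surface_measure H)" for h and c :: real by (rule borel_measurable_times_ennreal[OF _ that]) simp
   show ?thesis by (subst nn_integral_add[OF t[OF m1] t[OF m2]])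
      (simp_all only: nn_integral_cmult[OF m1] nn_integral_cmult[OF m2] space_borel UNIV_I)
  qed
  finally show "?N (?\<chi> k) \<le> ennreal (2 * a^2) * ?N (\<phi> k) + ennreal (2 * b^2) * ?N (\<psi> k)" .
 next
  show "(\<lambda>k. ennreal (2 * a^2) * ?N (\<phi> k) + ennreal (2 * b^2) * ?N (\<psi> k)) \<longlonglongrightarrow> 0"
   using tendsto_add[OF ennreal_cmult_tendsto_0[OF \<phi>(4), of "2 * a^2"] ennreal_cmult_tendsto_0[OF \<psi>(4), of "2 * b^2"]] by simp
 qed
 show ?thesis unfolding has_trace_def by (intro conjI exI[of _ ?\<chi>] c1 l1 l2 l3) simp
qed

lemma H1_D_lincomb:
 assumes v: "v \<in> H1_D D \<Gamma>" "w \<in> H1_D D \<Gamma>"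
 shows "(\<lambda>x. a *\<^sub>R v x + b *\<^sub>R w x) \<in> H1_D D \<Gamma>"
proof -
 have h: "v \<in> H1 D" "w \<in> H1 D" using v by (auto simp: H1_D_def)
 have "has_trace D {x. c \<bullet> x = d} (closure \<Gamma> \<inter> {x. c \<bullet> x = d}) (\<lambda>x. a *\<^sub>R v x + b *\<^sub>R w x) (\<lambda>_. 0)" if "c \<noteq> 0" for c d
  by (rule has_zero_trace_lincomb[OF h]) (use v that in \<open>auto simp: H1_D_def zero_trace_on_def closed_hyperplane\<close>)
 then show ?thesis using H1_lincomb(1)[OF domain_facts(1,3) h] by (simp add: H1_D_def zero_trace_on_def)
qed

lemma is_weak_grad_limit:
 assumes v: "\<And>k::nat. v k \<in> H1 D" and w: "w \<in> L2_space D" "G \<in> L2_space D"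
  and l: "(\<lambda>k. l2norm D (\<lambda>x. v k x - w x)) \<longlonglongrightarrow> 0" "(\<lambda>k. l2norm D (\<lambda>x. wgrad D (v k) x - G x)) \<longlonglongrightarrow> 0"
 shows "is_weak_grad D w G" unfolding is_weak_grad_def
proof (intro conjI allI impI w(2))
 fix \<phi> \<gamma> i assume t: "test_fun D \<phi> \<gamma>"
 note tL = test_fun_L2[OF dom_sets(1) t]
 have comp: "(\<lambda>k. l2norm D (\<lambda>x. f k x $ l - h x $ l)) \<longlonglongrightarrow> 0"
  if "\<And>k. f k \<in> L2_space D" "h \<in> L2_space D" "(\<lambda>k. l2norm D (\<lambda>x. f k x - h x)) \<longlonglongrightarrow> 0"
  for f :: "nat \<Rightarrow> real^'n \<Rightarrow> 'b::euclidean_space^'m" and h and l :: 'm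
 proof (rule Lim_null_comparison[OF _ that(3)], intro always_eventually allI)
  show "norm (l2norm D (\<lambda>x. f k x $ l - h x $ l)) \<le> l2norm D (\<lambda>x. f k x - h x)" for k
   using l2norm_component_le[OF L2_diff[OF that(1)[of k] that(2)], of l] by simp
 qed
 show "(LINT x|leb D. (w x $ i) *\<^sub>R \<gamma> x) = - (LINT x|leb D. \<phi> x *\<^sub>R (G x $ i))"
 proof (rule vec_eq_iff[THEN iffD2], rule allI)
  fix j
  have eq: "(LINT x|leb D. (f x $ i) *\<^sub>R \<gamma> x) $ j = ip D (\<lambda>x. f x $ i) (\<lambda>x. \<gamma> x $ j)"
   if "f \<in> L2_space D" for f :: "real^'n \<Rightarrow> real^'n"
   using integral_vec_component[OF L2_scaleR_integrable[OF L2_component[OF that, of i] tL(2)], of j] by (simp add: ip_def)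
  have eq': "(LINT x|leb D. \<phi> x *\<^sub>R (H x $ i)) $ j = ip D (\<lambda>x. H x $ i $ j) \<phi>"
   if "H \<in> L2_space D" for H :: "real^'n \<Rightarrow> real^'n^'n"
   using integral_vec_component[OF L2_scaleR_integrable[OF tL(1) L2_component[OF that, of i]], of j] by (simp add: ip_def mult.commute)
  have a: "(\<lambda>k. ip D (\<lambda>x. v k x $ i) (\<lambda>x. \<gamma> x $ j)) \<longlonglongrightarrow> ip D (\<lambda>x. w x $ i) (\<lambda>x. \<gamma> x $ j)"
   by (rule ip_tendsto[OF L2_component[OF H1D(1)[OF v]] L2_component[OF w(1)] L2_component[OF tL(2)] comp[OF H1D(1)[OF v] w(1) l(1)]])
  have b: "(\<lambda>k. ip D (\<lambda>x. wgrad D (v k) x $ i $ j) \<phi>) \<longlonglongrightarrow> ip D (\<lambda>x. G x $ i $ j) \<phi>"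
   by (rule ip_tendsto[OF L2_component[OF L2_component[OF H1D(3)[OF v]]] L2_component[OF L2_component[OF w(2)]] tL(1)
     comp[OF L2_component[OF H1D(3)[OF v]] L2_component[OF w(2)] comp[OF H1D(3)[OF v] w(2) l(2)]]])
  have "ip D (\<lambda>x. v k x $ i) (\<lambda>x. \<gamma> x $ j) = - ip D (\<lambda>x. wgrad D (v k) x $ i $ j) \<phi>" for k
   using H1D(2)[OF v, of k, unfolded is_weak_grad_def, THEN conjunct2, rule_format, OF t, of i]
    eq[OF H1D(1)[OF v], of k] eq'[OF H1D(3)[OF v], of k] by simp
  then have "(\<lambda>k. - ip D (\<lambda>x. wgrad D (v k) x $ i $ j) \<phi>) \<longlonglongrightarrow> ip D (\<lambda>x. w x $ i) (\<lambda>x. \<gamma> x $ j)" using a by simp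
  from LIMSEQ_unique[OF this tendsto_minus[OF b]]
  show "(LINT x|leb D. (w x $ i) *\<^sub>R \<gamma> x) $ j = (- (LINT x|leb D. \<phi> x *\<^sub>R (G x $ i))) $ j" using eq[OF w(1)] eq'[OF w(2)] by simp
 qed
qed

text \<open>A diagonal sequence: for each \<open>k\<close> a C1 field is taken that is within
  \<open>1 / (k + 1)\<close> of \<open>v k\<close> in all three quantities of
  \<open>has_trace\<close>.\<close>

lemma has_zero_trace_limit:
 assumes v: "\<And>k::nat. v k \<in> H1 D" and w: "w \<in> L2_space D" "G \<in> L2_space D" and wG: "AE x in leb D. wgrad D w x = G x"
  and l: "(\<lambda>k. l2norm D (\<lambda>x. v k x - w x)) \<longlonglongrightarrow> 0" "(\<lambda>k. l2norm D (\<lambda>x. wgrad D (v k) x - G x)) \<longlonglongrightarrow> 0"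
  and tr: "\<And>k. has_trace D H A (v k) (\<lambda>_. 0)"
 shows "has_trace D H A w (\<lambda>_. 0)"
proof -
 let ?N = "\<lambda>\<phi> :: real^'n \<Rightarrow> real^'n. set_nn_integral (surface_measure H) A (\<lambda>x. ennreal ((norm (\<phi> x - 0))^2))"
 have ex: "\<exists>\<phi>. C1_field \<phi> \<and> l2norm D (\<lambda>x. \<phi> x - v k x) < e \<and> l2norm D (\<lambda>x. jacobian \<phi> (at x) - wgrad D (v k) x) < e \<and> ?N \<phi> < ennreal e"
  if e: "e > 0" for e k
 proof -
  obtain \<phi> where \<phi>: "\<forall>m. C1_field (\<phi> m)" "(\<lambda>m. l2norm D (\<lambda>x. \<phi> m x - v k x)) \<longlonglongrightarrow> 0"
   "(\<lambda>m. l2norm D (\<lambda>x. jacobian (\<phi> m) (at x) - wgrad D (v k) x)) \<longlonglongrightarrow> 0" "(\<lambda>m. ?N (\<phi> m)) \<longlonglongrightarrow> 0"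
   using tr[of k] unfolding has_trace_def by (elim conjE exE)
  have "\<forall>\<^sub>F m in sequentially. l2norm D (\<lambda>x. \<phi> m x - v k x) < e \<and> l2norm D (\<lambda>x. jacobian (\<phi> m) (at x) - wgrad D (v k) x) < e \<and> ?N (\<phi> m) < ennreal e"
   using e by (intro eventually_conj order_tendstoD(2)[OF \<phi>(2)] order_tendstoD(2)[OF \<phi>(3)] order_tendstoD(2)[OF \<phi>(4)]) simp_all
  then obtain m where "l2norm D (\<lambda>x. \<phi> m x - v k x) < e \<and> l2norm D (\<lambda>x. jacobian (\<phi> m) (at x) - wgrad D (v k) x) < e \<and> ?N (\<phi> m) < ennreal e"
   using eventually_happens' sequentially_bot by blast
  then show ?thesis using \<phi>(1) by blast
 qed
 have "\<forall>k. \<exists>\<phi>. C1_field \<phi> \<and> l2norm D (\<lambda>x. \<phi> x - v k x) < inverse (real (Suc k)) \<and>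
   l2norm D (\<lambda>x. jacobian \<phi> (at x) - wgrad D (v k) x) < inverse (real (Suc k)) \<and> ?N \<phi> < ennreal (inverse (real (Suc k)))" by (intro allI ex) simp
 then obtain \<psi> where \<psi>: "\<forall>k. C1_field (\<psi> k) \<and> l2norm D (\<lambda>x. \<psi> k x - v k x) < inverse (real (Suc k)) \<and>
   l2norm D (\<lambda>x. jacobian (\<psi> k) (at x) - wgrad D (v k) x) < inverse (real (Suc k)) \<and> ?N (\<psi> k) < ennreal (inverse (real (Suc k)))"
  unfolding choice_iff by (elim exE)
 have c1: "\<forall>k. C1_field (\<psi> k)" using \<psi> by simp
 have n0: "(\<lambda>k. inverse (real (Suc k))) \<longlonglongrightarrow> 0" by (rule LIMSEQ_inverse_real_of_nat)
 have sq: "(\<lambda>k. l2norm D (\<lambda>x. f k x - h x)) \<longlonglongrightarrow> 0"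
  if "\<And>k. f k \<in> L2_space D" "\<And>k. g k \<in> L2_space D" "h \<in> L2_space D"
   "\<And>k. l2norm D (\<lambda>x. f k x - g k x) < inverse (real (Suc k))" "(\<lambda>k. l2norm D (\<lambda>x. g k x - h x)) \<longlonglongrightarrow> 0"
  for f :: "nat \<Rightarrow> real^'n \<Rightarrow> 'b::euclidean_space" and g h
 proof (rule Lim_null_comparison)
  show "\<forall>\<^sub>F k in sequentially. norm (l2norm D (\<lambda>x. f k x - h x)) \<le> inverse (real (Suc k)) + l2norm D (\<lambda>x. g k x - h x)"
  proof (intro always_eventually allI)
   fix k
   show "norm (l2norm D (\<lambda>x. f k x - h x)) \<le> inverse (real (Suc k)) + l2norm D (\<lambda>x. g k x - h x)"
    using l2norm_triangle_diff[OF that(1)[of k] that(2)[of k] that(3)] that(4)[of k] by simp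
  qed
  show "(\<lambda>k. inverse (real (Suc k)) + l2norm D (\<lambda>x. g k x - h x)) \<longlonglongrightarrow> 0" using tendsto_add[OF n0 that(5)] by simp
 qed
 have l1: "(\<lambda>k. l2norm D (\<lambda>x. \<psi> k x - w x)) \<longlonglongrightarrow> 0"
  by (rule sq[OF H1_C1_L2(1)[OF spec[OF c1]] H1D(1)[OF v] w(1) _ l(1)]) (use \<psi> in simp)
 have l2': "(\<lambda>k. l2norm D (\<lambda>x. jacobian (\<psi> k) (at x) - G x)) \<longlonglongrightarrow> 0"
  by (rule sq[OF H1_C1_L2(2)[OF spec[OF c1]] H1D(3)[OF v] w(2) _ l(2)]) (use \<psi> in simp)
 have "l2norm D (\<lambda>x. jacobian (\<psi> k) (at x) - wgrad D w x) = l2norm D (\<lambda>x. jacobian (\<psi> k) (at x) - G x)" for k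
  by (rule l2norm_cong_AE[OF dom_sets(1)]) (use wG in eventually_elim, simp)
 then have l2: "(\<lambda>k. l2norm D (\<lambda>x. jacobian (\<psi> k) (at x) - wgrad D w x)) \<longlonglongrightarrow> 0" using l2' by simp
 have l3: "(\<lambda>k. ?N (\<psi> k)) \<longlonglongrightarrow> 0"
 proof (rule tendsto_0_le_ennreal)
  show "?N (\<psi> k) \<le> ennreal (inverse (real (Suc k)))" for k using \<psi> by (simp add: less_imp_le)
  show "(\<lambda>k. ennreal (inverse (real (Suc k)))) \<longlonglongrightarrow> 0" using tendsto_ennrealI[OF n0] by simp
 qed
 show ?thesis unfolding has_trace_def by (intro conjI exI[of _ \<psi>] c1 l1 l2 l3) simp
qed

text \<open>\<open>G\<close> is not known to be a gradient beforehand; this is how a limit of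
  gradients is recognised as one, with the trace condition preserved.\<close>

lemma H1_D_closed:
 assumes v: "\<And>k::nat. v k \<in> H1_D D \<Gamma>" and w: "w \<in> L2_space D" "G \<in> L2_space D"
  and l: "(\<lambda>k. l2norm D (\<lambda>x. v k x - w x)) \<longlonglongrightarrow> 0" "(\<lambda>k. l2norm D (\<lambda>x. wgrad D (v k) x - G x)) \<longlonglongrightarrow> 0"
 shows "w \<in> H1_D D \<Gamma>" "AE x in leb D. wgrad D w x = G x"
proof -
 have vH: "v k \<in> H1 D" for k using v by (simp add: H1_D_def)
 have wg: "is_weak_grad D w G" by (rule is_weak_grad_limit[OF vH w l])
 show wG: "AE x in leb D. wgrad D w x = G x" by (rule wgrad_eq[OF domain_facts(1,3) wg])
 have "has_trace D {x. c \<bullet> x = d} (closure \<Gamma> \<inter> {x. c \<bullet> x = d}) w (\<lambda>_. 0)" if "c \<noteq> 0" for c d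
  by (rule has_zero_trace_limit[OF vH w wG l]) (use v that in \<open>auto simp: H1_D_def zero_trace_on_def\<close>)
 moreover have "w \<in> H1 D" using w(1) wg by (auto simp: H1_def)
 ultimately show "w \<in> H1_D D \<Gamma>" by (simp add: H1_D_def zero_trace_on_def)
qed

text \<open>Any hyperplane supplies such a sequence, even one that misses the boundary.\<close>

lemma H1_D_approximable:
 assumes "v \<in> H1_D D \<Gamma>" obtains \<phi> where "C1_approximable D v \<phi>"
proof -
 obtain a :: "real^'n" where "a \<noteq> 0" using axis_eq_0_iff[of _ "1::real"] by (metis zero_neq_one)
 then have "has_trace D {x. a \<bullet> x = 0} (closure \<Gamma> \<inter> {x. a \<bullet> x = 0}) v (\<lambda>_. 0)" using assms by (simp add: H1_D_def zero_trace_on_def)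
 then show ?thesis using that unfolding has_trace_def C1_approximable_def by blast
qed

lemma has_trace_subset:
 assumes "has_trace D H A v w" "B \<subseteq> A"
 shows "has_trace D H B v w"
proof -
 obtain \<phi> where w: "w \<in> borel_measurable borel" and \<phi>: "\<forall>k. C1_field (\<phi> k)" "(\<lambda>k. l2norm D (\<lambda>x. \<phi> k x - v x)) \<longlonglongrightarrow> 0"
  "(\<lambda>k. l2norm D (\<lambda>x. jacobian (\<phi> k) (at x) - wgrad D v x)) \<longlonglongrightarrow> 0"
  "(\<lambda>k. set_nn_integral (surface_measure H) A (\<lambda>x. ennreal ((norm (\<phi> k x - w x))^2))) \<longlonglongrightarrow> 0"
  using assms(1) unfolding has_trace_def by (elim conjE exE)
 have "(\<lambda>k. set_nn_integral (surface_measure H) B (\<lambda>x. ennreal ((norm (\<phi> k x - w x))^2))) \<longlonglongrightarrow> 0"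
  by (rule tendsto_0_le_ennreal[OF _ \<phi>(4)]) (use assms(2) in \<open>auto intro!: nn_integral_mono simp: indicator_def\<close>)
 then show ?thesis unfolding has_trace_def using w \<phi> by (intro conjI exI[of _ \<phi>])
qed

lemma H1_D_facet_trace:
 assumes v: "v \<in> H1_D D \<Gamma>" and T: "T \<in> M" "S facet_of T" "S \<subseteq> closure \<Gamma>"
 shows "has_trace D (affine hull S) S v (\<lambda>_. 0)"
proof -
 obtain C c where C: "full_simplex C" "T = convex hull C" "c \<in> C" "S = convex hull (C - {c})" using element_facet[OF T(1,2)] by blast
 interpret full_simplex C by fact
 have H: "affine hull S = {x. gr c \<bullet> x = snd (cf c)}" using affine_hull_fct[OF C(3)] C(4) by simp
 have "has_trace D (affine hull S) (closure \<Gamma> \<inter> affine hull S) v (\<lambda>_. 0)"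
  using v gr_nonzero[OF C(3)] unfolding H by (simp add: H1_D_def zero_trace_on_def)
 then show ?thesis by (rule has_trace_subset) (use T(3) hull_subset[of S affine] in blast)
qed

end

context stokes_mesh
begin

text \<open>Poincare--Friedrichs: the bound holds on an element with a Dirichlet side, by the cone formula, and
 spreads to its neighbours by the Poincare inequality on convex sets; the domain is connected.\<close>

definition controlled :: "(real^'n) set \<Rightarrow> bool" where
 "controlled A \<longleftrightarrow> (\<exists>K\<ge>0. \<forall>v\<in>H1_D D \<Gamma>D. l2norm A v \<le> K * l2norm D (wgrad D v))"

lemma H1_D_H1: "v \<in> H1_D D \<Gamma> \<Longrightarrow> v \<in> H1 D" by (simp add: H1_D_def)

lemma controlled_of_mean:
 fixes C A :: "(real^'n) set"
 assumes C: "open C" "convex C" "C \<subseteq> D" and A: "open A" "A \<noteq> {}" "A \<subseteq> C"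
  and K: "0 \<le> K" "\<And>v. v \<in> H1_D D \<Gamma>D \<Longrightarrow> norm (LINT x|leb A. v x) \<le> K * l2norm D (wgrad D v)"
 shows "controlled C"
proof -
 obtain K1 K2 where P: "0 \<le> K1" "0 \<le> K2" "\<And>v \<phi>. v \<in> H1 D \<Longrightarrow> C1_approximable D v \<phi> \<Longrightarrow>
  (l2norm C v)^2 \<le> K1 * (l2norm D (wgrad D v))^2 + K2 * (norm (LINT x|leb A. v x))^2"
  by (rule poincare_H1[OF dom_sets(1) domain_facts(3) C A]) (rule that; assumption)
 have "l2norm C v \<le> sqrt (K1 + K2 * K^2) * l2norm D (wgrad D v)" if v: "v \<in> H1_D D \<Gamma>D" for v
 proof (rule power2_le_imp_le)
  obtain \<phi> where \<phi>: "C1_approximable D v \<phi>" by (rule H1_D_approximable[OF v])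
  have "(norm (LINT x|leb A. v x))^2 \<le> (K * l2norm D (wgrad D v))^2" by (rule power_mono[OF K(2)[OF v] norm_ge_zero])
  then have "K2 * (norm (LINT x|leb A. v x))^2 \<le> K2 * (K * l2norm D (wgrad D v))^2" by (rule mult_left_mono[OF _ P(2)])
  then have "(l2norm C v)^2 \<le> (K1 + K2 * K^2) * (l2norm D (wgrad D v))^2" using P(3)[OF H1_D_H1[OF v] \<phi>] by (simp add: algebra_simps power_mult_distrib)
  moreover have "0 \<le> K1 + K2 * K^2" using P by simp
  ultimately show "(l2norm C v)^2 \<le> (sqrt (K1 + K2 * K^2) * l2norm D (wgrad D v))^2" by (simp add: power_mult_distrib)
  show "0 \<le> sqrt (K1 + K2 * K^2) * l2norm D (wgrad D v)" using \<open>0 \<le> K1 + K2 * K^2\<close> by simp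
 qed
 moreover have "0 \<le> sqrt (K1 + K2 * K^2)" using P by simp
 ultimately show ?thesis unfolding controlled_def by blast
qed

lemma open_subset_lmeasurable: "open A \<Longrightarrow> A \<subseteq> D \<Longrightarrow> A \<in> lmeasurable" by (meson bounded_subset domain_facts(3) lmeasurable_open)

lemma controlled_subset:
 assumes "controlled B" "open A" "open B" "A \<subseteq> B" "B \<subseteq> D" shows "controlled A"
proof -
 obtain K where K: "K \<ge> 0" "\<And>v. v \<in> H1_D D \<Gamma>D \<Longrightarrow> l2norm B v \<le> K * l2norm D (wgrad D v)"
  using assms(1) unfolding controlled_def by blast
 have s: "A \<in> sets lebesgue" "B \<in> sets lebesgue" using assms(2,3) by auto
 have "l2norm A v \<le> K * l2norm D (wgrad D v)" if v: "v \<in> H1_D D \<Gamma>D" for v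
  using L2_subset(2)[OF s assms(4) L2_subset(1)[OF s(2) dom_sets(1) assms(5) H1D(1)[OF H1_D_H1[OF v]]]] K(2)[OF v] by linarith
 then show ?thesis unfolding controlled_def using K(1) by blast
qed

text \<open>Control on \<open>A\<close> bounds the integral over \<open>A\<close>, which is the
  datum that the Poincare inequality on \<open>C\<close> asks for.\<close>

lemma controlled_spread:
 assumes C: "open C" "convex C" "C \<subseteq> D" and A: "open A" "A \<noteq> {}" "A \<subseteq> C" "controlled A"
 shows "controlled C"
proof -
 obtain K where K: "K \<ge> 0" "\<And>v. v \<in> H1_D D \<Gamma>D \<Longrightarrow> l2norm A v \<le> K * l2norm D (wgrad D v)"
  using A(4) unfolding controlled_def by blast
 have AD: "A \<subseteq> D" using A(3) C(3) by blast
 have m: "A \<in> lmeasurable" by (rule open_subset_lmeasurable[OF A(1) AD])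
 have b: "norm (LINT x|leb A. v x) \<le> (sqrt (measure lebesgue A) * K) * l2norm D (wgrad D v)" if v: "v \<in> H1_D D \<Gamma>D" for v
 proof -
  have "v \<in> L2_space A" by (rule L2_subset(1)[OF fmeasurableD[OF m] dom_sets(1) AD H1D(1)[OF H1_D_H1[OF v]]])
  from L2_norm_integral_le[OF m this] mult_left_mono[OF K(2)[OF v], of "sqrt (measure lebesgue A)"]
  show ?thesis by (simp add: mult.assoc)
 qed
 show ?thesis by (rule controlled_of_mean[OF C A(1-3) _ b]) (use K(1) in simp)
qed

lemma controlled_start:
 obtains T where "T \<in> M" "controlled (interior T)"
proof -
 obtain T S where T: "T \<in> M" "S facet_of T" "S \<subseteq> closure \<Gamma>D" by (rule ex_Dirichlet_facet[OF parts res]) (rule that; assumption)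
 obtain C c where C: "full_simplex C" "T = convex hull C" "c \<in> C" "S = convex hull (C - {c})" using element_facet[OF T(1,2)] by blast
 interpret full_simplex C by fact
 have int: "interior T \<subseteq> D" by (rule interior_element_subset[OF T(1)])
 obtain R where R: "0 \<le> R" "\<And>G :: real^'n \<Rightarrow> real^'n^'n. G \<in> L2_space (interior (convex hull C)) \<Longrightarrow> (\<lambda>x. G x *v (x - c)) \<in> L2_space (interior (convex hull C))"
   "\<And>G :: real^'n \<Rightarrow> real^'n^'n. G \<in> L2_space (interior (convex hull C)) \<Longrightarrow>
   l2norm (interior (convex hull C)) (\<lambda>x. G x *v (x - c)) \<le> R * l2norm (interior (convex hull C)) G" by (rule matrix_vector_L2) (rule that; assumption)
 note R = R[folded C(2)]
 let ?s = "sqrt (measure lebesgue (interior T))"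
 have b: "norm (LINT x|leb (interior T). v x) \<le> (?s * R / real CARD('n)) * l2norm D (wgrad D v)" if v: "v \<in> H1_D D \<Gamma>D" for v
 proof -
  note vH = H1_D_H1[OF v]
  let ?W = "\<lambda>x. wgrad D v x *v (x - c)"
  have WL: "wgrad D v \<in> L2_space (interior T)" by (rule L2_element[OF H1D(3)[OF vH] T(1)])
  have "has_trace D (affine hull (convex hull (C - {c}))) (convex hull (C - {c})) v (\<lambda>_. 0)" using H1_D_facet_trace[OF v T] C(4) by simp
  from cone_formula_trace[OF dom_sets(1) domain_facts(3) int[unfolded C(2)] C(3) vH this, folded C(2)]
  \<comment> \<open>The vertex \<open>c\<close> is opposite the Dirichlet side, so the surface term
    is zero and the integral of \<open>v\<close> is expressed by its gradient alone.\<close>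
  have "(LINT x|leb (interior T). real CARD('n) *\<^sub>R v x + ?W x) = 0" by simp
  moreover have "integrable (leb (interior T)) v" by (rule L2_element_integrable[OF H1D(1)[OF vH] T(1)])
  moreover have "integrable (leb (interior T)) ?W" by (rule L2_integrable[OF interior_lmeasurable(1)[OF T(1)] R(2)[OF WL]])
  ultimately have "real CARD('n) *\<^sub>R (LINT x|leb (interior T). v x) = - (LINT x|leb (interior T). ?W x)" by (simp add: eq_neg_iff_add_eq_0)
  then have "real CARD('n) * norm (LINT x|leb (interior T). v x) = norm (LINT x|leb (interior T). ?W x)"
   using norm_scaleR[of "real CARD('n)" "LINT x|leb (interior T). v x"] by simp
  also have "... \<le> ?s * l2norm (interior T) ?W" by (rule L2_norm_integral_le[OF interior_lmeasurable(1)[OF T(1)] R(2)[OF WL]])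
  also have "... \<le> ?s * (R * l2norm D (wgrad D v))"
   by (intro mult_left_mono order_trans[OF R(3)[OF WL]] L2_subset(2)[OF interior_lmeasurable(2) dom_sets(1) int H1D(3)[OF vH]] R(1)) simp
  finally show ?thesis by (simp add: field_simps)
 qed
 have "controlled (interior T)"
  by (rule controlled_of_mean[OF open_interior convex_interior[OF element_convex[OF T(1)]] int open_interior interior_element_nonempty[OF T(1)] order_refl _ b])
    (use R(1) in simp)
 then show ?thesis by (rule that[OF T(1)])
qed

text \<open>Elements that meet in a point of the open domain, possibly only in a vertex, are joined
  through a ball around that point: it lies in the domain and overlaps both interiors.\<close>

lemma controlled_neighbour:
 assumes T: "T \<in> M" "T' \<in> M" and x: "x \<in> T" "x \<in> T'" "x \<in> D" and c: "controlled (interior T)"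
 shows "controlled (interior T')"
proof -
 obtain e where e: "e > 0" "ball x e \<subseteq> D" using domain_facts(1) x(3) open_contains_ball by blast
 have ne: "ball x e \<inter> interior U \<noteq> {}" if "U \<in> M" "x \<in> U" for U
 proof -
  have "closure (interior U) = closure U" by (rule convex_closure_interior[OF element_convex[OF that(1)] interior_element_nonempty[OF that(1)]])
  then have "x \<in> closure (interior U)" using that(2) closure_subset by blast
  then obtain y where "y \<in> interior U" "dist y x < e" using e(1) unfolding closure_approachable by blast
  then show ?thesis by (auto simp: dist_commute)
 qed
 have "controlled (ball x e \<inter> interior T)" by (rule controlled_subset[OF c _ open_interior _ interior_element_subset[OF T(1)]]) auto
 then have "controlled (ball x e)" by (intro controlled_spread[OF open_ball convex_ball e(2) _ ne[OF T(1) x(1)]]) auto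
 then have "controlled (ball x e \<inter> interior T')" by (rule controlled_subset[OF _ _ open_ball _ e(2)]) auto
 then show ?thesis by (intro controlled_spread[OF open_interior convex_interior[OF element_convex[OF T(2)]] interior_element_subset[OF T(2)] _ ne[OF T(2) x(2)]]) auto
qed

text \<open>The unions of the controlled and of the uncontrolled elements are closed, cover the
  domain and are disjoint inside it, so connectedness leaves only one of them.\<close>

lemma controlled_element:
 assumes "T \<in> M" shows "controlled (interior T)"
proof (rule ccontr)
 assume n: "\<not> controlled (interior T)"
 let ?G = "\<Union>{T \<in> M. controlled (interior T)}" and ?B = "\<Union>{T \<in> M. \<not> controlled (interior T)}"
 have c: "closed ?G" "closed ?B" by (rule closed_Union; use finite_M element_compact compact_imp_closed in force)+
 have cov: "D \<subseteq> ?G \<union> ?B" using Union_M closure_subset[of D] by blast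
 have dis: "?G \<inter> ?B \<inter> D = {}" using controlled_neighbour by blast
 have "?G \<inter> D = {} \<or> ?B \<inter> D = {}" using domain_facts(2) c cov dis unfolding connected_closed by blast
 moreover obtain T0 where "T0 \<in> M" "controlled (interior T0)" by (rule controlled_start)
 then have "?G \<inter> D \<noteq> {}" using interior_element_subset[of T0] interior_element_nonempty[of T0] interior_subset[of T0] by blast
 moreover have "?B \<inter> D \<noteq> {}" using n assms interior_element_subset[of T] interior_element_nonempty[of T] interior_subset[of T] by blast
 ultimately show False by blast
qed

lemma poincare_friedrichs:
 obtains K where "K \<ge> 0" "\<And>v. v \<in> H1_D D \<Gamma>D \<Longrightarrow> l2norm D v \<le> K * l2norm D (wgrad D v)"
proof -
 have "\<forall>T\<in>M. \<exists>K. K \<ge> 0 \<and> (\<forall>v\<in>H1_D D \<Gamma>D. l2norm (interior T) v \<le> K * l2norm D (wgrad D v))"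
  using controlled_element unfolding controlled_def by blast
 then obtain K where K: "\<And>T. T \<in> M \<Longrightarrow> K T \<ge> 0" "\<And>T v. T \<in> M \<Longrightarrow> v \<in> H1_D D \<Gamma>D \<Longrightarrow> l2norm (interior T) v \<le> K T * l2norm D (wgrad D v)"
  unfolding bchoice_iff by blast
 have "l2norm D v \<le> sqrt (\<Sum>T\<in>M. (K T)^2) * l2norm D (wgrad D v)" if v: "v \<in> H1_D D \<Gamma>D" for v
 proof (rule power2_le_imp_le)
  have "(l2norm D v)^2 = (\<Sum>T\<in>M. (l2norm (interior T) v)^2)"
   unfolding l2norm_sq_integral by (rule integral_split[OF L2_norm_sq_integrable[OF H1D(1)[OF H1_D_H1[OF v]]]])
  also have "... \<le> (\<Sum>T\<in>M. (K T * l2norm D (wgrad D v))^2)" by (intro sum_mono power_mono K(2) v l2norm_nonneg)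
  also have "... = (sqrt (\<Sum>T\<in>M. (K T)^2) * l2norm D (wgrad D v))^2" by (simp add: power_mult_distrib sum_distrib_right sum_nonneg)
  finally show "(l2norm D v)^2 \<le> (sqrt (\<Sum>T\<in>M. (K T)^2) * l2norm D (wgrad D v))^2" .
  show "0 \<le> sqrt (\<Sum>T\<in>M. (K T)^2) * l2norm D (wgrad D v)" by (simp add: sum_nonneg)
 qed
 then show ?thesis by (intro that[of "sqrt (\<Sum>T\<in>M. (K T)^2)"]) (simp_all add: sum_nonneg)
qed

text \<open>By Poincare--Friedrichs the gradients form a closed subspace, so the projection is a gradient again.\<close>

lemma gradient_projection:
 assumes e: "e \<in> L2_space D"
 obtains w where "w \<in> H1_D D \<Gamma>D" "\<And>v. v \<in> H1_D D \<Gamma>D \<Longrightarrow> ip D (\<lambda>x. e x - wgrad D w x) (wgrad D v) = 0"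
proof -
 let ?V = "{G \<in> L2_space D. \<exists>v\<in>H1_D D \<Gamma>D. AE x in leb D. G x = wgrad D v x}"
 obtain K where K: "K \<ge> 0" "\<And>v. v \<in> H1_D D \<Gamma>D \<Longrightarrow> l2norm D v \<le> K * l2norm D (wgrad D v)"
  by (rule poincare_friedrichs) (rule that; assumption)
 have lin: "(\<lambda>x. a *\<^sub>R G x + b *\<^sub>R H x) \<in> ?V" if GH: "G \<in> ?V" "H \<in> ?V" for G H a b
 proof -
  obtain v w where v: "v \<in> H1_D D \<Gamma>D" "AE x in leb D. G x = wgrad D v x"
   and w: "w \<in> H1_D D \<Gamma>D" "AE x in leb D. H x = wgrad D w x" using GH by blast
  have "AE x in leb D. a *\<^sub>R G x + b *\<^sub>R H x = wgrad D (\<lambda>x. a *\<^sub>R v x + b *\<^sub>R w x) x"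
   using v(2) w(2) H1_lincomb(2)[OF domain_facts(1,3) H1_D_H1[OF v(1)] H1_D_H1[OF w(1)], of a b] by eventually_elim simp
  moreover have "(\<lambda>x. a *\<^sub>R G x + b *\<^sub>R H x) \<in> L2_space D" using GH by (intro L2_add L2_scaleR) auto
  ultimately show ?thesis using H1_D_lincomb[OF v(1) w(1), of a b] by blast
 qed
 obtain v0 where v0: "v0 \<in> H1_D D \<Gamma>D" "v0 = (\<lambda>_. 0)"
 proof -
  have wg: "is_weak_grad D (\<lambda>_. 0) (\<lambda>_. 0)" by (simp add: is_weak_grad_def)
  have c: "C1_field (\<lambda>_. 0 :: real^'n)" "jacobian (\<lambda>_. 0 :: real^'n) (at x) = 0" for x :: "real^'n" by (rule C1_fieldI[where m = "\<lambda>_. 0"]; simp)+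
  have "l2norm D (\<lambda>x. 0 - wgrad D (\<lambda>_. 0) x) = l2norm D (\<lambda>_. 0 :: real^'n^'n)"
   by (rule l2norm_cong_AE[OF dom_sets(1)]) (use wgrad_eq[OF domain_facts(1,3) wg] in eventually_elim, simp)
  then have "has_trace D H A (\<lambda>_. 0) (\<lambda>_. 0)" for H A
   unfolding has_trace_def by (intro conjI exI[of _ "\<lambda>_ _. 0"]) (simp_all add: c, simp_all add: l2norm_def)
  then show ?thesis using that wg by (auto simp: H1_D_def H1_def zero_trace_on_def)
 qed
 have z: "(\<lambda>x. 0) \<in> ?V"
 proof -
  have wg: "is_weak_grad D (\<lambda>_. 0) (\<lambda>_. 0)" by (simp add: is_weak_grad_def)
  have "AE x in leb D. 0 = wgrad D v0 x" using wgrad_eq[OF domain_facts(1,3) wg] unfolding v0(2) by eventually_elim simp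
  then show ?thesis using v0(1) by blast
 qed
 have V: "?V \<subseteq> L2_space D" by blast
 have add: "(\<lambda>x. G x + H x) \<in> ?V" if "G \<in> ?V" "H \<in> ?V" for G H using lin[OF that, of 1 1] by simp
 have scale: "(\<lambda>x. c *\<^sub>R G x) \<in> ?V" if "G \<in> ?V" for G c using lin[OF that z, of c 0] by simp
 obtain G g where G: "\<And>k::nat. G k \<in> ?V" and g: "g \<in> L2_space D" and
  lim: "(\<lambda>k. l2norm D (\<lambda>x. G k x - g x)) \<longlonglongrightarrow> 0" and orth: "\<And>w. w \<in> ?V \<Longrightarrow> ip D (\<lambda>x. e x - g x) w = 0"
  by (rule L2_closure_projection[OF V z add scale e]) (assumption | rule that; assumption)+
 have "\<forall>k. \<exists>v. v \<in> H1_D D \<Gamma>D \<and> (AE x in leb D. G k x = wgrad D v x)" using G by blast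
 then obtain v where v: "\<forall>k. v k \<in> H1_D D \<Gamma>D \<and> (AE x in leb D. G k x = wgrad D (v k) x)" unfolding choice_iff by (elim exE)
 have vD: "v k \<in> H1_D D \<Gamma>D" and vG: "AE x in leb D. G k x = wgrad D (v k) x" for k using v by simp_all
 have GL: "G k \<in> L2_space D" for k using G by simp
 \<comment> \<open>Poincare--Friedrichs transfers the Cauchy property from the gradients to the
   fields.\<close>
 have bound: "l2norm D (\<lambda>x. v m x - v n x) \<le> K * l2norm D (\<lambda>x. G m x - G n x)" for m n
 proof -
  have "(\<lambda>x. 1 *\<^sub>R v m x + (-1) *\<^sub>R v n x) \<in> H1_D D \<Gamma>D" by (rule H1_D_lincomb[OF vD vD])
  from K(2)[OF this] have "l2norm D (\<lambda>x. v m x - v n x) \<le> K * l2norm D (wgrad D (\<lambda>x. 1 *\<^sub>R v m x + (-1) *\<^sub>R v n x))" by simp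
  also have "l2norm D (wgrad D (\<lambda>x. 1 *\<^sub>R v m x + (-1) *\<^sub>R v n x)) = l2norm D (\<lambda>x. G m x - G n x)"
  proof (rule l2norm_cong_AE[OF dom_sets(1)])
   show "AE x in leb D. wgrad D (\<lambda>x. 1 *\<^sub>R v m x + (-1) *\<^sub>R v n x) x = G m x - G n x"
    using H1_lincomb(2)[OF domain_facts(1,3) H1_D_H1[OF vD] H1_D_H1[OF vD], of 1 m "-1" n] vG[of m] vG[of n] by eventually_elim simp
  qed
  finally show ?thesis .
 qed
 have Cauchy: "\<exists>N. \<forall>m\<ge>N. \<forall>n\<ge>N. l2norm D (\<lambda>x. v m x - v n x) < r" if r: "r > 0" for r
 proof -
  \<comment> \<open>Dividing by \<open>K + 1\<close> instead of \<open>K\<close> covers the case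
    \<open>K = 0\<close>.\<close>
  define q where "q = r / (K + 1) / 2"
  have "q + q = r / (K + 1)" unfolding q_def by (rule field_sum_of_halves)
  then have q: "q > 0" "(K + 1) * (q + q) = r" using r K(1) by (simp_all add: q_def)
  from order_tendstoD(2)[OF lim q(1)] obtain N where N: "\<And>k. k \<ge> N \<Longrightarrow> l2norm D (\<lambda>x. G k x - g x) < q"
   unfolding eventually_sequentially by blast
  have "l2norm D (\<lambda>x. v m x - v n x) < r" if "m \<ge> N" "n \<ge> N" for m n
  proof -
   have "l2norm D (\<lambda>x. G m x - G n x) \<le> l2norm D (\<lambda>x. G m x - g x) + l2norm D (\<lambda>x. g x - G n x)" by (rule l2norm_triangle_diff[OF GL g GL])
   then have "l2norm D (\<lambda>x. G m x - G n x) < q + q" using N[OF that(1)] N[OF that(2)] l2norm_minus_commute[of D g "G n"] by linarith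
   then have "(K + 1) * l2norm D (\<lambda>x. G m x - G n x) < r" unfolding q(2)[symmetric] using K(1) by (intro mult_strict_left_mono) simp_all
   moreover have "K * l2norm D (\<lambda>x. G m x - G n x) \<le> (K + 1) * l2norm D (\<lambda>x. G m x - G n x)" by (rule mult_right_mono) simp_all
   ultimately show ?thesis using bound[of m n] by linarith
  qed
  then show ?thesis by blast
 qed
 obtain w where w: "w \<in> L2_space D" "(\<lambda>k. l2norm D (\<lambda>x. v k x - w x)) \<longlonglongrightarrow> 0"
  by (rule L2_complete[OF H1D(1)[OF H1_D_H1[OF vD]] Cauchy]) (assumption | rule that; assumption)+
 have "l2norm D (\<lambda>x. wgrad D (v k) x - g x) = l2norm D (\<lambda>x. G k x - g x)" for k
  by (rule l2norm_cong_AE[OF dom_sets(1)]) (use vG[of k] in eventually_elim, simp)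
 then have lim': "(\<lambda>k. l2norm D (\<lambda>x. wgrad D (v k) x - g x)) \<longlonglongrightarrow> 0" using lim by simp
 note w' = H1_D_closed[OF vD w(1) g w(2) lim']
 have "ip D (\<lambda>x. e x - wgrad D w x) (wgrad D u) = 0" if u: "u \<in> H1_D D \<Gamma>D" for u
 proof -
  have "ip D (\<lambda>x. e x - wgrad D w x) (wgrad D u) = ip D (\<lambda>x. e x - g x) (wgrad D u)"
   by (rule ip_cong_AE[OF dom_sets(1)]) (use w'(2) in eventually_elim, simp, simp)
  also have "wgrad D u \<in> ?V" using u H1D(3)[OF H1_D_H1[OF u]] by (auto intro!: bexI[of _ u])
  then have "ip D (\<lambda>x. e x - g x) (wgrad D u) = 0" by (rule orth)
  finally show ?thesis .
 qed
 then show ?thesis by (rule that[OF w'(1)])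
qed

end

section \<open>Strong duality\<close>

lemma bounded_linear_dev: "bounded_linear dev" unfolding linear_conv_bounded_linear[symmetric]
 by (rule linearI) (simp_all add: dev_def trace_def sum.distrib sum_distrib_left[symmetric] algebra_simps add_divide_distrib scaleR_add_left)

lemma trace_dev: "trace (dev A) = 0" by (simp add: dev_def trace_def mat_def sum_subtractf)

lemma trace_eq_inner: "trace (A :: real^'n^'n) = A \<bullet> mat 1" by (simp add: trace_def inner_vec_def mat_def if_distrib[of "\<lambda>x. _ * x"] cong: if_cong)

lemma dev_inner_trace_free: "trace (B :: real^'n^'n) = 0 \<Longrightarrow> dev A \<bullet> B = A \<bullet> B"
 using inner_commute[of "mat 1" B] by (simp add: dev_def inner_diff_left trace_eq_inner)

lemma trace_scaleR: "trace (a *\<^sub>R A) = a * trace (A :: real^'n^'n)" by (simp add: trace_eq_inner)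

lemma dev_lincomb: "dev (A + t *\<^sub>R B) = dev A + t *\<^sub>R dev B"
 by (simp add: linear_add[OF bounded_linear.linear[OF bounded_linear_dev]] linear_scale[OF bounded_linear.linear[OF bounded_linear_dev]])

text \<open>Turns optimality along a line into the vanishing of the first variation, for the
  minimisers and, after a change of sign, for the maximisers.\<close>

lemma quadratic_nonneg_imp_linear_zero:
 fixes a b :: real
 assumes "\<And>t. 0 \<le> t * b + t^2 * a"
 shows "b = 0"
proof (rule ccontr)
 assume b: "b \<noteq> 0"
 \<comment> \<open>As \<open>a \<le> c / 2 - 1\<close>, the value at \<open>t = - b / c\<close> is
   at most \<open>- (b^2 / (2 * c)) - b^2 / c^2\<close>, which is negative.\<close>
 define c where "c = 2 * (\<bar>a\<bar> + 1)"
 have c: "c > 0" "a \<le> c / 2 - 1" by (auto simp: c_def field_simps)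
 have "0 \<le> (- b / c) * b + (- b / c)^2 * a" by (rule assms)
 also have "... \<le> (- b / c) * b + (- b / c)^2 * (c / 2 - 1)" by (intro add_left_mono mult_left_mono c) simp
 finally have "0 \<le> (- b / c) * b + (- b / c)^2 * (c / 2 - 1)" .
 moreover have "(- b / c) * b + (- b / c)^2 * (c / 2 - 1) = - (b^2 / (2 * c)) - b^2 / c^2" using c(1) by (simp add: power2_eq_square field_simps)
 moreover have "b^2 / (2 * c) > 0" "b^2 / c^2 \<ge> 0" using b c(1) by simp_all
 ultimately show False by linarith
qed

context mesh
begin

lemma l2norm_add_scaleR_sq:
 assumes "f \<in> L2_space D" "g \<in> L2_space D"
 shows "(l2norm D (\<lambda>x. f x + t *\<^sub>R g x))^2 = (l2norm D f)^2 + 2 * t * ip D f g + t^2 * (l2norm D g)^2"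
 using l2norm_diff_scaleR_sq[OF assms, of "- t"] by (simp add: l2norm_sq)

lemma H1_add_scaleR:
 assumes "v \<in> H1 D" "w \<in> H1 D"
 shows "(\<lambda>x. v x + t *\<^sub>R w x) \<in> H1 D"
  and "AE x in leb D. wgrad D (\<lambda>x. v x + t *\<^sub>R w x) x = wgrad D v x + t *\<^sub>R wgrad D w x"
 using H1_lincomb[OF domain_facts(1,3) assms, of 1 t] by simp_all

lemma Hdiv_add_scaleR:
 assumes "v \<in> Hdiv D" "w \<in> Hdiv D"
 shows "(\<lambda>x. v x + t *\<^sub>R w x) \<in> Hdiv D"
  and "AE x in leb D. wdiv D (\<lambda>x. v x + t *\<^sub>R w x) x = wdiv D v x + t *\<^sub>R wdiv D w x"
 using Hdiv_lincomb[OF domain_facts(1,3) assms, of 1 t] by simp_all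

lemma primal_expand:
 assumes f: "f \<in> L2_space D" "F \<in> L2_space D" and h: "u \<in> H1 D" "w \<in> H1 D" "uD \<in> H1 D"
 shows "primal D \<nu> f F uD (\<lambda>x. u x + t *\<^sub>R w x) = primal D \<nu> f F uD u
  + (t * (\<nu> * ip D (\<lambda>x. wgrad D u x + wgrad D uD x) (wgrad D w) - ip D f w - ip D F (wgrad D w))
  + t^2 * (\<nu> / 2 * (l2norm D (wgrad D w))^2))"
proof -
 let ?G = "\<lambda>x. wgrad D u x + wgrad D uD x"
 note L = f H1D(1)[OF h(1)] H1D(1)[OF h(2)] H1D(3)[OF h(1)] H1D(3)[OF h(2)] H1D(3)[OF h(3)]
 have GL: "?G \<in> L2_space D" by (intro L2_add L)
 note h' = H1_add_scaleR[OF h(1,2), of t]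
 have "AE x in leb D. wgrad D (\<lambda>x. u x + t *\<^sub>R w x + uD x) x = ?G x + t *\<^sub>R wgrad D w x"
  using H1_add_scaleR(2)[OF h'(1) h(3), of 1] h'(2) unfolding scaleR_one by eventually_elim (simp add: algebra_simps)
 from l2norm_cong_AE[OF dom_sets(1) this]
 have 1: "(l2norm D (wgrad D (\<lambda>x. u x + t *\<^sub>R w x + uD x)))^2
  = (l2norm D ?G)^2 + 2 * t * ip D ?G (wgrad D w) + t^2 * (l2norm D (wgrad D w))^2" using l2norm_add_scaleR_sq[OF GL L(6), of t] by simp
 have "AE x in leb D. wgrad D (\<lambda>x. u x + uD x) x = ?G x" using H1_add_scaleR(2)[OF h(1,3), of 1] by simp
 from l2norm_cong_AE[OF dom_sets(1) this]
 have 2: "l2norm D (wgrad D (\<lambda>x. u x + uD x)) = l2norm D ?G" by simp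
 have 3: "ip D f (\<lambda>x. u x + t *\<^sub>R w x) = ip D f u + t * ip D f w" using ip_add_right[OF L(3) L2_scaleR[OF L(4)] f(1), of t] by (simp add: ip_scaleR_right)
 have "ip D F (wgrad D (\<lambda>x. u x + t *\<^sub>R w x)) = ip D F (\<lambda>x. wgrad D u x + t *\<^sub>R wgrad D w x)"
  by (rule ip_cong_AE[OF dom_sets(1) _ h'(2)]) simp
 also have "... = ip D F (wgrad D u) + t * ip D F (wgrad D w)" using ip_add_right[OF L(5) L2_scaleR[OF L(6)] f(2), of t] by (simp add: ip_scaleR_right)
 finally show ?thesis unfolding primal_def 1 2 3 by (simp add: field_simps)
qed

text \<open>One computation for both levels: \<open>Z\<close> is the deviatoric stress,
  \<open>d\<close> the deviator of the variation and \<open>g\<close> the gradient of the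
  lift.\<close>

lemma dual_quadratic:
 assumes Z: "Z \<in> L2_space D" "d \<in> L2_space D" and g: "g \<in> L2_space D"
 shows "- (1 / (2 * \<nu>)) * (l2norm D (\<lambda>x. Z x + t *\<^sub>R d x))^2 + ip D (\<lambda>x. Z x + t *\<^sub>R d x) g
  = - (1 / (2 * \<nu>)) * (l2norm D Z)^2 + ip D Z g
  - (t * ip D d (\<lambda>x. (1 / \<nu>) *\<^sub>R Z x - g x) + t^2 * (1 / (2 * \<nu>) * (l2norm D d)^2))"
proof -
 have 1: "ip D d (\<lambda>x. (1 / \<nu>) *\<^sub>R Z x - g x) = (1 / \<nu>) * ip D Z d - ip D d g"
  using ip_diff_right[OF L2_scaleR[OF Z(1)] g Z(2), of "1 / \<nu>"] ip_commute[of D Z] by (simp add: ip_scaleR_right)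
 have 2: "ip D (\<lambda>x. Z x + t *\<^sub>R d x) g = ip D Z g + t * ip D d g" using ip_add_left[OF Z(1) L2_scaleR[OF Z(2)] g, of t] by (simp add: ip_scaleR_left)
 show ?thesis unfolding 1 2 l2norm_add_scaleR_sq[OF Z] by (cases "\<nu> = 0") (simp_all add: field_simps)
qed

lemma ip_dev:
 assumes "AE x in leb D. trace (W x) = 0"
 shows "ip D (\<lambda>x. dev (A x)) W = ip D A W" unfolding ip_def by (rule integral_cong_AE_lebesgue_on[OF dom_sets(1)])
  (use assms in eventually_elim, simp add: dev_inner_trace_free)

text \<open>The core of both duality arguments: the part of the residual that is orthogonal to the
 gradients is an admissible variation of the stress, and the remaining gradient one of the velocity.\<close>

lemma stress_identity:
 fixes Z gu gD gw :: "real^'n \<Rightarrow> real^'n^'n"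
 assumes \<nu>: "\<nu> > 0" and L: "Z \<in> L2_space D" "gu \<in> L2_space D" "gD \<in> L2_space D" "gw \<in> L2_space D"
  and tr: "\<And>x. trace (Z x) = 0" "AE x in leb D. trace (gu x) = 0" "AE x in leb D. trace (gD x) = 0"
  and E: "\<And>x. E x = (1 / \<nu>) *\<^sub>R Z x - (gu x + gD x)" and R: "\<And>x. R x = E x - gw x"
  and orth: "ip D R gw = 0" "ip D R gu = 0" "ip D (\<lambda>x. dev (R x)) (\<lambda>x. (1 / \<nu>) *\<^sub>R Z x - gD x) = 0"
  and w: "AE x in leb D. trace (gw x) = 0 \<Longrightarrow> ip D E gw = 0"
 shows "AE x in leb D. Z x = \<nu> *\<^sub>R (gu x + gD x)"
proof -
 let ?Q = "\<lambda>x. (1 / \<nu>) *\<^sub>R Z x - gD x"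
 have QL: "?Q \<in> L2_space D" by (intro L2_diff L2_scaleR L)
 have EQ: "E = (\<lambda>x. ?Q x - gu x)" by (simp add: fun_eq_iff E)
 have EL: "E \<in> L2_space D" unfolding EQ by (rule L2_diff[OF QL L(2)])
 have Rf: "R = (\<lambda>x. E x - gw x)" by (simp add: fun_eq_iff R)
 have RL: "R \<in> L2_space D" unfolding Rf by (rule L2_diff[OF EL L(4)])
 have "AE x in leb D. trace (?Q x) = 0" using tr(3) by eventually_elim (simp add: trace_sub trace_scaleR tr(1))
 then have "ip D R ?Q = 0" using ip_dev[of ?Q R] orth(3) by simp
 \<comment> \<open>\<open>R\<close> is orthogonal to both parts of \<open>E\<close> and to
   \<open>gw\<close>, hence to itself, so \<open>E = gw\<close> almost everywhere. Only then is
   \<open>gw\<close> known to be trace-free and the hypothesis \<open>w\<close> applicable.\<close>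
 then have "ip D R E = 0" unfolding EQ using ip_diff_right[OF QL L(2) RL] orth(2) by simp
 then have "ip D R (\<lambda>x. E x - gw x) = 0" using ip_diff_right[OF EL L(4) RL] orth(1) by simp
 from l2norm_zero_AE[OF RL this[folded Rf]] have Ew: "AE x in leb D. E x = gw x" by eventually_elim (simp add: R)
 then have "AE x in leb D. trace (gw x) = 0" using tr(2,3)
 proof eventually_elim
  case (elim x)
  have "trace (E x) = 0" unfolding E using elim(2,3) by (simp add: trace_sub trace_add trace_scaleR tr(1))
  then show ?case using elim(1) by simp
 qed
 then have "ip D E gw = 0" by (rule w)
 then have "ip D E E = 0" using ip_cong_AE[OF dom_sets(1) _ Ew, of E E] by simp
 from l2norm_zero_AE[OF EL this] show ?thesis
 proof eventually_elim
  case (elim x)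
  then have "\<nu> *\<^sub>R ((1 / \<nu>) *\<^sub>R Z x) = \<nu> *\<^sub>R (gu x + gD x)" by (simp add: E)
  then show ?case using \<nu> by simp
 qed
qed

text \<open>A test function times a unit vector is a C1 field that vanishes on the frontier, hence
  lies in \<open>H1_D\<close>. Orthogonality to its gradient is the defining identity of a vanishing
  weak divergence.\<close>

lemma zero_wdiv_free:
 assumes \<tau>: "\<tau> \<in> L2_space D" and orth: "\<And>v. v \<in> H1_D D \<Gamma> \<Longrightarrow> ip D \<tau> (wgrad D v) = 0" and \<Gamma>: "closure \<Gamma> \<subseteq> frontier D"
 shows "is_weak_div D \<tau> (\<lambda>_. 0)" unfolding is_weak_div_def
proof (intro conjI allI impI L2_zero)
 fix \<phi> \<gamma> and i :: 'n assume t: "test_fun D \<phi> \<gamma>"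
 define \<psi> :: "real^'n \<Rightarrow> real^'n" where "\<psi> x = \<phi> x *\<^sub>R axis i 1" for x
 define J :: "real^'n \<Rightarrow> real^'n^'n" where "J x = (\<chi> k. if k = i then \<gamma> x else 0)" for x
 note t' = t[unfolded test_fun_def]
 have d: "(\<psi> has_derivative (\<lambda>h. J x *v h)) (at x)" for x
 proof -
  have "(\<phi> has_derivative (\<lambda>h. h \<bullet> \<gamma> x)) (at x)" using t' unfolding gderiv_def by blast
  then have "(\<psi> has_derivative (\<lambda>h. (h \<bullet> \<gamma> x) *\<^sub>R axis i 1)) (at x)" unfolding \<psi>_def by (rule has_derivative_scaleR_left)
  moreover have "(\<lambda>h. (h \<bullet> \<gamma> x) *\<^sub>R axis i 1) = (\<lambda>h. J x *v h)"
   by (simp add: fun_eq_iff vec_eq_iff matrix_vector_mult_component J_def axis_def inner_commute)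
  ultimately show ?thesis by simp
 qed
 have Jc: "continuous_on UNIV J"
 proof -
  have "continuous_on UNIV (\<lambda>x. if k = i then \<gamma> x else 0)" for k using t' by (cases "k = i") auto
  then show ?thesis unfolding J_def by (rule continuous_on_vec_lambda)
 qed
 note C1 = C1_fieldI[OF d Jc]
 have JL: "J \<in> L2_space D" and \<psi>L: "\<psi> \<in> L2_space D" by (rule continuous_L2[OF dom_sets(1) domain_facts(3)], fact Jc)
    (rule H1_C1_L2(1)[OF C1(1)])
 \<comment> \<open>The gradient of a compactly supported function integrates to 0; this is read off
   from \<open>RT_weak_div\<close> for a constant matrix field.\<close>
 have zero_int: "(LINT x|leb D. \<theta> x) = 0" if \<theta>: "test_fun D \<eta> \<theta>" for \<eta> and \<theta> :: "real^'n \<Rightarrow> real^'n"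
 proof (rule vec_eq_iff[THEN iffD2], rule allI)
  fix j :: 'n
  define m :: "real^'n \<Rightarrow> real^'n^'n" where "m x = (\<chi> k. axis j 1)" for x
  have P: "m \<in> P1 M" unfolding P1_def m_def by (auto intro!: exI[of _ "\<lambda>_. 0"] simp: linear_zero)
  have e: "ea T m = m" if "T \<in> M" for T using ea_eq[OF P that linear_zero, of "\<chi> k. axis j 1"] by (simp add: m_def[abs_def])
  have "m \<in> RT_N ({} :: (real^'n) set) M"
  proof (rule RT_N_I[OF P, where \<kappa> = "\<lambda>T S. (\<chi> k. axis j 1) *v outer_normal T S"])
   show "ea T m x *v outer_normal T S = (\<chi> k. axis j 1) *v outer_normal T S" if "T \<in> M" for T S x by (simp only: e[OF that] m_def)
   show "(\<chi> k. axis j 1) *v outer_normal T' S = - ((\<chi> k. axis j 1) *v outer_normal T S)"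
    if "T \<in> M" "T' \<in> M" "T \<noteq> T'" "S facet_of T" "S facet_of T'" for T T' S
    unfolding common_facet_opposite(1)[OF that] by (simp add: vec_eq_iff matrix_vector_mult_component)
   show "(\<chi> k. axis j 1) *v outer_normal T S = 0" if "T \<in> M" "S facet_of T" "S \<subseteq> closure ({} :: (real^'n) set)" for T S
    using facet_nonempty[OF that(1,2)] that(3) by simp
  qed
  then have "m \<in> RT M" by (simp add: RT_N_def)
  from RT_weak_div[OF this, unfolded is_weak_div_def, THEN conjunct2, rule_format, OF \<theta>, of i]
  have "(LINT x|leb D. (m x $ i) \<bullet> \<theta> x) = - (LINT x|leb D. \<eta> x * (rt_div m x $ i))" .
  moreover have "rt_div m x = 0" for x
  proof -
   have "jacobian (\<lambda>y. m y $ k) (at x) = 0" for k unfolding m_def by (rule jacobian_eqI) simp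
   then show ?thesis by (simp add: rt_div_def vec_eq_iff trace_def)
  qed
  ultimately have "(LINT x|leb D. \<theta> x $ j) = 0" by (simp add: m_def inner_axis')
  then show "(LINT x|leb D. \<theta> x) $ j = 0 $ j" using integral_vec_component[OF L2_integrable[OF dom_sets(2) test_fun_L2(2)[OF dom_sets(1) \<theta>]], of j] by simp
 qed
 have wg: "is_weak_grad D \<psi> J" unfolding is_weak_grad_def
 proof (intro conjI allI impI JL)
  fix \<phi>' \<gamma>' and k :: 'n assume s: "test_fun D \<phi>' \<gamma>'"
  note s' = s[unfolded test_fun_def]
  note tL = test_fun_L2[OF dom_sets(1) t] and sL = test_fun_L2[OF dom_sets(1) s]
  \<comment> \<open>The product of two test functions is again a test function, and the integral of
    its gradient is the integration by parts that \<open>wg\<close> asks for.\<close>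
  have "test_fun D (\<lambda>x. \<phi> x * \<phi>' x) (\<lambda>x. \<phi> x *\<^sub>R \<gamma>' x + \<phi>' x *\<^sub>R \<gamma> x)" unfolding test_fun_def
  proof (intro conjI allI)
   show "GDERIV (\<lambda>x. \<phi> x * \<phi>' x) x :> \<phi> x *\<^sub>R \<gamma>' x + \<phi>' x *\<^sub>R \<gamma> x" for x
    using GDERIV_mult[of \<phi> x "\<gamma> x" \<phi>' "\<gamma>' x"] t' s' by simp
   show "continuous_on UNIV (\<lambda>x. \<phi> x *\<^sub>R \<gamma>' x + \<phi>' x *\<^sub>R \<gamma> x)"
    using t' s' by (intro continuous_intros test_fun_continuous[OF t] test_fun_continuous[OF s]) auto
   show "\<exists>K. compact K \<and> K \<subseteq> D \<and> (\<forall>x. x \<notin> K \<longrightarrow> \<phi> x * \<phi>' x = 0)" using t' by auto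
  qed
  from zero_int[OF this] have "(LINT x|leb D. \<phi> x *\<^sub>R \<gamma>' x) = - (LINT x|leb D. \<phi>' x *\<^sub>R \<gamma> x)"
   using L2_scaleR_integrable[OF tL(1) sL(2)] L2_scaleR_integrable[OF sL(1) tL(2)] by (simp add: eq_neg_iff_add_eq_0)
  then show "(LINT x|leb D. (\<psi> x $ k) *\<^sub>R \<gamma>' x) = - (LINT x|leb D. \<phi>' x *\<^sub>R (J x $ k))"
   by (cases "k = i") (simp_all add: \<psi>_def J_def axis_def)
 qed
 have wgJ: "AE x in leb D. wgrad D \<psi> x = J x" by (rule wgrad_eq[OF domain_facts(1,3) wg])
 have "l2norm D (\<lambda>x. J x - wgrad D \<psi> x) = l2norm D (\<lambda>_. 0 :: real^'n^'n)" by (rule l2norm_cong_AE[OF dom_sets(1)]) (use wgJ in eventually_elim, simp)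
 then have l: "l2norm D (\<lambda>x. jacobian \<psi> (at x) - wgrad D \<psi> x) = 0" by (simp add: C1(2) l2norm_def)
 have "has_trace D H (closure \<Gamma> \<inter> H) \<psi> (\<lambda>_. 0)" for H
 proof -
  obtain K where "compact K" "K \<subseteq> D" "\<And>x. x \<notin> K \<Longrightarrow> \<phi> x = 0" using t' by blast
  moreover have "x \<notin> D" if "x \<in> closure \<Gamma>" for x using that \<Gamma> domain_facts(1) by (auto simp: frontier_def interior_open)
  ultimately have "\<psi> x = 0" if "x \<in> closure \<Gamma>" for x using that by (auto simp: \<psi>_def)
  then have "(\<lambda>x. ennreal ((norm (\<psi> x - 0))^2) * indicator (closure \<Gamma> \<inter> H) x) = (\<lambda>_. 0)" by (auto simp: fun_eq_iff indicator_def)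
  then show ?thesis unfolding has_trace_def using l by (intro conjI exI[of _ "\<lambda>_. \<psi>"]) (simp_all add: C1(1), simp_all add: l2norm_def)
 qed
 then have "\<psi> \<in> H1_D D \<Gamma>" using \<psi>L wg by (auto simp: H1_D_def H1_def zero_trace_on_def)
 from orth[OF this] have "ip D \<tau> J = 0" using ip_cong_AE[OF dom_sets(1) _ wgJ, of \<tau> \<tau>] by simp
 moreover have "\<tau> x \<bullet> J x = \<tau> x $ i \<bullet> \<gamma> x" for x by (simp add: inner_matrix_rows J_def if_distrib[of "inner _"] cong: if_cong)
 ultimately show "(LINT x|leb D. (\<tau> x $ i) \<bullet> \<gamma> x) = - (LINT x|leb D. \<phi> x * (0 $ i))" by (simp add: ip_def)
qed

end

section \<open>Strong duality for the continuous problem\<close>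

context stokes_mesh
begin

lemma KT_D:
 assumes "F \<in> L2_space D" "T \<in> KT D \<Gamma>D f F"
 shows "(\<lambda>x. T x - F x) \<in> Hdiv D" "T \<in> L2_space D"
  "v \<in> H1_D D \<Gamma>D \<Longrightarrow> ip D T (wgrad D v) = ip D f v + ip D F (wgrad D v)"
proof -
 show h: "(\<lambda>x. T x - F x) \<in> Hdiv D" using assms(2) by (simp add: KT_def Hdiv_N_def)
 show TL: "T \<in> L2_space D" using L2_add[OF HdivD(1)[OF h] assms(1)] by simp
 assume v: "v \<in> H1_D D \<Gamma>D"
 have "ip D (wdiv D (\<lambda>x. T x - F x)) v = ip D (\<lambda>x. - f x) v" by (rule ip_cong_AE[OF dom_sets(1)]) (use assms(2) in \<open>simp_all add: KT_def\<close>)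
 moreover have "ip D (\<lambda>x. T x - F x) (wgrad D v) + ip D (wdiv D (\<lambda>x. T x - F x)) v = 0" using assms(2) v by (simp add: KT_def Hdiv_N_def)
 ultimately show "ip D T (wgrad D v) = ip D f v + ip D F (wgrad D v)" using ip_diff_left[OF TL assms(1) H1D(3)[OF H1_D_H1[OF v]]] by (simp add: ip_uminus_left)
qed

theorem stokes_stress:
 assumes \<nu>: "\<nu> > 0" and f: "f \<in> L2_space D" "F \<in> L2_space D"
  and uD: "uD \<in> H1 D" "AE x in leb D. trace (wgrad D uD x) = 0"
  and u: "is_arg_min (primal D \<nu> f F uD) (\<lambda>v. v \<in> Ku D \<Gamma>D) u"
  and T: "is_arg_max (dual D \<nu> uD) (\<lambda>\<tau>. \<tau> \<in> KT D \<Gamma>D f F) T"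
 shows "AE x in leb D. dev (T x) = \<nu> *\<^sub>R (wgrad D u x + wgrad D uD x)"
proof -
 have uK: "u \<in> Ku D \<Gamma>D" and umin: "\<And>v. v \<in> Ku D \<Gamma>D \<Longrightarrow> primal D \<nu> f F uD u \<le> primal D \<nu> f F uD v"
  using u by (auto simp: is_arg_min_def not_less)
 have TK: "T \<in> KT D \<Gamma>D f F" and Tmax: "\<And>\<tau>. \<tau> \<in> KT D \<Gamma>D f F \<Longrightarrow> dual D \<nu> uD \<tau> \<le> dual D \<nu> uD T"
  using T by (auto simp: is_arg_max_def not_less)
 have uH: "u \<in> H1_D D \<Gamma>D" and utr: "AE x in leb D. trace (wgrad D u x) = 0" using uK by (auto simp: Ku_def)
 note TD = KT_D[OF f(2) TK]
 define Z where "Z x = dev (T x)" for x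
 define G where "G x = wgrad D u x + wgrad D uD x" for x
 define E where "E x = (1 / \<nu>) *\<^sub>R Z x - G x" for x
 have DL: "Z \<in> L2_space D" unfolding Z_def[abs_def] by (rule L2_bounded_linear[OF TD(2) bounded_linear_dev])
 have gL: "wgrad D u \<in> L2_space D" "wgrad D uD \<in> L2_space D" using H1D(3)[OF H1_D_H1[OF uH]] H1D(3)[OF uD(1)] .
 have GL: "G \<in> L2_space D" unfolding G_def[abs_def] by (intro L2_add gL)
 have EL: "E \<in> L2_space D" unfolding E_def[abs_def] by (intro L2_diff L2_scaleR DL GL)
 \<comment> \<open>First variation of the primal functional. The constraint on \<open>T\<close>
   rewrites the load as the pairing of \<open>T\<close> with \<open>wgrad D w\<close>, and the
   deviator may be inserted because this gradient is trace-free.\<close>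
 have Ku_orth: "ip D E (wgrad D w) = 0" if w: "w \<in> H1_D D \<Gamma>D" "AE x in leb D. trace (wgrad D w x) = 0" for w
 proof -
  note wH = H1_D_H1[OF w(1)]
  have "(\<lambda>x. u x + t *\<^sub>R w x) \<in> Ku D \<Gamma>D" for t
  proof -
   have "(\<lambda>x. 1 *\<^sub>R u x + t *\<^sub>R w x) \<in> H1_D D \<Gamma>D" by (rule H1_D_lincomb[OF uH w(1)])
   moreover have "AE x in leb D. trace (wgrad D (\<lambda>x. u x + t *\<^sub>R w x) x) = 0" using H1_add_scaleR(2)[OF H1_D_H1[OF uH] wH, of t] utr w(2)
    by eventually_elim (simp add: trace_add trace_scaleR)
   ultimately show ?thesis by (simp add: Ku_def)
  qed
  then have "0 \<le> t * (\<nu> * ip D G (wgrad D w) - ip D f w - ip D F (wgrad D w)) + t^2 * (\<nu> / 2 * (l2norm D (wgrad D w))^2)" for t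
   using umin[of "\<lambda>x. u x + t *\<^sub>R w x"] primal_expand[OF f H1_D_H1[OF uH] wH uD(1), of \<nu> t] unfolding G_def[abs_def] by simp
  from quadratic_nonneg_imp_linear_zero[OF this] have 1: "\<nu> * ip D G (wgrad D w) = ip D f w + ip D F (wgrad D w)" by simp
  have "ip D Z (wgrad D w) = ip D T (wgrad D w)" unfolding ip_def by (rule integral_cong_AE_lebesgue_on[OF dom_sets(1)])
    (use w(2) in eventually_elim, simp add: Z_def dev_inner_trace_free)
  then have "ip D Z (wgrad D w) = \<nu> * ip D G (wgrad D w)" using TD(3)[OF w(1)] 1 by simp
  then show ?thesis using ip_diff_left[OF L2_scaleR[OF DL] GL H1D(3)[OF wH], of "1 / \<nu>"] \<nu> unfolding E_def[abs_def] by (simp add: ip_scaleR_left)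
 qed
 obtain w where w: "w \<in> H1_D D \<Gamma>D" and orth: "\<And>v. v \<in> H1_D D \<Gamma>D \<Longrightarrow> ip D (\<lambda>x. E x - wgrad D w x) (wgrad D v) = 0"
  by (rule gradient_projection[OF EL]) (rule that; assumption)
 define \<tau> where "\<tau> x = E x - wgrad D w x" for x
 note wL = H1D(3)[OF H1_D_H1[OF w]]
 have \<tau>L: "\<tau> \<in> L2_space D" unfolding \<tau>_def[abs_def] by (intro L2_diff EL wL)
 have orth: "ip D \<tau> (wgrad D v) = 0" if "v \<in> H1_D D \<Gamma>D" for v using orth[OF that] by (simp add: \<tau>_def[abs_def])
 have wd: "is_weak_div D \<tau> (\<lambda>_. 0)" by (rule zero_wdiv_free[OF \<tau>L orth closure_Dirichlet_subset(1)[OF parts res]])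
 have \<tau>H: "\<tau> \<in> Hdiv D" using \<tau>L wd by (auto simp: Hdiv_def)
 have wd0: "AE x in leb D. wdiv D \<tau> x = 0" by (rule wdiv_eq[OF domain_facts(1,3) wd])
 \<comment> \<open>\<open>\<tau>\<close> satisfies the homogeneous constraint: its weak divergence
   is zero, and its orthogonality to gradients then is the weak Neumann condition.\<close>
 have inKT: "(\<lambda>x. T x + t *\<^sub>R \<tau> x) \<in> KT D \<Gamma>D f F" for t
 proof -
  let ?S = "\<lambda>x. (T x - F x) + t *\<^sub>R \<tau> x"
  note S = Hdiv_add_scaleR[OF TD(1) \<tau>H, of t]
  have wS: "AE x in leb D. wdiv D ?S x = wdiv D (\<lambda>x. T x - F x) x" using S(2) wd0 by eventually_elim simp
  have "ip D ?S (wgrad D v) + ip D (wdiv D ?S) v = 0" if v: "v \<in> H1_D D \<Gamma>D" for v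
  proof -
   have "ip D (wdiv D ?S) v = ip D (wdiv D (\<lambda>x. T x - F x)) v" by (rule ip_cong_AE[OF dom_sets(1) wS]) simp
   moreover have "ip D ?S (wgrad D v) = ip D (\<lambda>x. T x - F x) (wgrad D v)"
    using ip_add_left[OF HdivD(1)[OF TD(1)] L2_scaleR[OF \<tau>L] H1D(3)[OF H1_D_H1[OF v]], of t] orth[OF v] by (simp add: ip_scaleR_left)
   ultimately show ?thesis using TK v by (simp add: KT_def Hdiv_N_def)
  qed
  moreover have "AE x in leb D. wdiv D (\<lambda>x. T x - F x) x = - f x" using TK by (simp add: KT_def)
  then have "AE x in leb D. wdiv D ?S x = - f x" using wS by eventually_elim simp
  moreover have "(\<lambda>x. (T x + t *\<^sub>R \<tau> x) - F x) = ?S" by (simp add: fun_eq_iff)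
  ultimately show ?thesis using S(1) by (simp add: KT_def Hdiv_N_def)
 qed
 have d\<tau>L: "(\<lambda>x. dev (\<tau> x)) \<in> L2_space D" by (rule L2_bounded_linear[OF \<tau>L bounded_linear_dev])
 let ?R = "\<lambda>x. (1 / \<nu>) *\<^sub>R Z x - wgrad D uD x"
 have "0 \<le> t * ip D (\<lambda>x. dev (\<tau> x)) ?R + t^2 * (1 / (2 * \<nu>) * (l2norm D (\<lambda>x. dev (\<tau> x)))^2)" for t
  using Tmax[OF inKT, of t] dual_quadratic[OF DL d\<tau>L gL(2), of \<nu> t] unfolding dual_def dev_lincomb Z_def by simp
 then have "ip D (\<lambda>x. dev (\<tau> x)) ?R = 0" by (rule quadratic_nonneg_imp_linear_zero)
 from stress_identity[OF \<nu> DL gL wL _ utr uD(2) _ \<tau>_def orth[OF w] orth[OF uH] this Ku_orth[OF w]]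
 show ?thesis by (simp add: E_def G_def Z_def trace_dev)
qed

end

section \<open>Crouzeix--Raviart interpolation\<close>

lemma bounded_linear_trace: "bounded_linear (trace :: real^'n^'n \<Rightarrow> real)" unfolding trace_eq_inner[abs_def] by (rule bounded_linear_inner_left)

lemma linear_C1_field:
 fixes A :: "real^'n \<Rightarrow> real^'n"
 assumes "linear A"
 shows "C1_field (\<lambda>x. A x + b)" "jacobian (\<lambda>x. A x + b) (at x) = matrix A"
proof -
 have "((\<lambda>x. A x + b) has_derivative (\<lambda>h. matrix A *v h)) (at x)" for x
  using has_derivative_add[OF linear_imp_has_derivative[OF assms] has_derivative_const[of b]] by (simp add: matrix_works'[OF assms])
 from C1_fieldI[OF this continuous_on_const]
 show "C1_field (\<lambda>x. A x + b)" "jacobian (\<lambda>x. A x + b) (at x) = matrix A" .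
qed

lemma bounded_linear_matrix_vector_left: "bounded_linear (\<lambda>m :: real^'n^'m. m *v c)"
proof (rule bounded_linear_intro)
 show "norm (m *v c) \<le> norm m * norm c" for m :: "real^'n^'m" by (rule norm_matrix_vector_mult_le)
qed (simp_all add: vec_eq_iff matrix_vector_mult_component inner_add_left)

text \<open>Barycentric coordinates spread the value \<open>k\<close> from the vertices to all
  points, and the origin shows that \<open>k\<close> is 0.\<close>

lemma (in full_simplex) matrix_zero_if_const_on_vertices:
 fixes N :: "real^'n^'n"
 assumes "\<And>c. c \<in> C \<Longrightarrow> N *v c = k" shows "N = 0"
proof -
 have all: "N *v x = k" for x
 proof -
  have "N *v x = N *v (\<Sum>c\<in>C. lam c x *\<^sub>R c)" by (simp add: sum_lam_vertex)
  also have "... = (\<Sum>c\<in>C. lam c x *\<^sub>R (N *v c))" by (simp add: linear_sum[OF matrix_vector_mul_linear] linear_scale[OF matrix_vector_mul_linear])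
  also have "... = (\<Sum>c\<in>C. lam c x) *\<^sub>R k" by (simp add: assms scaleR_left.sum)
  finally show ?thesis by (simp add: sum_lam)
 qed
 have "k = 0" using all[of 0] by simp
 then have "N *v x = 0 *v x" for x using all by simp
 then show ?thesis by (simp add: matrix_eq)
qed

context mesh
begin

lemma cr_trace:
 assumes I: "is_cr_interpolation D M Icr" and v: "v \<in> H1 D" and T: "T \<in> M" "S facet_of T"
 obtains w where "has_trace D (affine hull S) S v w" "sint S (ea T (Icr v)) = sint S w"
proof -
 have "Icr v \<in> P1 M" using I v CR_P1 by (auto simp: is_cr_interpolation_def)
 then have e: "sint S (elem_val T (Icr v)) = sint S (ea T (Icr v))" by (intro sint_cong elem_val_facet[OF _ T])
 obtain w where w: "has_trace D (affine hull S) S v w" "side_mean S (elem_val T (Icr v)) = side_mean S w" using I v T unfolding is_cr_interpolation_def by blast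
 have "sint S (elem_val T (Icr v)) = sint S w" using w(2) smeas_facet_pos[OF T] by (simp add: side_mean_sint)
 then show ?thesis using that[OF w(1)] e by simp
qed

text \<open>At each vertex the cone formulas of \<open>v\<close> and of its interpolant have the
  same right side. Subtracting the differences for two vertices removes the volume term and leaves
  the integral of the gradient error applied to \<open>c' - c\<close>; as the edges span the space,
  that integral vanishes.\<close>

lemma cr_grad:
 assumes I: "is_cr_interpolation D M Icr" and v: "v \<in> H1 D" and T: "T \<in> M" and x: "x \<in> interior T"
 shows "grad_h (Icr v) x = Pi_h M (wgrad D v) x"
proof -
 obtain C where C: "full_simplex C" "T = convex hull C" by (rule element_simplex[OF T])
 interpret full_simplex C by fact
 have P: "Icr v \<in> P1 M" using I v CR_P1 by (auto simp: is_cr_interpolation_def)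
 obtain A b where A: "linear A" "ea T (Icr v) = (\<lambda>x. A x + b)"
  "\<And>x. x \<in> interior T \<Longrightarrow> grad_h (Icr v) x = matrix A" by (rule grad_h_P1[OF P T]) (rule that; assumption)
 note vL = L2_element[OF H1D(1)[OF v] T] and WL = L2_element[OF H1D(3)[OF v] T]
 note m = interior_lmeasurable(1)[OF T]
 let ?W = "wgrad D v" and ?q = "\<lambda>x. A x + b" and ?d = "real CARD('n)" and ?L = "leb (interior T)"
 have qc: "continuous_on UNIV ?q" by (rule C1_field_continuous[OF linear_C1_field(1)[OF A(1)]])
 have qL: "?q \<in> L2_space (interior T)" by (rule L2_element[OF continuous_L2[OF dom_sets(1) domain_facts(3) qc] T])
 have cL: "(\<lambda>x. matrix A) \<in> L2_space (interior T)" by (rule L2_element[OF continuous_L2[OF dom_sets(1) domain_facts(3) continuous_on_const] T])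
 have dL: "(\<lambda>x. matrix A - ?W x) \<in> L2_space (interior T)" by (rule L2_diff[OF cL WL])
 let ?N = "LINT x|?L. matrix A - ?W x"
 have same: "?N *v c = ?N *v c'" if c: "c \<in> C" "c' \<in> C" for c c'
 proof -
  have int: "integrable ?L (\<lambda>x. (?d *\<^sub>R ?q x + matrix A *v (x - c)) - (?d *\<^sub>R v x + ?W x *v (x - c)))" (is "integrable _ (?g c)")
   and z: "(LINT x|?L. (?d *\<^sub>R ?q x + matrix A *v (x - c)) - (?d *\<^sub>R v x + ?W x *v (x - c))) = 0" if "c \<in> C" for c
  proof -
   have S: "fct c facet_of T" using facet_iff that C(2) by blast
   obtain w where w: "has_trace D (affine hull fct c) (fct c) v w" "sint (fct c) (ea T (Icr v)) = sint (fct c) w" by (rule cr_trace[OF I v T S])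
   obtain R where R: "\<And>G :: real^'n \<Rightarrow> real^'n^'n. G \<in> L2_space (interior (convex hull C)) \<Longrightarrow> (\<lambda>x. G x *v (x - c)) \<in> L2_space (interior (convex hull C))"
    by (rule matrix_vector_L2) (rule that; assumption)
   note R = R[folded C(2)]
   have i: "integrable ?L (\<lambda>x. ?d *\<^sub>R ?q x + matrix A *v (x - c))" "integrable ?L (\<lambda>x. ?d *\<^sub>R v x + ?W x *v (x - c))"
    by (rule L2_integrable[OF m L2_add[OF L2_scaleR[OF qL] R[OF cL]]],
      rule L2_integrable[OF m L2_add[OF L2_scaleR[OF vL] R[OF WL]]])
   then show "integrable ?L (?g c)" by (rule Bochner_Integration.integrable_diff)
   have "(LINT x|?L. ?d *\<^sub>R ?q x + matrix A *v (x - c)) = ht c *\<^sub>R sint (fct c) ?q"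
    using cone_formula_field[OF linear_C1_field(1)[OF A(1)] that, of b] unfolding linear_C1_field(2)[OF A(1)] C(2) .
   moreover have "(LINT x|?L. ?d *\<^sub>R v x + ?W x *v (x - c)) = ht c *\<^sub>R sint (fct c) w"
    using cone_formula_trace[OF dom_sets(1) domain_facts(3) interior_element_subset[OF T, unfolded C(2)] that v w(1)] unfolding C(2) .
   ultimately show "(LINT x|?L. ?g c x) = 0" using Bochner_Integration.integral_diff[OF i] w(2) A(2) by simp
  qed
  have "(matrix A - ?W x) *v (c' - c) = ?g c x - ?g c' x" for x by (simp add: matrix_vector_mult_diff_rdistrib matrix_vector_mult_diff_distrib algebra_simps)
  then have "(LINT x|?L. (matrix A - ?W x) *v (c' - c)) = 0" using Bochner_Integration.integral_diff[OF int[OF c(1)] int[OF c(2)]] z[OF c(1)] z[OF c(2)] by simp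
  moreover have "(LINT x|?L. (matrix A - ?W x) *v (c' - c)) = ?N *v (c' - c)"
   by (rule integral_bounded_linear[OF bounded_linear_matrix_vector_left L2_integrable[OF m dL]])
  ultimately have "?N *v c' - ?N *v c = 0" by (simp add: matrix_vector_mult_diff_distrib)
  then show ?thesis by simp
 qed
 obtain c0 where "c0 \<in> C" using card_C by fastforce
 then have "?N = 0" by (intro matrix_zero_if_const_on_vertices[where k = "?N *v c0"] same)
 moreover have "?N = measure lebesgue (interior T) *\<^sub>R matrix A - (LINT x|?L. ?W x)"
  using Bochner_Integration.integral_diff[OF L2_integrable[OF m cL] L2_integrable[OF m WL]]
   measure_restrict_space[of "interior T" lebesgue "interior T"] by simp
 ultimately have "(LINT x|?L. ?W x) = measure lebesgue (interior T) *\<^sub>R matrix A" by simp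
 then show ?thesis using measure_element_pos[OF T] by (simp add: Pi_h_interior[OF T x] A(3)[OF x])
qed

text \<open>The trace chosen by the interpolation may differ from the zero trace supplied by
  \<open>H1_D\<close>, but the cone formula gives both the same side integral.\<close>

lemma cr_boundary:
 assumes I: "is_cr_interpolation D M Icr" and v: "v \<in> H1_D D \<Gamma>"
 shows "Icr v \<in> CR_D \<Gamma> M"
proof (rule CR_D_I)
 have vH: "v \<in> H1 D" using v by (simp add: H1_D_def)
 show "Icr v \<in> CR M" using I vH by (simp add: is_cr_interpolation_def)
 fix T S assume T: "T \<in> M" "S facet_of T" "S \<subseteq> closure \<Gamma>"
 obtain C c where C: "full_simplex C" "T = convex hull C" "c \<in> C" "S = convex hull (C - {c})" using element_facet[OF T(1,2)] by blast
 interpret full_simplex C by fact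
 obtain w where w: "has_trace D (affine hull S) S v w" "sint S (ea T (Icr v)) = sint S w" by (rule cr_trace[OF I vH T(1,2)])
 note cone = cone_formula_trace[OF dom_sets(1) domain_facts(3) interior_element_subset[OF T(1), unfolded C(2)] C(3) vH, folded C(4)]
 have "ht c *\<^sub>R sint S w = ht c *\<^sub>R sint S (\<lambda>_. 0 :: real^'n)" using cone[OF w(1)] cone[OF H1_D_facet_trace[OF v T]] by simp
 then show "sint S (ea T (Icr v)) = 0" using ht_pos[OF C(3)] w(2) by simp
qed

text \<open>The trace commutes with element means, so by \<open>cr_grad\<close> the interpolant
  inherits the constraint.\<close>

lemma cr_div_free:
 assumes I: "is_cr_interpolation D M Icr" and v: "v \<in> H1 D" and d: "AE x in leb D. trace (wgrad D v x) = 0"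
 shows "AE x in leb D. div_h (Icr v) x = 0"
proof (rule AE_elementI)
 fix T x assume T: "T \<in> M" "x \<in> interior T"
 have "div_h (Icr v) x = trace (Pi_h M (wgrad D v) x)" unfolding div_h_def by (simp add: cr_grad[OF I v T])
 also have "... = Pi_h M (\<lambda>y. trace (wgrad D v y)) x" by (rule Pi_h_bounded_linear[OF H1D(3)[OF v] bounded_linear_trace T, symmetric])
 also have "... = Pi_h M (\<lambda>y. 0 :: real) x" by (rule Pi_h_cong_AE[OF d T])
 also have "... = 0" using Pi_h_interior[OF T, of "\<lambda>y. 0 :: real"] by simp
 finally show "div_h (Icr v) x = 0" .
qed

section \<open>Side functions and element-wise constant stresses\<close>

text \<open>The global Crouzeix--Raviart basis function of \<open>S\<close>: on an element with side
  \<open>S\<close> it is \<open>1 - d * lam c\<close> for the vertex \<open>c\<close> opposite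
  \<open>S\<close>, on all other elements it is zero.\<close>

lemma ex_facet_function:
 fixes S :: "(real^'n) set"
 shows "\<exists>\<psi> :: real^'n \<Rightarrow> real. \<psi> \<in> P1 M \<and> (\<forall>T\<in>M. \<forall>S'. S' facet_of T \<longrightarrow> sint S' (ea T \<psi>) = (if S' = S then smeas S else 0))"
proof -
 have "\<exists>q :: real^'n \<Rightarrow> real. (\<exists>A b. linear A \<and> q = (\<lambda>x. A x + b)) \<and> (\<forall>S'. S' facet_of T \<longrightarrow> sint S' q = (if S' = S then smeas S else 0))"
  if T: "T \<in> M" for T
 proof (cases "S facet_of T")
  case True
  obtain C c where C: "full_simplex C" "T = convex hull C" "c \<in> C" "S = convex hull (C - {c})" using element_facet[OF T True] by blast
  interpret full_simplex C by fact
  let ?q = "\<lambda>x. 1 - real CARD('n) * lam c x"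
  have "linear (\<lambda>x. (- (real CARD('n)) *\<^sub>R gr c) \<bullet> x)" by (rule bounded_linear.linear[OF bounded_linear_inner_right])
  moreover have "?q = (\<lambda>x. (- (real CARD('n)) *\<^sub>R gr c) \<bullet> x + (1 + real CARD('n) * snd (cf c)))" by (simp add: fun_eq_iff lam_def algebra_simps)
  moreover have "sint S' ?q = (if S' = S then smeas S else 0)" if S': "S' facet_of T" for S'
  proof -
   obtain v where v: "v \<in> C" "S' = fct v" using S' facet_iff C(2) by blast
   show ?thesis
   proof (cases "v = c")
    case True
    then have "sint S' ?q = sint S' (\<lambda>x. 1)" using v mem_fct[OF C(3)] by (intro sint_cong) simp
    then show ?thesis using sint_const[OF T S', of 1] True v C(4) by simp
   next
    case False
    \<comment> \<open>The centre of \<open>S\<close> lies on no other facet of the simplex, which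
      separates \<open>S'\<close> from \<open>S\<close>.\<close>
    obtain z where z: "lam c z = 0" "\<And>c'. c' \<in> C - {c} \<Longrightarrow> 0 < lam c' z" by (rule facet_center[OF C(3)]) (rule that; assumption)
    have "z \<in> S" unfolding C(4) using rel_interior_fct[OF C(3) z] rel_interior_subset by blast
    moreover have "z \<notin> S'" using z(2)[of v] v False mem_fct[OF v(1)] by auto
    ultimately have "S' \<noteq> S" by blast
    then show ?thesis using CR_basis_mean[OF C(3) v(1) False] v(2) by simp
   qed
  qed
  ultimately show ?thesis by blast
 next
  case False
  then show ?thesis by (intro exI[of _ "\<lambda>x. 0"] conjI exI[of _ "\<lambda>x. 0"]) (auto simp: linear_zero)
 qed
 then obtain q :: "(real^'n) set \<Rightarrow> real^'n \<Rightarrow> real" where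
  q: "\<And>T. T \<in> M \<Longrightarrow> \<exists>A b. linear A \<and> q T = (\<lambda>x. A x + b)"
   "\<And>T S'. T \<in> M \<Longrightarrow> S' facet_of T \<Longrightarrow> sint S' (q T) = (if S' = S then smeas S else 0)"
  using bchoice[of M] by (metis (no_types, lifting))
 define \<psi> where "\<psi> x = (\<Sum>T\<in>M. indicator (interior T) x * q T x)" for x
 have \<psi>: "\<psi> x = q T x" if "T \<in> M" "x \<in> interior T" for T x
 proof -
  have "(\<Sum>T'\<in>M - {T}. indicator (interior T') x * q T' x) = 0"
   using interior_element_disjoint[OF that(1)] that interior_subset by (intro sum.neutral) (auto simp: indicator_def)
  then show ?thesis unfolding \<psi>_def using sum.remove[OF finite_M that(1), of "\<lambda>T. indicator (interior T) x * q T x"] that(2) by simp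
 qed
 have P: "\<psi> \<in> P1 M" unfolding P1_def mem_Collect_eq
 proof
  fix T assume T: "T \<in> M"
  obtain A b where "linear A" "q T = (\<lambda>x. A x + b)" using q(1)[OF T] by blast
  then show "\<exists>A b. linear A \<and> (\<forall>x\<in>interior T. \<psi> x = A x + b)" using \<psi>[OF T] by auto
 qed
 have "ea T \<psi> = q T" if T: "T \<in> M" for T
 proof -
  obtain A b where A: "linear A" "q T = (\<lambda>x. A x + b)" using q(1)[OF T] by blast
  show ?thesis unfolding A(2) by (rule ea_eq[OF P T A(1)]) (use \<psi>[OF T] A(2) in simp)
 qed
 then show ?thesis using P q(2) by (intro exI[of _ \<psi>]) simp
qed

definition facet_fun :: "(real^'n) set \<Rightarrow> real^'n \<Rightarrow> real" where
 "facet_fun S = (SOME \<psi>. \<psi> \<in> P1 M \<and> (\<forall>T\<in>M. \<forall>S'. S' facet_of T \<longrightarrow> sint S' (ea T \<psi>) = (if S' = S then smeas S else 0)))"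

definition facet_field :: "(real^'n) set \<times> 'n \<Rightarrow> real^'n \<Rightarrow> real^'n" where
 "facet_field p x = facet_fun (fst p) x *\<^sub>R axis (snd p) 1"

lemma facet_fun:
 shows "facet_fun S \<in> P1 M"
  and "T \<in> M \<Longrightarrow> S' facet_of T \<Longrightarrow> sint S' (ea T (facet_fun S)) = (if S' = S then smeas S else 0)"
 using someI_ex[OF ex_facet_function[of S]] unfolding facet_fun_def[symmetric] by blast+

lemma facet_field:
 shows "facet_field (S, i) \<in> P1 M"
  and "T \<in> M \<Longrightarrow> S' facet_of T \<Longrightarrow> sint S' (ea T (facet_field (S, i))) = (if S' = S then smeas S else 0) *\<^sub>R axis i 1"
proof -
 have l: "linear (\<lambda>t :: real. t *\<^sub>R (axis i 1 :: real^'n))" by (rule bounded_linear.linear[OF bounded_linear_scaleR_left])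
 have ff: "facet_field (S, i) = (\<lambda>x. facet_fun S x *\<^sub>R axis i 1)" by (simp add: facet_field_def fun_eq_iff)
 show "facet_field (S, i) \<in> P1 M" unfolding ff by (rule P1_bounded_linear(1)[OF facet_fun(1) l])
 assume T: "T \<in> M" "S' facet_of T"
 let ?e = "ea T (facet_fun S)"
 have c: "continuous_on UNIV ?e" by (rule ea_continuous[OF facet_fun(1) T(1)])
 have e: "ea T (facet_field (S, i)) = (\<lambda>x. ?e x *\<^sub>R axis i 1)" unfolding ff by (rule P1_bounded_linear(2)[OF facet_fun(1) l T(1)])
 have "sint S' (\<lambda>x. ?e x *\<^sub>R axis i 1 :: real^'n) $ k = (sint S' ?e *\<^sub>R axis i 1 :: real^'n) $ k" for k
 proof -
  have "sint S' (\<lambda>x. ?e x *\<^sub>R axis i 1 :: real^'n) $ k = sint S' (\<lambda>x. (?e x *\<^sub>R axis i 1 :: real^'n) $ k)"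
   by (rule sint_component[OF T]) (intro continuous_intros c)
  also have "... = sint S' (\<lambda>x. (axis i 1 :: real^'n) $ k *\<^sub>R ?e x)" by (simp add: mult.commute)
  also have "... = (axis i 1 :: real^'n) $ k *\<^sub>R sint S' ?e" by (rule sint_scaleR[OF T c])
  finally show ?thesis by (simp add: mult.commute)
 qed
 then show "sint S' (ea T (facet_field (S, i))) = (if S' = S then smeas S else 0) *\<^sub>R axis i 1" unfolding e using facet_fun(2)[OF T] by (simp add: vec_eq_iff)
qed

lemma facet_field_CR_D:
 assumes "\<not> S \<subseteq> closure \<Gamma>" shows "facet_field (S, i) \<in> CR_D \<Gamma> M"
 by (rule CR_D_I[OF CR_I[OF facet_field(1)]]) (use assms in \<open>auto simp: facet_field(2)\<close>)

lemma P0_ea: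
 assumes R: "R \<in> P0 M" and T: "T \<in> M"
 obtains c where "ea T R = (\<lambda>x. c)" "\<And>x. x \<in> interior T \<Longrightarrow> R x = c"
proof -
 obtain c where c: "\<And>x. x \<in> interior T \<Longrightarrow> R x = c" using R T unfolding P0_def by blast
 have "ea T R = (\<lambda>x. 0 + c)" by (rule ea_eq[OF P0_subset_P1[OF R] T linear_zero]) (simp add: c)
 then show ?thesis by (intro that[of c]) (simp_all add: c)
qed

lemma rt_div_of_P0:
 assumes R: "R \<in> P0 M" shows "AE x in leb D. rt_div R x = 0"
proof (rule AE_elementI)
 fix T x assume T: "T \<in> M" "x \<in> interior T"
 obtain c where c: "ea T R = (\<lambda>x. c)" by (rule P0_ea[OF R T(1)])
 have "rt_div R x $ i = 0" for i
 proof -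
  have "ea T (\<lambda>x. R x $ i) = (\<lambda>x. 0 + c $ i)" using ea_row[OF P0_subset_P1[OF R] T(1)] c by simp
  from rt_div_interior[OF P0_subset_P1[OF R] T(1) linear_zero this T(2)]
  show ?thesis by (simp add: trace_def matrix_def)
 qed
 then show "rt_div R x = 0" by (simp add: vec_eq_iff)
qed

text \<open>The element-wise divergence of a constant field vanishes, and its flux is trivially
  constant on every side, although not continuous from element to element.\<close>

lemma P0_grad_pairing:
 assumes R: "R \<in> P0 M" and v: "v \<in> P1 M"
 shows "ip D R (grad_h v) = (\<Sum>T\<in>M. \<Sum>S\<in>facets T. flux R T S \<bullet> sint S (ea T v))"
proof -
 have "ea T R x *v outer_normal T S = flux R T S" if T: "T \<in> M" for T S x
 proof -
  obtain c where "ea T R = (\<lambda>x. c)" by (rule P0_ea[OF R T])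
  then show ?thesis by (simp add: flux_def)
 qed
 from normal_trace_pairing[OF P0_subset_P1[OF R] v this]
 show ?thesis using ip_cong_AE[OF dom_sets(1) rt_div_of_P0[OF R], of v v] by simp
qed

text \<open>The side function has zero mean on all sides but \<open>S\<close>, so the test isolates
  the total flux through \<open>S\<close>.\<close>

lemma facet_field_pairing:
 assumes R: "R \<in> P0 M" and z: "ip D R (grad_h (facet_field (S, i))) = 0" and S: "T \<in> M" "S facet_of T"
 shows "(\<Sum>T\<in>{T\<in>M. S facet_of T}. flux R T S $ i) = 0"
proof -
 have "ip D R (grad_h (facet_field (S, i))) = (\<Sum>T\<in>M. \<Sum>S'\<in>facets T. if S' = S then smeas S * flux R T S $ i else 0)"
  unfolding P0_grad_pairing[OF R facet_field(1)] by (intro sum.cong refl) (auto simp: facets_def facet_field(2) inner_axis)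
 also have "... = (\<Sum>T\<in>M. if S facet_of T then smeas S * flux R T S $ i else 0)" by (intro sum.cong refl) (simp add: finite_facets, simp add: facets_def)
 also have "... = (\<Sum>T\<in>{T\<in>M. S facet_of T}. smeas S * flux R T S $ i)" by (rule sum.inter_filter[symmetric]) simp
 finally have "smeas S * (\<Sum>T\<in>{T\<in>M. S facet_of T}. flux R T S $ i) = 0" using z by (simp add: sum_distrib_left)
 then show ?thesis using smeas_facet_pos[OF S] by simp
qed

end

context stokes_mesh
begin

text \<open>Testing with the side functions recovers the continuity of the normal components.\<close>

lemma RT_N_of_orthogonal:
 assumes R: "R \<in> P0 M"
  and orth: "\<And>T S i. T \<in> M \<Longrightarrow> S facet_of T \<Longrightarrow> \<not> S \<subseteq> closure \<Gamma>D \<Longrightarrow> ip D R (grad_h (facet_field (S, i))) = 0"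
 shows "R \<in> RT_N \<Gamma>N M"
proof (rule RT_N_I[OF P0_subset_P1[OF R], where \<kappa> = "flux R"])
 fix T S x assume T: "T \<in> M"
 obtain c where c: "ea T R = (\<lambda>x. c)" by (rule P0_ea[OF R T])
 show "ea T R x *v outer_normal T S = flux R T S" unfolding flux_def c ..
next
 fix T T' S assume T: "T \<in> M" "T' \<in> M" "T \<noteq> T'" "S facet_of T" "S facet_of T'"
 have "\<not> S \<subseteq> closure \<Gamma>D" using facet_not_frontier[OF T] closure_Dirichlet_subset(1)[OF parts res] by blast
 note o = facet_field_pairing[OF R orth[OF T(1,4) this] T(1,4)]
 have "{U \<in> M. S facet_of U} = {T, T'}" using common_facet_unique[OF T(1,2) _ T(3) _ T(4,5)] T by blast
 then have "flux R T S $ i + flux R T' S $ i = 0" for i using o[of i] T(3) by simp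
 then show "flux R T' S = - flux R T S" by (simp add: vec_eq_iff eq_neg_iff_add_eq_0 add.commute)
next
 fix T S assume T: "T \<in> M" "S facet_of T" "S \<subseteq> closure \<Gamma>N"
 have "\<not> S \<subseteq> closure \<Gamma>D" using facet_not_both[OF parts res T(1,2) _ T(3)] by blast
 note o = facet_field_pairing[OF R orth[OF T(1,2) this] T(1,2)]
 have "S \<subseteq> frontier D" using T(3) closure_Dirichlet_subset(2)[OF parts res] by blast
 then have "{U \<in> M. S facet_of U} = {T}" using facet_not_frontier[OF T(1) _ _ T(2)] T by blast
 then show "flux R T S = 0" using o by (simp add: vec_eq_iff)
qed

section \<open>Discrete projection and strong duality for the discrete problem\<close>

lemma RT_N_CR_orthogonal:
 assumes R: "R \<in> RT_N \<Gamma>N M" and d: "AE x in leb D. rt_div R x = 0" and v: "v \<in> CR_D \<Gamma>D M"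
 shows "ip D R (grad_h v) = 0" using RT_CR_ibp[OF parts res R v] ip_cong_AE[OF dom_sets(1) d, of v v] by simp

lemma CR_D_P1: "v \<in> CR_D \<Gamma> M \<Longrightarrow> v \<in> P1 M" using CR_P1 by (auto simp: CR_D_def)

lemma CR_D_zero: "(\<lambda>x. 0) \<in> CR_D \<Gamma> M"
proof -
 have P: "(\<lambda>x. 0 :: real^'n) \<in> P1 M" unfolding P1_def by (auto intro!: exI[of _ "\<lambda>_. 0"] simp: linear_zero)
 have "ea T (\<lambda>x. 0 :: real^'n) = (\<lambda>x. 0)" if "T \<in> M" for T using ea_eq[OF P that linear_zero, of 0] by simp
 then show ?thesis by (intro CR_D_I CR_I P) auto
qed

lemma grad_h_add_scaleR:
 assumes "f \<in> P1 M" "g \<in> P1 M"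
 shows "AE x in leb D. grad_h (\<lambda>x. f x + c *\<^sub>R g x) x = grad_h f x + c *\<^sub>R grad_h g x"
 by (rule AE_elementI) (simp add: grad_h_add[OF assms(1) P1_scaleR[OF assms(2)]] grad_h_scaleR[OF assms(2)])

lemma CR_D_combination:
 assumes "finite I" "\<And>p. p \<in> I \<Longrightarrow> \<psi> p \<in> CR_D \<Gamma> M"
 shows "\<exists>w\<in>CR_D \<Gamma> M. AE x in leb D. grad_h w x = (\<Sum>p\<in>I. c p *\<^sub>R grad_h (\<psi> p) x)" using assms
proof (induction I)
 case empty
 have "grad_h (\<lambda>x. 0) x = 0" for x :: "real^'n" unfolding grad_h_def by (rule jacobian_eqI) simp
 then show ?case by (intro bexI[OF _ CR_D_zero]) simp
next
 case (insert p I)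
 obtain w where w: "w \<in> CR_D \<Gamma> M" "AE x in leb D. grad_h w x = (\<Sum>p\<in>I. c p *\<^sub>R grad_h (\<psi> p) x)" using insert.IH insert.prems by blast
 have p: "\<psi> p \<in> CR_D \<Gamma> M" using insert.prems by simp
 have "AE x in leb D. grad_h (\<lambda>x. w x + c p *\<^sub>R \<psi> p x) x = (\<Sum>p\<in>insert p I. c p *\<^sub>R grad_h (\<psi> p) x)"
  using grad_h_add_scaleR[OF CR_D_P1[OF w(1)] CR_D_P1[OF p], of "c p"] w(2) by eventually_elim (use insert.hyps in \<open>simp add: add.commute\<close>)
 then show ?case using CR_D_lincomb[OF w(1) p, of "c p"] by blast
qed

text \<open>The projection is onto the span of the gradients of the side functions off the Dirichlet
  boundary. This span is finite-dimensional, so closedness is no issue, and these test fields are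
  exactly those that characterise \<open>RT_N\<close> among element-wise constants.\<close>

lemma discrete_gradient_projection:
 assumes e: "e \<in> P0 M"
 obtains w where "w \<in> CR_D \<Gamma>D M" "(\<lambda>x. e x - grad_h w x) \<in> RT_N \<Gamma>N M"
proof -
 define I where "I = {S \<in> (\<Union>T\<in>M. facets T). \<not> S \<subseteq> closure \<Gamma>D} \<times> (UNIV :: 'n set)"
 have fin: "finite I" unfolding I_def by (intro finite_cartesian_product finite_Collect_conjI disjI1) (simp_all add: finite_facets)
 have Z: "facet_field p \<in> CR_D \<Gamma>D M" if "p \<in> I" for p using that facet_field_CR_D by (cases p) (auto simp: I_def)
 have L: "grad_h (facet_field p) \<in> L2_space D" if "p \<in> I" for p by (rule P0_L2[OF grad_h_P0[OF CR_D_P1[OF Z[OF that]]]])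
 from L2_finite_projection[where b = "\<lambda>p. grad_h (facet_field p)", OF fin L P0_L2[OF e]]
 obtain c where c: "\<And>p. p \<in> I \<Longrightarrow> ip D (\<lambda>x. e x - (\<Sum>q\<in>I. c q *\<^sub>R grad_h (facet_field q) x)) (grad_h (facet_field p)) = 0" by blast
 from CR_D_combination[where \<psi> = facet_field and c = c, OF fin Z]
 obtain w where w: "w \<in> CR_D \<Gamma>D M" "AE x in leb D. grad_h w x = (\<Sum>p\<in>I. c p *\<^sub>R grad_h (facet_field p) x)" by blast
 have "(\<lambda>x. e x - grad_h w x) \<in> RT_N \<Gamma>N M"
 proof (rule RT_N_of_orthogonal[OF P0_map2[OF e grad_h_P0[OF CR_D_P1[OF w(1)]]]])
  fix T S i assume "T \<in> M" "S facet_of T" "\<not> S \<subseteq> closure \<Gamma>D"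
  then have "(S, i) \<in> I" by (auto simp: I_def facets_def)
  have "ip D (\<lambda>x. e x - grad_h w x) (grad_h (facet_field (S, i)))
   = ip D (\<lambda>x. e x - (\<Sum>q\<in>I. c q *\<^sub>R grad_h (facet_field q) x)) (grad_h (facet_field (S, i)))"
   by (rule ip_cong_AE[OF dom_sets(1)]) (use w(2) in eventually_elim, simp, simp)
  then show "ip D (\<lambda>x. e x - grad_h w x) (grad_h (facet_field (S, i))) = 0" using c[OF \<open>(S, i) \<in> I\<close>] by simp
 qed
 then show ?thesis by (rule that[OF w(1)])
qed

lemma Pi_h_add_scaleR:
 assumes "f \<in> L2_space D" "g \<in> L2_space D" "T \<in> M" "x \<in> interior T"
 shows "Pi_h M (\<lambda>x. f x + c *\<^sub>R g x) x = Pi_h M f x + c *\<^sub>R Pi_h M g x"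
 using Pi_h_add[OF assms(1) L2_scaleR[OF assms(2)] assms(3,4), of c] Pi_h_bounded_linear[OF assms(2) bounded_linear_scaleR_right assms(3,4), of c] by simp

lemma KT_h_D:
 assumes \<tau>: "\<tau> \<in> KT_h D \<Gamma>N M (Pi_h M f) (Pi_h M F)"
 shows "(\<lambda>x. \<tau> x - Pi_h M F x) \<in> RT_N \<Gamma>N M" "(\<lambda>x. \<tau> x - Pi_h M F x) \<in> RT M" "\<tau> \<in> L2_space D"
  "AE x in leb D. rt_div (\<lambda>x. \<tau> x - Pi_h M F x) x = - Pi_h M f x"
  "v \<in> CR_D \<Gamma>D M \<Longrightarrow> ip D (Pi_h M \<tau>) (grad_h v) = ip D (Pi_h M f) v + ip D (Pi_h M F) (grad_h v)"
proof -
 let ?\<sigma> = "\<lambda>x. \<tau> x - Pi_h M F x"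
 show N: "?\<sigma> \<in> RT_N \<Gamma>N M" and R: "?\<sigma> \<in> RT M" using \<tau> by (auto simp: KT_h_def RT_N_def)
 note \<sigma>L = P1_L2[OF RT_P1[OF R]]
 show \<tau>L: "\<tau> \<in> L2_space D" using L2_add[OF \<sigma>L Pi_h_L2[of F]] by simp
 have "AE x in leb D. wdiv D ?\<sigma> x = - Pi_h M f x" using \<tau> by (simp add: KT_h_def)
 then show d: "AE x in leb D. rt_div ?\<sigma> x = - Pi_h M f x" using RT_wdiv[OF R] by eventually_elim simp
 assume v: "v \<in> CR_D \<Gamma>D M"
 have gP: "grad_h v \<in> P0 M" by (rule grad_h_P0[OF CR_D_P1[OF v]])
 have "ip D (rt_div ?\<sigma>) v = ip D (\<lambda>x. - Pi_h M f x) v" by (rule ip_cong_AE[OF dom_sets(1) d]) simp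
 then have "ip D ?\<sigma> (grad_h v) = ip D (Pi_h M f) v" using RT_CR_ibp[OF parts res N v] by (simp add: ip_uminus_left)
 then show "ip D (Pi_h M \<tau>) (grad_h v) = ip D (Pi_h M f) v + ip D (Pi_h M F) (grad_h v)"
  using ip_diff_left[OF \<tau>L Pi_h_L2[of F] P0_L2[OF gP]] ip_Pi_h[OF \<tau>L gP] by simp
qed

lemma primal_h_expand:
 assumes f: "fh \<in> P0 M" "Fh \<in> P0 M" and h: "u \<in> P1 M" "w \<in> P1 M" "uDh \<in> P1 M"
 shows "primal_h D M \<nu> fh Fh uDh (\<lambda>x. u x + t *\<^sub>R w x) = primal_h D M \<nu> fh Fh uDh u
  + (t * (\<nu> * ip D (\<lambda>x. grad_h u x + grad_h uDh x) (grad_h w) - ip D fh w - ip D Fh (grad_h w))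
  + t^2 * (\<nu> / 2 * (l2norm D (grad_h w))^2))"
proof -
 let ?G = "\<lambda>x. grad_h u x + grad_h uDh x"
 note gL = P0_L2[OF grad_h_P0[OF h(1)]] P0_L2[OF grad_h_P0[OF h(2)]] P0_L2[OF grad_h_P0[OF h(3)]]
 note L = P0_L2[OF f(1)] P0_L2[OF f(2)] P1_L2[OF h(1)] P1_L2[OF h(2)]
 have GL: "?G \<in> L2_space D" by (intro L2_add gL)
 have P: "(\<lambda>x. u x + t *\<^sub>R w x) \<in> P1 M" by (intro P1_add P1_scaleR h)
 note e = grad_h_add_scaleR[OF h(1,2), of t]
 have "AE x in leb D. grad_h (\<lambda>x. u x + t *\<^sub>R w x + uDh x) x = ?G x + t *\<^sub>R grad_h w x"
  using grad_h_add_scaleR[OF P h(3), of 1] e unfolding scaleR_one by eventually_elim (simp add: algebra_simps)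
 from l2norm_cong_AE[OF dom_sets(1) this]
 have 1: "(l2norm D (grad_h (\<lambda>x. u x + t *\<^sub>R w x + uDh x)))^2
  = (l2norm D ?G)^2 + 2 * t * ip D ?G (grad_h w) + t^2 * (l2norm D (grad_h w))^2" using l2norm_add_scaleR_sq[OF GL gL(2), of t] by simp
 have "AE x in leb D. grad_h (\<lambda>x. u x + uDh x) x = ?G x" using grad_h_add_scaleR[OF h(1,3), of 1] by simp
 from l2norm_cong_AE[OF dom_sets(1) this]
 have 2: "l2norm D (grad_h (\<lambda>x. u x + uDh x)) = l2norm D ?G" by simp
 have pi: "ip D fh (Pi_h M v) = ip D fh v" if "v \<in> L2_space D" for v using ip_Pi_h[OF that f(1)] ip_commute[of D fh] by simp
 have 3: "ip D fh (Pi_h M (\<lambda>x. u x + t *\<^sub>R w x)) = ip D fh (Pi_h M u) + t * ip D fh w"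
  using ip_add_right[OF L(3) L2_scaleR[OF L(4)] L(1), of t] by (simp add: pi P1_L2[OF P] L ip_scaleR_right)
 have "ip D Fh (grad_h (\<lambda>x. u x + t *\<^sub>R w x)) = ip D Fh (\<lambda>x. grad_h u x + t *\<^sub>R grad_h w x)" by (rule ip_cong_AE[OF dom_sets(1) _ e]) simp
 also have "... = ip D Fh (grad_h u) + t * ip D Fh (grad_h w)" using ip_add_right[OF gL(1) L2_scaleR[OF gL(2)] L(2), of t] by (simp add: ip_scaleR_right)
 finally show ?thesis unfolding primal_h_def 1 2 3 by (simp add: field_simps)
qed

text \<open>The residual is element-wise constant here, so the remainder of the projection is a
  constant field of \<open>RT_N\<close>; having zero divergence, it may be added to \<open>T\<close>
  without violating the constraint.\<close>

theorem discrete_stokes_stress: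
 fixes f u :: "real^'n \<Rightarrow> real^'n" and F T :: "real^'n \<Rightarrow> real^'n^'n"
 defines "fh \<equiv> Pi_h M f" and "Fh \<equiv> Pi_h M F"
 assumes \<nu>: "\<nu> > 0" and uD: "uDh \<in> P1 M" "AE x in leb D. div_h uDh x = 0"
  and u: "is_arg_min (primal_h D M \<nu> fh Fh uDh) (\<lambda>v. v \<in> Ku_h D \<Gamma>D M) u"
  and T: "is_arg_max (dual_h D M \<nu> uDh) (\<lambda>\<tau>. \<tau> \<in> KT_h D \<Gamma>N M fh Fh) T"
 shows "AE x in leb D. dev (Pi_h M T x) = \<nu> *\<^sub>R (grad_h u x + grad_h uDh x)"
proof -
 have uK: "u \<in> Ku_h D \<Gamma>D M" and umin: "\<And>v. v \<in> Ku_h D \<Gamma>D M \<Longrightarrow> primal_h D M \<nu> fh Fh uDh u \<le> primal_h D M \<nu> fh Fh uDh v"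
  using u by (auto simp: is_arg_min_def not_less)
 have TK: "T \<in> KT_h D \<Gamma>N M fh Fh" and Tmax: "\<And>\<tau>. \<tau> \<in> KT_h D \<Gamma>N M fh Fh \<Longrightarrow> dual_h D M \<nu> uDh \<tau> \<le> dual_h D M \<nu> uDh T"
  using T by (auto simp: is_arg_max_def not_less)
 have uD': "u \<in> CR_D \<Gamma>D M" and utr: "AE x in leb D. trace (grad_h u x) = 0" using uK by (auto simp: Ku_h_def div_h_def)
 have uDtr: "AE x in leb D. trace (grad_h uDh x) = 0" using uD(2) by (simp add: div_h_def)
 note uP = CR_D_P1[OF uD']
 note TD = KT_h_D[OF TK[unfolded fh_def Fh_def], folded fh_def Fh_def]
 have P: "fh \<in> P0 M" "Fh \<in> P0 M" unfolding fh_def Fh_def by (rule Pi_h_P0)+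
 define Z where "Z x = dev (Pi_h M T x)" for x
 define G where "G x = grad_h u x + grad_h uDh x" for x
 define E where "E x = (1 / \<nu>) *\<^sub>R Z x - G x" for x
 have DP: "Z \<in> P0 M" unfolding Z_def[abs_def] by (rule P0_map[OF Pi_h_P0])
 have gP: "grad_h u \<in> P0 M" "grad_h uDh \<in> P0 M" using grad_h_P0[OF uP] grad_h_P0[OF uD(1)] .
 have GP: "G \<in> P0 M" unfolding G_def[abs_def] by (rule P0_map2[OF gP])
 have EP: "E \<in> P0 M" unfolding E_def[abs_def] by (rule P0_map2[OF DP GP])
 note DL = P0_L2[OF DP] and GL = P0_L2[OF GP] and gL = P0_L2[OF gP(1)] P0_L2[OF gP(2)]
 have Ku_orth: "ip D E (grad_h w) = 0" if w: "w \<in> CR_D \<Gamma>D M" "AE x in leb D. trace (grad_h w x) = 0" for w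
 proof -
  note wP = CR_D_P1[OF w(1)]
  note wL = P0_L2[OF grad_h_P0[OF wP]]
  have "(\<lambda>x. u x + t *\<^sub>R w x) \<in> Ku_h D \<Gamma>D M" for t
  proof -
   have "AE x in leb D. trace (grad_h (\<lambda>x. u x + t *\<^sub>R w x) x) = 0" using grad_h_add_scaleR[OF uP wP, of t] utr w(2)
    by eventually_elim (simp add: trace_add trace_scaleR)
   then show ?thesis using CR_D_lincomb[OF uD' w(1)] by (simp add: Ku_h_def div_h_def)
  qed
  then have "0 \<le> t * (\<nu> * ip D G (grad_h w) - ip D fh w - ip D Fh (grad_h w)) + t^2 * (\<nu> / 2 * (l2norm D (grad_h w))^2)" for t
   using umin[of "\<lambda>x. u x + t *\<^sub>R w x"] primal_h_expand[OF P uP wP uD(1), of \<nu> t] unfolding G_def[abs_def] by simp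
  from quadratic_nonneg_imp_linear_zero[OF this] have 1: "\<nu> * ip D G (grad_h w) = ip D fh w + ip D Fh (grad_h w)" by simp
  have "ip D Z (grad_h w) = ip D (Pi_h M T) (grad_h w)" unfolding Z_def[abs_def] by (rule ip_dev[OF w(2)])
  then have "ip D Z (grad_h w) = \<nu> * ip D G (grad_h w)" using TD(5)[OF w(1)] 1 by simp
  then show ?thesis using ip_diff_left[OF L2_scaleR[OF DL] GL wL, of "1 / \<nu>"] \<nu> unfolding E_def[abs_def] by (simp add: ip_scaleR_left)
 qed
 obtain w where w: "w \<in> CR_D \<Gamma>D M" and RN: "(\<lambda>x. E x - grad_h w x) \<in> RT_N \<Gamma>N M" by (rule discrete_gradient_projection[OF EP])
 define R where "R x = E x - grad_h w x" for x
 have wP: "grad_h w \<in> P0 M" by (rule grad_h_P0[OF CR_D_P1[OF w]])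
 have RP: "R \<in> P0 M" unfolding R_def[abs_def] by (rule P0_map2[OF EP wP])
 have RN: "R \<in> RT_N \<Gamma>N M" using RN by (simp add: R_def[abs_def])
 have RR: "R \<in> RT M" using RN by (simp add: RT_N_def)
 note RL = P0_L2[OF RP] and wL = P0_L2[OF wP]
 note rd = rt_div_of_P0[OF RP]
 note orth = RT_N_CR_orthogonal[OF RN rd]
 have wd: "AE x in leb D. wdiv D R x = 0" using RT_wdiv[OF RR] rd by eventually_elim simp
 have inKT: "(\<lambda>x. T x + t *\<^sub>R R x) \<in> KT_h D \<Gamma>N M fh Fh" for t
 proof -
  let ?S = "\<lambda>x. (T x - Fh x) + t *\<^sub>R R x"
  have "AE x in leb D. wdiv D (\<lambda>x. T x - Fh x) x = - fh x" using TK by (simp add: KT_h_def)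
  then have "AE x in leb D. wdiv D ?S x = - fh x" using Hdiv_add_scaleR(2)[OF RT_Hdiv[OF TD(2)] RT_Hdiv[OF RR], of t] wd by eventually_elim simp
  moreover have "?S \<in> RT_N \<Gamma>N M" by (rule RT_N_lincomb[OF TD(1) RN])
  moreover have "(\<lambda>x. (T x + t *\<^sub>R R x) - Fh x) = ?S" by (simp add: fun_eq_iff)
  ultimately show ?thesis by (simp add: KT_h_def)
 qed
 define d where "d x = dev (R x)" for x
 have dL: "d \<in> L2_space D" unfolding d_def[abs_def] by (rule L2_bounded_linear[OF RL bounded_linear_dev])
 let ?Q = "\<lambda>x. (1 / \<nu>) *\<^sub>R Z x - grad_h uDh x"
 have "0 \<le> t * ip D d ?Q + t^2 * (1 / (2 * \<nu>) * (l2norm D d)^2)" for t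
 proof -
  \<comment> \<open>The variation \<open>R\<close> is element-wise constant and hence its own mean,
    so the dual functional is quadratic along it.\<close>
  have ae: "AE x in leb D. dev (Pi_h M (\<lambda>x. T x + t *\<^sub>R R x) x) = Z x + t *\<^sub>R d x"
   by (rule AE_elementI) (simp add: Pi_h_add_scaleR[OF TD(3) RL] Pi_h_of_P0[OF RP] dev_lincomb Z_def d_def)
  have "dual_h D M \<nu> uDh (\<lambda>x. T x + t *\<^sub>R R x)
   = - (1 / (2 * \<nu>)) * (l2norm D (\<lambda>x. Z x + t *\<^sub>R d x))^2 + ip D (\<lambda>x. Z x + t *\<^sub>R d x) (grad_h uDh)"
   unfolding dual_h_def l2norm_cong_AE[OF dom_sets(1) ae] by (intro arg_cong2[where f = "(+)"] ip_cong_AE[OF dom_sets(1) ae]) simp_all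
  moreover have "dual_h D M \<nu> uDh T = - (1 / (2 * \<nu>)) * (l2norm D Z)^2 + ip D Z (grad_h uDh)" by (simp add: dual_h_def Z_def[abs_def])
  ultimately show ?thesis using Tmax[OF inKT, of t] dual_quadratic[OF DL dL gL(2), of \<nu> t] by linarith
 qed
 then have "ip D (\<lambda>x. dev (R x)) ?Q = 0" unfolding d_def[abs_def, symmetric] by (rule quadratic_nonneg_imp_linear_zero)
 from stress_identity[OF \<nu> DL gL wL _ utr uDtr _ R_def orth[OF w] orth[OF uD'] this Ku_orth[OF w]]
 show ?thesis by (simp add: E_def G_def Z_def trace_dev)
qed

end

section \<open>Error identity and error estimate\<close>

context stokes_mesh
begin

lemma Pi_h_dev:
 assumes "f \<in> L2_space D" "T \<in> M" "x \<in> interior T"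
 shows "Pi_h M (\<lambda>y. dev (f y)) x = dev (Pi_h M f x)" by (rule Pi_h_bounded_linear[OF assms(1) bounded_linear_dev assms(2,3)])

lemma Pi_h_diff:
 assumes "f \<in> L2_space D" "g \<in> L2_space D" "T \<in> M" "x \<in> interior T"
 shows "Pi_h M (\<lambda>x. f x - g x) x = Pi_h M f x - Pi_h M g x" using Pi_h_add_scaleR[OF assms, of "-1"] by simp

lemma dev_diff: "dev (A - B) = dev A - dev B" using dev_lincomb[of A "-1" B] by simp

text \<open>Against a gradient of element-wise affine functions the mean may be dropped, against a
  trace-free one also the deviator; what is left is discrete integration by parts.\<close>

lemma Pi_dev_orthogonal:
 assumes \<sigma>: "\<sigma> \<in> RT_N \<Gamma>N M" "AE x in leb D. rt_div \<sigma> x = 0"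
  and e: "e \<in> CR_D \<Gamma>D M" "AE x in leb D. trace (grad_h e x) = 0"
 shows "ip D (Pi_h M (\<lambda>y. dev (\<sigma> y))) (grad_h e) = 0"
proof -
 have "\<sigma> \<in> L2_space D" using \<sigma>(1) P1_L2[OF RT_P1] by (simp add: RT_N_def)
 then have "(\<lambda>y. dev (\<sigma> y)) \<in> L2_space D" by (rule L2_bounded_linear[OF _ bounded_linear_dev])
 from ip_Pi_h[OF this grad_h_P0[OF CR_D_P1[OF e(1)]]]
 show ?thesis using ip_dev[OF e(2), of \<sigma>] RT_N_CR_orthogonal[OF \<sigma> e(1)] by simp
qed

text \<open>Linearity is taken from the weak divergence, to which \<open>rt_div\<close> is equal
  almost everywhere for each of the three fields.\<close>

lemma RT_N_diff_div:
 assumes "\<sigma> \<in> RT_N \<Gamma>N M" "\<tau> \<in> RT_N \<Gamma>N M"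
  and "AE x in leb D. rt_div \<sigma> x = g x" "AE x in leb D. rt_div \<tau> x = g x"
 shows "(\<lambda>x. \<sigma> x - \<tau> x) \<in> RT_N \<Gamma>N M" "AE x in leb D. rt_div (\<lambda>x. \<sigma> x - \<tau> x) x = 0"
proof -
 show N: "(\<lambda>x. \<sigma> x - \<tau> x) \<in> RT_N \<Gamma>N M" using RT_N_lincomb[OF assms(1,2), of "-1"] by simp
 have R: "\<sigma> \<in> RT M" "\<tau> \<in> RT M" "(\<lambda>x. \<sigma> x - \<tau> x) \<in> RT M" using assms(1,2) N by (simp_all add: RT_N_def)
 have "AE x in leb D. wdiv D (\<lambda>x. \<sigma> x + (-1) *\<^sub>R \<tau> x) x = 0"
  using Hdiv_add_scaleR(2)[OF RT_Hdiv[OF R(1)] RT_Hdiv[OF R(2)], of "-1"] RT_wdiv[OF R(1)] RT_wdiv[OF R(2)] assms(3,4) by eventually_elim simp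
 then show "AE x in leb D. rt_div (\<lambda>x. \<sigma> x - \<tau> x) x = 0" using RT_wdiv[OF R(3)] by eventually_elim simp
qed

lemma CR_D_diff_trace:
 assumes "v \<in> CR_D \<Gamma>D M" "w \<in> CR_D \<Gamma>D M"
  and "AE x in leb D. trace (grad_h v x) = 0" "AE x in leb D. trace (grad_h w x) = 0"
 obtains e where "e \<in> CR_D \<Gamma>D M" "AE x in leb D. grad_h e x = grad_h v x - grad_h w x"
  "AE x in leb D. trace (grad_h e x) = 0"
proof -
 have e: "AE x in leb D. grad_h (\<lambda>x. v x + (-1) *\<^sub>R w x) x = grad_h v x - grad_h w x"
  using grad_h_add_scaleR[OF CR_D_P1[OF assms(1)] CR_D_P1[OF assms(2)], of "-1"] by simp
 then have "AE x in leb D. trace (grad_h (\<lambda>x. v x + (-1) *\<^sub>R w x) x) = 0" using assms(3,4) by eventually_elim (simp add: trace_sub)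
 then show ?thesis using that[OF CR_D_lincomb[OF assms(1,2), of "-1"] e] by blast
qed

text \<open>Pointwise, with \<open>a = \<sigma> - s\<close>, \<open>b = \<sigma> - p\<close> and
  \<open>c = \<sigma> - q\<close>, the gap between the two sides of \<open>pt\<close> is the square
  of the norm of \<open>a - b - c\<close>. The mixed term is
  \<open>2 * ((p - s) \<bullet> (q - s))\<close>, which integrates to zero.\<close>

lemma l2norm_sq_le_orthogonal:
 fixes s p q :: "real^'n \<Rightarrow> 'b::euclidean_space"
 assumes L: "\<sigma> \<in> L2_space D" "s \<in> L2_space D" "p \<in> L2_space D" "q \<in> L2_space D"
  and orth: "ip D (\<lambda>x. p x - s x) (\<lambda>x. q x - s x) = 0"
 shows "(l2norm D (\<lambda>x. \<sigma> x - s x))^2 \<le> (l2norm D (\<lambda>x. \<sigma> x - p x))^2 + (l2norm D (\<lambda>x. \<sigma> x - q x))^2"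
proof -
 let ?x = "\<lambda>x. \<sigma> x - p x" and ?y = "\<lambda>x. \<sigma> x - q x" and ?s = "\<lambda>x. \<sigma> x - s x"
 have pt: "(norm a)^2 \<le> (norm b)^2 + (norm c)^2 + 2 * ((a - b) \<bullet> (a - c))" for a b c :: 'b
 proof -
  have "0 \<le> (a - b - c) \<bullet> (a - b - c)" by simp
  then show ?thesis by (simp add: power2_norm_eq_inner inner_diff_left inner_diff_right inner_commute algebra_simps)
 qed
 have "(LINT x|leb D. (norm (?s x))^2) \<le> (LINT x|leb D. ((norm (?x x))^2 + (norm (?y x))^2) + 2 * ((p x - s x) \<bullet> (q x - s x)))"
 proof (rule integral_mono)
  show "integrable (leb D) (\<lambda>x. (norm (?s x))^2)" by (intro L2_norm_sq_integrable L2_diff L)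
  show "integrable (leb D) (\<lambda>x. ((norm (?x x))^2 + (norm (?y x))^2) + 2 * ((p x - s x) \<bullet> (q x - s x)))"
   by (intro Bochner_Integration.integrable_add L2_norm_sq_integrable L2_diff L integrable_mult_right L2_inner_integrable)
  show "(norm (?s x))^2 \<le> ((norm (?x x))^2 + (norm (?y x))^2) + 2 * ((p x - s x) \<bullet> (q x - s x))" for x using pt[of "?s x" "?x x" "?y x"] by simp
 qed
 also have "... = (LINT x|leb D. (norm (?x x))^2) + (LINT x|leb D. (norm (?y x))^2) + 2 * ip D (\<lambda>x. p x - s x) (\<lambda>x. q x - s x)"
  using L2_norm_sq_integrable[OF L2_diff[OF L(1,3)]] L2_norm_sq_integrable[OF L2_diff[OF L(1,4)]]
   L2_inner_integrable[OF L2_diff[OF L(3,2)] L2_diff[OF L(4,2)]] by (simp add: ip_def)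
 finally show ?thesis by (simp add: l2norm_sq_integral orth)
qed

end

theorem theorem2:
  fixes \<Omega> \<Gamma>\<^sub>D \<Gamma>\<^sub>N :: "(real^'n) set"
    and M :: "(real^'n) set set"
    and \<nu> :: real
    and f fh u uD uh uDh :: "real^'n \<Rightarrow> real^'n"
    and F Fh T Th :: "real^'n \<Rightarrow> real^'n^'n"
    and Icr :: "(real^'n \<Rightarrow> real^'n) \<Rightarrow> (real^'n \<Rightarrow> real^'n)"
    and Irt :: "(real^'n \<Rightarrow> real^'n^'n) \<Rightarrow> (real^'n \<Rightarrow> real^'n^'n)"
  assumes "CARD('n) \<ge> 2"
    and "polyhedral_lipschitz_domain \<Omega>"
    and "boundary_parts \<Omega> \<Gamma>\<^sub>D \<Gamma>\<^sub>N"
    and "simplicial_mesh \<Omega> M"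
    and "mesh_resolves_boundary \<Omega> \<Gamma>\<^sub>D \<Gamma>\<^sub>N M"
    and "\<nu> > 0"
    and "f \<in> L2_space \<Omega>" and "F \<in> L2_space \<Omega>"
    and "uD \<in> H1 \<Omega>" and "AE x in lebesgue_on \<Omega>. trace (wgrad \<Omega> uD x) = 0"
    and "is_cr_interpolation \<Omega> M Icr"
    and "is_rt_interpolation \<Omega> \<Gamma>\<^sub>D \<Gamma>\<^sub>N M Irt"
    and "is_arg_min (primal \<Omega> \<nu> f F uD) (\<lambda>v. v \<in> Ku \<Omega> \<Gamma>\<^sub>D) u"
    and "is_arg_max (dual \<Omega> \<nu> uD) (\<lambda>\<tau>. \<tau> \<in> KT \<Omega> \<Gamma>\<^sub>D f F) T"
    and "fh = Pi_h M f" and "Fh = Pi_h M F" and "uDh = Icr uD"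
    and "is_arg_min (primal_h \<Omega> M \<nu> fh Fh uDh) (\<lambda>v. v \<in> Ku_h \<Omega> \<Gamma>\<^sub>D M) uh"
    and "is_arg_max (dual_h \<Omega> M \<nu> uDh) (\<lambda>\<tau>. \<tau> \<in> KT_h \<Omega> \<Gamma>\<^sub>N M fh Fh) Th"
  shows
    "(\<nu> / 2 * (l2norm \<Omega> (\<lambda>x. grad_h (Icr u) x - grad_h uh x))\<^sup>2
      + 1 / (2 * \<nu>) * (l2norm \<Omega> (\<lambda>x. Pi_h M (\<lambda>y. dev (Irt (\<lambda>z. T z - F z) y)) x
                                       - Pi_h M (\<lambda>y. dev (Th y - Fh y)) x))\<^sup>2
      = 1 / (2 * \<nu>) * (l2norm \<Omega> (\<lambda>x. Pi_h M (\<lambda>y. dev (T y - F y)) x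
                                       - Pi_h M (\<lambda>y. dev (Irt (\<lambda>z. T z - F z) y)) x))\<^sup>2)
     \<and>
     (\<nu> * (l2norm \<Omega> (\<lambda>x. wgrad \<Omega> (\<lambda>y. u y + uD y) x - grad_h (\<lambda>y. uh y + uDh y) x))\<^sup>2
      + 1 / \<nu> * (l2norm \<Omega> (\<lambda>x. dev (T x) - Pi_h M (\<lambda>y. dev (Th y)) x))\<^sup>2
      \<le> 6 * (INF vh \<in> Ku_h \<Omega> \<Gamma>\<^sub>D M.
               \<nu> * (l2norm \<Omega> (\<lambda>x. wgrad \<Omega> (\<lambda>y. u y + uD y) x - grad_h (\<lambda>y. vh y + uDh y) x))\<^sup>2)
        + 6 * (INF \<tau>h \<in> KT_h \<Omega> \<Gamma>\<^sub>N M fh Fh.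
               1 / \<nu> * (l2norm \<Omega> (\<lambda>x. dev (T x) - dev (Pi_h M \<tau>h x)))\<^sup>2))"
proof -
 interpret stokes_mesh \<Omega> M \<Gamma>\<^sub>D \<Gamma>\<^sub>N by unfold_locales (fact assms)+
 note \<nu> = assms(6) and f = assms(7,8) and uD = assms(9,10) and cr = assms(11) and rt = assms(12)
  and u = assms(13) and T = assms(14) and fh = assms(15) and Fh = assms(16) and uDh = assms(17)
  and uh = assms(18) and Th = assms(19)
 have uK: "u \<in> H1_D \<Omega> \<Gamma>\<^sub>D" "AE x in leb \<Omega>. trace (wgrad \<Omega> u x) = 0" using u by (auto simp: is_arg_min_def Ku_def)
 have TK: "T \<in> KT \<Omega> \<Gamma>\<^sub>D f F" using T by (simp add: is_arg_max_def)
 have uhK: "uh \<in> Ku_h \<Omega> \<Gamma>\<^sub>D M" using uh by (simp add: is_arg_min_def)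
 have uhD: "uh \<in> CR_D \<Gamma>\<^sub>D M" "AE x in leb \<Omega>. trace (grad_h uh x) = 0" using uhK by (auto simp: Ku_h_def div_h_def)
 have ThK: "Th \<in> KT_h \<Omega> \<Gamma>\<^sub>N M fh Fh" using Th by (simp add: is_arg_max_def)
 note uH = H1_D_H1[OF uK(1)]
 note KhD = KT_h_D[of _ f F, folded fh Fh]
 note TD = KT_D[OF f(2) TK] and ThD = KhD[OF ThK]
 have uDhP: "uDh \<in> P1 M" using cr uD(1) CR_P1 unfolding uDh is_cr_interpolation_def by blast
 have uDh0: "AE x in leb \<Omega>. div_h uDh x = 0" unfolding uDh by (rule cr_div_free[OF cr uD])
 note stress = stokes_stress[OF \<nu> f uD u T]
 note stress_h = discrete_stokes_stress[OF \<nu> uDhP uDh0 uh[unfolded fh Fh] Th[unfolded fh Fh]]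
 have FhP: "Fh \<in> P0 M" unfolding Fh by (rule Pi_h_P0)
 define s where "s x = wgrad \<Omega> u x + wgrad \<Omega> uD x" for x
 define sh where "sh x = grad_h uh x + grad_h uDh x" for x
 have gL: "wgrad \<Omega> u \<in> L2_space \<Omega>" "wgrad \<Omega> uD \<in> L2_space \<Omega>" using H1D(3)[OF uH] H1D(3)[OF uD(1)] .
 have sL: "s \<in> L2_space \<Omega>" unfolding s_def[abs_def] by (intro L2_add gL)
 have shP: "sh \<in> P0 M" unfolding sh_def[abs_def] by (rule P0_map2[OF grad_h_P0[OF CR_D_P1[OF uhD(1)]] grad_h_P0[OF uDhP]])
 note shL = P0_L2[OF shP]
 show ?thesis
 proof (rule conjI)
  let ?G = "\<lambda>z. T z - F z"
  define W where "W x = grad_h (Icr u) x - grad_h uh x" for x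
  define A where "A x = Pi_h M (\<lambda>y. dev (?G y)) x" for x
  define B where "B x = Pi_h M (\<lambda>y. dev (Irt ?G y)) x" for x
  define C where "C x = Pi_h M (\<lambda>y. dev (Th y - Fh y)) x" for x
  have GH: "?G \<in> Hdiv_N \<Omega> \<Gamma>\<^sub>D" "AE x in leb \<Omega>. wdiv \<Omega> ?G x = - f x" using TK by (auto simp: KT_def)
  have IN: "Irt ?G \<in> RT_N \<Gamma>\<^sub>N M" "AE x in leb \<Omega>. wdiv \<Omega> (Irt ?G) x = Pi_h M (wdiv \<Omega> ?G) x"
   using rt GH(1) unfolding is_rt_interpolation_def by auto
  have IR: "Irt ?G \<in> RT M" using IN(1) by (simp add: RT_N_def)
  \<comment> \<open>\<open>Irt\<close> commutes with the divergence up to the mean, so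
    \<open>Irt ?G\<close> and \<open>Th - Fh\<close> both have divergence
    \<open>- fh\<close>.\<close>
  have "AE x in leb \<Omega>. Pi_h M (wdiv \<Omega> ?G) x = - fh x"
  proof (rule AE_elementI)
   fix K x assume K: "K \<in> M" "x \<in> interior K"
   have "Pi_h M (wdiv \<Omega> ?G) x = Pi_h M (\<lambda>x. - f x) x" by (rule Pi_h_cong_AE[OF GH(2) K])
   also have "... = - Pi_h M f x" by (rule Pi_h_bounded_linear[OF f(1) bounded_linear_minus[OF bounded_linear_ident] K])
   finally show "Pi_h M (wdiv \<Omega> ?G) x = - fh x" by (simp add: fh)
  qed
  then have "AE x in leb \<Omega>. rt_div (Irt ?G) x = - fh x" using IN(2) RT_wdiv[OF IR] by eventually_elim simp
  note \<sigma> = RT_N_diff_div[OF IN(1) ThD(1) this ThD(4)]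
  have Iu: "Icr u \<in> CR_D \<Gamma>\<^sub>D M" by (rule cr_boundary[OF cr uK(1)])
  have Iu0: "AE x in leb \<Omega>. trace (grad_h (Icr u) x) = 0" using cr_div_free[OF cr uH uK(2)] by (simp add: div_h_def)
  obtain e where e: "e \<in> CR_D \<Gamma>\<^sub>D M" "AE x in leb \<Omega>. grad_h e x = W x" "AE x in leb \<Omega>. trace (grad_h e x) = 0"
   unfolding W_def by (rule CR_D_diff_trace[OF Iu uhD(1) Iu0 uhD(2)])
  have IL: "Irt ?G \<in> L2_space \<Omega>" by (rule P1_L2[OF RT_P1[OF IR]])
  have ThFL: "(\<lambda>y. Th y - Fh y) \<in> L2_space \<Omega>" by (rule L2_diff[OF ThD(3) P0_L2[OF FhP]])
  have AL: "A \<in> L2_space \<Omega>" "B \<in> L2_space \<Omega>" "C \<in> L2_space \<Omega>" unfolding A_def[abs_def] B_def[abs_def] C_def[abs_def] by (rule Pi_h_L2)+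
  have BC: "AE x in leb \<Omega>. B x - C x = Pi_h M (\<lambda>y. dev (Irt ?G y - (Th y - Fh y))) x"
   by (rule AE_elementI) (simp only: B_def C_def Pi_h_dev[OF L2_diff[OF IL ThFL]] Pi_h_dev[OF IL] Pi_h_dev[OF ThFL] Pi_h_diff[OF IL ThFL], simp only: dev_diff)
  \<comment> \<open>Adding \<open>dev (Pi_h M Th x)\<close> removes the data terms, because
    \<open>Fh\<close> is the mean of \<open>F\<close> and its own mean. By \<open>cr_grad\<close>
    the projected continuous stress is \<open>\<nu>\<close> times the broken gradient of the
    interpolants of \<open>u\<close> and of the lift.\<close>
  have "AE x in leb \<Omega>. A x - C x + dev (Pi_h M Th x) = \<nu> *\<^sub>R (grad_h (Icr u) x + grad_h uDh x)"
  proof (rule AE_elementI)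
   fix K x assume K: "K \<in> M" "x \<in> interior K"
   have "A x - C x + dev (Pi_h M Th x) = dev (Pi_h M T x)"
    by (simp only: A_def C_def Pi_h_dev[OF HdivD(1)[OF TD(1)] K] Pi_h_dev[OF ThFL K] Pi_h_diff[OF TD(2) f(2) K] Pi_h_diff[OF ThD(3) P0_L2[OF FhP] K]
      Pi_h_of_P0[OF FhP K] Fh[symmetric]) (simp add: dev_diff)
   also have "... = Pi_h M (\<lambda>y. dev (T y)) x" by (rule Pi_h_dev[OF TD(2) K, symmetric])
   also have "... = Pi_h M (\<lambda>y. \<nu> *\<^sub>R s y) x" by (rule Pi_h_cong_AE[OF stress[folded s_def] K])
   also have "... = \<nu> *\<^sub>R Pi_h M s x" by (rule Pi_h_bounded_linear[OF sL bounded_linear_scaleR_right K])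
   also have "Pi_h M s x = Pi_h M (wgrad \<Omega> u) x + Pi_h M (wgrad \<Omega> uD) x" unfolding s_def[abs_def] by (rule Pi_h_add[OF gL K])
   finally show "A x - C x + dev (Pi_h M Th x) = \<nu> *\<^sub>R (grad_h (Icr u) x + grad_h uDh x)" by (simp add: uDh cr_grad[OF cr uH K] cr_grad[OF cr uD(1) K])
  qed
  then have AC: "AE x in leb \<Omega>. A x - C x = \<nu> *\<^sub>R W x" using stress_h by eventually_elim (simp add: W_def algebra_simps)
  have "ip \<Omega> (\<lambda>x. B x - C x) W = ip \<Omega> (Pi_h M (\<lambda>y. dev (Irt ?G y - (Th y - Fh y)))) (grad_h e)"
   by (rule ip_cong_AE[OF dom_sets(1) BC]) (use e(2) in eventually_elim, simp)
  then have orth: "ip \<Omega> (\<lambda>x. B x - C x) W = 0" using Pi_dev_orthogonal[OF \<sigma> e(1,3)] by simp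
  have WL: "W \<in> L2_space \<Omega>" unfolding W_def[abs_def] by (rule L2_diff[OF P0_L2[OF grad_h_P0[OF CR_D_P1[OF Iu]]] P0_L2[OF grad_h_P0[OF CR_D_P1[OF uhD(1)]]]])
  have "AE x in leb \<Omega>. A x - B x = \<nu> *\<^sub>R W x - 1 *\<^sub>R (B x - C x)" using AC by eventually_elim (simp add: algebra_simps)
  from l2norm_cong_AE[OF dom_sets(1) this]
  have "(l2norm \<Omega> (\<lambda>x. A x - B x))^2 = (l2norm \<Omega> (\<lambda>x. \<nu> *\<^sub>R W x))^2 + (l2norm \<Omega> (\<lambda>x. B x - C x))^2"
   using l2norm_diff_scaleR_sq[OF L2_scaleR[OF WL] L2_diff[OF AL(2,3)], of \<nu> 1] orth ip_commute[of \<Omega> W]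
   by (simp only: ip_scaleR_left l2norm_sq[of \<Omega> "\<lambda>x. B x - C x"]) simp
  then have "\<nu> / 2 * (l2norm \<Omega> W)^2 + 1 / (2 * \<nu>) * (l2norm \<Omega> (\<lambda>x. B x - C x))^2 = 1 / (2 * \<nu>) * (l2norm \<Omega> (\<lambda>x. A x - B x))^2"
   using \<nu> by (simp add: l2norm_scaleR power_mult_distrib field_simps power2_eq_square)
  then show "\<nu> / 2 * (l2norm \<Omega> (\<lambda>x. grad_h (Icr u) x - grad_h uh x))^2
   + 1 / (2 * \<nu>) * (l2norm \<Omega> (\<lambda>x. Pi_h M (\<lambda>y. dev (Irt ?G y)) x - Pi_h M (\<lambda>y. dev (Th y - Fh y)) x))^2
   = 1 / (2 * \<nu>) * (l2norm \<Omega> (\<lambda>x. Pi_h M (\<lambda>y. dev (T y - F y)) x - Pi_h M (\<lambda>y. dev (Irt ?G y)) x))^2"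
   unfolding W_def[abs_def] A_def[abs_def] B_def[abs_def] C_def[abs_def] .
 next
  define X where "X vh = \<nu> * (l2norm \<Omega> (\<lambda>x. wgrad \<Omega> (\<lambda>y. u y + uD y) x - grad_h (\<lambda>y. vh y + uDh y) x))^2" for vh
  define Y where "Y \<tau>h = 1 / \<nu> * (l2norm \<Omega> (\<lambda>x. dev (T x) - dev (Pi_h M \<tau>h x)))^2" for \<tau>h
  have s_eq: "AE x in leb \<Omega>. wgrad \<Omega> (\<lambda>y. u y + uD y) x = s x" using H1_add_scaleR(2)[OF uH uD(1), of 1] by (simp add: s_def)
  have X_eq: "X vh = \<nu> * (l2norm \<Omega> (\<lambda>x. s x - (grad_h vh x + grad_h uDh x)))^2" if "vh \<in> P1 M" for vh
  proof -
   have "AE x in leb \<Omega>. wgrad \<Omega> (\<lambda>y. u y + uD y) x - grad_h (\<lambda>y. vh y + uDh y) x = s x - (grad_h vh x + grad_h uDh x)"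
    using s_eq grad_h_add_scaleR[OF that uDhP, of 1] unfolding scaleR_one by eventually_elim simp
   from l2norm_cong_AE[OF dom_sets(1) this] show ?thesis unfolding X_def by (rule arg_cong)
  qed
  have scale: "1 / \<nu> * (l2norm \<Omega> (\<lambda>x. \<nu> *\<^sub>R h x))^2 = \<nu> * (l2norm \<Omega> h)^2" for h :: "real^'n \<Rightarrow> real^'n^'n"
   using \<nu> by (simp add: l2norm_scaleR power2_eq_square)
  have Y_eq: "Y \<tau>h = \<nu> * (l2norm \<Omega> (\<lambda>x. s x - (1 / \<nu>) *\<^sub>R dev (Pi_h M \<tau>h x)))^2" for \<tau>h
  proof -
   have "AE x in leb \<Omega>. dev (T x) - dev (Pi_h M \<tau>h x) = \<nu> *\<^sub>R (s x - (1 / \<nu>) *\<^sub>R dev (Pi_h M \<tau>h x))"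
    using stress[folded s_def] by eventually_elim (use \<nu> in \<open>simp add: scaleR_diff_right\<close>)
   from l2norm_cong_AE[OF dom_sets(1) this] show ?thesis unfolding Y_def by (simp only: scale)
  qed
  have err: "1 / \<nu> * (l2norm \<Omega> (\<lambda>x. dev (T x) - Pi_h M (\<lambda>y. dev (Th y)) x))^2 = \<nu> * (l2norm \<Omega> (\<lambda>x. s x - sh x))^2"
  proof -
   have "AE x in leb \<Omega>. Pi_h M (\<lambda>y. dev (Th y)) x = dev (Pi_h M Th x)" by (rule AE_elementI) (rule Pi_h_dev[OF ThD(3)])
   then have "AE x in leb \<Omega>. dev (T x) - Pi_h M (\<lambda>y. dev (Th y)) x = \<nu> *\<^sub>R (s x - sh x)"
    using stress[folded s_def] stress_h[folded sh_def] by eventually_elim (simp add: scaleR_diff_right)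
   from l2norm_cong_AE[OF dom_sets(1) this] show ?thesis by (simp only: scale)
  qed
  define L where "L = X uh + 1 / \<nu> * (l2norm \<Omega> (\<lambda>x. dev (T x) - Pi_h M (\<lambda>y. dev (Th y)) x))^2"
  \<comment> \<open>By the two stress identities the stress error is the velocity gradient error in
    another scaling, so the two contributions to \<open>L\<close> are equal.\<close>
  have L_eq: "L = 2 * (\<nu> * (l2norm \<Omega> (\<lambda>x. s x - sh x))^2)" unfolding L_def err X_eq[OF CR_D_P1[OF uhD(1)]] sh_def by simp
  have nn: "0 \<le> X vh" "0 \<le> Y \<tau>h" for vh \<tau>h using \<nu> by (simp_all add: X_def Y_def)
  have main: "L \<le> 6 * X vh + 6 * Y \<tau>h" if vh: "vh \<in> Ku_h \<Omega> \<Gamma>\<^sub>D M" and \<tau>h: "\<tau>h \<in> KT_h \<Omega> \<Gamma>\<^sub>N M fh Fh" for vh \<tau>h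
  proof -
   have vhD: "vh \<in> CR_D \<Gamma>\<^sub>D M" "AE x in leb \<Omega>. trace (grad_h vh x) = 0" using vh by (auto simp: Ku_h_def div_h_def)
   note \<tau>D = KhD[OF \<tau>h]
   define p where "p x = grad_h vh x + grad_h uDh x" for x
   define q where "q x = (1 / \<nu>) *\<^sub>R dev (Pi_h M \<tau>h x)" for x
   have pL: "p \<in> L2_space \<Omega>" unfolding p_def[abs_def] by (rule P0_L2[OF P0_map2[OF grad_h_P0[OF CR_D_P1[OF vhD(1)]] grad_h_P0[OF uDhP]]])
   have qL: "q \<in> L2_space \<Omega>" unfolding q_def[abs_def] by (rule P0_L2[OF P0_map[OF Pi_h_P0]])
   obtain e where e: "e \<in> CR_D \<Gamma>\<^sub>D M" "AE x in leb \<Omega>. grad_h e x = grad_h vh x - grad_h uh x" "AE x in leb \<Omega>. trace (grad_h e x) = 0"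
    by (rule CR_D_diff_trace[OF vhD(1) uhD(1) vhD(2) uhD(2)])
   note \<sigma> = RT_N_diff_div[OF \<tau>D(1) ThD(1) \<tau>D(4) ThD(4)]
   let ?P = "\<lambda>x. Pi_h M (\<lambda>y. dev ((\<tau>h y - Fh y) - (Th y - Fh y))) x"
   have "AE x in leb \<Omega>. ?P x = dev (Pi_h M \<tau>h x) - dev (Pi_h M Th x)"
    by (rule AE_elementI) (simp add: Pi_h_dev[OF L2_diff[OF \<tau>D(3) ThD(3)]] Pi_h_diff[OF \<tau>D(3) ThD(3)], simp add: dev_diff)
   then have q: "AE x in leb \<Omega>. q x - sh x = (1 / \<nu>) *\<^sub>R ?P x"
    using stress_h[folded sh_def] by eventually_elim (use \<nu> in \<open>simp add: q_def scaleR_diff_right\<close>)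
   have "ip \<Omega> (\<lambda>x. p x - sh x) (\<lambda>x. q x - sh x) = ip \<Omega> (grad_h e) (\<lambda>x. (1 / \<nu>) *\<^sub>R ?P x)"
    by (rule ip_cong_AE[OF dom_sets(1) _ q]) (use e(2) in eventually_elim, simp add: p_def sh_def)
   also have "... = 0" using Pi_dev_orthogonal[OF \<sigma> e(1,3)] ip_commute[of \<Omega> "grad_h e"] by (simp add: ip_scaleR_right)
   finally have orth: "ip \<Omega> (\<lambda>x. p x - sh x) (\<lambda>x. q x - sh x) = 0" .
   have "\<nu> * (l2norm \<Omega> (\<lambda>x. s x - sh x))^2 \<le> \<nu> * ((l2norm \<Omega> (\<lambda>x. s x - p x))^2 + (l2norm \<Omega> (\<lambda>x. s x - q x))^2)"
    by (rule mult_left_mono[OF l2norm_sq_le_orthogonal[OF sL shL pL qL orth]]) (use \<nu> in simp)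
   also have "... = X vh + Y \<tau>h" by (simp add: X_eq[OF CR_D_P1[OF vhD(1)]] Y_eq p_def q_def distrib_left)
   \<comment> \<open>The bound obtained is \<open>2 * (X vh + Y \<tau>h)\<close>; nonnegativity of
     both terms leads to the factor 6.\<close>
   finally show ?thesis unfolding L_eq using nn(1)[of vh] nn(2)[of \<tau>h] by linarith
  qed
  \<comment> \<open>The infima are taken one at a time, over \<open>vh\<close> with
    \<open>\<tau>h\<close> fixed and then over \<open>\<tau>h\<close>; \<open>uh\<close> and
    \<open>Th\<close> witness that the two sets are nonempty.\<close>
  have "(L - 6 * Y \<tau>h) / 6 \<le> (INF vh \<in> Ku_h \<Omega> \<Gamma>\<^sub>D M. X vh)" if "\<tau>h \<in> KT_h \<Omega> \<Gamma>\<^sub>N M fh Fh" for \<tau>h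
   by (rule cINF_greatest) (use uhK main[OF _ that] in \<open>auto simp: field_simps\<close>)
  then have "(L - 6 * (INF vh \<in> Ku_h \<Omega> \<Gamma>\<^sub>D M. X vh)) / 6 \<le> (INF \<tau>h \<in> KT_h \<Omega> \<Gamma>\<^sub>N M fh Fh. Y \<tau>h)"
   by (intro cINF_greatest) (use ThK in \<open>auto simp: field_simps\<close>)
  then have "L \<le> 6 * (INF vh \<in> Ku_h \<Omega> \<Gamma>\<^sub>D M. X vh) + 6 * (INF \<tau>h \<in> KT_h \<Omega> \<Gamma>\<^sub>N M fh Fh. Y \<tau>h)" by (simp add: field_simps)
  then show "\<nu> * (l2norm \<Omega> (\<lambda>x. wgrad \<Omega> (\<lambda>y. u y + uD y) x - grad_h (\<lambda>y. uh y + uDh y) x))^2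
   + 1 / \<nu> * (l2norm \<Omega> (\<lambda>x. dev (T x) - Pi_h M (\<lambda>y. dev (Th y)) x))^2
   \<le> 6 * (INF vh \<in> Ku_h \<Omega> \<Gamma>\<^sub>D M.
        \<nu> * (l2norm \<Omega> (\<lambda>x. wgrad \<Omega> (\<lambda>y. u y + uD y) x - grad_h (\<lambda>y. vh y + uDh y) x))^2)
    + 6 * (INF \<tau>h \<in> KT_h \<Omega> \<Gamma>\<^sub>N M fh Fh.
        1 / \<nu> * (l2norm \<Omega> (\<lambda>x. dev (T x) - dev (Pi_h M \<tau>h x)))^2)" unfolding L_def X_def[abs_def] Y_def[abs_def] .
 qed
qed

end
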